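(* Let $(M,J)$ be an almost complex manifold of complex dimension $n$, let $\Omega\subset M$ be a smoothly bounded domain with boundary $b\Omega$, and let $E\subset\overline\Omega$ be a smooth totally real $n$-dimensional submanifold. Suppose that $u$ is a plurisubharmonic function on $\Omega$, bounded above, and that for some point $p\in E\cap b\Omega$ one has $\limsup_{E\ni q\to p}u^*(q)=-\infty$. Then for every $\alpha>1$ one has $\lim_{A_\alpha(p)\ni q\to p}u(q)=-\infty$.
   Context: All manifolds and almost complex structures are of class $C^\infty$. An almost complex manifold $(M,J)$ of complex dimension $n$ is a smooth $2n$-dimensional manifold with a smooth field $J$ of endomorphisms of the tangent spaces, $J(p):T_pM\to T_pM$, $J(p)^2=-I$. Fix a Riemannian metric on $M$; $dist$ is the associated distance. A submanifold $E$ is totally real if $T_pE\cap J(p)T_pE=\{0\}$ for every $p\in E$. Let $\mathbb{D}=\{\zeta\in\mathbb{C}:|\zeta|<1\}$ with its standard complex structure $J_{st}$. A $J$-complex disc is a $C^1$ map $f:\mathbb{D}\to M$ with $df\circ J_{st}=J\circ df$. An upper semicontinuous function $u:\Omega\to[-\infty,+\infty)$ is plurisubharmonic if $u\circ f$ is subharmonic on $\mathbb{D}$ for every $J$-complex disc $f:\mathbb{D}\to\Omega$. For $q\in b\Omega$ and $\alpha\ge 1$ put $A_\alpha(q)=\{p\in\Omega: dist(p,q)\le \alpha\, d_q(p)\}$, where $d_q(p)$ is the distance from $p$ to the tangent plane $T_q(b\Omega)$ to $b\Omega$ at $q$ (realized as a hyperplane in a local coordinate chart near $q$; only points $p$ near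 $q$ matter). The upper non-tangential boundary extension $u^*$ of a plurisubharmonic function $u$ on $\Omega$ is $u^*(q)=u(q)$ for $q\in\Omega$ and $u^*(q)=\sup_{\alpha>1}\big(\limsup_{A_\alpha(q)\ni p\to q}u(p)\big)$ for $q\in b\Omega$. In $\limsup_{E\ni q\to p}$ the point $q$ ranges over $E\setminus\{p\}$. *)

theory Defs
  imports "HOL-Analysis.Analysis"
begin

section \<open>Smooth maps and smooth structures\<close>

text \<open>
  \<open>Ck_on k S f\<close> is meant for open \<open>S\<close> in a finite-dimensional space, where continuity of all
  directional derivatives of a differentiable map is continuity of the derivative.
\<close>

primrec Ck_on ::
  "nat \<Rightarrow> 'a::real_normed_vector set \<Rightarrow> ('a \<Rightarrow> 'b::real_normed_vector) \<Rightarrow> bool" where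
  "Ck_on 0 S f \<longleftrightarrow> continuous_on S f"
| "Ck_on (Suc k) S f \<longleftrightarrow>
     (\<forall>x\<in>S. f differentiable (at x)) \<and>
     (\<forall>v. Ck_on k S (\<lambda>x. frechet_derivative f (at x) v))"

definition smooth_on ::
  "'a::real_normed_vector set \<Rightarrow> ('a \<Rightarrow> 'b::real_normed_vector) \<Rightarrow> bool" where
  "smooth_on S f \<longleftrightarrow> (\<forall>k. Ck_on k S f)"

text \<open>
  A chart is its domain together with its coordinate map; values of the map outside the domain
  are irrelevant.
\<close>

type_synonym ('m, 'e) chart = "'m set \<times> ('m \<Rightarrow> 'e)"

definition inv_chart :: "('m, 'e) chart \<Rightarrow> 'e \<Rightarrow> 'm" where
  "inv_chart c = inv_into (fst c) (snd c)"

definition is_chart :: "('m::topological_space, 'e::euclidean_space) chart \<Rightarrow> bool" where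
  "is_chart c \<longleftrightarrow> open (fst c) \<and> open (snd c ` fst c) \<and>
     homeomorphism (fst c) (snd c ` fst c) (snd c) (inv_chart c)"

definition compatible ::
  "('m::topological_space, 'e::euclidean_space) chart \<Rightarrow> ('m, 'e) chart \<Rightarrow> bool" where
  "compatible c c' \<longleftrightarrow>
     smooth_on (snd c ` (fst c \<inter> fst c')) (snd c' \<circ> inv_chart c) \<and>
     smooth_on (snd c' ` (fst c \<inter> fst c')) (snd c \<circ> inv_chart c')"

text \<open>
  A smooth structure is a maximal smooth atlas, so \<open>c \<in> A\<close> says that \<open>c\<close> is an arbitrary local
  coordinate chart. The dimension of the manifold is \<open>DIM('e)\<close>.
\<close>

definition smooth_structure ::
  "('m::{t2_space,second_countable_topology}, 'e::euclidean_space) chart set \<Rightarrow> bool" where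
  "smooth_structure A \<longleftrightarrow>
     (\<forall>c\<in>A. is_chart c) \<and>
     (\<Union>c\<in>A. fst c) = UNIV \<and>
     (\<forall>c\<in>A. \<forall>c'\<in>A. compatible c c') \<and>
     (\<forall>c. is_chart c \<and> (\<forall>c'\<in>A. compatible c c') \<longrightarrow> c \<in> A)"

text \<open>Maps of class \<open>C\<^sup>k\<close> from an open subset \<open>S\<close> of a vector space into the manifold.\<close>

definition Ck_map ::
  "('m::topological_space, 'e::euclidean_space) chart set \<Rightarrow> nat \<Rightarrow>
   'a::real_normed_vector set \<Rightarrow> ('a \<Rightarrow> 'm) \<Rightarrow> bool" where
  "Ck_map A k S f \<longleftrightarrow> continuous_on S f \<and>
     (\<forall>c\<in>A. Ck_on k {x\<in>S. f x \<in> fst c} (snd c \<circ> f))"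

text \<open>Smooth real functions on an open subset \<open>V\<close> of the manifold.\<close>

definition smooth_fun ::
  "('m::topological_space, 'e::euclidean_space) chart set \<Rightarrow> 'm set \<Rightarrow> ('m \<Rightarrow> real) \<Rightarrow> bool" where
  "smooth_fun A V \<rho> \<longleftrightarrow> (\<forall>c\<in>A. smooth_on (snd c ` (fst c \<inter> V)) (\<rho> \<circ> inv_chart c))"


section \<open>Tangent vectors\<close>

text \<open>
  A tangent vector at \<open>p\<close> is the family of its coordinate vectors in all charts around \<open>p\<close>,
  subject to the usual transformation law. It is extended by \<open>0\<close> to the remaining charts, so that
  distinct families represent distinct vectors and \<open>\<lambda>_. 0\<close> is the zero vector.
\<close>

type_synonym ('m, 'e) tangent = "('m, 'e) chart \<Rightarrow> 'e"

definition tangent_space ::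
  "('m, 'e::euclidean_space) chart set \<Rightarrow> 'm \<Rightarrow> ('m, 'e) tangent set" where
  "tangent_space A p = {v.
     (\<forall>c\<in>A. \<forall>c'\<in>A. p \<in> fst c \<longrightarrow> p \<in> fst c' \<longrightarrow>
        v c' = frechet_derivative (snd c' \<circ> inv_chart c) (at (snd c p)) (v c)) \<and>
     (\<forall>c. \<not> (c \<in> A \<and> p \<in> fst c) \<longrightarrow> v c = 0)}"

text \<open>The differential at \<open>x\<close>, in the direction \<open>h\<close>, of a map \<open>f\<close> into the manifold.\<close>

definition differential ::
  "('m, 'e::euclidean_space) chart set \<Rightarrow> ('a::real_normed_vector \<Rightarrow> 'm) \<Rightarrow> 'a \<Rightarrow> 'a \<Rightarrow>
   ('m, 'e) tangent" where
  "differential A f x h =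
     (\<lambda>c. if c \<in> A \<and> f x \<in> fst c then frechet_derivative (snd c \<circ> f) (at x) h else 0)"

text \<open>The tangent vector at \<open>p\<close> whose coordinate vector in the chart \<open>c\<close> is \<open>e\<close>.\<close>

definition coord_vec ::
  "('m, 'e::euclidean_space) chart set \<Rightarrow> ('m, 'e) chart \<Rightarrow> 'm \<Rightarrow> 'e \<Rightarrow> ('m, 'e) tangent" where
  "coord_vec A c p e = differential A (inv_chart c) (snd c p) e"

text \<open>Embedded submanifolds (without boundary) of dimension \<open>k\<close>, by slice charts.\<close>

definition submanifold ::
  "('m, 'e::euclidean_space) chart set \<Rightarrow> nat \<Rightarrow> 'm set \<Rightarrow> bool" where
  "submanifold A k E \<longleftrightarrow>
     (\<forall>p\<in>E. \<exists>c\<in>A. p \<in> fst c \<and>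
        (\<exists>L. subspace L \<and> dim L = k \<and> snd c ` (E \<inter> fst c) = snd c ` fst c \<inter> L))"

text \<open>The tangent space of a submanifold: velocities of smooth curves running in it.\<close>

definition tangent_space_of ::
  "('m::topological_space, 'e::euclidean_space) chart set \<Rightarrow> 'm set \<Rightarrow> 'm \<Rightarrow>
   ('m, 'e) tangent set" where
  "tangent_space_of A E p = {differential A \<gamma> (0::real) 1 | \<gamma>.
     \<exists>\<epsilon>>0. (\<forall>k. Ck_map A k {-\<epsilon><..<\<epsilon>} \<gamma>) \<and> \<gamma> ` {-\<epsilon><..<\<epsilon>} \<subseteq> E \<and> \<gamma> 0 = p}"


section \<open>Almost complex structures\<close>

text \<open>Only the restriction of \<open>J p\<close> to \<open>tangent_space A p\<close> is relevant.\<close>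

definition almost_complex_structure ::
  "('m, 'e::euclidean_space) chart set \<Rightarrow>
   ('m \<Rightarrow> ('m, 'e) tangent \<Rightarrow> ('m, 'e) tangent) \<Rightarrow> bool" where
  "almost_complex_structure A J \<longleftrightarrow>
     (\<forall>p. \<forall>v\<in>tangent_space A p.
        J p v \<in> tangent_space A p \<and>
        J p (J p v) = (\<lambda>c. - v c) \<and>
        (\<forall>a. J p (\<lambda>c. a *\<^sub>R v c) = (\<lambda>c. a *\<^sub>R J p v c)) \<and>
        (\<forall>w\<in>tangent_space A p. J p (\<lambda>c. v c + w c) = (\<lambda>c. J p v c + J p w c))) \<and>
     (\<forall>c\<in>A. \<forall>e. smooth_on (snd c ` fst c)
        (\<lambda>x. J (inv_chart c x) (coord_vec A c (inv_chart c x) e) c))"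

definition totally_real ::
  "('m::topological_space, 'e::euclidean_space) chart set \<Rightarrow>
   ('m \<Rightarrow> ('m, 'e) tangent \<Rightarrow> ('m, 'e) tangent) \<Rightarrow> 'm set \<Rightarrow> bool" where
  "totally_real A J E \<longleftrightarrow>
     (\<forall>p\<in>E. tangent_space_of A E p \<inter> J p ` tangent_space_of A E p = {\<lambda>_. 0})"

definition J_complex_disc ::
  "('m::topological_space, 'e::euclidean_space) chart set \<Rightarrow>
   ('m \<Rightarrow> ('m, 'e) tangent \<Rightarrow> ('m, 'e) tangent) \<Rightarrow> (complex \<Rightarrow> 'm) \<Rightarrow> bool" where
  "J_complex_disc A J f \<longleftrightarrow>
     Ck_map A 1 (ball 0 1) f \<and>
     (\<forall>z\<in>ball 0 1. \<forall>h. differential A f z (\<i> * h) = J (f z) (differential A f z h))"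


section \<open>Subharmonic and plurisubharmonic functions\<close>

definition usc_on :: "'a::topological_space set \<Rightarrow> ('a \<Rightarrow> ereal) \<Rightarrow> bool" where
  "usc_on S u \<longleftrightarrow> (\<forall>a. openin (top_of_set S) {x\<in>S. u x < a})"

text \<open>
  The integral of the positive part minus that of the negative part (\<open>e2ennreal\<close> maps negative
  values to \<open>0\<close>). It is used only for functions that are bounded above on a space of finite
  measure, where the difference is never \<open>\<infinity> - \<infinity>\<close>.
\<close>

definition ereal_integral :: "'a measure \<Rightarrow> ('a \<Rightarrow> ereal) \<Rightarrow> ereal" where
  "ereal_integral M v =
     enn2ereal (\<integral>\<^sup>+ x. e2ennreal (v x) \<partial>M) - enn2ereal (\<integral>\<^sup>+ x. e2ennreal (- v x) \<partial>M)"

definition circle_mean :: "(complex \<Rightarrow> ereal) \<Rightarrow> complex \<Rightarrow> real \<Rightarrow> ereal" where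
  "circle_mean v a r = ereal (1 / (2 * pi)) *
     ereal_integral (restrict_space lborel {0..2 * pi}) (\<lambda>\<theta>. v (a + of_real r * cis \<theta>))"

text \<open>The function that is identically \<open>-\<infinity>\<close> counts as subharmonic.\<close>

definition subharmonic_on :: "complex set \<Rightarrow> (complex \<Rightarrow> ereal) \<Rightarrow> bool" where
  "subharmonic_on S v \<longleftrightarrow>
     usc_on S v \<and> (\<forall>z\<in>S. v z \<noteq> \<infinity>) \<and>
     (\<forall>a r. 0 < r \<and> cball a r \<subseteq> S \<longrightarrow> v a \<le> circle_mean v a r)"

definition plurisubharmonic ::
  "('m::topological_space, 'e::euclidean_space) chart set \<Rightarrow>
   ('m \<Rightarrow> ('m, 'e) tangent \<Rightarrow> ('m, 'e) tangent) \<Rightarrow> 'm set \<Rightarrow> ('m \<Rightarrow> ereal) \<Rightarrow> bool" where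
  "plurisubharmonic A J \<Omega> u \<longleftrightarrow>
     usc_on \<Omega> u \<and> (\<forall>x\<in>\<Omega>. u x \<noteq> \<infinity>) \<and>
     (\<forall>f. J_complex_disc A J f \<and> f ` ball 0 1 \<subseteq> \<Omega> \<longrightarrow> subharmonic_on (ball 0 1) (u \<circ> f))"


section \<open>Riemannian distance\<close>

definition riemannian_metric ::
  "('m, 'e::euclidean_space) chart set \<Rightarrow>
   ('m \<Rightarrow> ('m, 'e) tangent \<Rightarrow> ('m, 'e) tangent \<Rightarrow> real) \<Rightarrow> bool" where
  "riemannian_metric A g \<longleftrightarrow>
     (\<forall>p. \<forall>v\<in>tangent_space A p.
        (v \<noteq> (\<lambda>_. 0) \<longrightarrow> g p v v > 0) \<and>
        (\<forall>w\<in>tangent_space A p.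
           g p v w = g p w v \<and>
           (\<forall>a. g p (\<lambda>c. a *\<^sub>R v c) w = a * g p v w) \<and>
           (\<forall>v'\<in>tangent_space A p. g p (\<lambda>c. v c + v' c) w = g p v w + g p v' w))) \<and>
     (\<forall>c\<in>A. \<forall>e e'. smooth_on (snd c ` fst c)
        (\<lambda>x. g (inv_chart c x) (coord_vec A c (inv_chart c x) e)
                (coord_vec A c (inv_chart c x) e')))"

text \<open>
  As for \<^const>\<open>piecewise_C1_differentiable_on\<close>, nothing is required at the exceptional points
  except continuity.
\<close>

definition piecewise_C1_path ::
  "('m::topological_space, 'e::euclidean_space) chart set \<Rightarrow> (real \<Rightarrow> 'm) \<Rightarrow> bool" where
  "piecewise_C1_path A \<gamma> \<longleftrightarrow>
     continuous_on {0..1} \<gamma> \<and> (\<exists>F. finite F \<and> Ck_map A 1 ({0<..<1} - F) \<gamma>)"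

definition path_length ::
  "('m, 'e::euclidean_space) chart set \<Rightarrow>
   ('m \<Rightarrow> ('m, 'e) tangent \<Rightarrow> ('m, 'e) tangent \<Rightarrow> real) \<Rightarrow> (real \<Rightarrow> 'm) \<Rightarrow> ennreal" where
  "path_length A g \<gamma> = (\<integral>\<^sup>+ t\<in>{0<..<1}.
     ennreal (sqrt (g (\<gamma> t) (differential A \<gamma> t 1) (differential A \<gamma> t 1))) \<partial>lborel)"

text \<open>Points in different components of the manifold have distance \<open>\<infinity>\<close>.\<close>

definition riem_dist ::
  "('m::topological_space, 'e::euclidean_space) chart set \<Rightarrow>
   ('m \<Rightarrow> ('m, 'e) tangent \<Rightarrow> ('m, 'e) tangent \<Rightarrow> real) \<Rightarrow> 'm \<Rightarrow> 'm \<Rightarrow> ennreal" where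
  "riem_dist A g p q =
     (INF \<gamma>\<in>{\<gamma>. piecewise_C1_path A \<gamma> \<and> \<gamma> 0 = p \<and> \<gamma> 1 = q}. path_length A g \<gamma>)"


section \<open>Smoothly bounded domains and non-tangential approach\<close>

definition smoothly_bounded_domain ::
  "('m::topological_space, 'e::euclidean_space) chart set \<Rightarrow> 'm set \<Rightarrow> bool" where
  "smoothly_bounded_domain A \<Omega> \<longleftrightarrow>
     open \<Omega> \<and> connected \<Omega> \<and> \<Omega> \<noteq> {} \<and>
     (\<forall>q\<in>frontier \<Omega>. \<exists>V \<rho>. open V \<and> q \<in> V \<and> smooth_fun A V \<rho> \<and>
        (\<forall>x\<in>V. \<forall>c\<in>A. x \<in> fst c \<longrightarrow>
           frechet_derivative (\<rho> \<circ> inv_chart c) (at (snd c x)) \<noteq> (\<lambda>_. 0)) \<and>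
        \<Omega> \<inter> V = {x\<in>V. \<rho> x < 0})"

text \<open>
  The tangent plane of the boundary at \<open>q\<close>, realized in the chart \<open>c\<close> around \<open>q\<close>: the points of
  the chart domain whose coordinates lie on the affine hyperplane through the coordinates of \<open>q\<close>
  parallel to the coordinate image of the tangent space.
\<close>

definition tangent_plane ::
  "('m::topological_space, 'e::euclidean_space) chart set \<Rightarrow> 'm set \<Rightarrow> ('m, 'e) chart \<Rightarrow> 'm \<Rightarrow>
   'm set" where
  "tangent_plane A \<Omega> c q =
     {x \<in> fst c. \<exists>v\<in>tangent_space_of A (frontier \<Omega>) q. snd c x = snd c q + v c}"

definition tangent_plane_dist ::
  "('m::topological_space, 'e::euclidean_space) chart set \<Rightarrow>
   ('m \<Rightarrow> ('m, 'e) tangent \<Rightarrow> ('m, 'e) tangent \<Rightarrow> real) \<Rightarrow> 'm set \<Rightarrow> ('m, 'e) chart \<Rightarrow>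
   'm \<Rightarrow> 'm \<Rightarrow> ennreal" where
  "tangent_plane_dist A g \<Omega> c q p = (INF x\<in>tangent_plane A \<Omega> c q. riem_dist A g p x)"

text \<open>
  In the following, \<open>\<kappa> q\<close> is the chart around the boundary point \<open>q\<close> in which the tangent plane at
  \<open>q\<close> is realized.
\<close>

definition approach_region ::
  "('m::topological_space, 'e::euclidean_space) chart set \<Rightarrow>
   ('m \<Rightarrow> ('m, 'e) tangent \<Rightarrow> ('m, 'e) tangent \<Rightarrow> real) \<Rightarrow> 'm set \<Rightarrow>
   ('m \<Rightarrow> ('m, 'e) chart) \<Rightarrow> real \<Rightarrow> 'm \<Rightarrow> 'm set" where
  "approach_region A g \<Omega> \<kappa> \<alpha> q =
     {p\<in>\<Omega>. riem_dist A g p q \<le> ennreal \<alpha> * tangent_plane_dist A g \<Omega> (\<kappa> q) q p}"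

text \<open>Relevant only on the closure of \<open>\<Omega>\<close>.\<close>

definition nontangential_extension ::
  "('m::topological_space, 'e::euclidean_space) chart set \<Rightarrow>
   ('m \<Rightarrow> ('m, 'e) tangent \<Rightarrow> ('m, 'e) tangent \<Rightarrow> real) \<Rightarrow> 'm set \<Rightarrow>
   ('m \<Rightarrow> ('m, 'e) chart) \<Rightarrow> ('m \<Rightarrow> ereal) \<Rightarrow> 'm \<Rightarrow> ereal" where
  "nontangential_extension A g \<Omega> \<kappa> u q =
     (if q \<in> \<Omega> then u q
      else (SUP \<alpha>\<in>{1<..}. Limsup (at q within approach_region A g \<Omega> \<kappa> \<alpha> q) u))"

end

theory Submission
  imports Defs
begin

text \<open>
  Every point \<open>z\<close> of an approach region at \<open>p\<close> that is close to \<open>p\<close> is the centre of a small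
  \<open>J\<close>-complex disc \<open>f\<close> in \<open>\<Omega>\<close> that is attached to \<open>E\<close> along half of its boundary circle and descends
  from \<open>E\<close> into \<open>\<Omega>\<close> non-tangentially. Along a radius that ends on this half circle the values of
  \<open>u \<circ> f\<close> are eventually controlled by \<open>u\<^sup>*\<close> at a point of \<open>E\<close> near \<open>p\<close>, hence at most \<open>-N\<close>;
  elsewhere they are at most an upper bound \<open>B\<close> of \<open>u\<close>. The mean value inequality and Fatou's lemma
  (\<open>subharmonic_radial_bound\<close>) give \<open>u z \<le> B - N / 2\<close>, where \<open>N\<close> is arbitrary.

  The discs are found by a blow-up. In a chart that maps \<open>E\<close> into a linear subspace, the dilation by
  \<open>\<delta> = norm (z - p)\<close> makes the almost complex structure a perturbation of size \<open>O(\<delta>)\<close> of a constant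
  one, \<open>J0\<close> (\<open>small_field_rescale\<close>). Since the subspace is totally real of half the dimension, it is the
  fixed space of a conjugation \<open>cj\<close> that anticommutes with \<open>J0\<close>, and the unperturbed discs are
  \<open>\<zeta> \<mapsto> c + sin \<zeta> d\<close> with \<open>c\<close>, \<open>d\<close> in the subspace. They are periodic on the strip \<open>0 \<le> y \<le> 1\<close>, so the
  perturbed equation \<open>F\<^sub>y = J0 F\<^sub>x + K(F) F\<^sub>x\<close> turns into ordinary differential equations for the
  Fourier coefficients with respect to \<open>x\<close>. Solving the linear equations gains one power of the
  frequency, which is what the derivative in \<open>K(F) F\<^sub>x\<close> costs; therefore Picard iteration contracts
  on coefficients of size \<open>O(\<bar>k\<bar>\<^sup>-\<^sup>3)\<close>, and there is a solution with prescribed centre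
  (\<open>attached_disc_exists\<close>).

  The disc descends because a defining function \<open>\<rho>\<close> of \<open>\<Omega>\<close> satisfies \<open>\<rho> \<le> 0\<close> on \<open>E\<close>, so that its
  differential at \<open>p\<close> vanishes on the tangent space of \<open>E\<close>. The normal component of \<open>z - p\<close>, which in an
  approach region is comparable to \<open>norm (z - p)\<close>, is then carried by \<open>J0 d\<close>, the \<open>y\<close>-derivative of
  the disc (\<open>attached_disc_below\<close>). Near a boundary point \<open>q\<close>, approach regions are the same as regions
  \<open>\<rho> z \<le> - a * norm (z - q)\<close> in any chart (\<open>approach_region_imp_rho\<close>, \<open>rho_imp_approach_region\<close>): Riemannian
  and coordinate distance are comparable, and the tangent plane is the kernel of the differential of \<open>\<rho>\<close>.
\<close>

section \<open>Termwise calculus for absolutely convergent series\<close>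

lemma continuous_on_infsum:
  fixes f :: "'i \<Rightarrow> 'a::topological_space \<Rightarrow> 'b::banach"
  assumes "\<And>i. i \<in> X \<Longrightarrow> continuous_on S (f i)"
    and "\<And>i x. i \<in> X \<Longrightarrow> x \<in> S \<Longrightarrow> norm (f i x) \<le> M i" and "M summable_on X"
  shows "continuous_on S (\<lambda>x. \<Sum>\<^sub>\<infinity>i\<in>X. f i x)"
proof (rule uniform_limit_theorem)
  show "uniform_limit S (\<lambda>F x. \<Sum>i\<in>F. f i x) (\<lambda>x. \<Sum>\<^sub>\<infinity>i\<in>X. f i x) (finite_subsets_at_top X)"
    using assms(2,3) by (rule Weierstrass_m_test_general)
  show "\<forall>\<^sub>F F in finite_subsets_at_top X. continuous_on S (\<lambda>x. \<Sum>i\<in>F. f i x)"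
    using assms(1)
    by (auto intro!: eventually_finite_subsets_at_top_weakI continuous_on_sum)
qed simp

lemma integral_infsum:
  fixes f :: "'i \<Rightarrow> real \<Rightarrow> 'b::banach"
  assumes "\<And>i. i \<in> X \<Longrightarrow> continuous_on {a..b} (f i)"
    and "\<And>i x. i \<in> X \<Longrightarrow> x \<in> {a..b} \<Longrightarrow> norm (f i x) \<le> M i" and "M summable_on X"
  shows "((\<lambda>i. integral {a..b} (f i)) has_sum integral {a..b} (\<lambda>x. \<Sum>\<^sub>\<infinity>i\<in>X. f i x)) X"
proof -
  let ?f = "\<lambda>F x. \<Sum>i\<in>F\<inter>X. f i x"
  have "uniform_limit {a..b} (\<lambda>F x. \<Sum>i\<in>F. f i x) (\<lambda>x. \<Sum>\<^sub>\<infinity>i\<in>X. f i x) (finite_subsets_at_top X)"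
    using assms(2,3) by (rule Weierstrass_m_test_general)
  also have "?this \<longleftrightarrow> uniform_limit {a..b} ?f (\<lambda>x. \<Sum>\<^sub>\<infinity>i\<in>X. f i x) (finite_subsets_at_top X)"
    by (rule uniform_limit_cong) (auto intro!: eventually_finite_subsets_at_top_weakI simp: Int_absorb2)
  finally have u: "uniform_limit {a..b} ?f (\<lambda>x. \<Sum>\<^sub>\<infinity>i\<in>X. f i x) (finite_subsets_at_top X)" .
  have c: "continuous_on {a..b} (?f F)" for F
    using assms(1) by (auto intro!: continuous_on_sum)
  obtain I J where I: "\<And>F. (?f F has_integral I F) {a..b}"
    and J: "((\<lambda>x. \<Sum>\<^sub>\<infinity>i\<in>X. f i x) has_integral J) {a..b}"
    and lim: "(I \<longlongrightarrow> J) (finite_subsets_at_top X)"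
    using uniform_limit_integral[OF u c] by auto
  have I': "I F = (\<Sum>i\<in>F. integral {a..b} (f i))" if "finite F" "F \<subseteq> X" for F
  proof -
    have "I F = integral {a..b} (?f F)" using I by (metis integral_unique)
    also have "\<dots> = (\<Sum>i\<in>F\<inter>X. integral {a..b} (f i))"
      using that assms(1) by (intro integral_sum) (auto intro!: integrable_continuous_real)
    finally show ?thesis using that by (simp add: Int_absorb2)
  qed
  have "\<forall>\<^sub>F F in finite_subsets_at_top X. I F = (\<Sum>i\<in>F. integral {a..b} (f i))"
    by (rule eventually_finite_subsets_at_top_weakI) (use I' in auto)
  with lim have "((\<lambda>F. \<Sum>i\<in>F. integral {a..b} (f i)) \<longlongrightarrow> J) (finite_subsets_at_top X)"
    using tendsto_cong by blast
  moreover have "J = integral {a..b} (\<lambda>x. \<Sum>\<^sub>\<infinity>i\<in>X. f i x)" using J by (simp add: integral_unique)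
  ultimately show ?thesis by (simp add: has_sum_def)
qed

lemma has_vector_derivative_infsum:
  fixes f :: "'i \<Rightarrow> real \<Rightarrow> 'b::banach"
  assumes der: "\<And>i x. i \<in> X \<Longrightarrow> x \<in> {a..b} \<Longrightarrow> (f i has_vector_derivative f' i x) (at x within {a..b})"
    and cont: "\<And>i. i \<in> X \<Longrightarrow> continuous_on {a..b} (f' i)"
    and bd: "\<And>i x. i \<in> X \<Longrightarrow> x \<in> {a..b} \<Longrightarrow> norm (f i x) \<le> M i" "M summable_on X"
    and bd': "\<And>i x. i \<in> X \<Longrightarrow> x \<in> {a..b} \<Longrightarrow> norm (f' i x) \<le> M' i" "M' summable_on X"
    and x: "x \<in> {a..b}"
  shows "((\<lambda>x. \<Sum>\<^sub>\<infinity>i\<in>X. f i x) has_vector_derivative (\<Sum>\<^sub>\<infinity>i\<in>X. f' i x)) (at x within {a..b})"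
proof -
  have sumf: "(\<lambda>i. f i x) summable_on X" if "x \<in> {a..b}" for x
  proof (rule abs_summable_summable)
    show "(\<lambda>i. f i x) abs_summable_on X"
      by (rule Infinite_Sum.abs_summable_on_comparison_test'[OF bd(2)]) (use bd(1) that in auto)
  qed
  have eq: "(\<Sum>\<^sub>\<infinity>i\<in>X. f i x) = (\<Sum>\<^sub>\<infinity>i\<in>X. f i a) + integral {a..x} (\<lambda>x. \<Sum>\<^sub>\<infinity>i\<in>X. f' i x)"
    if x: "x \<in> {a..b}" for x
  proof -
    have "((\<lambda>i. integral {a..x} (f' i)) has_sum integral {a..x} (\<lambda>x. \<Sum>\<^sub>\<infinity>i\<in>X. f' i x)) X"
    proof (rule integral_infsum[where M=M'])
      show "continuous_on {a..x} (f' i)" if "i \<in> X" for i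
        by (rule continuous_on_subset[OF cont[OF that]]) (use x in auto)
    qed (use x bd' in auto)
    moreover have int: "integral {a..x} (f' i) = f i x - f i a" if i: "i \<in> X" for i
    proof (rule integral_unique, rule fundamental_theorem_of_calculus)
      show "(f i has_vector_derivative f' i t) (at t within {a..x})" if "t \<in> {a..x}" for t
        by (rule has_vector_derivative_within_subset[OF der[OF i]]) (use that x in auto)
    qed (use x in auto)
    ultimately have 1: "((\<lambda>i. f i x - f i a) has_sum integral {a..x} (\<lambda>x. \<Sum>\<^sub>\<infinity>i\<in>X. f' i x)) X"
      using has_sum_cong[of X "\<lambda>i. integral {a..x} (f' i)" "\<lambda>i. f i x - f i a"] by simp
    have "a \<in> {a..b}" using x by auto
    from has_sum_add[OF 1 has_sum_infsum[OF sumf[OF this]]]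
    have "((\<lambda>i. f i x) has_sum integral {a..x} (\<lambda>x. \<Sum>\<^sub>\<infinity>i\<in>X. f' i x) + (\<Sum>\<^sub>\<infinity>i\<in>X. f i a)) X"
      by simp
    then show ?thesis by (simp add: infsumI add.commute)
  qed
  have "continuous_on {a..b} (\<lambda>x. \<Sum>\<^sub>\<infinity>i\<in>X. f' i x)"
    using cont bd' by (rule continuous_on_infsum)
  then have "((\<lambda>u. (\<Sum>\<^sub>\<infinity>i\<in>X. f i a) + integral {a..u} (\<lambda>x. \<Sum>\<^sub>\<infinity>i\<in>X. f' i x)) 
      has_vector_derivative 0 + (\<Sum>\<^sub>\<infinity>i\<in>X. f' i x)) (at x within {a..b})"
    by (rule has_vector_derivative_add[OF has_vector_derivative_const 
          integral_has_vector_derivative[OF _ x]])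
  then have "((\<lambda>u. (\<Sum>\<^sub>\<infinity>i\<in>X. f i a) + integral {a..u} (\<lambda>x. \<Sum>\<^sub>\<infinity>i\<in>X. f' i x)) 
      has_vector_derivative (\<Sum>\<^sub>\<infinity>i\<in>X. f' i x)) (at x within {a..b})"
    by simp
  then show ?thesis
    by (rule has_vector_derivative_transform[OF x eq, rotated])
qed

section \<open>Weights on the integers\<close>

definition wt :: "int \<Rightarrow> real" where
  "wt k = 1 + \<bar>of_int k\<bar>"

lemma wt_ge_1 [simp]: "1 \<le> wt k" and wt_pos [simp]: "0 < wt k" and wt_nz [simp]: "wt k \<noteq> 0"
  by (auto simp: wt_def)

lemma abs_le_wt: "\<bar>of_int k\<bar> \<le> wt k"
  by (simp add: wt_def)

lemma wt_minus [simp]: "wt (- k) = wt k"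
  by (simp add: wt_def)

lemma wt_subadditive: "wt k \<le> wt (k - j) + wt j"
  by (simp add: wt_def)

lemma wt_summable: "(\<lambda>k. 1 / wt k ^ 2) summable_on UNIV"
proof -
  have *: "(\<lambda>n::nat. 1 / wt (int n) ^ 2) summable_on UNIV"
  proof (rule norm_summable_imp_summable_on)
    have "summable (\<lambda>n. inverse ((real (Suc n))\<^sup>2))"
      using inverse_power_summable[of 2, where 'a=real]
      by (subst summable_Suc_iff) auto
    then show "summable (\<lambda>n. norm (1 / wt (int n) ^ 2))"
      by (simp add: wt_def divide_inverse add.commute)
  qed
  have 1: "(\<lambda>k. 1 / wt k ^ 2) summable_on range int"
    using * by (subst summable_on_reindex) (auto simp: o_def)
  have 2: "(\<lambda>k. 1 / wt k ^ 2) summable_on range (\<lambda>n. - int n)"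
    using * by (subst summable_on_reindex) (auto simp: o_def inj_on_def)
  have "UNIV = range int \<union> (range (\<lambda>n. - int n) - range int)"
    by (auto simp: image_iff) (metis int_cases2)
  moreover have "(\<lambda>k. 1 / wt k ^ 2) summable_on range (\<lambda>n. - int n) - range int"
    by (rule summable_on_subset_banach[OF 2]) auto
  ultimately show ?thesis
    using summable_on_Un_disjoint[OF 1] by fastforce
qed

definition wt_sum :: real where
  "wt_sum = (\<Sum>\<^sub>\<infinity>k. 1 / wt k ^ 2)"

lemma wt_sum_ge_1: "1 \<le> wt_sum"
proof -
  have "(\<Sum>\<^sub>\<infinity>k\<in>{0}. 1 / wt k ^ 2) \<le> wt_sum"
    unfolding wt_sum_def by (rule infsum_mono2) (auto intro: wt_summable)
  then show ?thesis by (simp add: wt_def)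
qed

lemma wt_shift_summable: "(\<lambda>j. 1 / wt (k - j) ^ 2) summable_on UNIV"
  and wt_shift_sum: "(\<Sum>\<^sub>\<infinity>j. 1 / wt (k - j) ^ 2) = wt_sum"
proof -
  have b: "bij (\<lambda>j. k - j)" by (rule bij_betw_byWitness[where f'="\<lambda>j. k - j"]) auto
  show "(\<lambda>j. 1 / wt (k - j) ^ 2) summable_on UNIV"
    using summable_on_reindex_bij_betw[OF b, of "\<lambda>k. 1 / wt k ^ 2"] wt_summable by simp
  show "(\<Sum>\<^sub>\<infinity>j. 1 / wt (k - j) ^ 2) = wt_sum"
    using infsum_reindex_bij_betw[OF b, of "\<lambda>k. 1 / wt k ^ 2"] by (simp add: wt_sum_def)
qed

text \<open>
  The weights are convolution-stable: since \<open>wt k \<le> wt (k - j) + wt j\<close>, at least one factor of a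
  convolution decays as fast as the result should, and the other one is summable.
\<close>

lemma wt_convolution:
  assumes "s = 1 \<or> s = 2"
  shows "1 / (wt (k - j) ^ s * wt j ^ 2) \<le> (2 / wt (k - j) ^ 2 + 2 / wt j ^ 2) / wt k ^ s"
  using assms
proof
  define a b c where abc: "a = wt (k - j)" "b = wt j" "c = wt k"
  have pos: "1 \<le> a" "1 \<le> b" "1 \<le> c" "c \<le> a + b"
    using wt_subadditive[of k j] by (auto simp: abc)
  {
    assume s: "s = 1"
    have "c * a \<le> (a + b) * a" using pos by (intro mult_right_mono) auto
    also have "\<dots> \<le> 2 * b ^ 2 + 2 * a ^ 2"
    proof -
      have "2 * (a * b) \<le> a ^ 2 + b ^ 2" using sum_squares_bound[of a b] by simp
      moreover have "0 \<le> a\<^sup>2" "0 \<le> b\<^sup>2" by auto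
      ultimately have "a * b + a\<^sup>2 \<le> 2 * b\<^sup>2 + 2 * a\<^sup>2" by linarith
      then show ?thesis by (simp add: algebra_simps power2_eq_square)
    qed
    finally have "c * a \<le> 2 * b ^ 2 + 2 * a ^ 2" .
    then have "1 / (a * b ^ 2) \<le> (2 / a ^ 2 + 2 / b ^ 2) / c"
      using pos by (simp add: divide_simps power2_eq_square)
        (simp add: algebra_simps)
    then show ?thesis by (simp add: s abc)
  next
    assume s: "s = 2"
    have "c ^ 2 \<le> (a + b) ^ 2" using pos by (intro power_mono) auto
    also have "\<dots> \<le> 2 * b ^ 2 + 2 * a ^ 2"
    proof -
      have "2 * (a * b) \<le> a ^ 2 + b ^ 2" using sum_squares_bound[of a b] by simp
      then show ?thesis by (simp add: power2_sum)
    qed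
    finally have "c ^ 2 \<le> 2 * b ^ 2 + 2 * a ^ 2" .
    then have "1 / (a ^ 2 * b ^ 2) \<le> (2 / a ^ 2 + 2 / b ^ 2) / c ^ 2"
      using pos by (simp add: divide_simps)
    then show ?thesis by (simp add: s abc)
  }
qed

text \<open>
  Convolution with a sequence of size \<open>O(1 / wt k ^ 2)\<close> preserves the decay rates 1 and 2.
\<close>

lemma infsum_wt_convolution:
  assumes "s = 1 \<or> s = 2"
  shows "(\<lambda>j. 1 / (wt (k - j) ^ s * wt j ^ 2)) summable_on UNIV"
    and "(\<Sum>\<^sub>\<infinity>j. 1 / (wt (k - j) ^ s * wt j ^ 2)) \<le> 4 * wt_sum / wt k ^ s"
proof -
  have hs: "((\<lambda>j. (2 / wt (k - j) ^ 2 + 2 / wt j ^ 2) / wt k ^ s) has_sum (2 * wt_sum + 2 * wt_sum) / wt k ^ s) UNIV"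
  proof -
    have "((\<lambda>j. 1 / wt (k - j) ^ 2) has_sum wt_sum) UNIV"
      using wt_shift_summable[of k] wt_shift_sum[of k] by (simp add: has_sum_iff)
    moreover have "((\<lambda>j. 1 / wt j ^ 2) has_sum wt_sum) UNIV"
      using wt_summable by (simp add: has_sum_iff wt_sum_def)
    ultimately have "((\<lambda>j. (2 * (1 / wt (k - j) ^ 2) + 2 * (1 / wt j ^ 2)) * (1 / wt k ^ s)) has_sum
         (2 * wt_sum + 2 * wt_sum) * (1 / wt k ^ s)) UNIV"
      by (intro has_sum_cmult_left has_sum_add has_sum_cmult_right)
    then show ?thesis by simp
  qed
  show 1: "(\<lambda>j. 1 / (wt (k - j) ^ s * wt j ^ 2)) summable_on UNIV"
    by (rule summable_on_comparison_test[OF has_sum_imp_summable[OF hs]]) 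
       (use wt_convolution[OF assms] in \<open>auto intro!: divide_nonneg_nonneg mult_nonneg_nonneg simp: less_imp_le\<close>)
  show "(\<Sum>\<^sub>\<infinity>j. 1 / (wt (k - j) ^ s * wt j ^ 2)) \<le> 4 * wt_sum / wt k ^ s"
    using infsum_mono[OF 1 has_sum_imp_summable[OF hs] wt_convolution[OF assms]] infsumI[OF hs]
    by simp
qed

section \<open>Fourier coefficients of scalar functions\<close>

text \<open>
  Without the usual factor \<open>1 / (2 * pi)\<close>, which enters only when a function is recovered from its
  coefficients.
\<close>

definition fc :: "(real \<Rightarrow> real) \<Rightarrow> int \<Rightarrow> complex" where
  "fc h k = integral {0..2*pi} (\<lambda>x. cis (- (of_int k * x)) * of_real (h x))"

lemma fc_integrable:
  assumes "continuous_on {0..2*pi} h"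
  shows "(\<lambda>x. cis (- (of_int k * x)) * of_real (h x)) integrable_on {0..2*pi}"
  by (intro integrable_continuous_real continuous_intros assms)

lemma fc_add:
  assumes "continuous_on {0..2*pi} f" "continuous_on {0..2*pi} g"
  shows "fc (\<lambda>x. f x + g x) k = fc f k + fc g k"
  unfolding fc_def
  by (subst integral_add[symmetric, OF fc_integrable[OF assms(1)] fc_integrable[OF assms(2)]])
    (simp add: algebra_simps)

lemma fc_sum:
  assumes "finite I" "\<And>i. i \<in> I \<Longrightarrow> continuous_on {0..2*pi} (f i)"
  shows "fc (\<lambda>x. \<Sum>i\<in>I. f i x) k = (\<Sum>i\<in>I. fc (f i) k)"
  unfolding fc_def
  by (subst integral_sum[symmetric, OF assms(1) fc_integrable[OF assms(2)]])
    (simp_all add: sum_distrib_left)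

lemma norm_fc_le:
  assumes "continuous_on {0..2*pi} h" "\<And>x. x \<in> {0..2*pi} \<Longrightarrow> \<bar>h x\<bar> \<le> A"
  shows "cmod (fc h k) \<le> 2 * pi * A"
proof -
  have "cmod (fc h k) \<le> A * (2*pi - 0)"
    unfolding fc_def
    by (rule integral_bound) (auto intro!: continuous_intros assms simp: norm_mult)
  then show ?thesis by (simp add: mult_ac)
qed

lemma has_vector_derivative_cis_mult:
  "((\<lambda>x. cis (a * x)) has_vector_derivative \<i> * of_real a * cis (a * x)) (at x within S)"
proof -
  have "((\<lambda>x. exp (\<i> * (of_real a * of_real x))) has_vector_derivative 
     \<i> * of_real a * exp (\<i> * (of_real a * of_real x))) (at x within S)"
    by (rule has_vector_derivative_real_field) (auto intro!: derivative_eq_intros)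
  then show ?thesis by (simp add: cis_conv_exp)
qed

lemma fc_deriv:
  assumes der: "\<And>x. x \<in> {0..2*pi} \<Longrightarrow> (h has_vector_derivative h' x) (at x within {0..2*pi})"
    and cont: "continuous_on {0..2*pi} h'" and per: "h (2*pi) = h 0"
  shows "fc h' k = \<i> * of_int k * fc h k"
proof -
  let ?e = "\<lambda>x. cis (- (of_int k * x))"
  have ch: "continuous_on {0..2*pi} h"
    using der by (intro continuous_on_vector_derivative) 
  have cisd: "(?e has_vector_derivative - \<i> * of_int k * ?e x) (at x within {0..2*pi})" for x
    using has_vector_derivative_cis_mult[of "- of_int k" x "{0..2*pi}"] by simp
  have ofr: "((\<lambda>x. of_real (h x) :: complex) has_vector_derivative of_real (h' x)) (at x within {0..2*pi})"
    if "x \<in> {0..2*pi}" for x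
    using bounded_linear.has_vector_derivative[OF bounded_linear_of_real der[OF that]] .
  have "((\<lambda>x. ?e x * of_real (h x)) has_vector_derivative
        ?e x * of_real (h' x) - \<i> * of_int k * (?e x * of_real (h x))) (at x within {0..2*pi})"
    if "x \<in> {0..2*pi}" for x
    using has_vector_derivative_mult[OF cisd[of x] ofr[OF that]]
    by (simp add: algebra_simps)
  then have "((\<lambda>x. ?e x * of_real (h' x) - \<i> * of_int k * (?e x * of_real (h x))) has_integral
      ?e (2*pi) * of_real (h (2*pi)) - ?e 0 * of_real (h 0)) {0..2*pi}"
    by (intro fundamental_theorem_of_calculus) auto
  moreover have "?e (2*pi) = 1"
    using cis_multiple_2pi[of "- of_int k"] by (simp add: mult_ac)
  ultimately have "((\<lambda>x. ?e x * of_real (h' x) - \<i> * of_int k * (?e x * of_real (h x))) has_integral 0) {0..2*pi}"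
    using per by simp
  moreover have "((\<lambda>x. ?e x * of_real (h' x) - \<i> * of_int k * (?e x * of_real (h x))) has_integral
      fc h' k - \<i> * of_int k * fc h k) {0..2*pi}"
    unfolding fc_def
    by (intro has_integral_diff has_integral_mult_right integrable_integral fc_integrable ch cont)
  ultimately have "fc h' k - \<i> * of_int k * fc h k = 0"
    using has_integral_unique by blast
  then show ?thesis by simp
qed

text \<open>
  Integration by parts divides by \<open>\<i> * k\<close>, so a coefficient of the function decays one order faster
  than that of its derivative. The frequency 0 is lost and has to be bounded separately.
\<close>

lemma fc_gain:
  assumes "\<And>x. x \<in> {0..2*pi} \<Longrightarrow> (h has_vector_derivative h' x) (at x within {0..2*pi})"
    and "continuous_on {0..2*pi} h'" and "h (2*pi) = h 0"
    and h': "\<And>k. cmod (fc h' k) \<le> B / wt k ^ s" and h0: "cmod (fc h 0) \<le> B"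
  shows "cmod (fc h k) \<le> 2 * B / wt k ^ Suc s"
proof (cases "k = 0")
  case True
  then show ?thesis using h0 order_trans[OF norm_ge_zero h0] by (simp add: wt_def)
next
  case False
  then have k: "1 \<le> \<bar>real_of_int k\<bar>" by simp
  have "wt k * cmod (fc h k) \<le> 2 * (\<bar>of_int k\<bar> * cmod (fc h k))"
    using mult_right_mono[OF k, of "cmod (fc h k)"] by (simp add: wt_def algebra_simps)
  also have "\<bar>of_int k\<bar> * cmod (fc h k) = cmod (fc h' k)"
    by (subst fc_deriv[OF assms(1-3)]) (auto simp: norm_mult)
  also have "\<dots> \<le> B / wt k ^ s" by (rule h')
  finally have "wt k * cmod (fc h k) \<le> 2 * (B / wt k ^ s)" by simp
  then have "cmod (fc h k) \<le> 2 * (B / wt k ^ s) / wt k"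
    using wt_pos[of k] by (simp only: pos_le_divide_eq mult.commute)
  also have "\<dots> = 2 * B / wt k ^ Suc s" by simp
  finally show ?thesis .
qed

lemma fc_C1:
  assumes der: "\<And>x. x \<in> {0..2*pi} \<Longrightarrow> (h has_vector_derivative h' x) (at x within {0..2*pi})"
    and cont: "continuous_on {0..2*pi} h'" and per: "h (2*pi) = h 0"
    and bd: "\<And>x. x \<in> {0..2*pi} \<Longrightarrow> \<bar>h x\<bar> \<le> A" "\<And>x. x \<in> {0..2*pi} \<Longrightarrow> \<bar>h' x\<bar> \<le> A"
  shows "cmod (fc h k) \<le> 4 * pi * A / wt k"
proof -
  have "cmod (fc h k) \<le> 2 * (2 * pi * A) / wt k ^ Suc 0"
  proof (rule fc_gain[OF der cont per])
    show "cmod (fc h' k) \<le> (2 * pi * A) / wt k ^ 0" for k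
      using norm_fc_le[OF cont bd(2)] by simp
    show "cmod (fc h 0) \<le> 2 * pi * A"
      by (rule norm_fc_le[OF continuous_on_vector_derivative[OF der] bd(1)])
  qed
  then show ?thesis by simp
qed

text \<open>
  The components of a vector-valued trigonometric series are real combinations of cosines and sines;
  multiplying by one of them shifts the frequency by \<open>j\<close> in both directions.
\<close>

lemma fc_cos_sin:
  assumes "continuous_on {0..2*pi} q"
  shows "integral {0..2*pi} (\<lambda>x. cis (- (of_int k * x)) * of_real (q x * (cos (of_int j * x) * a + sin (of_int j * x) * b)))
    = of_real a * (fc q (k - j) + fc q (k + j)) / 2 - \<i> * of_real b * (fc q (k - j) - fc q (k + j)) / 2"
proof (rule integral_unique)
  have 1: "cis (- (of_int k * x)) * of_real (q x * (cos (of_int j * x) * a + sin (of_int j * x) * b)) =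
      of_real a * (cis (- (of_int (k - j) * x)) * of_real (q x) + cis (- (of_int (k + j) * x)) * of_real (q x)) / 2
      - \<i> * of_real b * (cis (- (of_int (k - j) * x)) * of_real (q x) - cis (- (of_int (k + j) * x)) * of_real (q x)) / 2"
    (is "?L = ?R") for x
  proof -
    define E where "E = cis (of_int j * x)"
    have c: "of_real (cos (of_int j * x)) = (E + cnj E) / 2"
      and s: "of_real (sin (of_int j * x)) = - \<i> * (E - cnj E) / 2"
      by (simp_all add: E_def complex_eq_iff)
    have k1: "cis (- (of_int (k - j) * x)) = cis (- (of_int k * x)) * E"
      unfolding E_def by (subst cis_mult) (simp add: algebra_simps)
    have k2: "cis (- (of_int (k + j) * x)) = cis (- (of_int k * x)) * cnj E"
      unfolding E_def cis_cnj by (subst cis_mult) (simp add: algebra_simps)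
    show ?thesis
      unfolding k1 k2 of_real_mult of_real_add c s by (simp add: field_simps)
  qed
  show "((\<lambda>x. cis (- (of_int k * x)) * of_real (q x * (cos (of_int j * x) * a + sin (of_int j * x) * b)))
    has_integral of_real a * (fc q (k - j) + fc q (k + j)) / 2 - \<i> * of_real b * (fc q (k - j) - fc q (k + j)) / 2) {0..2*pi}"
    unfolding 1 fc_def
    by (intro has_integral_diff has_integral_divide has_integral_add has_integral_mult_right 
        integrable_integral fc_integrable assms)
qed

section \<open>Vector-valued trigonometric series\<close>

text \<open>
  A real vector space with a complex structure \<open>J0\<close> and a conjugation \<open>cj\<close>; the fixed points of the
  conjugation form a totally real subspace.
\<close>

locale conj_space =
  fixes J0 cj :: "'e::euclidean_space \<Rightarrow> 'e"
  assumes lin_J0: "linear J0" and J0_J0 [simp]: "J0 (J0 v) = - v"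
    and lin_cj: "linear cj" and cj_cj [simp]: "cj (cj v) = v" and cj_J0: "cj (J0 v) = - J0 (cj v)"
begin

text \<open>
  Multiplication by a complex number, with \<open>J0\<close> in the role of the imaginary unit.
\<close>

definition cm :: "complex \<Rightarrow> 'e \<Rightarrow> 'e" where
  "cm z v = Re z *\<^sub>R v + Im z *\<^sub>R J0 v"

text \<open>
  A common bound for complex multiplication and for the conjugation.
\<close>

definition cmb :: real where
  "cmb = 1 + onorm J0 + onorm cj"

lemma bl_J0: "bounded_linear J0" and bl_cj: "bounded_linear cj"
  using lin_J0 lin_cj by (auto simp: linear_conv_bounded_linear)

lemma norm_J0: "norm (J0 v) \<le> onorm J0 * norm v" and norm_cj: "norm (cj v) \<le> onorm cj * norm v"
  by (rule onorm bl_J0 bl_cj)+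

lemma cmb_ge_1: "1 \<le> cmb" and onorm_J0_le: "1 + onorm J0 \<le> cmb" and onorm_cj_le: "onorm cj \<le> cmb"
  using onorm_pos_le[OF bl_J0] onorm_pos_le[OF bl_cj] by (auto simp: cmb_def)

lemma norm_J0_cmb: "norm v + norm (J0 v) \<le> cmb * norm v"
  using norm_J0[of v] onorm_J0_le mult_right_mono[OF onorm_J0_le, of "norm v"] by (simp add: algebra_simps)

lemma norm_cj_cmb: "norm (cj v) \<le> cmb * norm v"
  using norm_cj[of v] mult_right_mono[OF onorm_cj_le, of "norm v"] by simp

lemma norm_cm: "norm (cm z v) \<le> cmb * (cmod z * norm v)"
proof -
  have "norm (cm z v) \<le> \<bar>Re z\<bar> * norm v + \<bar>Im z\<bar> * norm (J0 v)"
    unfolding cm_def by (rule norm_triangle_le) simp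
  also have "\<dots> \<le> cmod z * norm v + cmod z * norm (J0 v)"
    by (intro add_mono mult_right_mono abs_Re_le_cmod abs_Im_le_cmod) auto
  also have "\<dots> = cmod z * (norm v + norm (J0 v))" by (simp add: algebra_simps)
  also have "\<dots> \<le> cmod z * (cmb * norm v)" by (intro mult_left_mono norm_J0_cmb) auto
  finally show ?thesis by (simp add: mult_ac)
qed

sublocale cm: bounded_bilinear cm
proof
  show "\<exists>K. \<forall>a b. norm (cm a b) \<le> norm a * norm b * K"
    using norm_cm by (intro exI[of _ cmb]) (auto simp: mult_ac)
qed (auto simp: cm_def algebra_simps linear_add[OF lin_J0] linear_scale[OF lin_J0])

lemma cm_mult: "cm (z * w) v = cm z (cm w v)"
  by (simp add: cm_def linear_add[OF lin_J0] linear_scale[OF lin_J0] algebra_simps)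

lemma cm_1 [simp]: "cm 1 v = v" and cm_i: "cm \<i> v = J0 v"
  by (simp_all add: cm_def)

lemma cm_of_real: "cm (of_real r) v = r *\<^sub>R v"
  by (simp add: cm_def)

lemma cj_cm: "cj (cm z v) = cm (cnj z) (cj v)"
  by (simp add: cm_def linear_add[OF lin_cj] linear_scale[OF lin_cj] cj_J0)

lemma cm_J0: "cm z (J0 v) = J0 (cm z v)"
  by (simp add: cm_i[symmetric] cm_mult[symmetric] mult.commute)

definition decay :: "nat \<Rightarrow> real \<Rightarrow> (int \<Rightarrow> 'e) \<Rightarrow> bool" where
  "decay s A c \<longleftrightarrow> (\<forall>k. norm (c k) \<le> A / wt k ^ s)"

lemma decay_nonneg: "decay s A c \<Longrightarrow> 0 \<le> A"
  by (drule decay_def[THEN iffD1, rule_format, of _ _ _ 0]) (auto simp: wt_def intro: order_trans[OF norm_ge_zero])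

lemma decay_3_2: "decay 3 A c \<Longrightarrow> decay 2 A c"
proof -
  assume d: "decay 3 A c"
  have "A / wt k ^ 3 \<le> A / wt k ^ 2" for k
    using decay_nonneg[OF d] by (intro divide_left_mono power_increasing) auto
  with d show ?thesis by (auto simp: decay_def intro: order_trans)
qed

definition tser :: "(int \<Rightarrow> 'e) \<Rightarrow> real \<Rightarrow> 'e" where
  "tser c x = (\<Sum>\<^sub>\<infinity>k. cm (cis (of_int k * x)) (c k))"

definition dcoef :: "(int \<Rightarrow> 'e) \<Rightarrow> int \<Rightarrow> 'e" where
  "dcoef c k = cm (\<i> * of_int k) (c k)"

lemma decay_dcoef: 
  assumes "decay 3 A c" shows "decay 2 (cmb * A) (dcoef c)"
  unfolding decay_def
proof
  fix k
  have "norm (dcoef c k) \<le> cmb * (\<bar>of_int k\<bar> * norm (c k))"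
    unfolding dcoef_def by (rule order_trans[OF norm_cm]) (simp add: norm_mult)
  also have "\<dots> \<le> cmb * (wt k * (A / wt k ^ 3))"
    using assms cmb_ge_1 by (intro mult_left_mono mult_mono abs_le_wt) (auto simp: decay_def less_imp_le)
  finally show "norm (dcoef c k) \<le> cmb * A / wt k ^ 2"
    by (simp add: power3_eq_cube power2_eq_square)
qed

lemma tser_term_bound:
  assumes "decay 2 A c"
  shows "norm (cm (cis t) (c k)) \<le> cmb * A * (1 / wt k ^ 2)"
proof -
  have "norm (cm (cis t) (c k)) \<le> cmb * norm (c k)" using norm_cm[of "cis t" "c k"] by simp
  also have "\<dots> \<le> cmb * (A / wt k ^ 2)"
    using assms cmb_ge_1 by (intro mult_left_mono) (auto simp: decay_def)
  finally show ?thesis by simp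
qed

lemma tser_bound_summable: "(\<lambda>k. B * (1 / wt k ^ 2)) summable_on UNIV"
  by (intro summable_on_cmult_right wt_summable)

lemma tser_has_sum:
  assumes "decay 2 A c"
  shows "((\<lambda>k. cm (cis (of_int k * x)) (c k)) has_sum tser c x) UNIV"
proof -
  have "(\<lambda>k. norm (cm (cis (of_int k * x)) (c k))) summable_on UNIV"
    by (rule Infinite_Sum.abs_summable_on_comparison_test'[OF tser_bound_summable tser_term_bound[OF assms]])
  then show ?thesis
    unfolding tser_def by (rule has_sum_infsum[OF abs_summable_summable])
qed

lemma norm_tser:
  assumes "decay 2 A c"
  shows "norm (tser c x) \<le> cmb * A * wt_sum"
proof (rule norm_infsum_le[OF tser_has_sum[OF assms]])
  show "((\<lambda>k. cmb * A * (1 / wt k ^ 2)) has_sum cmb * A * wt_sum) UNIV"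
    unfolding wt_sum_def by (intro has_sum_cmult_right has_sum_infsum wt_summable)
qed (rule tser_term_bound[OF assms])

lemma tser_diff:
  assumes "decay 2 A c" "decay 2 A' c'"
  shows "tser (\<lambda>k. c k - c' k) x = tser c x - tser c' x"
proof -
  have "((\<lambda>k. cm (cis (of_int k * x)) (c k) + - cm (cis (of_int k * x)) (c' k)) has_sum tser c x + - tser c' x) UNIV"
    by (intro has_sum_add tser_has_sum[OF assms(1)])
      (simp add: has_sum_uminus tser_has_sum[OF assms(2)])
  then show ?thesis
    unfolding tser_def[of "\<lambda>k. c k - c' k"] by (simp add: infsumI cm.diff_right)
qed

lemma dcoef_diff: "dcoef (\<lambda>k. c k - c' k) = (\<lambda>k. dcoef c k - dcoef c' k)"
  by (auto simp: dcoef_def cm.diff_right)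

lemma tser_periodic: "tser c (x + 2 * pi) = tser c x"
proof -
  have "cis (of_int k * (x + 2 * pi)) = cis (of_int k * x)" for k
    using cis_multiple_2pi[of "of_int k"] by (simp add: distrib_left cis_mult[symmetric] mult_ac)
  then show ?thesis by (simp add: tser_def)
qed

lemma continuous_on_tser_param:
  assumes "\<And>k. continuous_on Y (a k)" "\<And>y. y \<in> Y \<Longrightarrow> decay 2 A (\<lambda>k. a k y)"
  shows "continuous_on (UNIV \<times> Y) (\<lambda>(x, y). tser (\<lambda>k. a k y) x)"
  unfolding tser_def case_prod_beta
proof (rule continuous_on_infsum)
  show "continuous_on (UNIV \<times> Y) (\<lambda>z. cm (cis (of_int k * fst z)) (a k (snd z)))" for k
    by (intro cm.continuous_on continuous_intros continuous_on_compose2[OF assms(1)]) auto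
  show "norm (cm (cis (of_int k * fst z)) (a k (snd z))) \<le> cmb * A * (1 / wt k ^ 2)"
    if "z \<in> UNIV \<times> Y" for k z
    using tser_term_bound[OF assms(2)] that by auto
qed (rule tser_bound_summable)

lemma continuous_on_tser:
  assumes "decay 2 A c" shows "continuous_on X (tser c)"
proof -
  have "continuous_on (UNIV \<times> {0::real}) (\<lambda>(x, y). tser (\<lambda>k. c k) x)"
    using continuous_on_tser_param[of "{0}" "\<lambda>k _. c k" A] assms by auto
  from continuous_on_compose2[OF this, of X "\<lambda>x. (x, 0)"] 
  have *: "continuous_on X (\<lambda>x. (x, 0::real)) \<Longrightarrow> continuous_on X (tser c)" by auto
  show ?thesis by (rule *) (intro continuous_intros)
qed

lemma tser_deriv_within:
  assumes d: "decay 3 A c" and x: "x \<in> {a..b}"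
  shows "(tser c has_vector_derivative tser (dcoef c) x) (at x within {a..b})"
proof -
  have "((\<lambda>x. \<Sum>\<^sub>\<infinity>k. cm (cis (of_int k * x)) (c k)) has_vector_derivative
     (\<Sum>\<^sub>\<infinity>k. cm (cis (of_int k * x)) (dcoef c k))) (at x within {a..b})"
  proof (rule has_vector_derivative_infsum[OF _ _ _ _ _ _ x])
    show "((\<lambda>x. cm (cis (of_int k * x)) (c k)) has_vector_derivative cm (cis (of_int k * t)) (dcoef c k)) (at t within {a..b})"
      for k t
    proof -
      have "((\<lambda>x. cis (of_int k * x)) has_vector_derivative \<i> * of_int k * cis (of_int k * t)) (at t within {a..b})"
        using has_vector_derivative_cis_mult[of "of_int k" t "{a..b}"] by simp
      from bounded_linear.has_vector_derivative[OF cm.bounded_linear_left this]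
      show ?thesis by (simp add: dcoef_def cm_mult[symmetric] mult_ac)
    qed
    show "continuous_on {a..b} (\<lambda>x. cm (cis (of_int k * x)) (dcoef c k))" for k
      by (intro cm.continuous_on continuous_intros)
  qed (rule tser_term_bound[OF decay_3_2[OF d]] tser_bound_summable tser_term_bound[OF decay_dcoef[OF d]])+
  then show ?thesis unfolding tser_def .
qed

lemma tser_deriv:
  assumes "decay 3 A c"
  shows "(tser c has_vector_derivative tser (dcoef c) x) (at x)"
  using tser_deriv_within[OF assms, of x "x - 1" "x + 1"] at_within_Icc_at[of "x - 1" x "x + 1"] by simp

text \<open>
  A single component is a real series; this is the form that scalar Fourier coefficients can be applied
  to.
\<close>

lemma tser_inner_has_sum:
  assumes "decay 2 A c"
  shows "((\<lambda>k. cos (of_int k * x) * (c k \<bullet> l) + sin (of_int k * x) * (J0 (c k) \<bullet> l)) has_sum tser c x \<bullet> l) UNIV"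
  using has_sum_bounded_linear[OF bounded_linear_inner_left tser_has_sum[OF assms], of x l]
  by (simp add: cm_def inner_add_left o_def)

text \<open>
  The coefficients of a product are a convolution, so the decay of \<open>q\<close> survives multiplication by a
  trigonometric series with coefficients of size \<open>O(1 / wt k ^ 2)\<close>.
\<close>

lemma fc_product:
  assumes q: "continuous_on {0..2*pi} q" and B: "\<And>k. cmod (fc q k) \<le> B / wt k ^ s" and s: "s = 1 \<or> s = 2"
    and d: "decay 2 A c"
  shows "cmod (fc (\<lambda>x. q x * (tser c x \<bullet> l)) k) \<le> 4 * wt_sum * cmb * norm l * A * B / wt k ^ s"
proof -
  let ?t = "\<lambda>j x. cos (of_int j * x) * (c j \<bullet> l) + sin (of_int j * x) * (J0 (c j) \<bullet> l)"
  let ?T = "\<lambda>j x. cis (- (of_int k * x)) * of_real (q x * ?t j x) :: complex"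
  let ?K = "norm l * cmb * A"
  have B0: "0 \<le> B" using order_trans[OF norm_ge_zero B[of 0]] by (simp add: wt_def)
  have K0: "0 \<le> ?K" using decay_nonneg[OF d] cmb_ge_1 by simp
  obtain Q where Q: "\<And>x. x \<in> {0..2*pi} \<Longrightarrow> \<bar>q x\<bar> \<le> Q" and Q0: "0 \<le> Q"
  proof -
    have "bounded (q ` {0..2*pi})" by (rule compact_imp_bounded[OF compact_continuous_image[OF q]]) simp
    then obtain Q where "\<forall>y\<in>q ` {0..2*pi}. \<bar>y\<bar> \<le> Q" by (auto simp: bounded_iff)
    then show ?thesis using that[of "max Q 0"] by (force simp: le_max_iff_disj)
  qed
  have ab: "\<bar>c j \<bullet> l\<bar> + \<bar>J0 (c j) \<bullet> l\<bar> \<le> ?K * (1 / wt j ^ 2)" for j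
  proof -
    have "\<bar>c j \<bullet> l\<bar> + \<bar>J0 (c j) \<bullet> l\<bar> \<le> (norm (c j) + norm (J0 (c j))) * norm l"
      unfolding distrib_right by (intro add_mono Cauchy_Schwarz_ineq2)
    also have "\<dots> \<le> (cmb * norm (c j)) * norm l" by (intro mult_right_mono norm_J0_cmb) auto
    also have "\<dots> \<le> (cmb * (A / wt j ^ 2)) * norm l"
      using d cmb_ge_1 by (intro mult_right_mono mult_left_mono) (auto simp: decay_def)
    finally show ?thesis by (simp add: mult_ac)
  qed
  have tb: "\<bar>?t j x\<bar> \<le> \<bar>c j \<bullet> l\<bar> + \<bar>J0 (c j) \<bullet> l\<bar>" for j x
  proof -
    have "\<bar>?t j x\<bar> \<le> \<bar>cos (of_int j * x)\<bar> * \<bar>c j \<bullet> l\<bar> + \<bar>sin (of_int j * x)\<bar> * \<bar>J0 (c j) \<bullet> l\<bar>"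
      by (metis abs_mult abs_triangle_ineq)
    also have "\<dots> \<le> 1 * \<bar>c j \<bullet> l\<bar> + 1 * \<bar>J0 (c j) \<bullet> l\<bar>"
      by (intro add_mono mult_right_mono abs_cos_le_one abs_sin_le_one) auto
    finally show ?thesis by simp
  qed
  have "((\<lambda>j. integral {0..2*pi} (?T j)) has_sum integral {0..2*pi} (\<lambda>x. \<Sum>\<^sub>\<infinity>j. ?T j x)) UNIV"
  proof (rule integral_infsum)
    show "continuous_on {0..2*pi} (?T j)" for j
      by (intro continuous_intros q)
    show "cmod (?T j x) \<le> Q * ?K * (1 / wt j ^ 2)" if "x \<in> {0..2*pi}" for j x
    proof -
      have "cmod (?T j x) = \<bar>q x\<bar> * \<bar>?t j x\<bar>" by (simp add: norm_mult abs_mult del: of_real_mult of_real_add)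
      also have "\<dots> \<le> Q * (?K * (1 / wt j ^ 2))"
        using Q[OF that] tb[of j x] ab[of j] Q0 by (intro mult_mono) auto
      finally show ?thesis by (simp add: mult_ac)
    qed
  qed (rule tser_bound_summable)
  moreover have "(\<Sum>\<^sub>\<infinity>j. ?T j x) = cis (- (of_int k * x)) * of_real (q x * (tser c x \<bullet> l))" for x
  proof (rule infsumI)
    have "((\<lambda>j. of_real (?t j x) :: complex) has_sum of_real (tser c x \<bullet> l)) UNIV"
      using tser_inner_has_sum[OF d] by (intro has_sum_of_real)
    from has_sum_cmult_right[OF this, of "cis (- (of_int k * x)) * of_real (q x)"]
    show "((\<lambda>j. ?T j x) has_sum cis (- (of_int k * x)) * of_real (q x * (tser c x \<bullet> l))) UNIV"
      by (simp add: mult.assoc)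
  qed
  ultimately have hs: "((\<lambda>j. integral {0..2*pi} (?T j)) has_sum fc (\<lambda>x. q x * (tser c x \<bullet> l)) k) UNIV"
    by (simp only: fc_def)
  have le: "cmod (integral {0..2*pi} (?T j)) \<le> ?K * B / 2 * (1 / (wt (k - j) ^ s * wt j ^ 2) + 1 / (wt (k + j) ^ s * wt j ^ 2))"
    for j
  proof -
    let ?u = "fc q (k - j)" and ?v = "fc q (k + j)"
    have "cmod (integral {0..2*pi} (?T j)) = 
        cmod (of_real (c j \<bullet> l) * (?u + ?v) / 2 - \<i> * of_real (J0 (c j) \<bullet> l) * (?u - ?v) / 2)"
      by (subst fc_cos_sin[OF q]) simp
    also have "\<dots> \<le> \<bar>c j \<bullet> l\<bar> * cmod (?u + ?v) / 2 + \<bar>J0 (c j) \<bullet> l\<bar> * cmod (?u - ?v) / 2"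
      by (rule order_trans[OF norm_triangle_ineq4]) (simp add: norm_mult norm_divide)
    also have "\<dots> \<le> \<bar>c j \<bullet> l\<bar> * (cmod ?u + cmod ?v) / 2 + \<bar>J0 (c j) \<bullet> l\<bar> * (cmod ?u + cmod ?v) / 2"
      by (intro add_mono divide_right_mono mult_left_mono norm_triangle_ineq norm_triangle_ineq4) auto
    also have "\<dots> = (\<bar>c j \<bullet> l\<bar> + \<bar>J0 (c j) \<bullet> l\<bar>) * (cmod ?u + cmod ?v) / 2" by (simp add: algebra_simps add_divide_distrib)
    also have "\<dots> \<le> (?K * (1 / wt j ^ 2)) * (B / wt (k - j) ^ s + B / wt (k + j) ^ s) / 2"
      using K0 by (intro divide_right_mono mult_mono ab add_mono B) (auto intro!: mult_nonneg_nonneg)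
    also have "\<dots> = ?K * B / 2 * (1 / (wt (k - j) ^ s * wt j ^ 2) + 1 / (wt (k + j) ^ s * wt j ^ 2))"
      by (simp add: field_simps)
    finally show ?thesis .
  qed
  have b: "bij (uminus :: int \<Rightarrow> int)" by (rule bij_uminus)
  have "((\<lambda>j. 1 / (wt (k - j) ^ s * wt j ^ 2)) has_sum (\<Sum>\<^sub>\<infinity>j. 1 / (wt (k - j) ^ s * wt j ^ 2))) UNIV"
    (is "(_ has_sum ?W) _")
    by (rule has_sum_infsum[OF infsum_wt_convolution(1)[OF s]])
  note W = this
  have W': "((\<lambda>j. 1 / (wt (k + j) ^ s * wt j ^ 2)) has_sum ?W) UNIV"
    using has_sum_reindex_bij_betw[OF b, of "\<lambda>j. 1 / (wt (k - j) ^ s * wt j ^ 2)"] W by simp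
  have "cmod (fc (\<lambda>x. q x * (tser c x \<bullet> l)) k) \<le> ?K * B / 2 * (?W + ?W)"
    by (rule norm_infsum_le[OF hs has_sum_cmult_right[OF has_sum_add[OF W W']]]) (rule le)
  also have "\<dots> \<le> ?K * B * (4 * wt_sum / wt k ^ s)"
  proof -
    have "?K * B * ?W \<le> ?K * B * (4 * wt_sum / wt k ^ s)"
      by (intro mult_left_mono infsum_wt_convolution(2)[OF s] mult_nonneg_nonneg K0 B0)
    then show ?thesis by simp
  qed
  finally show ?thesis by (simp add: mult_ac)
qed

end

section \<open>Composition of smooth functions with trigonometric series\<close>

text \<open>
  Functions that are small, together with their derivatives up to order \<open>n\<close>, in the Lipschitz norm. The
  partial derivatives are part of the recursion because the chain rule below is applied to each of
  them separately.
\<close>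

primrec lip_class :: "nat \<Rightarrow> real \<Rightarrow> real \<Rightarrow> ('e::euclidean_space \<Rightarrow> real) \<Rightarrow> bool" where
  "lip_class 0 R \<eta> q \<longleftrightarrow>
     (\<forall>v\<in>ball 0 R. \<bar>q v\<bar> \<le> \<eta> \<and> (\<forall>w\<in>ball 0 R. \<bar>q v - q w\<bar> \<le> \<eta> * norm (v - w)))"
| "lip_class (Suc n) R \<eta> q \<longleftrightarrow>
     (\<forall>v\<in>ball 0 R. \<bar>q v\<bar> \<le> \<eta> \<and> (\<forall>w\<in>ball 0 R. \<bar>q v - q w\<bar> \<le> \<eta> * norm (v - w))) \<and>
     (\<exists>q'. (\<forall>v\<in>ball 0 R. (q has_derivative (\<lambda>h. \<Sum>l\<in>Basis. q' l v * (h \<bullet> l))) (at v)) \<and>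
           (\<forall>l\<in>Basis. lip_class n R \<eta> (q' l)))"

lemma lip_classD:
  assumes "lip_class n R \<eta> q" "v \<in> ball 0 R"
  shows "\<bar>q v\<bar> \<le> \<eta>" and "w \<in> ball 0 R \<Longrightarrow> \<bar>q v - q w\<bar> \<le> \<eta> * norm (v - w)"
  using assms by (cases n; simp)+

lemma lip_class_nonneg: "lip_class n R \<eta> q \<Longrightarrow> 0 < R \<Longrightarrow> 0 \<le> \<eta>"
  using lip_classD(1)[of n R \<eta> q 0] by auto

lemma lip_class_continuous:
  assumes "lip_class n R \<eta> q" "0 < R" shows "continuous_on (ball 0 R) q"
proof -
  have "\<eta>-lipschitz_on (ball 0 R) q"
    using lip_classD(2)[OF assms(1)] lip_class_nonneg[OF assms] by (auto simp: lipschitz_on_def dist_norm)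
  then show ?thesis by (rule lipschitz_on_continuous_on)
qed

context conj_space
begin

lemma abs_inner_Basis_le: "l \<in> Basis \<Longrightarrow> norm v \<le> B \<Longrightarrow> \<bar>(v::'e) \<bullet> l\<bar> \<le> B"
  using Basis_le_norm order_trans by blast

lemma abs_sum_Basis_le:
  assumes "\<And>l. l \<in> (Basis :: 'e set) \<Longrightarrow> norm (f l) \<le> B"
  shows "norm (\<Sum>l\<in>(Basis :: 'e set). f l) \<le> real (DIM('e)) * B"
  using sum_norm_bound[OF assms, of Basis "\<lambda>x. x"] by (auto simp: mult.commute)

context
  fixes R A :: real
  assumes RA: "cmb * A * wt_sum < R" and A0: "0 \<le> A"
begin

text \<open>
  The constants in this section depend on the decay bound \<open>A\<close> and on \<open>J0\<close> and \<open>cj\<close>, but not on the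
  function \<open>q\<close>, whose size enters only through \<open>\<eta>\<close>. They are collected here to make the linear dependence
  on \<open>\<eta>\<close> visible, which gives the contraction.
\<close>

definition bnd0 :: "real \<Rightarrow> real" where "bnd0 t = cmb * t * wt_sum"

lemma bnd0_nonneg [simp]: "0 \<le> t \<Longrightarrow> 0 \<le> bnd0 t"
  using cmb_ge_1 wt_sum_ge_1 by (simp add: bnd0_def)

lemma R_pos: "0 < R"
  using RA cmb_ge_1 wt_sum_ge_1 A0 by (intro le_less_trans[OF _ RA]) (intro mult_nonneg_nonneg, auto)

lemma tser_in_ball: "decay 3 A c \<Longrightarrow> tser c x \<in> ball 0 R"
  using norm_tser[OF decay_3_2] RA by (auto intro: le_less_trans)

lemma norm_tser_dcoef: "decay 3 B c \<Longrightarrow> norm (tser (dcoef c) x) \<le> bnd0 (cmb * B)"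
  using norm_tser[OF decay_dcoef] by (simp add: bnd0_def)

lemma norm_tser_bnd0: "decay 3 B c \<Longrightarrow> norm (tser c x) \<le> bnd0 B"
  using norm_tser[OF decay_3_2] by (simp add: bnd0_def)

lemma continuous_on_comp:
  assumes "lip_class n R \<eta> q" "decay 3 A c"
  shows "continuous_on X (\<lambda>x. q (tser c x))"
  by (rule continuous_on_compose2[OF lip_class_continuous[OF assms(1) R_pos] 
        continuous_on_tser[OF decay_3_2[OF assms(2)]]]) (use tser_in_ball[OF assms(2)] in auto)

lemma comp_deriv:
  assumes "\<And>v. v \<in> ball 0 R \<Longrightarrow> (q has_derivative (\<lambda>h. \<Sum>l\<in>Basis. q' l v * (h \<bullet> l))) (at v)"
    and d: "decay 3 A c"
  shows "((\<lambda>x. q (tser c x)) has_vector_derivative (\<Sum>l\<in>Basis. q' l (tser c x) * (tser (dcoef c) x \<bullet> l))) (at x within X)"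
proof -
  have "(tser c has_derivative (\<lambda>t. t *\<^sub>R tser (dcoef c) x)) (at x)"
    using tser_deriv[OF d, of x] by (simp add: has_vector_derivative_def)
  from has_derivative_compose[OF this assms(1)[OF tser_in_ball[OF d]]]
  have "((\<lambda>x. q (tser c x)) has_derivative (\<lambda>t. t *\<^sub>R (\<Sum>l\<in>Basis. q' l (tser c x) * (tser (dcoef c) x \<bullet> l)))) (at x)"
    by (simp add: sum_distrib_left mult_ac)
  then show ?thesis
    using has_vector_derivative_at_within by (simp add: has_vector_derivative_def has_derivative_at_withinI)
qed

lemma tser_2pi: "tser c (2*pi) = tser c 0"
  using tser_periodic[of c 0] by simp

definition comp1 :: real where "comp1 = 4 * pi * (1 + real (DIM('e)) * bnd0 (cmb * A))"
definition comp2 :: real where "comp2 = 2 * (2 * pi + real (DIM('e)) * (4 * wt_sum * cmb * (cmb * A) * comp1))"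
definition diff1 :: real where
  "diff1 = 4 * pi * (bnd0 1 + real (DIM('e)) * (bnd0 cmb + bnd0 1 * bnd0 (cmb * A)))"
definition diff2 :: real where
  "diff2 = 2 * (2 * pi * bnd0 1 + real (DIM('e)) * (4 * wt_sum * cmb * cmb * comp1 + 4 * wt_sum * cmb * (cmb * A) * diff1))"
definition diff3 :: real where
  "diff3 = 4 * wt_sum * cmb * cmb * comp2 + 4 * wt_sum * cmb * (cmb * A) * diff2"

lemma bnd0_scale: "bnd0 (s * t) = bnd0 s * t"
  by (simp add: bnd0_def)

lemma comp1_nonneg: "0 \<le> comp1" and comp2_nonneg: "0 \<le> comp2" and diff1_nonneg: "0 \<le> diff1"
  and diff2_nonneg: "0 \<le> diff2" and diff3_nonneg: "0 \<le> diff3"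
proof -
  have [simp]: "0 \<le> cmb" "0 \<le> wt_sum" using cmb_ge_1 wt_sum_ge_1 by auto
  show 1: "0 \<le> comp1" unfolding comp1_def using A0 by (auto intro!: mult_nonneg_nonneg add_nonneg_nonneg)
  then show 2: "0 \<le> comp2" unfolding comp2_def using A0 by (auto intro!: mult_nonneg_nonneg add_nonneg_nonneg)
  show 3: "0 \<le> diff1" unfolding diff1_def using A0 by (auto intro!: mult_nonneg_nonneg add_nonneg_nonneg)
  with 1 show 4: "0 \<le> diff2" unfolding diff2_def using A0 by (auto intro!: mult_nonneg_nonneg add_nonneg_nonneg)
  with 2 show "0 \<le> diff3" unfolding diff3_def using A0 by (auto intro!: mult_nonneg_nonneg add_nonneg_nonneg)
qed

lemma fc_comp1:
  assumes q: "lip_class (Suc n) R \<eta> q" and d: "decay 3 A c"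
  shows "cmod (fc (\<lambda>x. q (tser c x)) k) \<le> comp1 * \<eta> / wt k ^ 1"
proof -
  obtain q' where q': "\<And>v. v \<in> ball 0 R \<Longrightarrow> (q has_derivative (\<lambda>h. \<Sum>l\<in>Basis. q' l v * (h \<bullet> l))) (at v)"
    and lc: "\<And>l. l \<in> Basis \<Longrightarrow> lip_class n R \<eta> (q' l)"
    using q by (subst (asm) lip_class.simps(2)) blast
  have \<eta>: "0 \<le> \<eta>" by (rule lip_class_nonneg[OF q R_pos])
  have "cmod (fc (\<lambda>x. q (tser c x)) k) \<le> 4 * pi * (\<eta> * (1 + real (DIM('e)) * bnd0 (cmb * A))) / wt k"
  proof (rule fc_C1)
    show "((\<lambda>x. q (tser c x)) has_vector_derivative (\<Sum>l\<in>Basis. q' l (tser c x) * (tser (dcoef c) x \<bullet> l))) (at x within {0..2*pi})" for x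
      by (rule comp_deriv[OF q' d])
    show "continuous_on {0..2*pi} (\<lambda>x. \<Sum>l\<in>Basis. q' l (tser c x) * (tser (dcoef c) x \<bullet> l))"
      by (intro continuous_intros continuous_on_comp[OF lc d] continuous_on_tser[OF decay_dcoef[OF d]])
    show "q (tser c (2*pi)) = q (tser c 0)" by (simp add: tser_2pi)
    fix x
    have "\<bar>q (tser c x)\<bar> \<le> \<eta>" by (rule lip_classD[OF q tser_in_ball[OF d]])
    also have "\<dots> \<le> \<eta> * (1 + real (DIM('e)) * bnd0 (cmb * A))"
      using A0 \<eta> cmb_ge_1 by (simp add: algebra_simps)
    finally show "\<bar>q (tser c x)\<bar> \<le> \<eta> * (1 + real (DIM('e)) * bnd0 (cmb * A))" .
    have "norm (\<Sum>l\<in>Basis. q' l (tser c x) * (tser (dcoef c) x \<bullet> l)) \<le> real (DIM('e)) * (\<eta> * bnd0 (cmb * A))"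
    proof (rule abs_sum_Basis_le)
      fix l :: 'e assume l: "l \<in> Basis"
      show "norm (q' l (tser c x) * (tser (dcoef c) x \<bullet> l)) \<le> \<eta> * bnd0 (cmb * A)"
        unfolding real_norm_def abs_mult
        by (intro mult_mono lip_classD(1)[OF lc[OF l] tser_in_ball[OF d]] abs_inner_Basis_le[OF l norm_tser_dcoef[OF d]] \<eta>) auto
    qed
    also have "\<dots> \<le> \<eta> * (1 + real (DIM('e)) * bnd0 (cmb * A))" using \<eta> by (simp add: algebra_simps)
    finally show "\<bar>\<Sum>l\<in>Basis. q' l (tser c x) * (tser (dcoef c) x \<bullet> l)\<bar> \<le> \<eta> * (1 + real (DIM('e)) * bnd0 (cmb * A))" by simp
  qed
  then show ?thesis by (simp add: comp1_def mult_ac)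
qed

text \<open>
  The chain rule writes the derivative as a sum of products of a partial derivative of \<open>q\<close>, whose
  coefficients already decay to first order, with a component of the differentiated series; a further
  integration by parts gives second order.
\<close>

lemma fc_comp2:
  assumes q: "lip_class (Suc (Suc n)) R \<eta> q" and d: "decay 3 A c"
  shows "cmod (fc (\<lambda>x. q (tser c x)) k) \<le> comp2 * \<eta> / wt k ^ 2"
proof -
  obtain q' where q': "\<And>v. v \<in> ball 0 R \<Longrightarrow> (q has_derivative (\<lambda>h. \<Sum>l\<in>Basis. q' l v * (h \<bullet> l))) (at v)"
    and lc: "\<And>l. l \<in> Basis \<Longrightarrow> lip_class (Suc n) R \<eta> (q' l)"
    using q by (subst (asm) lip_class.simps(2)) blast
  have \<eta>: "0 \<le> \<eta>" by (rule lip_class_nonneg[OF q R_pos])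
  let ?C = "4 * wt_sum * cmb * (cmb * A) * comp1"
  have C0: "0 \<le> ?C" using A0 comp1_nonneg cmb_ge_1 wt_sum_ge_1 by auto
  have cont: "continuous_on {0..2*pi} (\<lambda>x. q' l (tser c x) * (tser (dcoef c) x \<bullet> l))" if "l \<in> Basis" for l
    by (intro continuous_intros continuous_on_comp[OF lc[OF that] d] continuous_on_tser[OF decay_dcoef[OF d]])
  have "cmod (fc (\<lambda>x. q (tser c x)) k) \<le> 2 * (\<eta> * (2 * pi + real (DIM('e)) * ?C)) / wt k ^ Suc 1"
  proof (rule fc_gain)
    show "((\<lambda>x. q (tser c x)) has_vector_derivative (\<Sum>l\<in>Basis. q' l (tser c x) * (tser (dcoef c) x \<bullet> l))) (at x within {0..2*pi})" for x
      by (rule comp_deriv[OF q' d])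
    show "continuous_on {0..2*pi} (\<lambda>x. \<Sum>l\<in>Basis. q' l (tser c x) * (tser (dcoef c) x \<bullet> l))"
      by (intro continuous_on_sum cont)
    show "q (tser c (2*pi)) = q (tser c 0)" by (simp add: tser_2pi)
    show "cmod (fc (\<lambda>x. \<Sum>l\<in>Basis. q' l (tser c x) * (tser (dcoef c) x \<bullet> l)) k) \<le> \<eta> * (2 * pi + real (DIM('e)) * ?C) / wt k ^ 1" for k
    proof -
      have "cmod (fc (\<lambda>x. \<Sum>l\<in>Basis. q' l (tser c x) * (tser (dcoef c) x \<bullet> l)) k) \<le> real (DIM('e)) * (?C * \<eta> / wt k ^ 1)"
      proof (subst fc_sum)
        show "cmod (\<Sum>l\<in>Basis. fc (\<lambda>x. q' l (tser c x) * (tser (dcoef c) x \<bullet> l)) k) \<le> real DIM('e) * (?C * \<eta> / wt k ^ 1)"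
        proof (rule abs_sum_Basis_le)
        fix l :: 'e assume l: "l \<in> Basis"
        from fc_product[OF continuous_on_comp[OF lc[OF l] d] fc_comp1[OF lc[OF l] d] _ decay_dcoef[OF d], of l k]
        show "cmod (fc (\<lambda>x. q' l (tser c x) * (tser (dcoef c) x \<bullet> l)) k) \<le> ?C * \<eta> / wt k ^ 1"
          using l by (simp add: mult_ac)
        qed
      qed (simp_all add: cont)
      also have "\<dots> \<le> \<eta> * (2 * pi + real (DIM('e)) * ?C) / wt k ^ 1"
        using \<eta> by (simp add: field_simps)
      finally show ?thesis .
    qed
    have "cmod (fc (\<lambda>x. q (tser c x)) 0) \<le> 2 * pi * \<eta>"
      by (rule norm_fc_le[OF continuous_on_comp[OF q d] lip_classD(1)[OF q tser_in_ball[OF d]]])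
    also have "\<dots> \<le> \<eta> * (2 * pi + real (DIM('e)) * ?C)" using mult_left_mono[of "2 * pi" "2 * pi + real (DIM('e)) * ?C" \<eta>] \<eta> mult_nonneg_nonneg[OF of_nat_0_le_iff C0]
      by (simp add: mult.commute)
    finally show "cmod (fc (\<lambda>x. q (tser c x)) 0) \<le> \<eta> * (2 * pi + real (DIM('e)) * ?C)" .
  qed
  then show ?thesis by (simp add: comp2_def mult_ac numeral_2_eq_2)
qed

context
  fixes c c' :: "int \<Rightarrow> 'e" and \<delta> :: real
  assumes d: "decay 3 A c" and d': "decay 3 A c'" and dd: "decay 3 \<delta> (\<lambda>k. c k - c' k)"
begin

lemma delta_nonneg: "0 \<le> \<delta>"
  by (rule decay_nonneg[OF dd])

lemma norm_tser_diff: "norm (tser c x - tser c' x) \<le> bnd0 1 * \<delta>"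
  using norm_tser_bnd0[OF dd, of x] tser_diff[OF decay_3_2[OF d] decay_3_2[OF d'], of x] by (simp add: bnd0_def mult_ac)

lemma tser_dcoef_diff: "tser (dcoef (\<lambda>k. c k - c' k)) x = tser (dcoef c) x - tser (dcoef c') x"
  using tser_diff[OF decay_dcoef[OF d] decay_dcoef[OF d'], of x] by (simp add: dcoef_diff)

lemma norm_tser_dcoef_diff: "norm (tser (dcoef c) x - tser (dcoef c') x) \<le> bnd0 cmb * \<delta>"
  using norm_tser_dcoef[OF dd, of x] by (simp add: tser_dcoef_diff bnd0_scale)

text \<open>
  A difference of products with each factor changed separately, which makes the estimates for the
  composition apply to differences.
\<close>

lemma diff_split:
  "a * (tser (dcoef c) x \<bullet> l) - b * (tser (dcoef c') x \<bullet> l) =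
   a * (tser (dcoef (\<lambda>k. c k - c' k)) x \<bullet> l) + (a - b) * (tser (dcoef c') x \<bullet> l)"
  by (simp add: tser_dcoef_diff inner_diff_left algebra_simps)

lemma comp_diff_deriv:
  assumes "\<And>v. v \<in> ball 0 R \<Longrightarrow> (q has_derivative (\<lambda>h. \<Sum>l\<in>Basis. q' l v * (h \<bullet> l))) (at v)"
  shows "((\<lambda>x. q (tser c x) - q (tser c' x)) has_vector_derivative
    (\<Sum>l\<in>Basis. q' l (tser c x) * (tser (dcoef (\<lambda>k. c k - c' k)) x \<bullet> l)
       + (q' l (tser c x) - q' l (tser c' x)) * (tser (dcoef c') x \<bullet> l))) (at x within X)"
  using has_vector_derivative_diff[OF comp_deriv[OF assms d] comp_deriv[OF assms d'], of x X]
  by (simp add: sum_subtractf[symmetric] diff_split)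

lemma abs_comp_diff:
  assumes "lip_class n R \<eta> q"
  shows "\<bar>q (tser c x) - q (tser c' x)\<bar> \<le> \<eta> * (bnd0 1 * \<delta>)"
proof -
  have "\<bar>q (tser c x) - q (tser c' x)\<bar> \<le> \<eta> * norm (tser c x - tser c' x)"
    by (rule lip_classD(2)[OF assms tser_in_ball[OF d] tser_in_ball[OF d']])
  also have "\<dots> \<le> \<eta> * (bnd0 1 * \<delta>)"
    by (intro mult_left_mono norm_tser_diff lip_class_nonneg[OF assms R_pos])
  finally show ?thesis .
qed

lemma fc_diff1:
  assumes q: "lip_class (Suc n) R \<eta> q"
  shows "cmod (fc (\<lambda>x. q (tser c x) - q (tser c' x)) k) \<le> diff1 * \<eta> * \<delta> / wt k ^ 1"
proof -
  obtain q' where q': "\<And>v. v \<in> ball 0 R \<Longrightarrow> (q has_derivative (\<lambda>h. \<Sum>l\<in>Basis. q' l v * (h \<bullet> l))) (at v)"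
    and lc: "\<And>l. l \<in> Basis \<Longrightarrow> lip_class n R \<eta> (q' l)"
    using q by (subst (asm) lip_class.simps(2)) blast
  have \<eta>: "0 \<le> \<eta>" by (rule lip_class_nonneg[OF q R_pos])
  let ?X = "\<eta> * \<delta> * (bnd0 1 + real (DIM('e)) * (bnd0 cmb + bnd0 1 * bnd0 (cmb * A)))"
  have "cmod (fc (\<lambda>x. q (tser c x) - q (tser c' x)) k) \<le> 4 * pi * ?X / wt k"
  proof (rule fc_C1)
    show "((\<lambda>x. q (tser c x) - q (tser c' x)) has_vector_derivative
      (\<Sum>l\<in>Basis. q' l (tser c x) * (tser (dcoef (\<lambda>k. c k - c' k)) x \<bullet> l)
       + (q' l (tser c x) - q' l (tser c' x)) * (tser (dcoef c') x \<bullet> l))) (at x within {0..2*pi})" for x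
      by (rule comp_diff_deriv[OF q'])
    show "continuous_on {0..2*pi} (\<lambda>x. \<Sum>l\<in>Basis. q' l (tser c x) * (tser (dcoef (\<lambda>k. c k - c' k)) x \<bullet> l)
       + (q' l (tser c x) - q' l (tser c' x)) * (tser (dcoef c') x \<bullet> l))"
      by (intro continuous_intros continuous_on_comp[OF lc d] continuous_on_comp[OF lc d'] continuous_on_tser[OF decay_dcoef[OF d']]
          continuous_on_tser[OF decay_dcoef[OF dd]])
    show "q (tser c (2*pi)) - q (tser c' (2*pi)) = q (tser c 0) - q (tser c' 0)" by (simp add: tser_2pi)
    fix x
    have "\<bar>q (tser c x) - q (tser c' x)\<bar> \<le> \<eta> * (bnd0 1 * \<delta>)" by (rule abs_comp_diff[OF q])
    also have "\<dots> \<le> ?X" using \<eta> delta_nonneg A0 cmb_ge_1 by (simp add: algebra_simps)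
    finally show "\<bar>q (tser c x) - q (tser c' x)\<bar> \<le> ?X" .
    have "norm (\<Sum>l\<in>Basis. q' l (tser c x) * (tser (dcoef (\<lambda>k. c k - c' k)) x \<bullet> l)
       + (q' l (tser c x) - q' l (tser c' x)) * (tser (dcoef c') x \<bullet> l)) \<le>
       real (DIM('e)) * (\<eta> * (bnd0 cmb * \<delta>) + \<eta> * (bnd0 1 * \<delta>) * bnd0 (cmb * A))"
    proof (rule abs_sum_Basis_le, rule norm_triangle_mono)
      fix l :: 'e assume l: "l \<in> Basis"
      show "norm (q' l (tser c x) * (tser (dcoef (\<lambda>k. c k - c' k)) x \<bullet> l)) \<le> \<eta> * (bnd0 cmb * \<delta>)"
        unfolding real_norm_def abs_mult tser_dcoef_diff
        by (intro mult_mono lip_classD(1)[OF lc[OF l] tser_in_ball[OF d]] abs_inner_Basis_le[OF l norm_tser_dcoef_diff] \<eta>) auto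
      show "norm ((q' l (tser c x) - q' l (tser c' x)) * (tser (dcoef c') x \<bullet> l)) \<le> \<eta> * (bnd0 1 * \<delta>) * bnd0 (cmb * A)"
        unfolding real_norm_def abs_mult using \<eta> delta_nonneg
        by (intro mult_mono abs_comp_diff[OF lc[OF l]] abs_inner_Basis_le[OF l norm_tser_dcoef[OF d']]) auto
    qed
    also have "\<dots> \<le> ?X" using \<eta> delta_nonneg by (simp add: algebra_simps)
    finally show "\<bar>\<Sum>l\<in>Basis. q' l (tser c x) * (tser (dcoef (\<lambda>k. c k - c' k)) x \<bullet> l)
       + (q' l (tser c x) - q' l (tser c' x)) * (tser (dcoef c') x \<bullet> l)\<bar> \<le> ?X" by simp
  qed
  then show ?thesis by (simp add: diff1_def mult_ac)
qed

lemma fc_diff2: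
  assumes q: "lip_class (Suc (Suc n)) R \<eta> q"
  shows "cmod (fc (\<lambda>x. q (tser c x) - q (tser c' x)) k) \<le> diff2 * \<eta> * \<delta> / wt k ^ 2"
proof -
  obtain q' where q': "\<And>v. v \<in> ball 0 R \<Longrightarrow> (q has_derivative (\<lambda>h. \<Sum>l\<in>Basis. q' l v * (h \<bullet> l))) (at v)"
    and lc: "\<And>l. l \<in> Basis \<Longrightarrow> lip_class (Suc n) R \<eta> (q' l)"
    using q by (subst (asm) lip_class.simps(2)) blast
  have \<eta>: "0 \<le> \<eta>" by (rule lip_class_nonneg[OF q R_pos])
  let ?C = "4 * wt_sum * cmb * cmb * comp1" and ?D = "4 * wt_sum * cmb * (cmb * A) * diff1"
  let ?X = "\<eta> * \<delta> * (2 * pi * bnd0 1 + real (DIM('e)) * (?C + ?D))"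
  have C0: "0 \<le> ?C" "0 \<le> ?D" using A0 comp1_nonneg diff1_nonneg cmb_ge_1 wt_sum_ge_1 by auto
  let ?f = "\<lambda>l x. q' l (tser c x) * (tser (dcoef (\<lambda>k. c k - c' k)) x \<bullet> l)"
  let ?g = "\<lambda>l x. (q' l (tser c x) - q' l (tser c' x)) * (tser (dcoef c') x \<bullet> l)"
  have contf: "continuous_on {0..2*pi} (?f l)" if "l \<in> Basis" for l
    by (intro continuous_intros continuous_on_comp[OF lc[OF that] d] continuous_on_tser[OF decay_dcoef[OF dd]])
  have contg: "continuous_on {0..2*pi} (?g l)" if "l \<in> Basis" for l
    by (intro continuous_intros continuous_on_comp[OF lc[OF that] d] continuous_on_comp[OF lc[OF that] d']
        continuous_on_tser[OF decay_dcoef[OF d']])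
  have "cmod (fc (\<lambda>x. q (tser c x) - q (tser c' x)) k) \<le> 2 * ?X / wt k ^ Suc 1"
  proof (rule fc_gain)
    show "((\<lambda>x. q (tser c x) - q (tser c' x)) has_vector_derivative (\<Sum>l\<in>Basis. ?f l x + ?g l x)) (at x within {0..2*pi})" for x
      by (rule comp_diff_deriv[OF q'])
    show "continuous_on {0..2*pi} (\<lambda>x. \<Sum>l\<in>Basis. ?f l x + ?g l x)"
      by (intro continuous_on_sum continuous_on_add contf contg)
    show "q (tser c (2*pi)) - q (tser c' (2*pi)) = q (tser c 0) - q (tser c' 0)" by (simp add: tser_2pi)
    show "cmod (fc (\<lambda>x. \<Sum>l\<in>Basis. ?f l x + ?g l x) k) \<le> ?X / wt k ^ 1" for k
    proof -
      have "cmod (fc (\<lambda>x. \<Sum>l\<in>Basis. ?f l x + ?g l x) k) \<le> real (DIM('e)) * (?C * \<eta> * \<delta> / wt k ^ 1 + ?D * \<eta> * \<delta> / wt k ^ 1)"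
      proof (subst fc_sum)
        show "cmod (\<Sum>l\<in>Basis. fc (\<lambda>x. ?f l x + ?g l x) k) \<le> real DIM('e) * (?C * \<eta> * \<delta> / wt k ^ 1 + ?D * \<eta> * \<delta> / wt k ^ 1)"
        proof (rule abs_sum_Basis_le)
        fix l :: 'e assume l: "l \<in> Basis"
        have "cmod (fc (?f l) k) \<le> ?C * \<eta> * \<delta> / wt k ^ 1"
          using fc_product[OF continuous_on_comp[OF lc[OF l] d] fc_comp1[OF lc[OF l] d] _ decay_dcoef[OF dd], of l k] l
          by (simp add: mult_ac)
        moreover have "cmod (fc (?g l) k) \<le> ?D * \<eta> * \<delta> / wt k ^ 1"
          using fc_product[OF continuous_on_diff[OF continuous_on_comp[OF lc[OF l] d] continuous_on_comp[OF lc[OF l] d']] 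
              fc_diff1[OF lc[OF l]] _ decay_dcoef[OF d'], of l k] l
          by (simp add: mult_ac)
        ultimately show "cmod (fc (\<lambda>x. ?f l x + ?g l x) k) \<le> ?C * \<eta> * \<delta> / wt k ^ 1 + ?D * \<eta> * \<delta> / wt k ^ 1"
          by (subst fc_add[OF contf[OF l] contg[OF l]]) (rule norm_triangle_mono)
        qed
      qed (simp_all add: continuous_on_add[OF contf contg])
      also have "\<dots> = \<eta> * \<delta> * (real (DIM('e)) * (?C + ?D)) / wt k ^ 1"
        by (simp add: field_simps)
      also have "\<dots> \<le> ?X / wt k ^ 1"
        using \<eta> delta_nonneg by (intro divide_right_mono mult_left_mono) (auto simp: less_imp_le)
      finally show ?thesis .
    qed
    have "cmod (fc (\<lambda>x. q (tser c x) - q (tser c' x)) 0) \<le> 2 * pi * (\<eta> * (bnd0 1 * \<delta>))"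
      by (rule norm_fc_le[OF continuous_on_diff[OF continuous_on_comp[OF q d] continuous_on_comp[OF q d']] abs_comp_diff[OF q]])
    also have "\<dots> = \<eta> * \<delta> * (2 * pi * bnd0 1)" by (simp add: mult_ac)
    also have "\<dots> \<le> ?X" using \<eta> delta_nonneg C0 by (intro mult_left_mono) auto
    finally show "cmod (fc (\<lambda>x. q (tser c x) - q (tser c' x)) 0) \<le> ?X" .
  qed
  then show ?thesis by (simp add: diff2_def mult_ac numeral_2_eq_2)
qed

text \<open>
  The term \<open>K(F) F\<^sub>x\<close> of the equation depends on \<open>F\<close> in a Lipschitz way, with a constant that is
  proportional to \<open>\<eta>\<close>, at the cost of one order of decay.
\<close>

lemma fc_diff3:
  assumes q: "lip_class (Suc (Suc n)) R \<eta> q" and l: "l \<in> Basis"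
  shows "cmod (fc (\<lambda>x. q (tser c x) * (tser (dcoef c) x \<bullet> l) - q (tser c' x) * (tser (dcoef c') x \<bullet> l)) k)
     \<le> diff3 * \<eta> * \<delta> / wt k ^ 2"
proof -
  let ?f = "\<lambda>x. q (tser c x) * (tser (dcoef (\<lambda>k. c k - c' k)) x \<bullet> l)"
  let ?g = "\<lambda>x. (q (tser c x) - q (tser c' x)) * (tser (dcoef c') x \<bullet> l)"
  have contf: "continuous_on {0..2*pi} ?f"
    by (intro continuous_intros continuous_on_comp[OF q d] continuous_on_tser[OF decay_dcoef[OF dd]])
  have contg: "continuous_on {0..2*pi} ?g"
    by (intro continuous_intros continuous_on_comp[OF q d] continuous_on_comp[OF q d']
        continuous_on_tser[OF decay_dcoef[OF d']])
  have "cmod (fc ?f k) \<le> 4 * wt_sum * cmb * cmb * comp2 * \<eta> * \<delta> / wt k ^ 2"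
    using fc_product[OF continuous_on_comp[OF q d] fc_comp2[OF q d] _ decay_dcoef[OF dd], of l k] l
    by (simp add: mult_ac)
  moreover have "cmod (fc ?g k) \<le> 4 * wt_sum * cmb * (cmb * A) * diff2 * \<eta> * \<delta> / wt k ^ 2"
    using fc_product[OF continuous_on_diff[OF continuous_on_comp[OF q d] continuous_on_comp[OF q d']] 
        fc_diff2[OF q] _ decay_dcoef[OF d'], of l k] l
    by (simp add: mult_ac)
  ultimately have "cmod (fc (\<lambda>x. ?f x + ?g x) k) \<le> 4 * wt_sum * cmb * cmb * comp2 * \<eta> * \<delta> / wt k ^ 2 
       + 4 * wt_sum * cmb * (cmb * A) * diff2 * \<eta> * \<delta> / wt k ^ 2"
    by (subst fc_add[OF contf contg]) (rule norm_triangle_mono)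
  also have "\<dots> = diff3 * \<eta> * \<delta> / wt k ^ 2"
    by (simp add: diff3_def field_simps)
  finally show ?thesis by (simp only: diff_split)
qed

end

end

end

section \<open>Fourier inversion\<close>

inductive trig_poly :: "(real \<Rightarrow> complex) \<Rightarrow> bool" where
  mono: "trig_poly (\<lambda>x. a * cis (of_int k * x))"
| add: "trig_poly f \<Longrightarrow> trig_poly g \<Longrightarrow> trig_poly (\<lambda>x. f x + g x)"

lemma trig_poly_mult:
  assumes "trig_poly f" "trig_poly g" shows "trig_poly (\<lambda>x. f x * g x)"
  using assms(1)
proof induction
  case (mono a k)
  show ?case using assms(2)
  proof induction
    case (mono b j)
    have "(\<lambda>x. a * cis (of_int k * x) * (b * cis (of_int j * x))) = (\<lambda>x. (a * b) * cis (of_int (k + j) * x))"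
      by (auto simp: cis_mult algebra_simps)
    then show ?case using trig_poly.mono[of "a * b" "k + j"] by simp
  next
    case (add f g)
    then show ?case using trig_poly.add by (auto simp: distrib_left)
  qed
next
  case (add f1 f2)
  then show ?case using trig_poly.add by (auto simp: distrib_right)
qed

lemma trig_poly_real_polynomial:
  fixes p :: "complex \<Rightarrow> real"
  assumes "real_polynomial_function p"
  shows "trig_poly (\<lambda>x. of_real (p (cis x)))"
  using assms
proof induction
  case (linear f)
  interpret f: bounded_linear f by fact
  have "f z = Re z * f 1 + Im z * f \<i>" for z
  proof -
    have "f z = f (Re z *\<^sub>R 1 + Im z *\<^sub>R \<i>)" by (rule arg_cong[where f=f]) (simp add: complex_eq_iff)
    also have "\<dots> = Re z * f 1 + Im z * f \<i>" unfolding f.add f.scaleR by simp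
    finally show ?thesis .
  qed
  note fz = this
  have *: "of_real (Re w * a + Im w * b) = (of_real a / 2 - \<i> * of_real b / 2) * w + (of_real a / 2 + \<i> * of_real b / 2) * cnj w"
    for w :: complex and a b
    by (intro complex_eqI) (simp_all add: field_simps)
  have "of_real (f (cis x)) = (of_real (f 1) / 2 - \<i> * of_real (f \<i>) / 2) * cis (of_int 1 * x)
      + (of_real (f 1) / 2 + \<i> * of_real (f \<i>) / 2) * cis (of_int (-1) * x)" for x
    unfolding fz[of "cis x"] * by (simp add: cis_cnj)
  then have "(\<lambda>x. of_real (f (cis x))) = (\<lambda>x. (of_real (f 1) / 2 - \<i> * of_real (f \<i>) / 2) * cis (of_int 1 * x)
      + (of_real (f 1) / 2 + \<i> * of_real (f \<i>) / 2) * cis (of_int (-1) * x))" by (rule ext)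
  then show ?case by (simp only: trig_poly.intros)
next
  case (const c)
  show ?case using trig_poly.mono[of "of_real c" 0] by simp
next
  case (add f g)
  then show ?case using trig_poly.add by auto
next
  case (mult f g)
  then show ?case using trig_poly_mult by auto
qed

lemma integral_trig_poly_zero:
  assumes "trig_poly h" and G: "continuous_on {0..2*pi} G" and z: "\<And>k. fc G k = 0"
  shows "((\<lambda>x. h x * of_real (G x)) has_integral 0) {0..2*pi}"
  using assms(1)
proof induction
  case (mono a k)
  have "((\<lambda>x. a * (cis (- (of_int (- k) * x)) * of_real (G x))) has_integral a * fc G (- k)) {0..2*pi}"
    unfolding fc_def by (intro has_integral_mult_right integrable_integral fc_integrable G)
  then show ?case using z[of "- k"] by (simp add: mult.assoc)
next
  case (add f g)
  then show ?case using has_integral_add[OF add.IH] by (simp add: distrib_right)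
qed

lemma cis_circle: "cis ` {0..2*pi} = sphere 0 1"
proof
  show "sphere 0 1 \<subseteq> cis ` {0..2*pi}"
  proof
    fix w :: complex assume "w \<in> sphere 0 1"
    then have "w = cis (Arg2pi w)" using Arg2pi_eq[of w] by (simp add: cis_conv_exp)
    then show "w \<in> cis ` {0..2*pi}" using Arg2pi_ge_0[of w] Arg2pi_lt_2pi[of w] by (auto intro!: image_eqI[of _ _ "Arg2pi w"])
  qed
qed auto

text \<open>
  By the Stone-Weierstrass theorem on the circle, \<open>G\<close> is a uniform limit of trigonometric polynomials,
  to which it is orthogonal; hence the integral of \<open>G\<^sup>2\<close> vanishes.
\<close>

lemma fourier_unique:
  assumes G: "continuous_on {0..2*pi} G" and per: "G (2*pi) = G 0" and z: "\<And>k. fc G k = 0"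
    and x: "x \<in> {0..2*pi}"
  shows "G x = 0"
proof -
  define g where "g = G \<circ> Arg2pi"
  have g: "g (cis x) = G x" if "x \<in> {0..2*pi}" for x
  proof (cases "x = 2*pi")
    case False
    then have "Arg2pi (cis x) = x"
      using that by (intro Arg2pi_unique[of 1]) (auto simp: cis_conv_exp)
    then show ?thesis by (simp add: g_def)
  next
    case True
    have "Arg2pi 1 = 0" using Arg2pi_unique[of 1 0 1] by simp
    then show ?thesis using True by (simp add: g_def per)
  qed
  have cg: "continuous_on (sphere 0 1) g"
  proof (subst continuous_on_open_gen[of g "sphere 0 1" "g ` sphere 0 1"], simp, intro allI impI)
    fix U assume "openin (top_of_set (g ` sphere 0 1)) U"
    then obtain T where T: "open T" "U = g ` sphere 0 1 \<inter> T" by (auto simp: openin_open)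
    let ?V = "sphere 0 1 \<inter> g -` U"
    have "{0..2*pi} \<inter> cis -` ?V = {0..2*pi} \<inter> G -` T"
      using g cis_circle by (auto simp: T(2)) (metis atLeastAtMost_iff image_eqI norm_cis mem_sphere_0)+
    moreover have "openin (top_of_set {0..2*pi}) ({0..2*pi} \<inter> G -` T)"
      using G T(1) by (simp add: continuous_openin_preimage_gen)
    ultimately have "openin (top_of_set {0..2*pi}) ({0..2*pi} \<inter> cis -` ?V)" by simp
    then show "openin (top_of_set (sphere 0 1)) ?V"
      using Abstract_Topology_2.continuous_imp_quotient_map[of "{0..2*pi}" cis "sphere 0 1" ?V] cis_circle
      by (simp add: continuous_on_cis continuous_on_id)
  qed
  have "bounded (G ` {0..2*pi})" by (rule compact_imp_bounded[OF compact_continuous_image[OF G]]) simp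
  then obtain M where "\<forall>y\<in>G ` {0..2*pi}. norm y \<le> M" unfolding bounded_iff by blast
  then have M: "\<bar>G x\<bar> \<le> M" if "x \<in> {0..2*pi}" for x using that by simp
  have M0: "0 \<le> M" using M[of 0] by auto
  let ?I = "integral {0..2*pi} (\<lambda>x. G x * G x)"
  have iG: "(\<lambda>x. G x * G x) integrable_on {0..2*pi}"
    by (intro integrable_continuous_real continuous_intros G)
  have "?I \<le> e * (2 * pi * M)" if e: "0 < e" for e
  proof -
    obtain p where p: "real_polynomial_function p" "\<And>w. w \<in> sphere 0 1 \<Longrightarrow> \<bar>g w - p w\<bar> < e"
      using Stone_Weierstrass_real_polynomial_function[OF compact_sphere cg e] by blast
    have cp: "continuous_on {0..2*pi} (\<lambda>x. p (cis x))"
      by (rule continuous_on_compose2[OF continuous_on_polymonial_function[where S=UNIV]])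
        (use p(1) in \<open>auto intro!: continuous_intros simp: real_polynomial_function_eq\<close>)
    have "((\<lambda>x. Re (of_real (p (cis x)) * of_real (G x))) has_integral Re 0) {0..2*pi}"
      by (rule has_integral_Re[OF integral_trig_poly_zero[OF trig_poly_real_polynomial[OF p(1)] G z]])
    then have 0: "((\<lambda>x. p (cis x) * G x) has_integral 0) {0..2*pi}" by simp
    have "integral {0..2*pi} (\<lambda>x. G x * G x - p (cis x) * G x) = ?I - 0"
      by (rule integral_unique[OF has_integral_diff[OF integrable_integral[OF iG] 0]])
    moreover have "norm (integral {0..2*pi} (\<lambda>x. G x * G x - p (cis x) * G x)) \<le> (e * M) * (2*pi - 0)"
    proof (rule integral_bound)
      fix x assume x: "x \<in> {0..2*pi}"
      have "norm (G x * G x - p (cis x) * G x) = \<bar>g (cis x) - p (cis x)\<bar> * \<bar>G x\<bar>"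
        by (simp add: g[OF x] abs_mult[symmetric] left_diff_distrib)
      also have "\<dots> \<le> e * M"
        using p(2)[of "cis x"] e by (intro mult_mono M[OF x]) auto
      finally show "norm (G x * G x - p (cis x) * G x) \<le> e * M" .
    qed (auto intro!: continuous_intros G cp)
    ultimately show ?thesis by (simp add: mult_ac)
  qed
  then have "?I \<le> 0"
  proof -
    assume *: "\<And>e. 0 < e \<Longrightarrow> ?I \<le> e * (2 * pi * M)"
    have P: "0 < 2 * pi * M + 1" using M0 by (simp add: add_nonneg_pos)
    show ?thesis
    proof (rule ccontr)
      assume "\<not> ?I \<le> 0"
      then have I: "0 < ?I" by simp
      have "?I \<le> ?I / (2 * (2 * pi * M + 1)) * (2 * pi * M)"
        using I P by (intro *) auto
      also have "\<dots> = ?I * ((2 * pi * M) / (2 * (2 * pi * M + 1)))" by simp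
      also have "\<dots> < ?I * 1" using P M0 by (intro mult_strict_left_mono[OF _ I]) (simp add: add_nonneg_pos)
      finally show False by simp
    qed
  qed
  moreover have "0 \<le> ?I" by (rule integral_nonneg[OF iG]) simp
  ultimately have "?I = 0" by simp
  then have "\<forall>x\<in>{0..2*pi}. G x * G x = 0"
    by (subst (asm) integral_eq_0_iff) (auto intro!: continuous_intros G)
  then show ?thesis using x by auto
qed

context conj_space
begin

definition vfc :: "(real \<Rightarrow> 'e) \<Rightarrow> int \<Rightarrow> 'e" where
  "vfc h k = (1 / (2*pi)) *\<^sub>R integral {0..2*pi} (\<lambda>x. cm (cis (- (of_int k * x))) (h x))"

lemma vfc_integrable:
  assumes "continuous_on {0..2*pi} h"
  shows "(\<lambda>x. cm (cis (- (of_int k * x))) (h x)) integrable_on {0..2*pi}"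
  by (intro integrable_continuous_real cm.continuous_on continuous_intros assms)

lemma vfc_diff:
  assumes "continuous_on {0..2*pi} f" "continuous_on {0..2*pi} g"
  shows "vfc (\<lambda>x. f x - g x) k = vfc f k - vfc g k"
  unfolding vfc_def cm.diff_right
  by (subst integral_diff[OF vfc_integrable[OF assms(1)] vfc_integrable[OF assms(2)]])
    (simp add: scaleR_diff_right)

lemma vfc_fc:
  assumes "continuous_on {0..2*pi} h"
  shows "vfc h k = (1 / (2*pi)) *\<^sub>R (\<Sum>i\<in>Basis. cm (fc (\<lambda>x. h x \<bullet> i) k) i)"
proof -
  have "((\<lambda>x. \<Sum>i\<in>Basis. cm (cis (- (of_int k * x)) * of_real (h x \<bullet> i)) i) has_integral
      (\<Sum>i\<in>Basis. cm (fc (\<lambda>x. h x \<bullet> i) k) i)) {0..2*pi}"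
  proof (rule has_integral_sum)
    fix i :: 'e assume "i \<in> Basis"
    have "((\<lambda>x. cis (- (of_int k * x)) * of_real (h x \<bullet> i)) has_integral fc (\<lambda>x. h x \<bullet> i) k) {0..2*pi}"
      unfolding fc_def by (intro integrable_integral fc_integrable continuous_intros assms)
    from has_integral_linear[OF this cm.bounded_linear_left[of i]]
    show "((\<lambda>x. cm (cis (- (of_int k * x)) * of_real (h x \<bullet> i)) i) has_integral cm (fc (\<lambda>x. h x \<bullet> i) k) i) {0..2*pi}"
      by (simp add: o_def)
  qed simp
  moreover have "(\<Sum>i\<in>Basis. cm (cis t * of_real (v \<bullet> i)) i) = cm (cis t) v" for t and v :: 'e
  proof -
    have "(\<Sum>i\<in>Basis. cm (cis t * of_real (v \<bullet> i)) i) = cm (cis t) (\<Sum>i\<in>Basis. (v \<bullet> i) *\<^sub>R i)"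
      by (simp add: cm_mult cm_of_real cm.sum_right)
    then show ?thesis by (simp add: euclidean_representation)
  qed
  ultimately show ?thesis by (simp add: vfc_def integral_unique)
qed

lemma norm_vfc_le:
  assumes h: "continuous_on {0..2*pi} h" and b: "\<And>i. i \<in> Basis \<Longrightarrow> cmod (fc (\<lambda>x. h x \<bullet> i) k) \<le> B"
  shows "norm (vfc h k) \<le> real (DIM('e)) * cmb * B"
proof -
  have "norm (\<Sum>i\<in>Basis. cm (fc (\<lambda>x. h x \<bullet> i) k) i) \<le> real (DIM('e)) * (cmb * B)"
  proof (rule abs_sum_Basis_le)
    fix i :: 'e assume i: "i \<in> Basis"
    show "norm (cm (fc (\<lambda>x. h x \<bullet> i) k) i) \<le> cmb * B"
      by (rule order_trans[OF norm_cm]) (use mult_left_mono[OF b[OF i], of cmb] cmb_ge_1 i in simp)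
  qed
  moreover have "norm (vfc h k) = (1 / (2*pi)) * norm (\<Sum>i\<in>Basis. cm (fc (\<lambda>x. h x \<bullet> i) k) i)"
    by (simp add: vfc_fc[OF h])
  moreover have "(1 / (2*pi)) * t \<le> 1 * t" if "0 \<le> t" for t
    using that pi_ge_two by (intro mult_right_mono) auto
  ultimately have "norm (vfc h k) \<le> real (DIM('e)) * (cmb * B)"
    using norm_ge_zero order_trans by (smt (verit, best))
  then show ?thesis by simp
qed

lemma integral_cis: "integral {0..2*pi} (\<lambda>x. cis (of_int k * x)) = (if k = 0 then 2 * pi else 0)"
proof (cases "k = 0")
  case False
  let ?G = "\<lambda>x. cis (of_int k * x) / (\<i> * of_int k)"
  have "((\<lambda>x. cis (of_int k * x)) has_integral ?G (2*pi) - ?G 0) {0..2*pi}"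
  proof (rule fundamental_theorem_of_calculus)
    fix x
    have "(?G has_vector_derivative (\<i> * of_real (of_int k) * cis (of_int k * x)) / (\<i> * of_int k)) (at x within {0..2*pi})"
      by (rule has_vector_derivative_divide[OF has_vector_derivative_cis_mult])
    then show "(?G has_vector_derivative cis (of_int k * x)) (at x within {0..2*pi})"
      using False by simp
  qed simp
  moreover have "cis (of_int k * (2 * pi)) = 1"
    using cis_multiple_2pi[of "of_int k"] by (simp add: mult_ac)
  ultimately show ?thesis using False by (simp add: integral_unique)
qed (simp add: scaleR_conv_of_real)

lemma vfc_tser:
  assumes d: "decay 2 A c"
  shows "vfc (tser c) k = c k"
proof -
  let ?T = "\<lambda>j x. cm (cis (- (of_int k * x))) (cm (cis (of_int j * x)) (c j))"
  have "((\<lambda>j. integral {0..2*pi} (?T j)) has_sum integral {0..2*pi} (\<lambda>x. \<Sum>\<^sub>\<infinity>j. ?T j x)) UNIV"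
  proof (rule integral_infsum)
    show "continuous_on {0..2*pi} (?T j)" for j
      by (intro cm.continuous_on continuous_intros)
    show "norm (?T j x) \<le> cmb * A * (1 / wt j ^ 2)" for j x
      using tser_term_bound[OF d, of "- (of_int k * x) + of_int j * x" j]
      by (simp add: cm_mult[symmetric] cis_mult)
  qed (rule tser_bound_summable)
  moreover have "(\<Sum>\<^sub>\<infinity>j. ?T j x) = cm (cis (- (of_int k * x))) (tser c x)" for x
    by (intro infsumI has_sum_bounded_linear[OF cm.bounded_linear_right tser_has_sum[OF d], unfolded o_def])
  moreover have "integral {0..2*pi} (?T j) = (if j = k then (2*pi) *\<^sub>R c k else 0)" for j
  proof -
    have "?T j = (\<lambda>x. cm (cis (of_int (j - k) * x)) (c j))"
      by (auto simp: cm_mult[symmetric] cis_mult algebra_simps)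
    then have "integral {0..2*pi} (?T j) = cm (integral {0..2*pi} (\<lambda>x. cis (of_int (j - k) * x))) (c j)"
      using integral_linear[of "\<lambda>x. cis (of_int (j - k) * x)" "{0..2*pi}" "\<lambda>z. cm z (c j)"]
      by (simp add: o_def cm.bounded_linear_left integrable_continuous_real continuous_intros)
    then show ?thesis using cm_of_real[of "2*pi"] by (simp only: integral_cis) (auto simp: cm.zero_left)
  qed
  ultimately have "((\<lambda>j. if j = k then (2*pi) *\<^sub>R c k else 0) has_sum (2*pi) *\<^sub>R vfc (tser c) k) UNIV"
    by (simp add: vfc_def)
  moreover have "((\<lambda>j. if j = k then (2*pi) *\<^sub>R c k else 0) has_sum (2*pi) *\<^sub>R c k) UNIV"
    using has_sum_finite[of "{k}" "\<lambda>j. if j = k then (2*pi) *\<^sub>R c k else 0"]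
    by (subst has_sum_cong_neutral[of "{k}" _ _ "\<lambda>j. if j = k then (2*pi) *\<^sub>R c k else 0"]) auto
  ultimately have "(2*pi) *\<^sub>R vfc (tser c) k = (2*pi) *\<^sub>R c k" by (rule has_sum_unique)
  then show ?thesis by simp
qed

text \<open>
  A vector-valued coefficient mixes the cosine and the sine integral through \<open>J0\<close>; the coefficients at
  \<open>k\<close> and \<open>-k\<close> together separate them.
\<close>

lemma fc_zero_if_vfc_zero:
  assumes g: "continuous_on {0..2*pi} g" and z: "\<And>k. vfc g k = 0"
  shows "fc (\<lambda>x. g x \<bullet> i) k = 0"
proof -
  define c where "c = integral {0..2*pi} (\<lambda>x. cos (of_int k * x) *\<^sub>R g x)"
  define s where "s = integral {0..2*pi} (\<lambda>x. sin (of_int k * x) *\<^sub>R g x)"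
  have ic: "(\<lambda>x. cos (of_int k * x) *\<^sub>R g x) integrable_on {0..2*pi}"
    and isn: "(\<lambda>x. sin (of_int k * x) *\<^sub>R g x) integrable_on {0..2*pi}"
    by (intro integrable_continuous_real continuous_intros g)+
  note ic' = integrable_integral[OF ic, folded c_def] and is' = integrable_integral[OF isn, folded s_def]
  have 1: "((\<lambda>x. cm (cis (- (of_int k * x))) (g x)) has_integral c - J0 s) {0..2*pi}"
    using has_integral_diff[OF ic' has_integral_linear[OF is' bl_J0]]
    by (simp add: cm_def o_def linear_scale[OF lin_J0])
  have 2: "((\<lambda>x. cm (cis (- (of_int (- k) * x))) (g x)) has_integral c + J0 s) {0..2*pi}"
    using has_integral_add[OF ic' has_integral_linear[OF is' bl_J0]]
    by (simp add: cm_def o_def linear_scale[OF lin_J0])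
  have e: "c - J0 s = 0" "c + J0 s = 0"
    using z[of k] z[of "- k"] integral_unique[OF 1] integral_unique[OF 2] by (simp_all add: vfc_def)
  then have "J0 s = c" by simp
  with e(2) have "c + c = 0" by simp
  then have c0: "c = 0" by (simp flip: scaleR_2)
  with \<open>J0 s = c\<close> have s0: "s = 0" using J0_J0[of s] linear_0[OF lin_J0] by simp
  have "((\<lambda>x. cos (of_int k * x) * (g x \<bullet> i)) has_integral 0) {0..2*pi}"
    using has_integral_linear[OF ic' bounded_linear_inner_left[of i]] by (simp add: o_def c0)
  moreover have "((\<lambda>x. sin (of_int k * x) * (g x \<bullet> i)) has_integral 0) {0..2*pi}"
    using has_integral_linear[OF is' bounded_linear_inner_left[of i]] by (simp add: o_def s0)
  ultimately have "((\<lambda>x. of_real (cos (of_int k * x) * (g x \<bullet> i)) - \<i> * of_real (sin (of_int k * x) * (g x \<bullet> i)))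
     has_integral of_real 0 - \<i> * of_real 0) {0..2*pi}"
    by (intro has_integral_diff has_integral_mult_right has_integral_of_real)
  moreover have "of_real (cos t * r) - \<i> * of_real (sin t * r) = cis (- t) * of_real r" for t r
    by (simp add: complex_eq_iff)
  ultimately show ?thesis by (simp add: fc_def integral_unique)
qed

text \<open>
  The function and its Fourier series have the same coefficients, so their difference vanishes by
  uniqueness.
\<close>

lemma fourier_inversion:
  assumes h: "continuous_on {0..2*pi} h" and per: "h (2*pi) = h 0" and d: "decay 2 A (vfc h)"
    and x: "x \<in> {0..2*pi}"
  shows "tser (vfc h) x = h x"
proof -
  have ct: "continuous_on {0..2*pi} (tser (vfc h))" by (rule continuous_on_tser[OF d])
  define g where "g x = h x - tser (vfc h) x" for x
  have g: "continuous_on {0..2*pi} g" unfolding g_def by (intro continuous_intros h ct)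
  have "vfc g k = 0" for k
    unfolding g_def by (simp add: vfc_diff[OF h ct] vfc_tser[OF d])
  note z = fc_zero_if_vfc_zero[OF g this]
  have "g x \<bullet> i = 0" for i
  proof (rule fourier_unique[OF _ _ z x])
    show "g (2*pi) \<bullet> i = g 0 \<bullet> i" using tser_periodic[of "vfc h" 0] by (simp add: g_def per)
  qed (intro continuous_intros g)
  then have "g x = 0" by (metis inner_eq_zero_iff)
  then show ?thesis by (simp add: g_def)
qed

end

section \<open>The linear boundary value problem\<close>

lemma integral_exp_bound:
  fixes h :: "real \<Rightarrow> 'a::euclidean_space"
  assumes "\<kappa> \<noteq> 0" "a \<le> b" "continuous_on {a..b} h" "\<And>s. s \<in> {a..b} \<Longrightarrow> norm (h s) \<le> B"
  shows "norm (integral {a..b} (\<lambda>s. exp (\<kappa> * s) *\<^sub>R h s)) \<le> B * ((exp (\<kappa> * b) - exp (\<kappa> * a)) / \<kappa>)"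
proof -
  have "((\<lambda>s. B * exp (\<kappa> * s)) has_integral B * (exp (\<kappa> * b) / \<kappa>) - B * (exp (\<kappa> * a) / \<kappa>)) {a..b}"
  proof (rule fundamental_theorem_of_calculus[OF assms(2)])
    show "((\<lambda>s. B * (exp (\<kappa> * s) / \<kappa>)) has_vector_derivative B * exp (\<kappa> * x)) (at x within {a..b})" for x
      unfolding has_real_derivative_iff_has_vector_derivative[symmetric]
      using assms(1) by (auto intro!: derivative_eq_intros)
  qed
  then have I: "((\<lambda>s. B * exp (\<kappa> * s)) has_integral B * ((exp (\<kappa> * b) - exp (\<kappa> * a)) / \<kappa>)) {a..b}"
    by (simp add: diff_divide_distrib right_diff_distrib)
  have "norm (integral {a..b} (\<lambda>s. exp (\<kappa> * s) *\<^sub>R h s)) \<le> integral {a..b} (\<lambda>s. B * exp (\<kappa> * s))"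
    by (rule integral_norm_bound_integral)
      (use I assms in \<open>auto intro!: integrable_continuous_real continuous_intros\<close>)
  then show ?thesis using integral_unique[OF I] by simp
qed

context conj_space
begin

text \<open>
  For the series with coefficients \<open>b k y\<close> the equation \<open>F\<^sub>y = J0 F\<^sub>x + h\<close> reads
  \<open>b' k = h k - k b k\<close>. For \<open>k < 0\<close> the homogeneous solutions grow with \<open>y\<close>, and the integration
  constant is fixed by \<open>b k 1 = 0\<close>, so that only decaying exponentials remain. The condition
  \<open>cj (F (x, 0)) = F (x, 0)\<close>, which is \<open>cj (b k 0) = b (-k) 0\<close>, then dictates the constant for
  \<open>k > 0\<close>, where the homogeneous solutions decay.
\<close>

definition primitive :: "(int \<Rightarrow> real \<Rightarrow> 'e) \<Rightarrow> int \<Rightarrow> real \<Rightarrow> 'e" where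
  "primitive h k y = integral {0..y} (\<lambda>s. exp (of_int k * s) *\<^sub>R h k s)"

definition initial_value :: "(int \<Rightarrow> real \<Rightarrow> 'e) \<Rightarrow> int \<Rightarrow> 'e" where
  "initial_value h k = (if k < 0 then - primitive h k 1 else if k = 0 then 0 else - cj (primitive h (- k) 1))"

definition sol :: "(int \<Rightarrow> real \<Rightarrow> 'e) \<Rightarrow> int \<Rightarrow> real \<Rightarrow> 'e" where
  "sol h k y = exp (- (of_int k * y)) *\<^sub>R (initial_value h k + primitive h k y)"

lemma sol_boundary: "cj (sol h k 0) = sol h (- k) 0"
  by (auto simp: sol_def initial_value_def primitive_def linear_0[OF lin_cj] linear_neg[OF lin_cj])

lemma sol_deriv:
  assumes "continuous_on {0..1} (h k)" "y \<in> {0..1}"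
  shows "(sol h k has_vector_derivative h k y - of_int k *\<^sub>R sol h k y) (at y within {0..1})"
proof -
  have p: "(primitive h k has_vector_derivative exp (of_int k * y) *\<^sub>R h k y) (at y within {0..1})"
    unfolding primitive_def
    by (rule integral_has_vector_derivative[OF _ assms(2)]) (intro continuous_intros assms)
  have e: "((\<lambda>y. exp (- (of_int k * y))) has_real_derivative - of_int k * exp (- (of_int k * y))) (at y within {0..1})"
    by (auto intro!: derivative_eq_intros)
  have "((\<lambda>y. exp (- (of_int k * y)) *\<^sub>R (initial_value h k + primitive h k y)) has_vector_derivative
    exp (- (of_int k * y)) *\<^sub>R (0 + exp (of_int k * y) *\<^sub>R h k y) 
    + (- of_int k * exp (- (of_int k * y))) *\<^sub>R (initial_value h k + primitive h k y)) (at y within {0..1})"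
    by (rule has_vector_derivative_scaleR[OF e has_vector_derivative_add[OF has_vector_derivative_const p]])
  moreover have "exp (- (of_int k * y)) *\<^sub>R (0 + exp (of_int k * y) *\<^sub>R h k y) = h k y"
    by (simp add: exp_minus)
  ultimately show ?thesis
    unfolding sol_def by simp
qed

lemma sol_continuous:
  assumes "continuous_on {0..1} (h k)"
  shows "continuous_on {0..1} (sol h k)"
  by (rule continuous_on_vector_derivative[OF sol_deriv[of h k, OF assms]])

lemma primitive_diff:
  assumes "continuous_on {0..1} (h k)" "continuous_on {0..1} (h' k)" "y \<le> 1"
  shows "primitive (\<lambda>k y. h k y - h' k y) k y = primitive h k y - primitive h' k y"
proof -
  have i: "(\<lambda>s. exp (of_int k * s) *\<^sub>R h k s) integrable_on {0..y}"
    and i': "(\<lambda>s. exp (of_int k * s) *\<^sub>R h' k s) integrable_on {0..y}"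
    using assms by (auto intro!: integrable_continuous_real continuous_intros intro: continuous_on_subset)
  show ?thesis
    unfolding primitive_def scaleR_diff_right by (rule integral_diff[OF i i'])
qed

lemma sol_diff:
  assumes "\<And>k. continuous_on {0..1} (h k)" "\<And>k. continuous_on {0..1} (h' k)" "y \<le> 1"
  shows "sol (\<lambda>k y. h k y - h' k y) k y = sol h k y - sol h' k y"
proof -
  have "initial_value (\<lambda>k y. h k y - h' k y) k = initial_value h k - initial_value h' k"
    unfolding initial_value_def using primitive_diff[OF assms(1,2), of 1]
    by (simp add: linear_diff[OF lin_cj])
  then show ?thesis
    unfolding sol_def primitive_diff[OF assms] by (simp only: scaleR_diff_right scaleR_add_right) simp
qed

text \<open>
  Integrating an exponential with rate \<open>\<bar>k\<bar>\<close> gains the factor \<open>1 / \<bar>k\<bar>\<close>.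
\<close>

lemma sol_bound:
  assumes hc: "\<And>k. continuous_on {0..1} (h k)" and hb: "\<And>k s. s \<in> {0..1} \<Longrightarrow> norm (h k s) \<le> B / wt k ^ 2"
    and y: "y \<in> {0..1}"
  shows "norm (sol h k y) \<le> 4 * cmb * B / wt k ^ 3"
proof -
  have B0: "0 \<le> B" using order_trans[OF norm_ge_zero hb[of 0 0]] by (simp add: wt_def)
  define W where "W = B / wt k ^ 2"
  have W0: "0 \<le> W" using B0 by (simp add: W_def)
  have hW: "norm (h k s) \<le> W" "norm (h (- k) s) \<le> W" if "s \<in> {0..1}" for s
    using hb[OF that, of k] hb[OF that, of "- k"] by (simp_all add: W_def)
  have sub: "continuous_on {a..b} (h j)" if "0 \<le> a" "b \<le> 1" for a b j
    by (rule continuous_on_subset[OF hc]) (use that in auto)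
  have "norm (sol h k y) \<le> cmb * (W * (2 / \<bar>of_int k\<bar>))" if "k \<noteq> 0"
  proof (cases "k < 0")
    case True
    define m where "m = - real_of_int k"
    have m: "0 < m" using True by (simp add: m_def)
    have k: "real_of_int k = - m" by (simp add: m_def)
    have "(\<lambda>s. exp (- m * s) *\<^sub>R h k s) integrable_on {0..1}"
      by (intro integrable_continuous_real continuous_intros hc)
    then have "primitive h k y + integral {y..1} (\<lambda>s. exp (- m * s) *\<^sub>R h k s) = primitive h k 1"
      unfolding primitive_def k using y by (auto intro!: Henstock_Kurzweil_Integration.integral_combine)
    then have "- primitive h k 1 + primitive h k y = - integral {y..1} (\<lambda>s. exp (- m * s) *\<^sub>R h k s)"
      by (metis add.commute add_diff_cancel_left' minus_diff_eq uminus_add_conv_diff)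
    then have "sol h k y = - (exp (m * y) *\<^sub>R integral {y..1} (\<lambda>s. exp (- m * s) *\<^sub>R h k s))"
      using True unfolding sol_def initial_value_def k by simp
    then have "norm (sol h k y) = exp (m * y) * norm (integral {y..1} (\<lambda>s. exp (- m * s) *\<^sub>R h k s))"
      by simp
    also have "\<dots> \<le> exp (m * y) * (W * ((exp (- m * 1) - exp (- m * y)) / (- m)))"
      using m y hW by (intro mult_left_mono integral_exp_bound sub) auto
    also have "\<dots> = W * ((1 - exp (m * y) * exp (- m)) / m)"
      using m by (simp add: field_simps exp_minus)
    also have "\<dots> \<le> W * (2 / m)"
    proof (intro mult_left_mono divide_right_mono W0)
      have "0 \<le> exp (m * y) * exp (- m)" by simp
      then show "1 - exp (m * y) * exp (- m) \<le> 2" by linarith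
    qed (use m in auto)
    also have "\<dots> \<le> cmb * (W * (2 / m))" using mult_right_mono[OF cmb_ge_1, of "W * (2 / m)"] W0 m by simp
    finally show ?thesis using k m by simp
  next
    case False
    define m where "m = real_of_int k"
    have m: "0 < m" using False that by (simp add: m_def)
    have k: "real_of_int k = m" by (simp add: m_def)
    have "norm (primitive h k y) \<le> W * ((exp (m * y) - exp (m * 0)) / m)"
      unfolding primitive_def k using m y hW by (intro integral_exp_bound sub) auto
    then have p: "norm (primitive h k y) \<le> W * ((exp (m * y) - 1) / m)" by simp
    have "norm (primitive h (- k) 1) \<le> W * ((exp (- m * 1) - exp (- m * 0)) / (- m))"
      unfolding primitive_def using m hW k by (subst of_int_minus, subst k, intro integral_exp_bound sub) auto
    also have "\<dots> = W * ((1 - exp (- m)) / m)" using m by (simp add: divide_simps) (simp add: algebra_simps)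
    also have "\<dots> \<le> W * (1 / m)" using W0 m by (intro mult_left_mono divide_right_mono) auto
    finally have q: "norm (primitive h (- k) 1) \<le> W * (1 / m)" .
    have "norm (initial_value h k) = norm (cj (primitive h (- k) 1))"
      using False that by (simp add: initial_value_def)
    also have "\<dots> \<le> cmb * norm (primitive h (- k) 1)" by (rule norm_cj_cmb)
    also have "\<dots> \<le> cmb * (W * (1 / m))" using q cmb_ge_1 by (intro mult_left_mono) auto
    finally have s: "norm (initial_value h k) \<le> cmb * (W * (1 / m))" .
    have "norm (sol h k y) \<le> exp (- (m * y)) * (norm (initial_value h k) + norm (primitive h k y))"
      unfolding sol_def k norm_scaleR by (intro mult_mono norm_triangle_ineq) auto
    also have "\<dots> = exp (- (m * y)) * norm (initial_value h k) + exp (- (m * y)) * norm (primitive h k y)"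
      by (simp add: distrib_left)
    also have "\<dots> \<le> 1 * (cmb * (W * (1 / m))) + exp (- (m * y)) * (W * ((exp (m * y) - 1) / m))"
      using m y s p by (intro add_mono mult_mono) auto
    also have "exp (- (m * y)) * (W * ((exp (m * y) - 1) / m)) = W * ((1 - exp (- (m * y))) / m)"
      using m by (simp add: field_simps exp_minus)
    also have "\<dots> \<le> 1 * (W * (1 / m))"
      unfolding mult_1_left using m W0 by (intro mult_left_mono divide_right_mono) auto
    also have "\<dots> \<le> cmb * (W * (1 / m))"
      using m W0 cmb_ge_1 by (intro mult_right_mono) auto
    finally show ?thesis using k m by (simp add: mult_ac)
  qed
  moreover have "2 / \<bar>real_of_int k\<bar> \<le> 4 / wt k" if "k \<noteq> 0"
  proof -
    have "1 \<le> \<bar>real_of_int k\<bar>" using that by simp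
    then show ?thesis by (simp add: wt_def divide_simps)
  qed
  moreover have "norm (sol h k y) \<le> cmb * (W * (4 / wt k))" if k: "k = 0"
  proof -
    have "norm (sol h k y) = norm (integral {0..y} (\<lambda>s. h k s))"
      by (simp add: k sol_def initial_value_def primitive_def)
    also have "\<dots> \<le> W * (y - 0)"
      using y hW by (intro integral_bound sub) auto
    also have "\<dots> \<le> W * 1" using y W0 by (intro mult_left_mono) auto
    also have "\<dots> \<le> cmb * W" using mult_right_mono[OF cmb_ge_1 W0] by simp
    also have "\<dots> \<le> cmb * (W * (4 / wt k))" using cmb_ge_1 W0 by (intro mult_left_mono) (auto simp: k wt_def)
    finally show ?thesis .
  qed
  moreover have "cmb * (W * (2 / \<bar>of_int k\<bar>)) \<le> cmb * (W * (4 / wt k))" if "2 / \<bar>real_of_int k\<bar> \<le> 4 / wt k"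
    using cmb_ge_1 W0 that by (intro mult_left_mono) auto
  ultimately have "norm (sol h k y) \<le> cmb * (W * (4 / wt k))"
    using order_trans by blast
  then show ?thesis by (simp add: W_def power2_eq_square power3_eq_cube mult_ac)
qed

text \<open>
  The coefficients of the disc \<open>\<zeta> \<mapsto> c + sin \<zeta> d\<close> attached to the fixed space of \<open>cj\<close> that takes the
  value \<open>v\<close> at \<open>\<zeta> = \<i> y0\<close>.
\<close>

definition free :: "real \<Rightarrow> 'e \<Rightarrow> int \<Rightarrow> real \<Rightarrow> 'e" where
  "free y0 v k y =
    (if k = 0 then (1/2) *\<^sub>R (v + cj v)
     else if k = 1 then (- exp (- y) / (4 * sinh y0)) *\<^sub>R (v - cj v)
     else if k = -1 then (exp y / (4 * sinh y0)) *\<^sub>R (v - cj v)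
     else 0)"

lemma free_diff: "free y0 v k y - free y0 v' k y = free y0 (v - v') k y"
  by (auto simp: free_def linear_diff[OF lin_cj] algebra_simps)

lemma free_boundary: "cj (free y0 v k 0) = free y0 v (- k) 0"
  by (auto simp: free_def linear_diff[OF lin_cj] linear_add[OF lin_cj] linear_scale[OF lin_cj] linear_0[OF lin_cj] algebra_simps)

lemma free_deriv:
  "(free y0 v k has_vector_derivative - of_int k *\<^sub>R free y0 v k y) (at y within S)"
proof -
  have 1: "((\<lambda>y. (- exp (- y) / (4 * sinh y0)) *\<^sub>R w) has_vector_derivative - ((- exp (- y) / (4 * sinh y0)) *\<^sub>R w)) (at y within S)"
    for w :: 'e
  proof -
    have "((\<lambda>y. - exp (- y) / (4 * sinh y0)) has_real_derivative - (- exp (- y) / (4 * sinh y0))) (at y within S)"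
      by (cases "sinh y0 = 0") (auto intro!: derivative_eq_intros)
    from has_vector_derivative_scaleR[OF this has_vector_derivative_const[of w]] show ?thesis by simp
  qed
  have 2: "((\<lambda>y. (exp y / (4 * sinh y0)) *\<^sub>R w) has_vector_derivative (exp y / (4 * sinh y0)) *\<^sub>R w) (at y within S)"
    for w :: 'e
  proof -
    have "((\<lambda>y. exp y / (4 * sinh y0)) has_real_derivative exp y / (4 * sinh y0)) (at y within S)"
      by (cases "sinh y0 = 0") (auto intro!: derivative_eq_intros)
    from has_vector_derivative_scaleR[OF this has_vector_derivative_const[of w]] show ?thesis by simp
  qed
  show ?thesis
    unfolding free_def using 1 2 by auto
qed

definition free_const :: "real \<Rightarrow> real" where
  "free_const y0 = (1 + cmb) * (1 + 2 * exp 1 / sinh y0)"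

lemma free_bound:
  assumes y0: "0 < y0" and y: "y \<in> {0..1}"
  shows "norm (free y0 v k y) \<le> free_const y0 * norm v / wt k ^ 3"
proof -
  have s: "0 < sinh y0" using y0 by simp
  have n: "norm (v + cj v) \<le> (1 + cmb) * norm v" "norm (v - cj v) \<le> (1 + cmb) * norm v"
    using norm_triangle_ineq[of v "cj v"] norm_triangle_ineq4[of v "cj v"] norm_cj_cmb[of v]
    by (auto simp: algebra_simps)
  have c1: "0 \<le> 1 + cmb" using cmb_ge_1 by simp
  have *: "(t / (4 * sinh y0)) * norm (v - cj v) \<le> free_const y0 * norm v / 8" if "0 \<le> t" "t \<le> exp 1" for t
  proof -
    have "(t / (4 * sinh y0)) * norm (v - cj v) \<le> (exp 1 / (4 * sinh y0)) * ((1 + cmb) * norm v)"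
      using that s by (intro mult_mono n divide_right_mono) auto
    also have "\<dots> = (1 + cmb) * (2 * exp 1 / sinh y0) * norm v / 8" using s by (simp add: field_simps)
    also have "\<dots> \<le> free_const y0 * norm v / 8"
      unfolding free_const_def using c1 s by (intro divide_right_mono mult_right_mono mult_left_mono) auto
    finally show ?thesis .
  qed
  consider "k = 0" | "k = 1" | "k = -1" | "k \<noteq> 0 \<and> k \<noteq> 1 \<and> k \<noteq> -1" by blast
  then show ?thesis
  proof cases
    case 1
    have "norm (free y0 v k y) \<le> norm (v + cj v)" by (simp add: free_def 1)
    also have "\<dots> \<le> (1 + cmb) * norm v" by (rule n)
    also have "\<dots> \<le> free_const y0 * norm v"
      unfolding free_const_def using s c1 cmb_ge_1 by (intro mult_right_mono) (auto simp: mult_le_cancel_left1)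
    finally show ?thesis by (simp add: 1 wt_def)
  next
    case 2
    have "norm (free y0 v k y) = exp (- y) / (4 * sinh y0) * norm (v - cj v)"
      using s by (simp add: free_def 2)
    also have "\<dots> \<le> free_const y0 * norm v / 8" using y by (intro *) auto
    finally show ?thesis by (simp add: 2 wt_def)
  next
    case 3
    have "norm (free y0 v k y) = exp y / (4 * sinh y0) * norm (v - cj v)"
      using s by (simp add: free_def 3)
    also have "\<dots> \<le> free_const y0 * norm v / 8" using y by (intro *) auto
    finally show ?thesis by (simp add: 3 wt_def)
  next
    case 4
    have "0 \<le> free_const y0" unfolding free_const_def using cmb_ge_1 s by (intro mult_nonneg_nonneg add_nonneg_nonneg) auto
    then show ?thesis using 4 by (auto simp: free_def less_imp_le intro!: divide_nonneg_nonneg mult_nonneg_nonneg)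
  qed
qed

lemma tser_three:
  assumes "\<And>k. k \<notin> {0, 1, -1} \<Longrightarrow> c k = 0"
  shows "tser c x = c 0 + cm (cis x) (c 1) + cm (cis (- x)) (c (-1))"
proof -
  have "tser c x = (\<Sum>\<^sub>\<infinity>k\<in>{0, 1, -1}. cm (cis (of_int k * x)) (c k))"
    unfolding tser_def by (rule infsum_cong_neutral) (use assms in \<open>auto simp: cm.zero_right\<close>)
  then show ?thesis by simp
qed

lemma tser_free:
  assumes "0 < y0" shows "tser (\<lambda>k. free y0 v k y0) 0 = v"
proof -
  have s: "sinh y0 \<noteq> 0" using assms by simp
  have "tser (\<lambda>k. free y0 v k y0) 0 = (1/2) *\<^sub>R (v + cj v) + ((exp y0 - exp (- y0)) / (4 * sinh y0)) *\<^sub>R (v - cj v)"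
    by (subst tser_three) (auto simp: free_def algebra_simps diff_divide_distrib)
  also have "(exp y0 - exp (- y0)) / (4 * sinh y0) = 1 / 2"
    using s by (simp add: sinh_def field_simps)
  also have "(1/2) *\<^sub>R (v + cj v) + (1/2) *\<^sub>R (v - cj v) = v"
    by (simp add: scaleR_add_right scaleR_diff_right scaleR_half_double flip: scaleR_add_left)
  finally show ?thesis .
qed

lemma tser_dcoef_free:
  "tser (dcoef (\<lambda>k. free y0 v k y)) x = cm (cos (Complex x y)) (- (1 / (2 * sinh y0)) *\<^sub>R J0 (v - cj v))"
proof -
  define w where "w = (1 / (4 * sinh y0)) *\<^sub>R (v - cj v)"
  have d1: "dcoef (\<lambda>k. free y0 v k y) 1 = cm (- \<i> * of_real (exp (- y))) w"
    by (simp add: dcoef_def free_def w_def cm_def linear_scale[OF lin_J0] linear_neg[OF lin_J0])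
  have d2: "dcoef (\<lambda>k. free y0 v k y) (-1) = cm (- \<i> * of_real (exp y)) w"
    by (simp add: dcoef_def free_def w_def cm_def linear_scale[OF lin_J0])
  have "tser (dcoef (\<lambda>k. free y0 v k y)) x = 0 + cm (cis x) (cm (- \<i> * of_real (exp (- y))) w) + cm (cis (- x)) (cm (- \<i> * of_real (exp y)) w)"
    unfolding d1[symmetric] d2[symmetric]
    by (subst tser_three) (auto simp: free_def dcoef_def cm.zero_left cm.zero_right)
  also have "\<dots> = cm (- \<i> * (cis x * of_real (exp (- y)) + cis (- x) * of_real (exp y))) w"
    by (simp add: cm_mult[symmetric] cm.add_left[symmetric] algebra_simps)
  also have "cis x * of_real (exp (- y)) + cis (- x) * of_real (exp y) = 2 * cos (Complex x y)"
  proof -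
    have "\<i> * Complex x y = Complex (- y) x" "- (\<i> * Complex x y) = Complex y (- x)"
      by (simp_all add: complex_eq_iff)
    then have "exp (\<i> * Complex x y) = of_real (exp (- y)) * cis x" "exp (- (\<i> * Complex x y)) = of_real (exp y) * cis (- x)"
      by (simp_all add: exp_eq_polar)
    then show ?thesis by (simp add: cos_exp_eq mult.commute)
  qed
  also have "cm (- \<i> * (2 * cos (Complex x y))) w = cm (cos (Complex x y)) (cm (- 2 * \<i>) w)"
    by (simp add: cm_mult[symmetric] mult_ac)
  also have "cm (- 2 * \<i>) w = - (1 / (2 * sinh y0)) *\<^sub>R J0 (v - cj v)"
    by (simp add: cm_def w_def linear_scale[OF lin_J0])
  finally show ?thesis .
qed

end

section \<open>The nonlinear boundary value problem\<close>

text \<open>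
  Families of coefficient functions are treated as single bounded continuous functions on
  \<open>int \<times> real\<close>, which form a complete space.
\<close>

lemma continuous_on_discrete_prod:
  fixes f :: "int \<Rightarrow> real \<Rightarrow> 'a::topological_space"
  assumes "\<And>k. continuous_on UNIV (f k)"
  shows "continuous_on UNIV (\<lambda>(k, y). f k y)"
  unfolding continuous_on_def
proof
  fix z :: "int \<times> real" assume "z \<in> UNIV"
  obtain k y where z: "z = (k, y)" by (cases z)
  have "(f k \<longlongrightarrow> f k y) (nhds y)"
    using assms[of k] by (simp add: continuous_on_eq_continuous_at isCont_def tendsto_at_iff_tendsto_nhds)
  then have "((\<lambda>z. f k (snd z)) \<longlongrightarrow> f k y) (nhds (k, y))"
    by (rule filterlim_compose) (use tendsto_snd[of "\<lambda>z. z" "(k, y)" "nhds (k, y)"] in \<open>simp add: filterlim_ident\<close>)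
  moreover have "\<forall>\<^sub>F z in nhds (k, y). f k (snd z) = (case z of (k, y) \<Rightarrow> f k y)"
  proof -
    have "open ({k} \<times> (UNIV :: real set))" by (intro open_Times open_discrete open_UNIV)
    then have "\<forall>\<^sub>F z in nhds (k, y). z \<in> {k} \<times> (UNIV :: real set)"
      by (rule eventually_nhds_in_open) auto
    then show ?thesis by eventually_elim auto
  qed
  ultimately have "((\<lambda>(k, y). f k y) \<longlongrightarrow> f k y) (nhds (k, y))"
    using filterlim_cong[OF refl refl] by fast
  then show "((\<lambda>(k, y). f k y) \<longlongrightarrow> (case z of (k, y) \<Rightarrow> f k y)) (at z within UNIV)"
    unfolding z prod.case by (rule tendsto_mono[OF at_within_le_nhds])
qed

lemma complete_cball_bcontfun:
  fixes a :: "'a::topological_space \<Rightarrow>\<^sub>C 'b::{real_normed_vector,complete_space}"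
  shows "complete (cball a r)"
proof (rule completeI)
  fix X :: "nat \<Rightarrow> 'a \<Rightarrow>\<^sub>C 'b" assume X: "\<forall>n. X n \<in> cball a r" "Cauchy X"
  then obtain g where "uniform_limit UNIV X g sequentially"
    using uniformly_convergent_eq_cauchy[of "\<lambda>_. True" X]
    unfolding Cauchy_def uniform_limit_sequentially_iff
    by (metis dist_fun_lt_imp_dist_val_lt)
  from uniform_limit_bcontfunE[OF this sequentially_bot]
  obtain l where l: "X \<longlonglongrightarrow> l" by metis
  moreover have "l \<in> cball a r"
    using Lim_in_closed_set[OF closed_cball _ _ l] X(1) by auto
  ultimately show "\<exists>l\<in>cball a r. X \<longlonglongrightarrow> l" by blast
qed

text \<open>
  The field \<open>K w\<close> of endomorphisms stands for the deviation of the almost complex structure at \<open>w\<close> from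
  the constant structure \<open>J0\<close>.
\<close>

definition small_field :: "real \<Rightarrow> real \<Rightarrow> ('e::euclidean_space \<Rightarrow> 'e \<Rightarrow> 'e) \<Rightarrow> bool" where
  "small_field R \<eta> K \<longleftrightarrow> (\<forall>w\<in>ball 0 R. linear (K w)) \<and>
     (\<forall>i\<in>Basis. \<forall>j\<in>Basis. lip_class 2 R \<eta> (\<lambda>w. K w j \<bullet> i))"

lemma small_field_inner:
  assumes "small_field R \<eta> K" "w \<in> ball 0 R"
  shows "K w v \<bullet> i = (\<Sum>j\<in>Basis. (K w j \<bullet> i) * (v \<bullet> j))"
proof -
  have l: "linear (K w)" using assms by (auto simp: small_field_def)
  have "K w v = K w (\<Sum>j\<in>Basis. (v \<bullet> j) *\<^sub>R j)" by (simp add: euclidean_representation)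
  also have "\<dots> = (\<Sum>j\<in>Basis. (v \<bullet> j) *\<^sub>R K w j)"
    by (simp add: linear_sum[OF l] linear_scale[OF l])
  finally show ?thesis by (simp add: inner_sum_left mult.commute)
qed

lemma small_field_norm:
  fixes K :: "'e::euclidean_space \<Rightarrow> 'e \<Rightarrow> 'e"
  assumes "small_field R \<eta> K" "w \<in> ball 0 R"
  shows "norm (K w v) \<le> real DIM('e) * (real DIM('e) * \<eta>) * norm v"
proof -
  have "norm (K w v) \<le> (\<Sum>i\<in>Basis. \<bar>K w v \<bullet> i\<bar>)" by (rule norm_le_l1)
  also have "\<dots> \<le> (\<Sum>i\<in>(Basis::'e set). \<Sum>j\<in>(Basis::'e set). \<eta> * norm v)"
  proof (rule sum_mono)
    fix i :: 'e assume i: "i \<in> Basis"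
    have "\<bar>K w v \<bullet> i\<bar> \<le> (\<Sum>j\<in>Basis. \<bar>(K w j \<bullet> i) * (v \<bullet> j)\<bar>)"
      by (subst small_field_inner[OF assms]) (rule sum_abs)
    also have "\<dots> \<le> (\<Sum>j\<in>(Basis::'e set). \<eta> * norm v)"
    proof (rule sum_mono)
      fix j :: 'e assume j: "j \<in> Basis"
      have "lip_class 2 R \<eta> (\<lambda>w. K w j \<bullet> i)" using assms(1) i j by (auto simp: small_field_def)
      from lip_classD(1)[OF this assms(2)] have "\<bar>K w j \<bullet> i\<bar> \<le> \<eta>" .
      then show "\<bar>(K w j \<bullet> i) * (v \<bullet> j)\<bar> \<le> \<eta> * norm v"
        unfolding abs_mult using Basis_le_norm[OF j, of v] by (intro mult_mono) auto
    qed
    finally show "\<bar>K w v \<bullet> i\<bar> \<le> (\<Sum>j\<in>(Basis::'e set). \<eta> * norm v)" .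
  qed
  finally show ?thesis by (simp add: mult_ac)
qed

context conj_space
begin

text \<open>
  The nonlinear term \<open>K(F) F\<^sub>x\<close> for the series \<open>F\<close> with coefficients \<open>c\<close>.
\<close>

definition pert :: "('e \<Rightarrow> 'e \<Rightarrow> 'e) \<Rightarrow> (int \<Rightarrow> 'e) \<Rightarrow> real \<Rightarrow> 'e" where
  "pert K c x = K (tser c x) (tser (dcoef c) x)"

context
  fixes A R \<eta> y0 :: real and K :: "'e \<Rightarrow> 'e \<Rightarrow> 'e" and Z :: 'e
  assumes RA: "cmb * A * wt_sum < R" and A0: "0 \<le> A" and sf: "small_field R \<eta> K"
    and y0: "0 < y0" "y0 \<le> 1"
begin

lemma in_ball: "decay 3 A c \<Longrightarrow> tser c x \<in> ball 0 R"
  by (rule tser_in_ball[OF RA A0])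

lemma entry: "i \<in> Basis \<Longrightarrow> j \<in> Basis \<Longrightarrow> lip_class (Suc (Suc 0)) R \<eta> (\<lambda>w. K w j \<bullet> i)"
  using sf by (simp add: small_field_def numeral_2_eq_2)

lemma eta_nonneg: "0 \<le> \<eta>"
  using lip_class_nonneg[OF entry R_pos[OF RA A0]] nonempty_Basis by blast

lemma pert_inner: 
  "decay 3 A c \<Longrightarrow> pert K c x \<bullet> i = (\<Sum>j\<in>Basis. (K (tser c x) j \<bullet> i) * (tser (dcoef c) x \<bullet> j))"
  unfolding pert_def by (rule small_field_inner[OF sf in_ball])

definition admissible :: "(real \<Rightarrow> int \<Rightarrow> 'e) \<Rightarrow> bool" where
  "admissible c \<longleftrightarrow> (\<forall>k. continuous_on {0..1} (\<lambda>y. c y k)) \<and> (\<forall>y\<in>{0..1}. decay 3 A (c y))"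

lemma admissible_tser_cont:
  assumes "admissible c"
  shows "continuous_on (UNIV \<times> {0..1}) (\<lambda>(x, y). tser (c y) x)"
    and "continuous_on (UNIV \<times> {0..1}) (\<lambda>(x, y). tser (dcoef (c y)) x)"
proof -
  have c: "continuous_on {0..1} (\<lambda>y. c y k)" "y \<in> {0..1} \<Longrightarrow> decay 3 A (c y)" for k y
    using assms by (auto simp: admissible_def)
  show "continuous_on (UNIV \<times> {0..1}) (\<lambda>(x, y). tser (c y) x)"
    using continuous_on_tser_param[of "{0..1}" "\<lambda>k y. c y k" A] c decay_3_2 by auto
  have "continuous_on {0..1} (\<lambda>y. dcoef (c y) k)" for k
    unfolding dcoef_def by (intro cm.continuous_on continuous_intros c)
  then show "continuous_on (UNIV \<times> {0..1}) (\<lambda>(x, y). tser (dcoef (c y)) x)"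
    using continuous_on_tser_param[of "{0..1}" "\<lambda>k y. dcoef (c y) k" "cmb * A"] decay_dcoef[OF c(2)] by auto
qed

lemma pert_cont:
  assumes "admissible c"
  shows "continuous_on (UNIV \<times> {0..1}) (\<lambda>(x, y). pert K (c y) x)"
  unfolding case_prod_beta
proof (subst continuous_on_componentwise, rule ballI)
  fix i :: 'e assume i: "i \<in> Basis"
  have d: "decay 3 A (c (snd z))" if "z \<in> UNIV \<times> {0..1}" for z :: "real \<times> real"
    using assms that by (auto simp: admissible_def)
  have t: "continuous_on (UNIV \<times> {0..1}) (\<lambda>z. tser (c (snd z)) (fst z))"
    "continuous_on (UNIV \<times> {0..1}) (\<lambda>z. tser (dcoef (c (snd z))) (fst z))"
    using admissible_tser_cont[OF assms] by (auto simp: case_prod_beta)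
  have "continuous_on (UNIV \<times> {0..1}) (\<lambda>z. \<Sum>j\<in>Basis. (K (tser (c (snd z)) (fst z)) j \<bullet> i) * (tser (dcoef (c (snd z))) (fst z) \<bullet> j))"
  proof (rule continuous_on_sum, rule continuous_on_mult)
    fix j :: 'e assume j: "j \<in> Basis"
    show "continuous_on (UNIV \<times> {0..1}) (\<lambda>z. tser (dcoef (c (snd z))) (fst z) \<bullet> j)"
      by (intro continuous_intros t(2))
    show "continuous_on (UNIV \<times> {0..1}) (\<lambda>z. K (tser (c (snd z)) (fst z)) j \<bullet> i)"
      by (rule continuous_on_compose2[OF lip_class_continuous[OF entry[OF i j] R_pos[OF RA A0]] t(1)])
        (use in_ball[OF d] in blast)
  qed
  then show "continuous_on (UNIV \<times> {0..1}) (\<lambda>z. pert K (c (snd z)) (fst z) \<bullet> i)"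
    by (rule continuous_on_eq) (simp add: pert_inner[OF d])
qed

lemma pert_cont1:
  assumes "decay 3 A c" shows "continuous_on X (pert K c)"
proof -
  have adm: "admissible (\<lambda>_. c)" using assms by (simp add: admissible_def)
  have "continuous_on X (\<lambda>x. case (x, 0::real) of (x, y) \<Rightarrow> pert K c x)"
    by (rule continuous_on_compose2[OF pert_cont[OF adm]]) (auto intro!: continuous_intros)
  then show ?thesis by simp
qed

definition pert_lip :: real where
  "pert_lip = real DIM('e) * cmb * (real DIM('e) * diff3 A)"

lemma pert_lip_nonneg: "0 \<le> pert_lip"
  unfolding pert_lip_def using cmb_ge_1 diff3_nonneg[OF RA A0] by (intro mult_nonneg_nonneg) auto

lemma vfc_pert_diff:
  assumes d: "decay 3 A c" and d': "decay 3 A c'" and dd: "decay 3 \<delta> (\<lambda>k. c k - c' k)"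
  shows "norm (vfc (pert K c) k - vfc (pert K c') k) \<le> pert_lip * \<eta> * \<delta> / wt k ^ 2"
proof -
  have "norm (vfc (\<lambda>x. pert K c x - pert K c' x) k) \<le> real DIM('e) * cmb * (real DIM('e) * (diff3 A * \<eta> * \<delta> / wt k ^ 2))"
  proof (rule norm_vfc_le)
    show "continuous_on {0..2*pi} (\<lambda>x. pert K c x - pert K c' x)"
      by (intro continuous_intros pert_cont1 d d')
    fix i :: 'e assume i: "i \<in> Basis"
    let ?f = "\<lambda>j x. (K (tser c x) j \<bullet> i) * (tser (dcoef c) x \<bullet> j) - (K (tser c' x) j \<bullet> i) * (tser (dcoef c') x \<bullet> j)"
    have "fc (\<lambda>x. (pert K c x - pert K c' x) \<bullet> i) k = fc (\<lambda>x. \<Sum>j\<in>Basis. ?f j x) k"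
      by (simp add: inner_diff_left pert_inner[OF d] pert_inner[OF d'] sum_subtractf)
    also have e2: "\<dots> = (\<Sum>j\<in>Basis. fc (?f j) k)"
    proof (rule fc_sum[OF finite_Basis])
      fix j :: 'e assume j: "j \<in> Basis"
      show "continuous_on {0..2*pi} (?f j)"
        by (intro continuous_intros continuous_on_comp[OF RA A0 entry[OF i j] d] continuous_on_comp[OF RA A0 entry[OF i j] d']
            continuous_on_tser[OF decay_dcoef[OF d]] continuous_on_tser[OF decay_dcoef[OF d']])
    qed
    finally have e: "fc (\<lambda>x. (pert K c x - pert K c' x) \<bullet> i) k = (\<Sum>j\<in>Basis. fc (?f j) k)" .
    have "cmod (\<Sum>j\<in>Basis. fc (?f j) k) \<le> real DIM('e) * (diff3 A * \<eta> * \<delta> / wt k ^ 2)"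
    proof (rule abs_sum_Basis_le)
      fix j :: 'e assume j: "j \<in> Basis"
      show "cmod (fc (?f j) k) \<le> diff3 A * \<eta> * \<delta> / wt k ^ 2"
        by (rule fc_diff3[OF RA A0 d d' dd entry[OF i j] j])
    qed
    then show "cmod (fc (\<lambda>x. (pert K c x - pert K c' x) \<bullet> i) k) \<le> real DIM('e) * (diff3 A * \<eta> * \<delta> / wt k ^ 2)"
      unfolding e .
  qed
  moreover have "vfc (\<lambda>x. pert K c x - pert K c' x) k = vfc (pert K c) k - vfc (pert K c') k"
    by (rule vfc_diff[OF pert_cont1[OF d] pert_cont1[OF d']])
  moreover have "real DIM('e) * cmb * (real DIM('e) * (diff3 A * \<eta> * \<delta> / wt k ^ 2)) = pert_lip * \<eta> * \<delta> / wt k ^ 2"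
    by (simp add: pert_lip_def)
  ultimately show ?thesis by (simp only:)
qed

definition pert_coeff :: "(real \<Rightarrow> int \<Rightarrow> 'e) \<Rightarrow> int \<Rightarrow> real \<Rightarrow> 'e" where
  "pert_coeff c k y = vfc (pert K (c y)) k"

text \<open>
  The solution of the linear problem changes the value at \<open>(0, y0)\<close>; the free part is chosen to restore
  the value \<open>Z\<close>.
\<close>

definition picard :: "(real \<Rightarrow> int \<Rightarrow> 'e) \<Rightarrow> int \<Rightarrow> real \<Rightarrow> 'e" where
  "picard c k y = sol (pert_coeff c) k y + free y0 (Z - tser (\<lambda>k. sol (pert_coeff c) k y0) 0) k y"

lemma pert_coeff_cont:
  assumes "admissible c" shows "continuous_on {0..1} (pert_coeff c k)"
proof -
  have "continuous_on {0..1} (\<lambda>y. integral (cbox 0 (2*pi)) (\<lambda>x. cm (cis (- (of_int k * x))) (pert K (c y) x)))"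
  proof (rule integral_continuous_on_param, unfold case_prod_beta, intro cm.continuous_on continuous_intros)
    show "continuous_on ({0..1} \<times> cbox 0 (2*pi)) (\<lambda>z. pert K (c (fst z)) (snd z))"
    proof -
      have "continuous_on ({0..1} \<times> cbox 0 (2*pi)) (\<lambda>z. case (snd z, fst z) of (x, y) \<Rightarrow> pert K (c y) x)"
        by (rule continuous_on_compose2[OF pert_cont[OF assms]]) (auto intro!: continuous_intros)
      then show ?thesis by simp
    qed
  qed
  then show ?thesis
    unfolding pert_coeff_def[abs_def] vfc_def by (intro continuous_intros) simp
qed

lemma zero_admissible: "admissible (\<lambda>_ _. 0)" and decay_zero: "0 \<le> B \<Longrightarrow> decay s B (\<lambda>_. 0)"
  using A0 by (auto simp: admissible_def decay_def less_imp_le)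

lemma pert_coeff_zero: "pert_coeff (\<lambda>_ _. 0) k y = 0"
proof -
  have "pert K (\<lambda>_. 0) x = 0" for x
  proof -
    have t: "tser (\<lambda>_. 0) x = 0" for x by (simp add: tser_def cm.zero_right)
    have l: "linear (K 0)" using sf R_pos[OF RA A0] by (auto simp: small_field_def)
    have "dcoef (\<lambda>_. 0) = (\<lambda>_. 0)" by (auto simp: dcoef_def cm.zero_right)
    then show ?thesis
      by (simp add: pert_def t linear_0[OF l])
  qed
  then show ?thesis by (simp add: pert_coeff_def vfc_def cm.zero_right)
qed

lemma picard_zero: "picard (\<lambda>_ _. 0) k y = free y0 Z k y"
proof -
  have "sol (pert_coeff (\<lambda>_ _. 0)) k y = 0" for k y
    by (simp add: sol_def initial_value_def primitive_def pert_coeff_zero linear_0[OF lin_cj])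
  then show ?thesis by (simp add: picard_def tser_def cm.zero_right)
qed

definition picard_lip :: real where
  "picard_lip = 4 * cmb * pert_lip + free_const y0 * (cmb * (4 * cmb * pert_lip) * wt_sum)"

lemma free_const_nonneg: "0 \<le> free_const y0"
  using cmb_ge_1 y0 by (simp add: free_const_def)

lemma picard_lip_nonneg: "0 \<le> picard_lip"
  unfolding picard_lip_def using cmb_ge_1 pert_lip_nonneg free_const_nonneg wt_sum_ge_1 
  by (intro add_nonneg_nonneg mult_nonneg_nonneg) auto

lemma sol_pert_coeff_diff:
  assumes a: "admissible c" and a': "admissible c'" and dd: "\<And>y. y \<in> {0..1} \<Longrightarrow> decay 3 \<delta> (\<lambda>k. c y k - c' y k)"
    and y: "y \<in> {0..1}"
  shows "norm (sol (pert_coeff c) k y - sol (pert_coeff c') k y) \<le> 4 * cmb * (pert_lip * \<eta> * \<delta>) / wt k ^ 3"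
proof -
  have "norm (sol (\<lambda>k y. pert_coeff c k y - pert_coeff c' k y) k y) \<le> 4 * cmb * (pert_lip * \<eta> * \<delta>) / wt k ^ 3"
  proof (rule sol_bound[OF _ _ y])
    show "continuous_on {0..1} (\<lambda>y. pert_coeff c k y - pert_coeff c' k y)" for k
      by (intro continuous_intros pert_coeff_cont a a')
    fix k and s :: real assume s: "s \<in> {0..1}"
    show "norm (pert_coeff c k s - pert_coeff c' k s) \<le> pert_lip * \<eta> * \<delta> / wt k ^ 2"
      unfolding pert_coeff_def using a a' s by (intro vfc_pert_diff dd) (auto simp: admissible_def)
  qed
  then show ?thesis
    using y by (subst (asm) sol_diff[OF pert_coeff_cont[OF a] pert_coeff_cont[OF a']]) auto
qed

lemma decay_sol_pert_coeff:
  assumes a: "admissible c" and y: "y \<in> {0..1}"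
  shows "decay 3 (4 * cmb * (pert_lip * \<eta> * A)) (\<lambda>k. sol (pert_coeff c) k y)"
  unfolding decay_def
proof
  fix k
  have "norm (sol (pert_coeff c) k y - sol (pert_coeff (\<lambda>_ _. 0)) k y) \<le> 4 * cmb * (pert_lip * \<eta> * A) / wt k ^ 3"
    by (rule sol_pert_coeff_diff[OF a zero_admissible _ y]) (use a in \<open>auto simp: admissible_def\<close>)
  moreover have "sol (pert_coeff (\<lambda>_ _. 0)) k y = 0"
    by (simp add: sol_def initial_value_def primitive_def pert_coeff_zero linear_0[OF lin_cj])
  ultimately show "norm (sol (pert_coeff c) k y) \<le> 4 * cmb * (pert_lip * \<eta> * A) / wt k ^ 3" by simp
qed

lemma picard_diff:
  assumes a: "admissible c" and a': "admissible c'" and dd: "\<And>y. y \<in> {0..1} \<Longrightarrow> decay 3 \<delta> (\<lambda>k. c y k - c' y k)"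
    and y: "y \<in> {0..1}"
  shows "norm (picard c k y - picard c' k y) \<le> picard_lip * \<eta> * \<delta> / wt k ^ 3"
proof -
  let ?E = "4 * cmb * (pert_lip * \<eta> * \<delta>)"
  let ?s = "\<lambda>c. tser (\<lambda>k. sol (pert_coeff c) k y0) 0"
  have y01: "y0 \<in> {0..1}" using y0 by simp
  have "decay 3 ?E (\<lambda>k. sol (pert_coeff c) k y0 - sol (pert_coeff c') k y0)"
    unfolding decay_def using sol_pert_coeff_diff[OF a a' dd y01] by blast
  from norm_tser[OF decay_3_2[OF this], of 0]
  have "norm (?s c - ?s c') \<le> cmb * ?E * wt_sum"
    by (subst (asm) tser_diff[OF decay_3_2[OF decay_sol_pert_coeff[OF a y01]] decay_3_2[OF decay_sol_pert_coeff[OF a' y01]]])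
  then have "norm (?s c' - ?s c) \<le> cmb * ?E * wt_sum" by (simp add: norm_minus_commute)
  then have f: "norm (free y0 (?s c' - ?s c) k y) \<le> free_const y0 * (cmb * ?E * wt_sum) / wt k ^ 3"
    using free_const_nonneg
    by (intro order_trans[OF free_bound[OF y0(1) y]] divide_right_mono mult_left_mono) (auto simp: less_imp_le)
  have "picard c k y - picard c' k y = (sol (pert_coeff c) k y - sol (pert_coeff c') k y) 
      + (free y0 (Z - ?s c) k y - free y0 (Z - ?s c') k y)"
    by (simp add: picard_def)
  also have "free y0 (Z - ?s c) k y - free y0 (Z - ?s c') k y = free y0 (?s c' - ?s c) k y"
    unfolding free_diff by simp
  finally have "norm (picard c k y - picard c' k y) \<le> ?E / wt k ^ 3 + free_const y0 * (cmb * ?E * wt_sum) / wt k ^ 3"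
    using norm_triangle_mono[OF sol_pert_coeff_diff[OF a a' dd y] f] by simp
  also have "\<dots> = picard_lip * \<eta> * \<delta> / wt k ^ 3" by (simp add: picard_lip_def field_simps)
  finally show ?thesis .
qed

lemma picard_cont:
  assumes "admissible c" shows "continuous_on {0..1} (picard c k)"
  unfolding picard_def
  by (intro continuous_intros sol_continuous[OF pert_coeff_cont[OF assms]] 
      continuous_on_vector_derivative[OF free_deriv])

text \<open>
  Rescaled by \<open>wt k ^ 3\<close>, the coefficients range over a ball in the space of bounded continuous functions,
  on which the Picard map is a contraction with factor \<open>1 / 2\<close>. The radius is twice the size of the free
  part, which is the image of 0.
\<close>

lemma picard_fixed_point:
  assumes A: "A = 2 * free_const y0" and small: "picard_lip * \<eta> \<le> 1 / 2" and Z: "norm Z \<le> 1"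
  obtains c where "admissible c" "\<And>y k. y \<in> {0..1} \<Longrightarrow> c y k = picard c k y"
proof -
  \<comment> \<open>Outside \<open>{0..1}\<close> coefficient functions are continued as constants, to be defined on the whole line.\<close>
  define cl :: "real \<Rightarrow> real" where "cl y = max 0 (min 1 y)" for y
  have cl: "cl y \<in> {0..1}" "y \<in> {0..1} \<Longrightarrow> cl y = y" "continuous_on UNIV cl" for y
    by (auto simp: cl_def intro!: continuous_intros)
  define co :: "((int \<times> real) \<Rightarrow>\<^sub>C 'e) \<Rightarrow> real \<Rightarrow> int \<Rightarrow> 'e"
    where "co a y k = (1 / wt k ^ 3) *\<^sub>R apply_bcontfun a (k, cl y)" for a y k
  define P where "P a = (\<lambda>(k, y). wt k ^ 3 *\<^sub>R picard (co a) k (cl y))" for a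
  let ?S = "cball (0 :: (int \<times> real) \<Rightarrow>\<^sub>C 'e) A"
  have adm: "admissible (co a)" if "a \<in> ?S" for a
    unfolding admissible_def
  proof (intro conjI allI ballI)
    show "continuous_on {0..1} (\<lambda>y. co a y k)" for k
    proof -
      have "continuous_on {0..1} (\<lambda>y. (k, cl y))"
        by (intro continuous_intros continuous_on_subset[OF cl(3)]) auto
      then show ?thesis
        unfolding co_def
        by (intro continuous_on_scaleR continuous_on_const)
          (rule continuous_on_compose2[OF continuous_on_apply_bcontfun[of UNIV a]], auto)
    qed
    show "decay 3 A (co a y)" for y
      unfolding decay_def
    proof
      fix k
      have "norm (apply_bcontfun a (k, cl y)) \<le> A"
        using that norm_bounded[of a "(k, cl y)"] by simp
      then show "norm (co a y k) \<le> A / wt k ^ 3"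
        by (simp add: co_def divide_right_mono less_imp_le)
    qed
  qed
  have dd: "decay 3 (dist a b) (\<lambda>k. co a y k - co b y k)" for a b y
    unfolding decay_def
  proof
    fix k
    have "norm (apply_bcontfun a (k, cl y) - apply_bcontfun b (k, cl y)) \<le> dist a b"
      using dist_bounded[of a "(k, cl y)" b] by (simp add: dist_norm)
    moreover have "co a y k - co b y k = (1 / wt k ^ 3) *\<^sub>R (apply_bcontfun a (k, cl y) - apply_bcontfun b (k, cl y))"
      by (simp add: co_def scaleR_diff_right)
    ultimately show "norm (co a y k - co b y k) \<le> dist a b / wt k ^ 3"
      by (simp add: divide_right_mono less_imp_le)
  qed
  have Pd: "norm (P a z - P b z) \<le> 1 / 2 * dist a b" if "a \<in> ?S" "b \<in> ?S" for a b z
  proof -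
    obtain k y where z: "z = (k, y)" by (cases z)
    have "norm (picard (co a) k (cl y) - picard (co b) k (cl y)) \<le> picard_lip * \<eta> * dist a b / wt k ^ 3"
      by (rule picard_diff[OF adm[OF that(1)] adm[OF that(2)] dd cl(1)])
    also have "\<dots> \<le> 1 / 2 * dist a b / wt k ^ 3"
      by (intro divide_right_mono mult_right_mono small) (auto simp: less_imp_le)
    finally have *: "norm (picard (co a) k (cl y) - picard (co b) k (cl y)) \<le> 1 / 2 * dist a b / wt k ^ 3" .
    have "norm (P a z - P b z) = wt k ^ 3 * norm (picard (co a) k (cl y) - picard (co b) k (cl y))"
      by (simp add: P_def z less_imp_le flip: scaleR_diff_right)
    also have "\<dots> \<le> wt k ^ 3 * (1 / 2 * dist a b / wt k ^ 3)"
      using * by (intro mult_left_mono) (auto simp: less_imp_le)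
    finally show ?thesis by simp
  qed
  have P0: "norm (P 0 z) \<le> free_const y0" for z
  proof -
    obtain k y where z: "z = (k, y)" by (cases z)
    have c0: "co 0 = (\<lambda>_ _. 0)" by (intro ext) (simp add: co_def zero_bcontfun.rep_eq)
    have "norm (P 0 z) = wt k ^ 3 * norm (free y0 Z k (cl y))"
      by (simp add: P_def z c0 picard_zero less_imp_le)
    also have "\<dots> \<le> wt k ^ 3 * (free_const y0 * norm Z / wt k ^ 3)"
      by (intro mult_left_mono free_bound[OF y0(1) cl(1)]) (auto simp: less_imp_le)
    also have "\<dots> \<le> free_const y0" using Z free_const_nonneg by (simp add: mult_left_le)
    finally show ?thesis .
  qed
  have PA: "norm (P a z) \<le> A" if "a \<in> ?S" for a z
  proof -
    have "norm (P a z) \<le> norm (P a z - P 0 z) + norm (P 0 z)"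
      using norm_triangle_ineq[of "P a z - P 0 z" "P 0 z"] by simp
    also have "\<dots> \<le> 1 / 2 * dist a 0 + free_const y0"
      using Pd[OF that, of 0 z] P0[of z] A0 by (intro add_mono) auto
    also have "\<dots> \<le> A" using that by (simp add: A dist_commute)
    finally show ?thesis .
  qed
  have Pb: "P a \<in> bcontfun" if "a \<in> ?S" for a
    unfolding bcontfun_def mem_Collect_eq
  proof
    show "continuous_on UNIV (P a)"
      unfolding P_def
    proof (rule continuous_on_discrete_prod)
      fix k
      show "continuous_on UNIV (\<lambda>y. wt k ^ 3 *\<^sub>R picard (co a) k (cl y))"
        by (intro continuous_intros continuous_on_compose2[OF picard_cont[OF adm[OF that]] cl(3)]) (use cl(1) in auto)
    qed
    show "bounded (range (P a))" using PA[OF that] by (auto simp: bounded_iff)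
  qed
  note ap = Bcontfun_inverse[OF Pb]
  have "\<exists>!a\<in>?S. Bcontfun (P a) = a"
  proof (rule Banach_fix)
    show "complete ?S" by (rule complete_cball_bcontfun)
    show "?S \<noteq> {}" using A0 by simp
    show "(\<lambda>a. Bcontfun (P a)) ` ?S \<subseteq> ?S"
    proof (rule image_subsetI)
      fix a assume a: "a \<in> ?S"
      have "norm (Bcontfun (P a)) \<le> A"
        by (rule norm_bound) (simp add: ap[OF a] PA[OF a])
      then show "Bcontfun (P a) \<in> ?S" by simp
    qed
    show "dist (Bcontfun (P a)) (Bcontfun (P b)) \<le> 1 / 2 * dist a b" if "a \<in> ?S" "b \<in> ?S" for a b
    proof (rule dist_bound)
      fix z show "dist (apply_bcontfun (Bcontfun (P a)) z) (apply_bcontfun (Bcontfun (P b)) z) \<le> 1 / 2 * dist a b"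
        using Pd[OF that] by (simp add: ap[OF that(1)] ap[OF that(2)] dist_norm)
    qed
  qed auto
  then obtain a where a: "a \<in> ?S" "Bcontfun (P a) = a" by blast
  show ?thesis
  proof (rule that[OF adm[OF a(1)]])
    fix y :: real and k assume y: "y \<in> {0..1}"
    have "apply_bcontfun a (k, cl y) = P a (k, cl y)" using ap[OF a(1)] a(2) by simp
    then show "co a y k = picard (co a) k y"
      by (simp add: co_def[of a y k] P_def cl(2)[OF y])
  qed
qed

end

end

context conj_space
begin

lemma tser_add:
  assumes "decay 2 A c" "decay 2 A' c'"
  shows "tser (\<lambda>k. c k + c' k) x = tser c x + tser c' x"
proof -
  have "((\<lambda>k. cm (cis (of_int k * x)) (c k) + cm (cis (of_int k * x)) (c' k)) has_sum tser c x + tser c' x) UNIV"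
    by (intro has_sum_add tser_has_sum[OF assms(1)] tser_has_sum[OF assms(2)])
  then show ?thesis
    unfolding tser_def[of "\<lambda>k. c k + c' k"] by (simp add: infsumI cm.add_right)
qed

text \<open>
  Real-linear maps commute with the series if they commute with \<open>J0\<close>; for the conjugation, which
  anticommutes with \<open>J0\<close>, the frequencies change sign.
\<close>

lemma J0_tser:
  assumes "decay 2 A c"
  shows "J0 (tser c x) = tser (\<lambda>k. J0 (c k)) x"
proof -
  have "((\<lambda>k. J0 (cm (cis (of_int k * x)) (c k))) has_sum J0 (tser c x)) UNIV"
    using has_sum_bounded_linear[OF bl_J0 tser_has_sum[OF assms]] by (simp add: o_def)
  then show ?thesis
    unfolding tser_def[of "\<lambda>k. J0 (c k)"] by (simp add: infsumI cm_J0)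
qed

lemma cj_tser:
  assumes d: "decay 2 A c" and s: "\<And>k. cj (c k) = c (- k)"
  shows "cj (tser c x) = tser c x"
proof (rule has_sum_unique)
  have "((\<lambda>k. cj (cm (cis (of_int k * x)) (c k))) has_sum cj (tser c x)) UNIV"
    using has_sum_bounded_linear[OF bl_cj tser_has_sum[OF d]] by (simp add: o_def)
  then show "((\<lambda>k. cm (cis (of_int (- k) * x)) (c (- k))) has_sum cj (tser c x)) UNIV"
    by (simp add: cj_cm s cis_cnj)
  show "((\<lambda>k. cm (cis (of_int (- k) * x)) (c (- k))) has_sum tser c x) UNIV"
    using has_sum_reindex_bij_betw[OF bij_uminus[where 'a=int], of "\<lambda>k. cm (cis (of_int k * x)) (c k)" "tser c x"]
      tser_has_sum[OF d] by simp
qed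

lemma tser_periodic_int: "tser c (x + 2 * pi * of_int n) = tser c x"
proof -
  have "cis (of_int k * (x + 2 * pi * of_int n)) = cis (of_int k * x)" for k
    using cis_multiple_2pi[of "of_int (k * n)"] by (simp add: distrib_left cis_mult[symmetric] mult_ac)
  then show ?thesis by (simp add: tser_def)
qed

lemma reduce_2pi: obtains x' n where "x' \<in> {0..2*pi}" "x = x' + 2 * pi * real_of_int n"
proof
  have P: "0 < 2 * pi" by simp
  let ?n = "\<lfloor>x / (2*pi)\<rfloor>"
  have "of_int ?n \<le> x / (2*pi)" "x / (2*pi) < of_int ?n + 1" by linarith+
  then have "of_int ?n * (2*pi) \<le> x" "x < (of_int ?n + 1) * (2*pi)"
    using P by (simp_all only: pos_le_divide_eq pos_divide_less_eq)
  then show "x - 2 * pi * of_int ?n \<in> {0..2*pi}" by (auto simp: algebra_simps)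
  show "x = x - 2 * pi * of_int ?n + 2 * pi * of_int ?n" by simp
qed

text \<open>
  The vector \<open>d\<close> of the unperturbed disc \<open>\<zeta> \<mapsto> c + sin \<zeta> d\<close> whose value at \<open>\<i> y0\<close> is \<open>Z\<close>.
\<close>

definition disc_velocity :: "real \<Rightarrow> 'e \<Rightarrow> 'e" where
  "disc_velocity y0 Z = - (1 / (2 * sinh y0)) *\<^sub>R J0 (Z - cj Z)"

text \<open>
  The fixed point of the Picard map, summed up. It differs from the free part by \<open>O(\<eta>)\<close> in \<open>C\<^sup>1\<close>, because
  the Picard map differs from its value at 0 by \<open>O(\<eta>)\<close>. The constants \<open>R\<close>, \<open>C\<close>, \<open>\<eta>0\<close> do not depend on
  \<open>K\<close> and \<open>Z\<close>, so that the theorem can be applied to all dilations of one structure.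
\<close>

theorem attached_disc_exists:
  assumes y0: "0 < y0" "y0 \<le> 1"
  shows "\<exists>R>0. \<exists>C\<ge>0. \<exists>\<eta>0>0. \<forall>\<eta> K Z. small_field R \<eta> K \<longrightarrow> \<eta> \<le> \<eta>0 \<longrightarrow> norm Z \<le> 1 \<longrightarrow>
    (\<exists>F Fx Fy :: real \<times> real \<Rightarrow> 'e.
       (\<forall>z\<in>UNIV \<times> {0..1}. (F has_derivative (\<lambda>(s, t). s *\<^sub>R Fx z + t *\<^sub>R Fy z)) (at z within UNIV \<times> {0..1})) \<and>
       continuous_on (UNIV \<times> {0..1}) Fx \<and> continuous_on (UNIV \<times> {0..1}) Fy \<and>
       (\<forall>z\<in>UNIV \<times> {0..1}. F z \<in> ball 0 R \<and> Fy z = J0 (Fx z) + K (F z) (Fx z) \<and>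
          norm (Fx z - cm (cos (Complex (fst z) (snd z))) (disc_velocity y0 Z)) \<le> C * \<eta> \<and>
          norm (Fy z - J0 (cm (cos (Complex (fst z) (snd z))) (disc_velocity y0 Z))) \<le> C * \<eta>) \<and>
       (\<forall>x. cj (F (x, 0)) = F (x, 0)) \<and> F (0, y0) = Z)"
proof -
  define A where "A = 2 * free_const y0"
  define R where "R = cmb * A * wt_sum + 1"
  have A0: "0 \<le> A" using cmb_ge_1 y0 by (simp add: A_def free_const_def)
  have RA: "cmb * A * wt_sum < R" by (simp add: R_def)
  have R0: "0 < R" by (rule R_pos[OF RA A0])
  define B where "B = cmb * cmb * wt_sum * picard_lip A y0 * A"
  define D where "D = real DIM('e) * real DIM('e) * (cmb * (cmb * A) * wt_sum)"
  define \<eta>0 where "\<eta>0 = 1 / (2 * (picard_lip A y0 + 1))"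
  have w0: "0 \<le> wt_sum" and c0: "0 \<le> cmb" using wt_sum_ge_1 cmb_ge_1 by auto
  have D0: "0 \<le> D" unfolding D_def using A0 w0 c0 by (intro mult_nonneg_nonneg) auto
  show ?thesis
  proof (cases "\<exists>\<eta> K. small_field R \<eta> (K :: 'e \<Rightarrow> 'e \<Rightarrow> 'e)")
    \<comment> \<open>Some field is needed to know that the constants below are nonnegative.\<close>
    case False
    then show ?thesis using R0 by (intro exI[of _ R] conjI exI[of _ 0] exI[of _ 1]) auto
  next
    case True
    then obtain \<eta>1 and K1 :: "'e \<Rightarrow> 'e \<Rightarrow> 'e" where sf1: "small_field R \<eta>1 K1" by blast
    have cp0: "0 \<le> picard_lip A y0" by (rule picard_lip_nonneg[OF RA A0 sf1 y0])
    have B0: "0 \<le> B" unfolding B_def using A0 w0 c0 cp0 by (intro mult_nonneg_nonneg) auto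
    have e0: "0 < \<eta>0" using cp0 by (simp add: \<eta>0_def)
    show ?thesis
    proof (rule exI[of _ R], intro conjI R0, rule exI[of _ "cmb * B + D"], intro conjI, simp add: B0 D0 c0, rule exI[of _ \<eta>0],
        intro conjI e0 allI impI)
      fix \<eta> and K :: "'e \<Rightarrow> 'e \<Rightarrow> 'e" and Z :: 'e
      assume sf: "small_field R \<eta> K" and eta: "\<eta> \<le> \<eta>0" and Z: "norm Z \<le> 1"
      note ctx = RA A0 sf y0
      have eta0: "0 \<le> \<eta>" by (rule eta_nonneg[OF ctx])
      have small: "picard_lip A y0 * \<eta> \<le> 1 / 2"
      proof -
        have "picard_lip A y0 * \<eta> \<le> (picard_lip A y0 + 1) * \<eta>0" using cp0 eta e0 eta0 by (intro mult_mono) auto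
        also have "\<dots> = 1 / 2" using cp0 by (simp add: \<eta>0_def)
        finally show ?thesis .
      qed
      obtain c where adm: "admissible A c" and fp: "\<And>y k. y \<in> {0..1} \<Longrightarrow> c y k = picard y0 K Z c k y"
        using picard_fixed_point[OF ctx A_def small Z] by blast
      have dec: "decay 3 A (c y)" if "y \<in> {0..1}" for y using adm that by (simp add: admissible_def[OF ctx])
      let ?h = "pert_coeff K c"
      define gy where "gy y k = ?h k y - of_int k *\<^sub>R c y k" for y k
      have decc: "decay 2 A (\<lambda>k. of_int k *\<^sub>R c y k)" if "y \<in> {0..1}" for y
        unfolding decay_def
      proof
        fix k
        have "norm (of_int k *\<^sub>R c y k) \<le> wt k * (A / wt k ^ 3)"
          unfolding norm_scaleR using dec[OF that] by (intro mult_mono abs_le_wt) (auto simp: decay_def less_imp_le)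
        then show "norm (of_int k *\<^sub>R c y k) \<le> A / wt k ^ 2" by (simp add: power2_eq_square power3_eq_cube)
      qed
      have dech: "decay 2 (pert_lip A * \<eta> * A) (\<lambda>k. ?h k y)" if y: "y \<in> {0..1}" for y
        unfolding decay_def
      proof
        fix k
        have "norm (vfc (pert K (c y)) k - vfc (pert K (\<lambda>_. 0)) k) \<le> pert_lip A * \<eta> * A / wt k ^ 2"
          by (rule vfc_pert_diff[OF ctx dec[OF y]]) (use dec[OF y] decay_zero[OF ctx A0] in auto)
        then show "norm (?h k y) \<le> pert_lip A * \<eta> * A / wt k ^ 2"
          using pert_coeff_zero[OF ctx, of k y] by (simp add: pert_coeff_def[OF ctx])
      qed
      have decgy: "decay 2 (pert_lip A * \<eta> * A + A) (gy y)" if y: "y \<in> {0..1}" for y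
        unfolding decay_def gy_def
      proof
        fix k
        have "norm (?h k y - of_int k *\<^sub>R c y k) \<le> pert_lip A * \<eta> * A / wt k ^ 2 + A / wt k ^ 2"
          using dech[OF y] decc[OF y] unfolding decay_def
          by (intro order_trans[OF norm_triangle_ineq4] add_mono) auto
        then show "norm (?h k y - of_int k *\<^sub>R c y k) \<le> (pert_lip A * \<eta> * A + A) / wt k ^ 2"
          by (simp add: add_divide_distrib)
      qed
      have hc: "continuous_on {0..1} (?h k)" for k by (rule pert_coeff_cont[OF ctx adm])
      have cy: "continuous_on {0..1} (\<lambda>y. c y k)" for k using adm by (simp add: admissible_def[OF ctx])
      have gyc: "continuous_on {0..1} (\<lambda>y. gy y k)" for k
        unfolding gy_def by (intro continuous_intros hc cy)
      have dery: "((\<lambda>y. c y k) has_vector_derivative gy y k) (at y within {0..1})" if y: "y \<in> {0..1}" for y k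
      proof (rule has_vector_derivative_transform[OF y fp])
        have "(picard y0 K Z c k has_vector_derivative (?h k y - of_int k *\<^sub>R sol ?h k y) 
            + - of_int k *\<^sub>R free y0 (Z - tser (\<lambda>k. sol ?h k y0) 0) k y) (at y within {0..1})"
          unfolding picard_def[OF ctx] by (intro has_vector_derivative_add sol_deriv hc y free_deriv)
        moreover have "(?h k y - of_int k *\<^sub>R sol ?h k y) 
            + - of_int k *\<^sub>R free y0 (Z - tser (\<lambda>k. sol ?h k y0) 0) k y = gy y k"
          by (simp add: gy_def fp[OF y] picard_def[OF ctx] algebra_simps)
        ultimately show "(picard y0 K Z c k has_vector_derivative gy y k) (at y within {0..1})" by simp
      qed
      \<comment> \<open>The disc, with its derivatives taken termwise; \<open>gy\<close> are the \<open>y\<close>-derivatives of the coefficients.\<close>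
      define F where "F z = tser (c (snd z)) (fst z)" for z :: "real \<times> real"
      define Fx where "Fx z = tser (dcoef (c (snd z))) (fst z)" for z :: "real \<times> real"
      define Fy where "Fy z = tser (gy (snd z)) (fst z)" for z :: "real \<times> real"
      have cFx: "continuous_on (UNIV \<times> {0..1}) Fx"
        using admissible_tser_cont(2)[OF ctx adm] by (simp add: Fx_def[abs_def] case_prod_beta)
      have cFy: "continuous_on (UNIV \<times> {0..1}) Fy"
        using continuous_on_tser_param[of "{0..1}" "\<lambda>k y. gy y k" "pert_lip A * \<eta> * A + A", OF gyc decgy]
        by (simp add: Fy_def[abs_def] case_prod_beta)
      have dFy: "((\<lambda>y. tser (c y) x) has_vector_derivative tser (gy y) x) (at y within {0..1})" if y: "y \<in> {0..1}" for x y
        unfolding tser_def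
      proof (rule has_vector_derivative_infsum[OF _ _ _ _ _ _ y])
        show "((\<lambda>y. cm (cis (of_int k * x)) (c y k)) has_vector_derivative cm (cis (of_int k * x)) (gy t k)) (at t within {0..1})"
          if "t \<in> {0..1}" for k t
          by (rule bounded_linear.has_vector_derivative[OF cm.bounded_linear_right dery[OF that]])
        show "continuous_on {0..1} (\<lambda>y. cm (cis (of_int k * x)) (gy y k))" for k
          by (intro cm.continuous_on continuous_intros gyc)
        show "norm (cm (cis (of_int k * x)) (c t k)) \<le> cmb * A * (1 / wt k ^ 2)" if "t \<in> {0..1}" for t k
          by (rule tser_term_bound[OF decay_3_2[OF dec[OF that]]])
        show "norm (cm (cis (of_int k * x)) (gy t k)) \<le> cmb * (pert_lip A * \<eta> * A + A) * (1 / wt k ^ 2)" if "t \<in> {0..1}" for t k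
          by (rule tser_term_bound[OF decgy[OF that]])
      qed (rule tser_bound_summable)+
      have dF: "(F has_derivative (\<lambda>(s, t). s *\<^sub>R Fx z + t *\<^sub>R Fy z)) (at z within UNIV \<times> {0..1})" if z: "z \<in> UNIV \<times> {0..1}" for z
      proof -
        obtain x y where xy: "z = (x, y)" "y \<in> {0..1}" using z by (cases z) auto
        have "((\<lambda>(x, y). tser (c y) x) has_derivative (\<lambda>(s, t). s *\<^sub>R Fx z + blinfun_apply (blinfun_scaleR_left (Fy (x, y))) t)) (at (x, y) within UNIV \<times> {0..1})"
        proof (rule has_derivative_partialsI)
          show "((\<lambda>x. tser (c y) x) has_derivative (\<lambda>s. s *\<^sub>R Fx z)) (at x within UNIV)"
            using tser_deriv[OF dec[OF xy(2)], of x] by (simp add: has_vector_derivative_def Fx_def xy)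
          show "((\<lambda>y. tser (c y) x) has_derivative blinfun_apply (blinfun_scaleR_left (Fy (x, y)))) (at y within {0..1})"
            if "y \<in> {0..1}" for x y
            using dFy[OF that, of x] by (simp add: has_vector_derivative_def Fy_def)
          show "continuous (at (x, y) within UNIV \<times> {0..1}) (\<lambda>(x, y). blinfun_scaleR_left (Fy (x, y)))"
          proof -
            have "continuous_on (UNIV \<times> {0..1}) (\<lambda>z. blinfun_scaleR_left (Fy z))"
              by (intro bounded_linear.continuous_on[OF bounded_linear_blinfun_scaleR_left] cFy)
            moreover have "(\<lambda>(x, y). blinfun_scaleR_left (Fy (x, y))) = (\<lambda>z. blinfun_scaleR_left (Fy z))" by auto
            ultimately show ?thesis
              using xy(2) by (simp add: continuous_on_eq_continuous_within)
          qed
        qed (use xy in auto)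
        moreover have "(\<lambda>(x, y). tser (c y) x) = F" by (auto simp: F_def)
        ultimately show ?thesis by (simp add: xy)
      qed
      have per: "pert K (c y) (x + 2 * pi * of_int n) = pert K (c y) x" for y x n
        by (simp add: pert_def tser_periodic_int)
      have inv: "tser (\<lambda>k. ?h k y) x = pert K (c y) x" if y: "y \<in> {0..1}" for x y
      proof -
        obtain x' n where x': "x' \<in> {0..2*pi}" "x = x' + 2 * pi * of_int n" by (rule reduce_2pi)
        have "vfc (pert K (c y)) = (\<lambda>k. ?h k y)" by (simp add: pert_coeff_def[OF ctx] fun_eq_iff)
        moreover have "pert K (c y) (2*pi) = pert K (c y) 0" using per[of y 0 1] by simp
        ultimately have "tser (\<lambda>k. ?h k y) x' = pert K (c y) x'"
          using fourier_inversion[OF pert_cont1[OF ctx dec[OF y]], of "pert_lip A * \<eta> * A" x'] dech[OF y] x'(1) by simp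
        then show ?thesis by (simp add: x'(2) tser_periodic_int per)
      qed
      have eq: "Fy z = J0 (Fx z) + K (F z) (Fx z)" if z: "z \<in> UNIV \<times> {0..1}" for z
      proof -
        obtain x y where xy: "z = (x, y)" "y \<in> {0..1}" using z by (cases z) auto
        have "J0 (Fx z) = tser (\<lambda>k. J0 (dcoef (c y) k)) x"
          unfolding Fx_def xy by (simp add: J0_tser[OF decay_dcoef[OF dec[OF xy(2)]]])
        also have "(\<lambda>k. J0 (dcoef (c y) k)) = (\<lambda>k. 0 - of_int k *\<^sub>R c y k)"
          by (simp add: dcoef_def cm_def linear_scale[OF lin_J0])
        also have "tser \<dots> x = tser (\<lambda>_. 0) x - tser (\<lambda>k. of_int k *\<^sub>R c y k) x"
          by (rule tser_diff[OF _ decc[OF xy(2)]]) (rule decay_zero[OF ctx order_refl])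
        also have "tser (\<lambda>_. 0) x = 0" by (simp add: tser_def cm.zero_right)
        finally have "J0 (Fx z) = - tser (\<lambda>k. of_int k *\<^sub>R c y k) x" by simp
        moreover have "Fy z = tser (\<lambda>k. ?h k y) x - tser (\<lambda>k. of_int k *\<^sub>R c y k) x"
          unfolding Fy_def xy snd_conv fst_conv gy_def by (rule tser_diff[OF dech[OF xy(2)] decc[OF xy(2)]])
        moreover have "tser (\<lambda>k. ?h k y) x = K (F z) (Fx z)"
          unfolding inv[OF xy(2)] by (simp add: pert_def F_def Fx_def xy)
        ultimately show ?thesis by simp
      qed
      have inb: "F z \<in> ball 0 R" if z: "z \<in> UNIV \<times> {0..1}" for z
        unfolding F_def by (rule in_ball[OF ctx dec]) (use z in auto)
      have apx: "norm (Fx z - cm (cos (Complex (fst z) (snd z))) (disc_velocity y0 Z)) \<le> B * \<eta>"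
        if z: "z \<in> UNIV \<times> {0..1}" for z
      proof -
        obtain x y where xy: "z = (x, y)" "y \<in> {0..1}" using z by (cases z) auto
        have df: "decay 3 (free_const y0 * norm Z) (\<lambda>k. free y0 Z k y)"
          unfolding decay_def using free_bound[OF y0(1) xy(2)] by blast
        have "decay 3 (picard_lip A y0 * \<eta> * A) (\<lambda>k. c y k - free y0 Z k y)"
          unfolding decay_def
        proof
          fix k
          have "norm (picard y0 K Z c k y - picard y0 K Z (\<lambda>_ _. 0) k y) \<le> picard_lip A y0 * \<eta> * A / wt k ^ 3"
            by (rule picard_diff[OF ctx adm zero_admissible[OF ctx] _ xy(2)]) (use dec in auto)
          then show "norm (c y k - free y0 Z k y) \<le> picard_lip A y0 * \<eta> * A / wt k ^ 3"
            by (simp add: fp[OF xy(2)] picard_zero[OF ctx])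
        qed
        from norm_tser[OF decay_dcoef[OF this], of x]
        have "norm (tser (dcoef (c y)) x - tser (dcoef (\<lambda>k. free y0 Z k y)) x) \<le> cmb * (cmb * (picard_lip A y0 * \<eta> * A)) * wt_sum"
          unfolding dcoef_diff
          by (subst (asm) tser_diff[OF decay_dcoef[OF dec[OF xy(2)]] decay_dcoef[OF df]])
        then show ?thesis
          by (simp add: Fx_def xy tser_dcoef_free disc_velocity_def B_def mult_ac)
      qed
      have apy: "norm (Fy z - J0 (cm (cos (Complex (fst z) (snd z))) (disc_velocity y0 Z))) \<le> (cmb * B + D) * \<eta>"
        if z: "z \<in> UNIV \<times> {0..1}" for z
      proof -
        let ?v = "cm (cos (Complex (fst z) (snd z))) (disc_velocity y0 Z)"
        have "Fy z - J0 ?v = J0 (Fx z - ?v) + K (F z) (Fx z)"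
          by (simp add: eq[OF z] linear_diff[OF lin_J0])
        moreover have "norm (J0 (Fx z - ?v)) \<le> cmb * (B * \<eta>)"
          using norm_J0_cmb[of "Fx z - ?v"] apx[OF z] c0 
          by (smt (verit, ccfv_SIG) mult_left_mono norm_ge_zero)
        moreover have "norm (K (F z) (Fx z)) \<le> D * \<eta>"
        proof -
          have "norm (Fx z) \<le> cmb * (cmb * A) * wt_sum"
            unfolding Fx_def by (rule norm_tser[OF decay_dcoef[OF dec]]) (use z in auto)
          then have "real DIM('e) * (real DIM('e) * \<eta>) * norm (Fx z) \<le> real DIM('e) * (real DIM('e) * \<eta>) * (cmb * (cmb * A) * wt_sum)"
            using eta0 by (intro mult_left_mono) auto
          then show ?thesis
            using small_field_norm[OF sf inb[OF z], of "Fx z"] by (simp add: D_def mult_ac)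
        qed
        ultimately show ?thesis by (auto simp: algebra_simps intro: norm_triangle_le)
      qed
      have bdry: "cj (F (x, 0)) = F (x, 0)" for x
        unfolding F_def fst_conv snd_conv
      proof (rule cj_tser[OF decay_3_2[OF dec]])
        have "c 0 = (\<lambda>k. picard y0 K Z c k 0)" using fp[of 0] by auto
        then show "cj (c 0 k) = c 0 (- k)" for k
          by (simp add: picard_def[OF ctx] linear_add[OF lin_cj] sol_boundary free_boundary)
      qed simp
      have val: "F (0, y0) = Z"
      proof -
        have y01: "y0 \<in> {0..1}" using y0 by simp
        let ?s = "tser (\<lambda>k. sol ?h k y0) 0"
        have "c y0 = (\<lambda>k. sol ?h k y0 + free y0 (Z - ?s) k y0)" using fp[OF y01] by (auto simp: picard_def[OF ctx])
        then have "F (0, y0) = tser (\<lambda>k. sol ?h k y0 + free y0 (Z - ?s) k y0) 0" by (simp add: F_def)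
        also have "\<dots> = ?s + tser (\<lambda>k. free y0 (Z - ?s) k y0) 0"
        proof (rule tser_add[OF decay_3_2[OF decay_sol_pert_coeff[OF ctx adm y01]]], rule decay_3_2)
          show "decay 3 (free_const y0 * norm (Z - ?s)) (\<lambda>k. free y0 (Z - ?s) k y0)"
            unfolding decay_def using free_bound[OF y0(1) y01] by blast
        qed
        also have "\<dots> = Z" by (simp add: tser_free[OF y0(1)])
        finally show ?thesis .
      qed
      have BD: "B * \<eta> \<le> (cmb * B + D) * \<eta>"
        using mult_right_mono[OF cmb_ge_1 B0] D0 by (intro mult_right_mono eta0) simp
      show "\<exists>F Fx Fy :: real \<times> real \<Rightarrow> 'e.
       (\<forall>z\<in>UNIV \<times> {0..1}. (F has_derivative (\<lambda>(s, t). s *\<^sub>R Fx z + t *\<^sub>R Fy z)) (at z within UNIV \<times> {0..1})) \<and>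
       continuous_on (UNIV \<times> {0..1}) Fx \<and> continuous_on (UNIV \<times> {0..1}) Fy \<and>
       (\<forall>z\<in>UNIV \<times> {0..1}. F z \<in> ball 0 R \<and> Fy z = J0 (Fx z) + K (F z) (Fx z) \<and>
          norm (Fx z - cm (cos (Complex (fst z) (snd z))) (disc_velocity y0 Z)) \<le> (cmb * B + D) * \<eta> \<and>
          norm (Fy z - J0 (cm (cos (Complex (fst z) (snd z))) (disc_velocity y0 Z))) \<le> (cmb * B + D) * \<eta>) \<and>
       (\<forall>x. cj (F (x, 0)) = F (x, 0)) \<and> F (0, y0) = Z"
        by (rule exI[of _ F], rule exI[of _ Fx], rule exI[of _ Fy])
          (intro conjI ballI allI dF cFx cFy inb eq order_trans[OF apx BD] apy bdry val)
    qed
  qed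
qed

end

section \<open>Calculus of continuously differentiable maps\<close>

lemma Ck_on_differentiable: "Ck_on (Suc k) S f \<Longrightarrow> x \<in> S \<Longrightarrow> f differentiable (at x)"
  by simp

lemma Ck_on_has_derivative:
  "Ck_on (Suc k) S f \<Longrightarrow> x \<in> S \<Longrightarrow> (f has_derivative frechet_derivative f (at x)) (at x)"
  using Ck_on_differentiable frechet_derivative_works by blast

lemma Ck_on_SucD: "Ck_on (Suc k) S f \<Longrightarrow> Ck_on k S f"
proof (induction k arbitrary: f)
  case 0
  then show ?case
    by (auto intro!: continuous_at_imp_continuous_on differentiable_imp_continuous_within)
next
  case (Suc k)
  then show ?case by (metis Ck_on.simps(2))
qed

lemma Ck_on_mono: "Ck_on k S f \<Longrightarrow> j \<le> k \<Longrightarrow> Ck_on j S f"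
proof (induction k)
  case (Suc k)
  then show ?case using Ck_on_SucD[of k S f] by (cases "j = Suc k") (auto simp del: Ck_on.simps)
qed simp

lemma Ck_on_continuous: "Ck_on k S f \<Longrightarrow> continuous_on S f"
  using Ck_on_mono[of k S f 0] by simp

lemma Ck_on_subset: "Ck_on k S f \<Longrightarrow> T \<subseteq> S \<Longrightarrow> Ck_on k T f"
  by (induction k arbitrary: f) (auto intro: continuous_on_subset)

lemma frechet_derivative_transform:
  assumes "open S" "x \<in> S" "\<And>y. y \<in> S \<Longrightarrow> f y = g y"
  shows "frechet_derivative f (at x) = frechet_derivative g (at x)"
proof -
  have "(f has_derivative D) (at x) \<longleftrightarrow> (g has_derivative D) (at x)" for D
    using has_derivative_transform_within_open[OF _ assms(1,2), where f=f and g=g and t=UNIV and f'=D]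
      has_derivative_transform_within_open[OF _ assms(1,2), where f=g and g=f and t=UNIV and f'=D] assms(3) by auto
  then show ?thesis by (simp add: frechet_derivative_def)
qed

lemma Ck_on_cong:
  assumes "open S" "\<And>x. x \<in> S \<Longrightarrow> f x = g x"
  shows "Ck_on k S f \<longleftrightarrow> Ck_on k S g"
proof -
  have "Ck_on k S f \<Longrightarrow> Ck_on k S g" if "\<And>x. x \<in> S \<Longrightarrow> f x = g x" for f g :: "'a \<Rightarrow> 'b"
    using that
  proof (induction k arbitrary: f g)
    case 0
    then show ?case by (simp cong: continuous_on_cong)
  next
    case (Suc k)
    have "g differentiable at x" if "x \<in> S" for x
      using Ck_on_has_derivative[OF Suc.prems(1) that]
        has_derivative_transform_within_open[OF _ assms(1) that, where f=f and g=g and t=UNIV] Suc.prems(2)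
      by (auto simp: differentiable_def)
    moreover have "Ck_on k S (\<lambda>x. frechet_derivative g (at x) v)" for v
    proof (rule Suc.IH)
      show "Ck_on k S (\<lambda>x. frechet_derivative f (at x) v)" using Suc.prems(1) by simp
      show "frechet_derivative f (at x) v = frechet_derivative g (at x) v" if "x \<in> S" for x
        using frechet_derivative_transform[OF assms(1) that Suc.prems(2)] by simp
    qed
    ultimately show ?case by simp
  qed
  then show ?thesis using assms(2) by metis
qed

text \<open>
  The definition refers to the derivative chosen by \<^const>\<open>frechet_derivative\<close>; any explicit formula for
  the derivative will do.
\<close>

lemma Ck_on_SucI:
  assumes "open S" and "\<And>x. x \<in> S \<Longrightarrow> (f has_derivative f' x) (at x)" and "\<And>v. Ck_on k S (\<lambda>x. f' x v)"
  shows "Ck_on (Suc k) S f"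
proof -
  have "Ck_on k S (\<lambda>x. frechet_derivative f (at x) v)" for v
    using Ck_on_cong[OF assms(1), of "\<lambda>x. frechet_derivative f (at x) v" "\<lambda>x. f' x v"]
      frechet_derivative_at[OF assms(2)] assms(3) by metis
  then show ?thesis using assms(2) by (auto simp: differentiable_def)
qed

lemma Ck_on_const: "open S \<Longrightarrow> Ck_on k S (\<lambda>x. c)"
proof (induction k arbitrary: c)
  case (Suc k)
  show ?case
    by (rule Ck_on_SucI[where f'="\<lambda>x v. 0"]) (use Suc in simp_all)
qed simp

lemma Ck_on_linear:
  assumes "bounded_linear L" "open S" "Ck_on k S f"
  shows "Ck_on k S (\<lambda>x. L (f x))"
  using assms(3)
proof (induction k arbitrary: f)
  case 0
  then show ?case using bounded_linear.continuous_on[OF assms(1)] by simp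
next
  case (Suc k)
  show ?case
  proof (rule Ck_on_SucI[OF assms(2)])
    show "((\<lambda>x. L (f x)) has_derivative (\<lambda>v. L (frechet_derivative f (at x) v))) (at x)" if "x \<in> S" for x
      by (rule bounded_linear.has_derivative[OF assms(1) Ck_on_has_derivative[OF Suc.prems that]])
    show "Ck_on k S (\<lambda>x. L (frechet_derivative f (at x) v))" for v
      by (rule Suc.IH) (use Suc.prems in simp)
  qed
qed

lemma Ck_on_id: "open S \<Longrightarrow> Ck_on k S (\<lambda>x. x)"
proof (cases k)
  case (Suc j)
  assume "open S"
  then show ?thesis
    unfolding Suc by (intro Ck_on_SucI[where f'="\<lambda>x v. v"] Ck_on_const) simp_all
qed (simp add: continuous_on_id)

lemma Ck_on_add:
  assumes "open S" "Ck_on k S f" "Ck_on k S g"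
  shows "Ck_on k S (\<lambda>x. f x + g x)"
  using assms(2,3)
proof (induction k arbitrary: f g)
  case 0
  then show ?case by (simp add: continuous_on_add)
next
  case (Suc k)
  show ?case
  proof (rule Ck_on_SucI[OF assms(1)])
    show "((\<lambda>x. f x + g x) has_derivative (\<lambda>v. frechet_derivative f (at x) v + frechet_derivative g (at x) v)) (at x)"
      if "x \<in> S" for x
      by (intro has_derivative_add Ck_on_has_derivative[OF Suc.prems(1) that] Ck_on_has_derivative[OF Suc.prems(2) that])
    show "Ck_on k S (\<lambda>x. frechet_derivative f (at x) v + frechet_derivative g (at x) v)" for v
      by (rule Suc.IH) (use Suc.prems in simp_all)
  qed
qed

lemma Ck_on_sum:
  assumes "open S" "finite I" "\<And>i. i \<in> I \<Longrightarrow> Ck_on k S (f i)"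
  shows "Ck_on k S (\<lambda>x. \<Sum>i\<in>I. f i x)"
  using assms(2,3)
proof (induction I rule: finite_induct)
  case empty
  show ?case using Ck_on_const[OF assms(1)] by simp
next
  case (insert i I)
  then show ?case using Ck_on_add[OF assms(1), of k "f i" "\<lambda>x. \<Sum>i\<in>I. f i x"] by simp
qed

lemma Ck_on_bilinear:
  assumes b: "bounded_bilinear bop" and S: "open S" "Ck_on k S f" "Ck_on k S g"
  shows "Ck_on k S (\<lambda>x. bop (f x) (g x))"
  using S(2,3)
proof (induction k arbitrary: f g)
  case 0
  then show ?case using bounded_bilinear.continuous_on[OF b] by simp
next
  case (Suc k)
  show ?case
  proof (rule Ck_on_SucI[OF S(1)])
    show "((\<lambda>x. bop (f x) (g x)) has_derivative
      (\<lambda>v. bop (f x) (frechet_derivative g (at x) v) + bop (frechet_derivative f (at x) v) (g x))) (at x)"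
      if "x \<in> S" for x
      by (intro bounded_bilinear.FDERIV[OF b] Ck_on_has_derivative[OF Suc.prems(1) that] Ck_on_has_derivative[OF Suc.prems(2) that])
    show "Ck_on k S (\<lambda>x. bop (f x) (frechet_derivative g (at x) v) + bop (frechet_derivative f (at x) v) (g x))" for v
      by (intro Ck_on_add[OF S(1)] Suc.IH) (use Suc.prems Ck_on_SucD in auto)
  qed
qed

lemmas Ck_on_scaleR = Ck_on_bilinear[OF bounded_bilinear_scaleR]
lemmas Ck_on_mult = Ck_on_bilinear[OF bounded_bilinear_mult]

lemma Ck_on_compose:
  fixes f :: "'a::real_normed_vector \<Rightarrow> 'b::euclidean_space"
  assumes "open S" "open T" "f ` S \<subseteq> T" "Ck_on k S f" "Ck_on k T g"
  shows "Ck_on k S (\<lambda>x. g (f x))"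
  using assms(3,4,5)
proof (induction k arbitrary: f g)
  case 0
  then show ?case by (auto intro: continuous_on_compose2)
next
  case (Suc k)
  have fT: "f x \<in> T" if "x \<in> S" for x using Suc.prems(1) that by auto
  let ?d = "\<lambda>x v. \<Sum>i\<in>Basis. (frechet_derivative f (at x) v \<bullet> i) *\<^sub>R frechet_derivative g (at (f x)) i"
  show ?case
  proof (rule Ck_on_SucI[OF assms(1)])
    fix x assume x: "x \<in> S"
    have dg: "(g has_derivative frechet_derivative g (at (f x))) (at (f x))"
      by (rule Ck_on_has_derivative[OF Suc.prems(3) fT[OF x]])
    have lin: "linear (frechet_derivative g (at (f x)))" using dg by (rule has_derivative_linear)
    have e: "frechet_derivative g (at (f x)) w = (\<Sum>i\<in>Basis. (w \<bullet> i) *\<^sub>R frechet_derivative g (at (f x)) i)" for w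
    proof -
      have "frechet_derivative g (at (f x)) w = frechet_derivative g (at (f x)) (\<Sum>i\<in>Basis. (w \<bullet> i) *\<^sub>R i)"
        by (simp only: euclidean_representation)
      then show ?thesis by (simp only: linear_sum[OF lin] linear_scale[OF lin])
    qed
    have "((\<lambda>x. g (f x)) has_derivative (\<lambda>v. frechet_derivative g (at (f x)) (frechet_derivative f (at x) v))) (at x)"
      by (rule has_derivative_compose[OF Ck_on_has_derivative[OF Suc.prems(2) x] dg])
    then show "((\<lambda>x. g (f x)) has_derivative ?d x) (at x)"
      by (rule has_derivative_eq_rhs) (rule ext, rule e)
  next
    fix v
    show "Ck_on k S (\<lambda>x. ?d x v)"
    proof (intro Ck_on_sum Ck_on_scaleR assms(1))
      fix i :: 'b assume "i \<in> Basis"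
      show "Ck_on k S (\<lambda>x. frechet_derivative f (at x) v \<bullet> i)"
        by (rule Ck_on_linear[OF bounded_linear_inner_left assms(1)]) (use Suc.prems in simp)
      show "Ck_on k S (\<lambda>x. frechet_derivative g (at (f x)) i)"
        by (rule Suc.IH[OF Suc.prems(1) Ck_on_SucD[OF Suc.prems(2)]]) (use Suc.prems in simp)
    qed simp
  qed
qed

lemma Ck_on_inverse: "Ck_on k (- {0}) (inverse :: real \<Rightarrow> real)"
proof (induction k)
  case 0
  show ?case by (simp add: continuous_on_inverse continuous_on_id)
next
  case (Suc k)
  have o: "open (- {0::real})" by (intro open_Compl closed_singleton)
  show ?case
  proof (rule Ck_on_SucI[OF o])
    show "(inverse has_derivative (\<lambda>v. inverse x * (inverse x * (- v)))) (at x)" if "x \<in> - {0}" for x :: real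
      using that by (auto intro!: derivative_eq_intros)
    show "Ck_on k (- {0}) (\<lambda>x. inverse x * (inverse x * (- v)))" for v :: real
      by (intro Ck_on_mult o Suc.IH Ck_on_const)
  qed
qed

lemma smooth_onD: "smooth_on S f \<Longrightarrow> Ck_on k S f"
  by (simp add: smooth_on_def)

lemma smooth_on_has_derivative:
  "smooth_on S f \<Longrightarrow> x \<in> S \<Longrightarrow> (f has_derivative frechet_derivative f (at x)) (at x)"
  using Ck_on_has_derivative[OF smooth_onD[of S f "Suc 0"]] .

section \<open>Tangent vectors in charts\<close>

lemma is_chart_facts:
  assumes "is_chart c"
  shows "open (fst c)" "open (snd c ` fst c)" "continuous_on (fst c) (snd c)"
    "continuous_on (snd c ` fst c) (inv_chart c)"
    "\<And>p. p \<in> fst c \<Longrightarrow> inv_chart c (snd c p) = p"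
    "\<And>x. x \<in> snd c ` fst c \<Longrightarrow> snd c (inv_chart c x) = x \<and> inv_chart c x \<in> fst c"
  using assms unfolding is_chart_def homeomorphism_def by auto

locale smooth_manifold =
  fixes A :: "('m::{t2_space,second_countable_topology}, 'e::euclidean_space) chart set"
  assumes smooth_structure: "smooth_structure A"
begin

lemma chart: "c \<in> A \<Longrightarrow> is_chart c"
  using smooth_structure by (simp add: smooth_structure_def)

lemmas chart_facts = is_chart_facts[OF chart]

lemma chart_in: "c \<in> A \<Longrightarrow> p \<in> fst c \<Longrightarrow> snd c p \<in> snd c ` fst c"
  by simp

lemma open_chart_image:
  assumes "c \<in> A" "open V"
  shows "open (snd c ` (fst c \<inter> V))"
proof -
  have "snd c ` (fst c \<inter> V) = snd c ` fst c \<inter> inv_chart c -` V"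
    using chart_facts(5,6)[OF assms(1)] by force
  then show ?thesis
    using continuous_open_preimage[OF chart_facts(4,2)[OF assms(1)] assms(2)] by (simp add: Int_commute)
qed

lemma transition: 
  "c \<in> A \<Longrightarrow> c' \<in> A \<Longrightarrow> smooth_on (snd c ` (fst c \<inter> fst c')) (snd c' \<circ> inv_chart c)"
  using smooth_structure by (simp add: smooth_structure_def compatible_def)

lemma transition_has_derivative:
  assumes "c \<in> A" "c' \<in> A" "p \<in> fst c" "p \<in> fst c'"
  shows "((snd c' \<circ> inv_chart c) has_derivative frechet_derivative (snd c' \<circ> inv_chart c) (at (snd c p))) (at (snd c p))"
  using smooth_on_has_derivative[OF transition[OF assms(1,2)]] assms by blast

text \<open>
  By the chain rule for transition maps, the differential is determined by a single chart.
\<close>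

lemma differential_coord_vec:
  assumes c: "c \<in> A" and S: "open S" "x \<in> S" "continuous_on S f" and fx: "f x \<in> fst c"
    and d: "(snd c \<circ> f) differentiable (at x)"
  shows "differential A f x h = coord_vec A c (f x) (frechet_derivative (snd c \<circ> f) (at x) h)"
proof
  fix c'
  let ?p = "f x"
  have p: "inv_chart c (snd c ?p) = ?p" by (rule chart_facts(5)[OF c fx])
  show "differential A f x h c' = coord_vec A c ?p (frechet_derivative (snd c \<circ> f) (at x) h) c'"
  proof (cases "c' \<in> A \<and> ?p \<in> fst c'")
    case True
    define W where "W = S \<inter> f -` (fst c \<inter> fst c')"
    have W: "open W" "x \<in> W"
      using continuous_open_preimage[OF S(3,1), of "fst c \<inter> fst c'"] chart_facts(1)[OF c] chart_facts(1)[of c'] True S(2) fx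
      by (auto simp: W_def)
    have "((snd c' \<circ> inv_chart c) \<circ> (snd c \<circ> f) has_derivative
        frechet_derivative (snd c' \<circ> inv_chart c) (at (snd c ?p)) \<circ> frechet_derivative (snd c \<circ> f) (at x)) (at x)"
      by (rule diff_chain_at) (use d transition_has_derivative[OF c _ fx, of c'] True frechet_derivative_works in auto)
    then have "(snd c' \<circ> f has_derivative
        frechet_derivative (snd c' \<circ> inv_chart c) (at (snd c ?p)) \<circ> frechet_derivative (snd c \<circ> f) (at x)) (at x)"
      by (rule has_derivative_transform_within_open[OF _ W]) (use chart_facts(5)[OF c] in \<open>auto simp: W_def\<close>)
    from frechet_derivative_at[OF this, symmetric] show ?thesis
      using True p by (simp add: differential_def coord_vec_def)
  next
    case False
    then show ?thesis using p by (auto simp: differential_def coord_vec_def)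
  qed
qed

context
  fixes c p
  assumes c: "c \<in> A" and p: "p \<in> fst c"
begin

lemma coord_vec_apply:
  "coord_vec A c p e c' = (if c' \<in> A \<and> p \<in> fst c' then frechet_derivative (snd c' \<circ> inv_chart c) (at (snd c p)) e else 0)"
  using chart_facts(5)[OF c p] by (simp add: coord_vec_def differential_def)

lemma coord_vec_self: "coord_vec A c p e c = e"
proof -
  have "((\<lambda>x. x) has_derivative (\<lambda>x. x)) (at (snd c p))" by simp
  then have "(snd c \<circ> inv_chart c has_derivative (\<lambda>x. x)) (at (snd c p))"
    by (rule has_derivative_transform_within_open[OF _ chart_facts(2)[OF c]]) (use chart_facts(6)[OF c] p in auto)
  from frechet_derivative_at[OF this, symmetric] show ?thesis
    using c p by (simp add: coord_vec_apply)
qed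

lemma linear_coord_vec: "c' \<in> A \<Longrightarrow> p \<in> fst c' \<Longrightarrow> linear (\<lambda>e. coord_vec A c p e c')"
  unfolding coord_vec_apply using has_derivative_linear[OF transition_has_derivative[OF c _ p]] by simp

lemma coord_vec_add: "coord_vec A c p (e + e') = (\<lambda>c'. coord_vec A c p e c' + coord_vec A c p e' c')"
proof
  fix c' show "coord_vec A c p (e + e') c' = coord_vec A c p e c' + coord_vec A c p e' c'"
    using linear_add[OF linear_coord_vec, of c' e e'] by (cases "c' \<in> A \<and> p \<in> fst c'") (auto simp: coord_vec_apply)
qed

lemma coord_vec_scaleR: "coord_vec A c p (a *\<^sub>R e) = (\<lambda>c'. a *\<^sub>R coord_vec A c p e c')"
proof
  fix c' show "coord_vec A c p (a *\<^sub>R e) c' = a *\<^sub>R coord_vec A c p e c'"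
    using linear_scale[OF linear_coord_vec, of c' a e] by (cases "c' \<in> A \<and> p \<in> fst c'") (auto simp: coord_vec_apply)
qed

lemma coord_vec_in_tangent_space: "coord_vec A c p e \<in> tangent_space A p"
  unfolding tangent_space_def mem_Collect_eq
proof (intro conjI ballI impI allI)
  fix c1 c2 assume A: "c1 \<in> A" "c2 \<in> A" "p \<in> fst c1" "p \<in> fst c2"
  define W where "W = snd c ` (fst c \<inter> (fst c1 \<inter> fst c2))"
  have W: "open W" "snd c p \<in> W"
    unfolding W_def using open_chart_image[OF c open_Int[OF chart_facts(1)[OF A(1)] chart_facts(1)[OF A(2)]]] A p by auto
  have e1: "(snd c1 \<circ> inv_chart c) (snd c p) = snd c1 p" using chart_facts(5)[OF c p] by simp
  have "((snd c2 \<circ> inv_chart c1) \<circ> (snd c1 \<circ> inv_chart c) has_derivative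
    frechet_derivative (snd c2 \<circ> inv_chart c1) (at (snd c1 p)) \<circ> frechet_derivative (snd c1 \<circ> inv_chart c) (at (snd c p))) (at (snd c p))"
    by (rule diff_chain_at[OF transition_has_derivative[OF c A(1) p A(3)]])
      (use transition_has_derivative[OF A(1,2) A(3,4)] e1 in simp)
  then have "(snd c2 \<circ> inv_chart c has_derivative
    frechet_derivative (snd c2 \<circ> inv_chart c1) (at (snd c1 p)) \<circ> frechet_derivative (snd c1 \<circ> inv_chart c) (at (snd c p))) (at (snd c p))"
    by (rule has_derivative_transform_within_open[OF _ W]) 
      (use chart_facts(5)[OF A(1)] chart_facts(5)[OF c] in \<open>auto simp: W_def\<close>)
  from frechet_derivative_at[OF this, symmetric]
  show "coord_vec A c p e c2 = frechet_derivative (snd c2 \<circ> inv_chart c1) (at (snd c1 p)) (coord_vec A c p e c1)"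
    using A by (simp add: coord_vec_apply)
qed (auto simp: coord_vec_apply)

lemma tangent_eq_coord_vec: 
  assumes "v \<in> tangent_space A p" shows "v = coord_vec A c p (v c)"
proof
  fix c'
  have 1: "\<forall>c\<in>A. \<forall>c'\<in>A. p \<in> fst c \<longrightarrow> p \<in> fst c' \<longrightarrow> 
        v c' = frechet_derivative (snd c' \<circ> inv_chart c) (at (snd c p)) (v c)"
    and 2: "\<forall>c. \<not> (c \<in> A \<and> p \<in> fst c) \<longrightarrow> v c = 0"
    using assms unfolding tangent_space_def by blast+
  show "v c' = coord_vec A c p (v c) c'"
    unfolding coord_vec_apply using 1[rule_format, OF c _ p, of c'] 2[rule_format, of c'] by presburger
qed

lemma coord_vec_zero_iff: "coord_vec A c p e = (\<lambda>_. 0) \<longleftrightarrow> e = 0"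
proof
  assume "coord_vec A c p e = (\<lambda>_. 0)"
  then show "e = 0" using coord_vec_self[of e] by simp
next
  assume "e = 0"
  then show "coord_vec A c p e = (\<lambda>_. 0)" using coord_vec_scaleR[of 0 e] by simp
qed

end

lemma Ck_map_inv_chart:
  assumes c: "c \<in> A" and S: "open S" and F: "Ck_on k S F" "F ` S \<subseteq> snd c ` fst c"
  shows "Ck_map A k S (inv_chart c \<circ> F)"
  unfolding Ck_map_def
proof (intro conjI ballI)
  show cont: "continuous_on S (inv_chart c \<circ> F)"
    by (rule continuous_on_compose[OF Ck_on_continuous[OF F(1)] continuous_on_subset[OF chart_facts(4)[OF c] F(2)]])
  fix c' assume c': "c' \<in> A"
  let ?S = "{x \<in> S. (inv_chart c \<circ> F) x \<in> fst c'}"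
  have o: "open ?S"
    using continuous_open_preimage[OF cont S chart_facts(1)[OF c']] by (simp add: vimage_def Int_def)
  have "Ck_on k ?S (\<lambda>x. (snd c' \<circ> inv_chart c) (F x))"
  proof (rule Ck_on_compose[OF o, where f=F and g="snd c' \<circ> inv_chart c"])
    show "open (snd c ` (fst c \<inter> fst c'))" by (rule open_chart_image[OF c chart_facts(1)[OF c']])
    show "F ` ?S \<subseteq> snd c ` (fst c \<inter> fst c')"
    proof
      fix y assume "y \<in> F ` ?S"
      then have y: "y \<in> snd c ` fst c" "inv_chart c y \<in> fst c'" using F(2) by auto
      then show "y \<in> snd c ` (fst c \<inter> fst c')"
        using chart_facts(6)[OF c y(1)] by (intro image_eqI[of _ _ "inv_chart c y"]) auto
    qed
    show "Ck_on k ?S F" by (rule Ck_on_subset[OF F(1)]) auto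
    show "Ck_on k (snd c ` (fst c \<inter> fst c')) (snd c' \<circ> inv_chart c)" by (rule smooth_onD[OF transition[OF c c']])
  qed
  then show "Ck_on k ?S (snd c' \<circ> (inv_chart c \<circ> F))" by (simp add: o_def)
qed

lemma differential_inv_chart:
  assumes c: "c \<in> A" and S: "open S" "x \<in> S" and F: "Ck_on (Suc k) S F" "F ` S \<subseteq> snd c ` fst c"
  shows "differential A (inv_chart c \<circ> F) x h = coord_vec A c (inv_chart c (F x)) (frechet_derivative F (at x) h)"
proof -
  have eq: "(snd c \<circ> (inv_chart c \<circ> F)) y = F y" if "y \<in> S" for y
    using F(2) chart_facts(6)[OF c, of "F y"] that by auto
  have cont: "continuous_on S (inv_chart c \<circ> F)"
    by (rule continuous_on_compose[OF Ck_on_continuous[OF F(1)] continuous_on_subset[OF chart_facts(4)[OF c] F(2)]])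
  have fx: "(inv_chart c \<circ> F) x \<in> fst c" using chart_facts(6)[OF c, of "F x"] F(2) S(2) by auto
  have "(F has_derivative frechet_derivative F (at x)) (at x)" by (rule Ck_on_has_derivative[OF F(1) S(2)])
  then have "(snd c \<circ> (inv_chart c \<circ> F) has_derivative frechet_derivative F (at x)) (at x)"
    by (rule has_derivative_transform_within_open[OF _ S]) (use eq in auto)
  then have d: "(snd c \<circ> (inv_chart c \<circ> F)) differentiable (at x)" by (auto simp: differentiable_def)
  show ?thesis
    using differential_coord_vec[OF c S cont fx d] frechet_derivative_transform[OF S eq] by simp
qed

end

section \<open>The half-disc map\<close>

definition cayley :: "complex \<Rightarrow> complex" where
  "cayley w = \<i> * (1 + w) / (1 - w)"

text \<open>
  The Cayley transform maps the unit disc onto the upper half plane, the square root maps this onto the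
  first quadrant, and the last transformation maps the quadrant onto the upper half of the unit disc.
  The lower half of the unit circle is mapped to the interval \<open>(-1, 1)\<close>.
\<close>

definition halfdisc :: "complex \<Rightarrow> complex" where
  "halfdisc w = (csqrt (cayley w) - 1) / (csqrt (cayley w) + 1)"

lemma cayley_Im: "w \<noteq> 1 \<Longrightarrow> Im (cayley w) = (1 - (cmod w)\<^sup>2) / (cmod (1 - w))\<^sup>2"
  and cayley_Re: "w \<noteq> 1 \<Longrightarrow> Re (cayley w) = - 2 * Im w / (cmod (1 - w))\<^sup>2"
  by (simp_all add: cayley_def Im_divide Re_divide cmod_power2)
    (simp_all add: power2_eq_square algebra_simps)

lemma quadrant_to_halfdisc:
  assumes "0 < Re q" "0 < Im q"
  shows "cmod ((q - 1) / (q + 1)) < 1" "0 < Im ((q - 1) / (q + 1))"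
proof -
  have q1: "q + 1 \<noteq> 0" using assms(1) by (auto simp: complex_eq_iff)
  have "(cmod (q - 1))\<^sup>2 < (cmod (q + 1))\<^sup>2"
    unfolding cmod_power2 using assms(1) by (simp add: power2_eq_square algebra_simps)
  then have "cmod (q - 1) < cmod (q + 1)" by (rule power2_less_imp_less) simp
  then show "cmod ((q - 1) / (q + 1)) < 1" using q1 by (simp add: norm_divide)
  have "Im ((q - 1) / (q + 1)) = 2 * Im q / (cmod (q + 1))\<^sup>2"
    by (simp add: Im_divide cmod_power2 algebra_simps)
  then show "0 < Im ((q - 1) / (q + 1))" using assms(2) q1 by simp
qed

lemma csqrt_upper:
  assumes "0 < Im z" shows "0 < Re (csqrt z)" "0 < Im (csqrt z)"
proof -
  define q where "q = csqrt z"
  have "q\<^sup>2 = z" by (simp add: q_def)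
  then have e: "2 * Re q * Im q = Im z" by (auto simp: power2_eq_square)
  moreover have "0 \<le> Re q" using csqrt_principal[of z] by (auto simp: q_def)
  ultimately have R: "0 < Re q" using assms by (cases "Re q = 0") auto
  from e assms have "0 < Re q * Im q" by linarith
  with R show "0 < Re (csqrt z)" "0 < Im (csqrt z)" unfolding q_def[symmetric] by (simp_all add: zero_less_mult_iff)
qed

lemma cayley_deriv:
  assumes "w \<noteq> 1" shows "(cayley has_field_derivative 2 * \<i> / (1 - w)\<^sup>2) (at w)"
  unfolding cayley_def[abs_def]
  by (rule derivative_eq_intros refl | use assms in \<open>simp add: power2_eq_square field_simps\<close>)+

lemma halfdisc_deriv:
  assumes w: "w \<noteq> 1" and c: "cayley w \<notin> \<real>\<^sub>\<le>\<^sub>0"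
  shows "(halfdisc has_field_derivative
     2 * \<i> / (1 - w)\<^sup>2 / (csqrt (cayley w) * (csqrt (cayley w) + 1)\<^sup>2)) (at w)"
proof -
  let ?q = "csqrt (cayley w)"
  have q: "0 < Re ?q"
  proof -
    have "cayley w \<noteq> 0" using c by auto
    then have "?q \<noteq> 0" by simp
    moreover have "Re ?q \<noteq> 0"
    proof
      assume "Re ?q = 0"
      then have "?q ^ 2 = - (of_real ((Im ?q)^2))" by (simp add: complex_eq_iff power2_eq_square)
      then have "cayley w = of_real (- ((Im ?q)^2))" by simp
      then have "cayley w \<in> \<real>\<^sub>\<le>\<^sub>0" by (metis neg_le_0_iff_le nonpos_Reals_of_real_iff zero_le_power2)
      with c show False by simp
    qed
    ultimately show ?thesis using csqrt_principal[of "cayley w"] by auto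
  qed
  then have q0: "?q \<noteq> 0" "?q + 1 \<noteq> 0"
    by (auto simp del: csqrt.simps simp: complex_eq_iff[of _ 0])
  have "((\<lambda>w. csqrt (cayley w)) has_field_derivative inverse (2 * ?q) * (2 * \<i> / (1 - w)\<^sup>2)) (at w)"
    by (rule DERIV_chain2[OF has_field_derivative_csqrt[OF c] cayley_deriv[OF w]])
  note d = this
  have "((\<lambda>w. (csqrt (cayley w) - 1) / (csqrt (cayley w) + 1)) has_field_derivative
     ((inverse (2 * ?q) * (2 * \<i> / (1 - w)\<^sup>2) - 0) * (?q + 1) - (?q - 1) * (inverse (2 * ?q) * (2 * \<i> / (1 - w)\<^sup>2) + 0)) / ((?q + 1) * (?q + 1))) (at w)"
    by (intro DERIV_divide DERIV_diff DERIV_add d DERIV_const q0)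
  moreover have "((inverse (2 * ?q) * (2 * \<i> / (1 - w)\<^sup>2) - 0) * (?q + 1) - (?q - 1) * (inverse (2 * ?q) * (2 * \<i> / (1 - w)\<^sup>2) + 0)) / ((?q + 1) * (?q + 1))
     = 2 * \<i> / (1 - w)\<^sup>2 / (?q * (?q + 1)\<^sup>2)"
  proof -
    have "(inverse (2 * q) * D - 0) * (q + 1) - (q - 1) * (inverse (2 * q) * D + 0) = D / q" if "q \<noteq> 0" for q D :: complex
      using that by (simp add: field_simps)
    note e = this[OF q0(1)]
    show ?thesis unfolding e by (simp add: power2_eq_square)
  qed
  ultimately show ?thesis by (simp add: halfdisc_def[abs_def])
qed

lemma halfdisc_interior:
  assumes "cmod w < 1"
  shows "cmod (halfdisc w) < 1" "0 < Im (halfdisc w)" "w \<noteq> 1" "cayley w \<notin> \<real>\<^sub>\<le>\<^sub>0"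
proof -
  show w: "w \<noteq> 1" using assms by auto
  have "(cmod w)\<^sup>2 < 1" using assms by (simp add: abs_square_less_1)
  then have I: "0 < Im (cayley w)" using w by (simp add: cayley_Im)
  show "cmod (halfdisc w) < 1" "0 < Im (halfdisc w)"
    unfolding halfdisc_def using quadrant_to_halfdisc csqrt_upper[OF I] by auto
  show "cayley w \<notin> \<real>\<^sub>\<le>\<^sub>0" using I by (auto simp: complex_nonpos_Reals_iff)
qed

lemma halfdisc_0: "Re (halfdisc 0) = 0"
proof -
  define q where "q = csqrt \<i>"
  have "q\<^sup>2 = \<i>" unfolding q_def by (rule power2_csqrt)
  then have n: "(cmod q)\<^sup>2 = 1" by (simp flip: norm_power)
  have "Re ((q - 1) / (q + 1)) = ((cmod q)\<^sup>2 - 1) / (cmod (q + 1))\<^sup>2"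
    unfolding Re_divide cmod_power2 by (simp add: power2_eq_square algebra_simps)
  then have "Re ((q - 1) / (q + 1)) = 0" by (simp add: n)
  then show ?thesis unfolding halfdisc_def cayley_def q_def by simp
qed

lemma cayley_circle:
  assumes "\<theta> \<in> {pi<..<2*pi}"
  shows "cis \<theta> \<noteq> 1" "cayley (cis \<theta>) \<in> \<real>" "0 < Re (cayley (cis \<theta>))"
proof -
  have s: "sin \<theta> < 0" using assms sin_lt_zero by auto
  then show w: "cis \<theta> \<noteq> 1" by (auto simp: complex_eq_iff)
  show "cayley (cis \<theta>) \<in> \<real>" by (simp add: complex_is_Real_iff cayley_Im[OF w])
  have "0 < (cmod (1 - cis \<theta>))\<^sup>2" using w by simp
  then show "0 < Re (cayley (cis \<theta>))" unfolding cayley_Re[OF w] using s by (simp add: divide_neg_pos)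
qed

definition edge :: "real \<Rightarrow> real" where
  "edge \<theta> = Re (halfdisc (cis \<theta>))"

lemma halfdisc_edge:
  assumes \<theta>: "\<theta> \<in> {pi<..<2*pi}"
  defines "q \<equiv> sqrt (Re (cayley (cis \<theta>)))"
  shows "halfdisc (cis \<theta>) = of_real (edge \<theta>)" "edge \<theta> = (q - 1) / (q + 1)" "0 < q" "\<bar>edge \<theta>\<bar> < 1"
    "csqrt (cayley (cis \<theta>)) = of_real q"
proof -
  note c = cayley_circle[OF \<theta>]
  have cr: "cayley (cis \<theta>) = of_real (Re (cayley (cis \<theta>)))" using c(2) by simp
  show q: "0 < q" using c(3) by (simp add: q_def)
  show cs: "csqrt (cayley (cis \<theta>)) = of_real q"
    unfolding q_def using c(3) by (subst cr) (simp add: csqrt_of_real_nonneg)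
  have h: "halfdisc (cis \<theta>) = of_real ((q - 1) / (q + 1))" by (simp add: halfdisc_def cs)
  then show e: "edge \<theta> = (q - 1) / (q + 1)" by (simp add: edge_def)
  show "halfdisc (cis \<theta>) = of_real (edge \<theta>)" by (simp add: h e)
  show "\<bar>edge \<theta>\<bar> < 1" unfolding e using q by (simp add: abs_if field_simps)
qed

lemma inj_on_edge: "inj_on edge {pi<..<2*pi}"
proof (rule inj_onI)
  fix s t assume st: "s \<in> {pi<..<2*pi}" "t \<in> {pi<..<2*pi}" and e: "edge s = edge t"
  let ?q = "\<lambda>\<theta>. sqrt (Re (cayley (cis \<theta>)))"
  have qs: "0 < ?q s" "0 < ?q t" using halfdisc_edge(3) st by blast+
  have "?q s = ?q t"
    using e qs unfolding halfdisc_edge(2)[OF st(1)] halfdisc_edge(2)[OF st(2)] by (simp add: field_simps)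
  then have "Re (cayley (cis s)) = Re (cayley (cis t))" by simp
  then have "cayley (cis s) = cayley (cis t)"
    using cayley_circle(2)[OF st(1)] cayley_circle(2)[OF st(2)] by (simp add: complex_eq_iff complex_is_Real_iff)
  then have "\<i> * (1 + cis s) * (1 - cis t) = \<i> * (1 + cis t) * (1 - cis s)"
    using cayley_circle(1)[OF st(1)] cayley_circle(1)[OF st(2)] by (simp add: cayley_def field_simps)
  then have "cis s = cis t" by (simp add: algebra_simps)
  moreover have "Arg2pi (cis x) = x" if "x \<in> {pi<..<2*pi}" for x
    using that pi_gt_zero by (intro Arg2pi_unique[of 1]) (auto simp: cis_conv_exp)
  ultimately show "s = t" using st by metis
qed

lemma eventually_at_left_if:
  "eventually P (at x) \<Longrightarrow> eventually P (at_left (x::real))"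
  by (simp add: eventually_at_split)

text \<open>
  The map is conformal at the points of the lower half circle, so the image of a radius meets the real
  axis orthogonally: for \<open>s\<close> close to 1 the image point is \<open>edge \<theta> + \<i> \<kappa> (1 - s)\<close>, with some speed \<open>\<kappa> > 0\<close>,
  up to an error of \<open>\<kappa> (1 - s) / 2\<close>.
\<close>

lemma halfdisc_radial:
  assumes \<theta>: "\<theta> \<in> {pi<..<2*pi}"
  shows "\<forall>\<^sub>F s in at_left 1. cmod (halfdisc (of_real s * cis \<theta>) - of_real (edge \<theta>)) \<le> 3 * Im (halfdisc (of_real s * cis \<theta>))"
    and "((\<lambda>s. halfdisc (of_real s * cis \<theta>)) \<longlongrightarrow> of_real (edge \<theta>)) (at_left 1)"
proof -
  note c = cayley_circle[OF \<theta>] and h = halfdisc_edge[OF \<theta>]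
  define q where "q = sqrt (Re (cayley (cis \<theta>)))"
  have q: "0 < q" "csqrt (cayley (cis \<theta>)) = of_real q" unfolding q_def by (rule h(3) h(5))+
  \<comment> \<open>The speed at which the image of the radius arrives at the real axis.\<close>
  define \<kappa> where "\<kappa> = 1 / ((1 - cos \<theta>) * (q * (q + 1)\<^sup>2))"
  have cos1: "cos \<theta> < 1"
  proof -
    have "sin \<theta> \<noteq> 0" using sin_lt_zero \<theta> by (metis greaterThanLessThan_iff less_irrefl)
    then have "cos \<theta> \<noteq> 1" using sin_cos_squared_add[of \<theta>] by (metis add_cancel_left_left one_power2 power_eq_0_iff)
    then show ?thesis using cos_le_one[of \<theta>] by linarith
  qed
  have \<kappa>: "0 < \<kappa>" unfolding \<kappa>_def using cos1 q by simp
  have np: "cayley (cis \<theta>) \<notin> \<real>\<^sub>\<le>\<^sub>0" using c(3) by (auto simp: complex_nonpos_Reals_iff)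
  have d0: "cis \<theta> * (2 * \<i> / (1 - cis \<theta>)\<^sup>2) = - \<i> / of_real (1 - cos \<theta>)"
  proof -
    have "(1 - cis \<theta>)\<^sup>2 = - 2 * of_real (1 - cos \<theta>) * cis \<theta>"
      by (simp add: complex_eq_iff power2_eq_square algebra_simps)
    moreover have "cis \<theta> \<noteq> 0" by simp
    moreover have "of_real (1 - cos \<theta>) \<noteq> (0::complex)" using cos1 by simp
    moreover have "c * (2 * \<i> / (- 2 * a * c)) = - \<i> / a" if "c \<noteq> 0" "a \<noteq> 0" for a c :: complex
      using that by (simp add: field_simps)
    ultimately show ?thesis by metis
  qed
  have "((\<lambda>s. halfdisc (of_real s * cis \<theta>)) has_vector_derivative
     cis \<theta> * (2 * \<i> / (1 - cis \<theta>)\<^sup>2 / (of_real q * (of_real q + 1)\<^sup>2))) (at 1)"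
  proof (rule has_vector_derivative_real_field)
    have 1: "((\<lambda>z. z * cis \<theta>) has_field_derivative cis \<theta>) (at (of_real 1))"
      by (auto intro!: derivative_eq_intros)
    have 2: "(halfdisc has_field_derivative 2 * \<i> / (1 - cis \<theta>)\<^sup>2 / (of_real q * (of_real q + 1)\<^sup>2)) (at (of_real 1 * cis \<theta>))"
      using halfdisc_deriv[OF c(1) np] by (simp add: q)
    show "((\<lambda>z. halfdisc (z * cis \<theta>)) has_field_derivative cis \<theta> * (2 * \<i> / (1 - cis \<theta>)\<^sup>2 / (of_real q * (of_real q + 1)\<^sup>2))) (at (of_real 1))"
      by (subst mult.commute[of "cis \<theta>"]) (rule DERIV_chain2[OF 2 1])
  qed
  also have "cis \<theta> * (2 * \<i> / (1 - cis \<theta>)\<^sup>2 / (of_real q * (of_real q + 1)\<^sup>2)) = - \<i> * of_real \<kappa>"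
  proof -
    have "cis \<theta> * (2 * \<i> / (1 - cis \<theta>)\<^sup>2 / (of_real q * (of_real q + 1)\<^sup>2)) 
      = (cis \<theta> * (2 * \<i> / (1 - cis \<theta>)\<^sup>2)) / (of_real q * (of_real q + 1)\<^sup>2)" by simp
    also have "\<dots> = - \<i> * of_real \<kappa>" unfolding d0 by (simp add: \<kappa>_def)
    finally show ?thesis .
  qed
  finally have d: "((\<lambda>s. halfdisc (of_real s * cis \<theta>)) has_vector_derivative - \<i> * of_real \<kappa>) (at 1)" .
  have lim: "((\<lambda>s. halfdisc (of_real s * cis \<theta>)) \<longlongrightarrow> halfdisc (of_real 1 * cis \<theta>)) (at 1)"
    using has_vector_derivative_continuous[OF d] by (simp add: isCont_def)
  then show "((\<lambda>s. halfdisc (of_real s * cis \<theta>)) \<longlongrightarrow> of_real (edge \<theta>)) (at_left 1)"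
    using h(1) by (auto intro: tendsto_mono[OF at_le])
  have "\<forall>\<^sub>F s in at 1. cmod (halfdisc (of_real s * cis \<theta>) - halfdisc (of_real 1 * cis \<theta>) - (s - 1) *\<^sub>R (- \<i> * of_real \<kappa>)) \<le> \<kappa> / 2 * norm (s - 1)"
    using d[unfolded has_vector_derivative_def has_derivative_within_alt2, THEN conjunct2, rule_format, of "\<kappa> / 2"] \<kappa> by simp
  then have "\<forall>\<^sub>F s in at_left 1. cmod (halfdisc (of_real s * cis \<theta>) - of_real (edge \<theta>) - of_real (1 - s) * (\<i> * of_real \<kappa>)) \<le> \<kappa> / 2 * norm (s - 1)"
  proof (rule eventually_mono[OF eventually_at_left_if])
    fix s assume "cmod (halfdisc (of_real s * cis \<theta>) - halfdisc (of_real 1 * cis \<theta>) - (s - 1) *\<^sub>R (- \<i> * of_real \<kappa>)) \<le> \<kappa> / 2 * norm (s - 1)"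
    then show "cmod (halfdisc (of_real s * cis \<theta>) - of_real (edge \<theta>) - of_real (1 - s) * (\<i> * of_real \<kappa>)) \<le> \<kappa> / 2 * norm (s - 1)"
      using h(1) by (simp add: scaleR_conv_of_real algebra_simps)
  qed
  moreover have "\<forall>\<^sub>F s in at_left (1::real). s < 1" by (simp add: eventually_at_filter)
  ultimately show "\<forall>\<^sub>F s in at_left 1. cmod (halfdisc (of_real s * cis \<theta>) - of_real (edge \<theta>)) \<le> 3 * Im (halfdisc (of_real s * cis \<theta>))"
  proof eventually_elim
    case (elim s)
    let ?z = "halfdisc (of_real s * cis \<theta>)" and ?t = "\<kappa> * (1 - s)"
    let ?e = "?z - of_real (edge \<theta>) - of_real (1 - s) * (\<i> * of_real \<kappa>)"
    have t: "0 < ?t" using elim \<kappa> by simp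
    have e: "cmod ?e \<le> ?t / 2" using elim by (simp add: abs_if mult.commute)
    have "- Im ?e \<le> ?t / 2" using e abs_Im_le_cmod[of ?e] by linarith
    moreover have "Im ?e = Im ?z - ?t" by (simp add: mult.commute)
    ultimately have I: "?t / 2 \<le> Im ?z" by linarith
    have "?z - of_real (edge \<theta>) = ?e + of_real (1 - s) * (\<i> * of_real \<kappa>)" by simp
    then have "cmod (?z - of_real (edge \<theta>)) \<le> cmod ?e + cmod (of_real (1 - s) * (\<i> * of_real \<kappa>))"
      using norm_triangle_ineq by metis
    also have "cmod (of_real (1 - s) * (\<i> * of_real \<kappa>)) = ?t"
      using elim \<kappa> by (simp add: norm_mult del: of_real_diff)
    finally show ?case using e I by linarith
  qed
qed

section \<open>Subharmonic functions with small radial boundary values\<close>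

lemma usc_circle_measurable:
  assumes usc: "usc_on (ball 0 1) v" and r: "0 \<le> r" "r < 1"
  shows "(\<lambda>\<theta>. v (0 + of_real r * cis \<theta>)) \<in> borel_measurable (restrict_space lborel X)"
proof -
  have "(\<lambda>\<theta>. v (0 + of_real r * cis \<theta>)) \<in> borel_measurable borel"
  proof (rule borel_measurableI_less)
    fix a
    obtain T where T: "open T" "{x \<in> ball 0 1. v x < a} = ball 0 1 \<inter> T"
      using usc unfolding usc_on_def openin_open by blast
    have "{\<theta> \<in> space borel. v (0 + of_real r * cis \<theta>) < a} = (\<lambda>\<theta>. of_real r * cis \<theta>) -` (ball 0 1 \<inter> T)"
      using r by (auto simp: T(2)[symmetric] norm_mult)
    moreover have "open ((\<lambda>\<theta>. of_real r * cis \<theta> :: complex) -` (ball 0 1 \<inter> T))"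
      by (intro open_vimage open_Int open_ball T continuous_intros)
    ultimately show "{\<theta> \<in> space borel. v (0 + of_real r * cis \<theta>) < a} \<in> sets borel" by simp
  qed
  then have "(\<lambda>\<theta>. v (0 + of_real r * cis \<theta>)) \<in> borel_measurable lborel" by simp
  then show ?thesis by (rule measurable_restrict_space1)
qed

text \<open>
  The mean values of \<open>v\<close> over circles of radius tending to 1 bound \<open>v 0\<close> from above. Fatou's lemma for the
  negative parts shows that the lower half circle, half of the total length, contributes at most
  \<open>- N / 2\<close> in the limit.
\<close>

lemma subharmonic_radial_bound:
  assumes sh: "subharmonic_on (ball 0 1) v" and B: "\<And>w. w \<in> ball 0 1 \<Longrightarrow> v w \<le> ereal B" and B0: "0 \<le> B"
    and N: "0 < N" and X: "finite X"
    and rad: "\<And>\<theta>. \<theta> \<in> {pi<..<2*pi} - X \<Longrightarrow> \<forall>\<^sub>F s in at_left 1. v (of_real s * cis \<theta>) \<le> ereal (- N)"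
  shows "v 0 \<le> ereal (B - N / 2)"
proof (rule ccontr)
  assume "\<not> v 0 \<le> ereal (B - N / 2)"
  then have gt: "ereal (B - N / 2) < v 0" by simp
  have "v 0 \<noteq> \<infinity>" using sh by (auto simp: subharmonic_on_def)
  then obtain x where x: "v 0 = ereal x" "B - N / 2 < x" using gt by (cases "v 0") auto
  define M where "M = restrict_space lborel {0..2 * pi}"
  define r where "r n = 1 - 1 / (real n + 2)" for n
  have r: "0 < r n" "r n < 1" for n by (auto simp: r_def field_simps)
  let ?v = "\<lambda>n \<theta>. v (0 + of_real (r n) * cis \<theta>)"
  \<comment> \<open>The negative part is what Fatou's lemma applies to; the positive part is at most \<open>B\<close>.\<close>
  define Q where "Q n = (\<integral>\<^sup>+ \<theta>. e2ennreal (- ?v n \<theta>) \<partial>M)" for n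
  have em: "emeasure M (space M) = ennreal (2 * pi)"
    by (simp add: M_def emeasure_restrict_space space_restrict_space)
  have Qle: "Q n \<le> ennreal (2 * pi * (B - x))" for n
  proof -
    let ?P = "\<integral>\<^sup>+ \<theta>. e2ennreal (?v n \<theta>) \<partial>M"
    have inb: "0 + of_real (r n) * cis \<theta> \<in> ball 0 1" for \<theta> using r[of n] by (simp add: norm_mult)
    have "?P \<le> (\<integral>\<^sup>+ \<theta>. ennreal B \<partial>M)"
      using B[OF inb] by (intro nn_integral_mono) (metis e2ennreal_ereal e2ennreal_mono)
    also have "\<dots> = ennreal (2 * pi * B)"
      using em B0 by (simp add: ennreal_mult mult.commute)
    finally have P: "enn2ereal ?P \<le> ereal (2 * pi * B)"
      using B0 by (simp add: enn2ereal_ennreal less_eq_ennreal.rep_eq)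
    have "v 0 \<le> circle_mean v 0 (r n)"
    proof -
      have "cball 0 (r n) \<subseteq> ball (0::complex) 1" using r[of n] by auto
      then show ?thesis using sh r[of n] by (simp add: subharmonic_on_def)
    qed
    also have "\<dots> = ereal (1 / (2 * pi)) * (enn2ereal ?P - enn2ereal (Q n))"
      by (simp add: circle_mean_def ereal_integral_def M_def Q_def)
    also have "\<dots> \<le> ereal (1 / (2 * pi)) * (ereal (2 * pi * B) - enn2ereal (Q n))"
      by (intro ereal_mult_left_mono ereal_minus_mono P) auto
    finally have le: "ereal x \<le> ereal (1 / (2 * pi)) * (ereal (2 * pi * B) - enn2ereal (Q n))" by (simp add: x)
    show ?thesis
    proof (cases "Q n")
      case (real t)
      then have "x \<le> (1 / (2 * pi)) * (2 * pi * B - t)" using le by (simp add: enn2ereal_ennreal)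
      then have "t \<le> 2 * pi * (B - x)" by (simp add: field_simps)
      then show ?thesis using real by (simp add: ennreal_leI)
    next
      case top
      then show ?thesis using le by (simp add: enn2ereal_top)
    qed
  qed
  have meas: "(\<lambda>\<theta>. e2ennreal (- ?v n \<theta>)) \<in> borel_measurable M" for n
    unfolding M_def
    by (rule measurable_compose[OF borel_measurable_uminus_ereal[OF usc_circle_measurable] measurable_e2ennreal])
      (use sh r[of n] in \<open>auto simp: subharmonic_on_def\<close>)
  have rlim: "filterlim r (at_left 1) sequentially"
  proof (rule tendsto_imp_filterlim_at_left)
    show "r \<longlonglongrightarrow> 1" unfolding r_def by real_asymp
  qed (use r in auto)
  have lim: "ennreal N \<le> liminf (\<lambda>n. e2ennreal (- ?v n \<theta>))" if "\<theta> \<in> {pi<..<2*pi} - X" for \<theta>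
  proof (rule Liminf_bounded)
    have "\<forall>\<^sub>F n in sequentially. v (of_real (r n) * cis \<theta>) \<le> ereal (- N)"
      using rad[OF that] rlim by (rule eventually_compose_filterlim)
    then show "\<forall>\<^sub>F n in sequentially. ennreal N \<le> e2ennreal (- ?v n \<theta>)"
    proof eventually_elim
      case (elim n)
      then have "ereal N \<le> - ?v n \<theta>" by (cases "?v n \<theta>") auto
      then show ?case by (metis e2ennreal_ereal e2ennreal_mono)
    qed
  qed
  have "ennreal (pi * N) = (\<integral>\<^sup>+ \<theta>. ennreal N * indicator ({pi<..<2*pi} - X) \<theta> \<partial>M)"
  proof -
    have s: "{pi<..<2*pi} - X \<in> sets M"
    proof -
      have "{pi<..<2*pi} - X \<in> sets borel"
        by (intro borel_open open_Diff open_greaterThanLessThan finite_imp_closed X)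
      then show ?thesis by (auto simp: M_def sets_restrict_space intro!: image_eqI[of _ _ "{pi<..<2*pi} - X"])
    qed
    have "emeasure M ({pi<..<2*pi} - X) = emeasure lborel ({pi<..<2*pi} - X)"
      unfolding M_def using X by (intro emeasure_restrict_space) auto
    also have "\<dots> = emeasure lborel {pi<..<2*pi}"
      by (intro emeasure_Diff_null_set countable_imp_null_set_lborel countable_finite X) auto
    finally have "emeasure M ({pi<..<2*pi} - X) = ennreal pi" by simp
    then show ?thesis using s N by (simp add: nn_integral_cmult_indicator ennreal_mult mult.commute)
  qed
  also have "\<dots> \<le> (\<integral>\<^sup>+ \<theta>. liminf (\<lambda>n. e2ennreal (- ?v n \<theta>)) \<partial>M)"
    using lim by (intro nn_integral_mono) (auto simp: indicator_def)
  also have "\<dots> \<le> liminf Q"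
    unfolding Q_def by (rule nn_integral_liminf[OF meas])
  also have "\<dots> \<le> ennreal (2 * pi * (B - x))"
    by (rule Liminf_le) (use Qle in auto)
  finally have "pi * N \<le> 2 * pi * (B - x) \<or> pi * N \<le> 0"
    by (cases "0 \<le> 2 * pi * (B - x)") (auto simp: ennreal_neg)
  then show False
  proof
    assume "pi * N \<le> 2 * pi * (B - x)"
    then have "N \<le> 2 * (B - x)" by (simp add: mult.assoc)
    then show False using x(2) by simp
  next
    assume "pi * N \<le> 0"
    then show False using N mult_pos_pos[OF pi_gt_zero N] by linarith
  qed
qed

section \<open>Riemannian distance in a chart\<close>

text \<open>
  If the speed is not integrable, the right-hand side is infinite; otherwise this is the fundamental
  theorem of calculus.
\<close>

lemma norm_increment_le_nn_integral:
  fixes f :: "real \<Rightarrow> 'a::euclidean_space"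
  assumes T: "0 \<le> T" and F: "finite F" and cont: "continuous_on {0..T} f"
    and der: "\<And>t. t \<in> {0<..<T} - F \<Longrightarrow> (f has_vector_derivative f' t) (at t)"
    and cont': "continuous_on ({0<..<T} - F) f'"
  shows "ennreal (norm (f T - f 0)) \<le> (\<integral>\<^sup>+ t\<in>{0<..<T} - F. ennreal (norm (f' t)) \<partial>lborel)"
proof -
  let ?S = "{0<..<T} - F"
  have S: "open ?S" "?S \<in> sets lborel"
    using F by (auto intro!: open_Diff finite_imp_closed borel_open)
  have m: "(\<lambda>t. indicator ?S t *\<^sub>R f' t) \<in> borel_measurable lborel"
    using borel_measurable_continuous_on_indicator[OF _ cont'] S(1) by simp
  have nn: "(\<integral>\<^sup>+ t\<in>?S. ennreal (norm (f' t)) \<partial>lborel) = (\<integral>\<^sup>+ t. ennreal (norm (indicator ?S t *\<^sub>R f' t)) \<partial>lborel)"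
    by (intro nn_integral_cong) (auto simp: indicator_def)
  show ?thesis
  proof (cases "(\<integral>\<^sup>+ t. ennreal (norm (indicator ?S t *\<^sub>R f' t)) \<partial>lborel) = \<infinity>")
    case True
    then show ?thesis by (simp add: nn)
  next
    case False
    then have i: "integrable lborel (\<lambda>t. indicator ?S t *\<^sub>R f' t)"
      by (intro integrableI_bounded m) (simp add: less_top)
    then have si: "set_integrable lborel ?S f'" by (simp add: set_integrable_def)
    have "(f' has_integral f T - f 0) {0..T}"
      by (rule fundamental_theorem_of_calculus_interior_strong[OF F T _ cont]) (use der in auto)
    then have "(f' has_integral f T - f 0) ?S"
    proof (rule has_integral_spike_set_eq[THEN iffD1, rotated 2])
      have fin: "finite (F \<union> {0, T})" using F by simp
      show "negligible {x \<in> {0..T} - ?S. f' x \<noteq> 0}" "negligible {x \<in> ?S - {0..T}. f' x \<noteq> 0}"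
        by (rule negligible_subset[OF negligible_finite[OF fin]], auto)+
    qed
    then have "f T - f 0 = (LINT t|lborel. indicator ?S t *\<^sub>R f' t)"
      using set_borel_integral_eq_integral(2)[OF si] by (simp add: integral_unique set_lebesgue_integral_def)
    then have "norm (f T - f 0) \<le> (LINT t|lborel. norm (indicator ?S t *\<^sub>R f' t))"
      using integral_norm_bound by metis
    then have "ennreal (norm (f T - f 0)) \<le> ennreal (LINT t|lborel. norm (indicator ?S t *\<^sub>R f' t))"
      by (rule ennreal_leI)
    also have "\<dots> = (\<integral>\<^sup>+ t. ennreal (norm (indicator ?S t *\<^sub>R f' t)) \<partial>lborel)"
      by (rule nn_integral_eq_integral[symmetric]) (use integrable_norm[OF i] in auto)
    finally show ?thesis by (simp add: nn)
  qed
qed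

locale riemannian_manifold = smooth_manifold A
  for A :: "('m::{t2_space,second_countable_topology}, 'e::euclidean_space) chart set" +
  fixes g
  assumes metric: "riemannian_metric A g"
begin

definition chart_metric where
  "chart_metric c x e e' = g (inv_chart c x) (coord_vec A c (inv_chart c x) e) (coord_vec A c (inv_chart c x) e')"

lemma chart_metric_algebra:
  assumes c: "c \<in> A" and x: "x \<in> snd c ` fst c"
  shows "chart_metric c x (a *\<^sub>R e) e' = a * chart_metric c x e e'" "chart_metric c x (e + e'') e' = chart_metric c x e e' + chart_metric c x e'' e'"
    "chart_metric c x e e' = chart_metric c x e' e" "e \<noteq> 0 \<Longrightarrow> 0 < chart_metric c x e e"
proof -
  let ?p = "inv_chart c x"
  have p: "?p \<in> fst c" using chart_facts(6)[OF c x] by simp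
  note t = coord_vec_in_tangent_space[OF c p]
  show "chart_metric c x (a *\<^sub>R e) e' = a * chart_metric c x e e'" "chart_metric c x (e + e'') e' = chart_metric c x e e' + chart_metric c x e'' e'"
    "chart_metric c x e e' = chart_metric c x e' e"
    using metric t unfolding riemannian_metric_def chart_metric_def
    by (simp_all only: coord_vec_scaleR[OF c p] coord_vec_add[OF c p])
  show "0 < chart_metric c x e e" if "e \<noteq> 0"
    using metric t[of e] that coord_vec_zero_iff[OF c p, of e] unfolding riemannian_metric_def chart_metric_def by blast
qed

lemma chart_metric_expand:
  assumes c: "c \<in> A" and x: "x \<in> snd c ` fst c"
  shows "chart_metric c x e e = (\<Sum>i\<in>Basis. \<Sum>j\<in>Basis. (e \<bullet> i) * (e \<bullet> j) * chart_metric c x i j)"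
proof -
  note a = chart_metric_algebra[OF c x]
  have l: "linear (\<lambda>e. chart_metric c x e e')" for e' by (intro linearI) (simp_all add: a(1,2))
  have l': "chart_metric c x e e' = (\<Sum>i\<in>Basis. (e \<bullet> i) * chart_metric c x i e')" for e e'
  proof -
    have "chart_metric c x e e' = chart_metric c x (\<Sum>i\<in>Basis. (e \<bullet> i) *\<^sub>R i) e'" by (simp only: euclidean_representation)
    then show ?thesis by (simp only: linear_sum[OF l] linear_scale[OF l]) simp
  qed
  have "chart_metric c x e e = (\<Sum>i\<in>Basis. (e \<bullet> i) * chart_metric c x e i)"
    by (subst l') (simp only: a(3)[of _ e])
  also have "\<dots> = (\<Sum>i\<in>Basis. (e \<bullet> i) * (\<Sum>j\<in>Basis. (e \<bullet> j) * chart_metric c x i j))"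
    by (subst l') (simp only: a(3))
  finally show ?thesis by (simp add: sum_distrib_left mult.assoc)
qed

lemma chart_metric_continuous: "c \<in> A \<Longrightarrow> continuous_on (snd c ` fst c) (\<lambda>x. chart_metric c x e e')"
  using metric smooth_onD[THEN Ck_on_continuous] unfolding riemannian_metric_def chart_metric_def by blast

text \<open>
  By homogeneity the quadratic form of the metric only has to be bounded on \<open>K\<close> times the unit sphere,
  which is compact.
\<close>

lemma metric_bounds:
  assumes c: "c \<in> A" and K: "compact K" "K \<subseteq> snd c ` fst c"
  obtains m M where "0 < m" "0 < M" "\<And>x e. x \<in> K \<Longrightarrow> m * norm e \<le> sqrt (chart_metric c x e e)"
    "\<And>x e. x \<in> K \<Longrightarrow> sqrt (chart_metric c x e e) \<le> M * norm e"
proof (cases "K = {}")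
  case True
  then show ?thesis using that[of 1 1] by auto
next
  case False
  let ?P = "K \<times> sphere (0::'e) 1"
  let ?h = "\<lambda>z. chart_metric c (fst z) (snd z) (snd z)"
  have P: "compact ?P" "?P \<noteq> {}" using K False by (auto intro: compact_Times)
  have "continuous_on ?P (\<lambda>z. \<Sum>i\<in>Basis. \<Sum>j\<in>Basis. (snd z \<bullet> i) * (snd z \<bullet> j) * chart_metric c (fst z) i j)"
    by (intro continuous_intros continuous_on_compose2[OF chart_metric_continuous[OF c]]) (use K in auto)
  then have ch: "continuous_on ?P ?h"
    by (rule continuous_on_eq) (use K chart_metric_expand[OF c] in auto)
  obtain z1 where z1: "z1 \<in> ?P" "\<And>z. z \<in> ?P \<Longrightarrow> ?h z1 \<le> ?h z"
    using continuous_attains_inf[OF P ch] by auto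
  obtain z2 where z2: "z2 \<in> ?P" "\<And>z. z \<in> ?P \<Longrightarrow> ?h z \<le> ?h z2"
    using continuous_attains_sup[OF P ch] by auto
  have pos: "0 < ?h z" if "z \<in> ?P" for z
  proof (rule chart_metric_algebra(4)[OF c])
    show "snd z \<noteq> 0" using that by (auto dest: arg_cong[where f=norm])
  qed (use that K in auto)
  have sc: "chart_metric c x e e = (norm e)\<^sup>2 * chart_metric c x (e /\<^sub>R norm e) (e /\<^sub>R norm e)" if "x \<in> K" "e \<noteq> 0" for x e
  proof -
    have x: "x \<in> snd c ` fst c" using that K by auto
    note a = chart_metric_algebra[OF c x]
    have "chart_metric c x (e /\<^sub>R norm e) (e /\<^sub>R norm e) = inverse (norm e) * (inverse (norm e) * chart_metric c x e e)"
      unfolding a(1) a(3)[of e "e /\<^sub>R norm e"] ..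
    then show ?thesis using that(2) by (simp add: power2_eq_square field_simps)
  qed
  have sq: "sqrt (chart_metric c x e e) = norm e * sqrt (?h (x, e /\<^sub>R norm e))" if "x \<in> K" "e \<noteq> 0" for x e
    by (subst sc[OF that]) (simp add: real_sqrt_mult)
  have z0: "chart_metric c x 0 0 = 0" if "x \<in> K" for x
    using chart_metric_algebra(1)[OF c, of x 0 0 0] that K by auto
  show ?thesis
  proof (rule that[of "sqrt (?h z1)" "sqrt (?h z2)"])
    show "0 < sqrt (?h z1)" "0 < sqrt (?h z2)" using pos z1 z2 by auto
    fix x e assume x: "x \<in> K"
    have "sqrt (?h z1) * norm e \<le> sqrt (chart_metric c x e e) \<and> sqrt (chart_metric c x e e) \<le> sqrt (?h z2) * norm e"
    proof (cases "e = 0")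
      case False
      then have "(x, e /\<^sub>R norm e) \<in> ?P" using x by simp
      from z1(2)[OF this] z2(2)[OF this] show ?thesis
        unfolding sq[OF x False] by (simp add: mult.commute mult_left_mono)
    qed (simp add: z0[OF x])
    then show "sqrt (?h z1) * norm e \<le> sqrt (chart_metric c x e e)" "sqrt (chart_metric c x e e) \<le> sqrt (?h z2) * norm e" by auto
  qed
qed

text \<open>
  The straight segment in the chart is a competitor in the infimum.
\<close>

lemma riem_dist_upper:
  assumes c: "c \<in> A" and K: "compact K" "convex K" "K \<subseteq> snd c ` fst c"
  obtains C where "0 < C" "\<And>z x. z \<in> K \<Longrightarrow> x \<in> K \<Longrightarrow> riem_dist A g (inv_chart c z) (inv_chart c x) \<le> ennreal (C * norm (z - x))"
proof -
  obtain m M where M: "0 < M" "\<And>x e. x \<in> K \<Longrightarrow> sqrt (chart_metric c x e e) \<le> M * norm e"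
    using metric_bounds[OF c K(1,3)] by metis
  show ?thesis
  proof (rule that[OF M(1)])
    fix z x assume zx: "z \<in> K" "x \<in> K"
    define F where "F t = z + t *\<^sub>R (x - z)" for t :: real
    have FK: "F t \<in> K" if "t \<in> {0..1}" for t
    proof -
      have "F t = (1 - t) *\<^sub>R z + t *\<^sub>R x" by (simp add: F_def algebra_simps)
      then show ?thesis using convexD_alt[OF K(2) zx, of t] that by simp
    qed
    have CF: "Ck_on k {0<..<1} F" for k
      unfolding F_def
      by (intro Ck_on_add Ck_on_const Ck_on_linear[OF bounded_linear_scaleR_left] Ck_on_id) auto
    have Fim: "F ` {0<..<1} \<subseteq> snd c ` fst c" using FK K(3) by force
    define \<gamma> where "\<gamma> = inv_chart c \<circ> F"
    have path: "piecewise_C1_path A \<gamma>"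
      unfolding piecewise_C1_path_def
    proof (intro conjI exI[of _ "{}"])
      show "continuous_on {0..1} \<gamma>"
        unfolding \<gamma>_def
        by (rule continuous_on_compose[OF _ continuous_on_subset[OF chart_facts(4)[OF c]]])
          (use FK K(3) in \<open>auto simp: F_def intro!: continuous_intros\<close>)
      show "Ck_map A 1 ({0<..<1} - {}) \<gamma>"
        unfolding \<gamma>_def using Ck_map_inv_chart[OF c _ CF Fim, of 1] by simp
    qed simp
    have e: "\<gamma> 0 = inv_chart c z" "\<gamma> 1 = inv_chart c x" by (simp_all add: \<gamma>_def F_def)
    have dF: "frechet_derivative F (at t) 1 = x - z" for t
    proof -
      have "(F has_derivative (\<lambda>h. h *\<^sub>R (x - z))) (at t)"
        unfolding F_def by (auto intro!: derivative_eq_intros)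
      from frechet_derivative_at[OF this, symmetric] show ?thesis by simp
    qed
    have "path_length A g \<gamma> \<le> (\<integral>\<^sup>+ t\<in>{0<..<1::real}. ennreal (M * norm (x - z)) \<partial>lborel)"
      unfolding path_length_def
    proof (rule nn_integral_mono)
      fix t :: real
      show "ennreal (sqrt (g (\<gamma> t) (differential A \<gamma> t 1) (differential A \<gamma> t 1))) * indicator {0<..<1} t \<le> ennreal (M * norm (x - z)) * indicator {0<..<1} t"
      proof (cases "t \<in> {0<..<1}")
        case True
        have "differential A \<gamma> t 1 = coord_vec A c (inv_chart c (F t)) (x - z)"
          unfolding \<gamma>_def using differential_inv_chart[OF c open_greaterThanLessThan True CF Fim, where h=1] by (simp add: dF)
        then have "g (\<gamma> t) (differential A \<gamma> t 1) (differential A \<gamma> t 1) = chart_metric c (F t) (x - z) (x - z)"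
          by (simp add: chart_metric_def \<gamma>_def)
        then show ?thesis using M(2)[OF FK, of t "x - z"] True by (simp add: ennreal_leI)
      qed simp
    qed
    also have "\<dots> = ennreal (M * norm (x - z))"
      by (subst nn_integral_cmult_indicator) auto
    finally have "path_length A g \<gamma> \<le> ennreal (M * norm (z - x))" by (simp add: norm_minus_commute)
    then show "riem_dist A g (inv_chart c z) (inv_chart c x) \<le> ennreal (M * norm (z - x))"
      unfolding riem_dist_def by (intro INF_lower2[of \<gamma>]) (use path e in auto)
  qed
qed

lemma path_length_lower:
  assumes c: "c \<in> A" and m: "\<And>x e. x \<in> K \<Longrightarrow> m * norm e \<le> sqrt (chart_metric c x e e)" "0 < m"
    and path: "piecewise_C1_path A \<gamma>" and T: "0 \<le> T" "T \<le> 1"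
    and inK: "\<And>t. t \<in> {0..T} \<Longrightarrow> \<gamma> t \<in> fst c \<and> snd c (\<gamma> t) \<in> K"
  shows "ennreal (m * norm (snd c (\<gamma> T) - snd c (\<gamma> 0))) \<le> path_length A g \<gamma>"
proof -
  obtain F where F: "finite F" "Ck_map A 1 ({0<..<1} - F) \<gamma>" and cont: "continuous_on {0..1} \<gamma>"
    using path by (auto simp: piecewise_C1_path_def)
  let ?S = "{0<..<T} - F"
  have S: "open ?S" "?S \<subseteq> {0<..<1} - F" using F T by (auto intro!: open_Diff finite_imp_closed)
  define f where "f = snd c \<circ> \<gamma>"
  have "Ck_on 1 {t \<in> {0<..<1} - F. \<gamma> t \<in> fst c} f"
    using F(2) c by (auto simp: Ck_map_def f_def)
  then have "Ck_on 1 ?S f" by (rule Ck_on_subset) (use S inK in auto)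
  then have Cf: "Ck_on (Suc 0) ?S f" unfolding One_nat_def .
  have der: "(f has_vector_derivative frechet_derivative f (at t) 1) (at t)" if t: "t \<in> ?S" for t
  proof -
    have d: "(f has_derivative frechet_derivative f (at t)) (at t)" by (rule Ck_on_has_derivative[OF Cf t])
    have "frechet_derivative f (at t) h = h *\<^sub>R frechet_derivative f (at t) 1" for h
      using linear_scale[OF has_derivative_linear[OF d], of h 1] by simp
    with d show ?thesis by (metis has_derivative_eq_rhs has_vector_derivative_def ext)
  qed
  have cf: "continuous_on {0..T} f"
    unfolding f_def
    by (rule continuous_on_compose[OF continuous_on_subset[OF cont] continuous_on_subset[OF chart_facts(3)[OF c]]])
      (use T inK in auto)
  have "ennreal (norm (f T - f 0)) \<le> (\<integral>\<^sup>+ t\<in>?S. ennreal (norm (frechet_derivative f (at t) 1)) \<partial>lborel)"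
    by (rule norm_increment_le_nn_integral[OF T(1) F(1) cf der]) (use Cf in auto)
  then have "ennreal m * ennreal (norm (f T - f 0)) \<le> ennreal m * (\<integral>\<^sup>+ t\<in>?S. ennreal (norm (frechet_derivative f (at t) 1)) \<partial>lborel)"
    by (rule mult_left_mono) simp
  also have "\<dots> = (\<integral>\<^sup>+ t. ennreal m * (ennreal (norm (frechet_derivative f (at t) 1)) * indicator ?S t) \<partial>lborel)"
  proof (rule nn_integral_cmult[symmetric])
    have "(\<lambda>t. indicator ?S t *\<^sub>R norm (frechet_derivative f (at t) 1)) \<in> borel_measurable borel"
      by (rule borel_measurable_continuous_on_indicator) (use Cf S(1) in \<open>auto intro!: continuous_intros\<close>)
    then have "(\<lambda>t. ennreal (indicator ?S t *\<^sub>R norm (frechet_derivative f (at t) 1))) \<in> borel_measurable lborel" by simp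
    moreover have "ennreal (indicator ?S t *\<^sub>R norm (frechet_derivative f (at t) 1)) = ennreal (norm (frechet_derivative f (at t) 1)) * indicator ?S t" for t
      by (auto simp: indicator_def)
    ultimately show "(\<lambda>t. ennreal (norm (frechet_derivative f (at t) 1)) * indicator ?S t) \<in> borel_measurable lborel"
      by (simp only:)
  qed
  also have "\<dots> \<le> path_length A g \<gamma>"
    unfolding path_length_def
  proof (rule nn_integral_mono)
    fix t :: real
    show "ennreal m * (ennreal (norm (frechet_derivative f (at t) 1)) * indicator ?S t) \<le> 
      ennreal (sqrt (g (\<gamma> t) (differential A \<gamma> t 1) (differential A \<gamma> t 1))) * indicator {0<..<1} t"
    proof (cases "t \<in> ?S")
      case True
      have t: "\<gamma> t \<in> fst c" "snd c (\<gamma> t) \<in> K" using inK[of t] True by auto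
      have "continuous_on ?S \<gamma>" by (rule continuous_on_subset[OF cont]) (use T in auto)
      then have "differential A \<gamma> t 1 = coord_vec A c (\<gamma> t) (frechet_derivative f (at t) 1)"
        unfolding f_def
        by (rule differential_coord_vec[where f=\<gamma>, OF c S(1) True])
          (use t(1) Ck_on_differentiable[OF Cf True] in \<open>simp_all add: f_def\<close>)
      then have "g (\<gamma> t) (differential A \<gamma> t 1) (differential A \<gamma> t 1) = chart_metric c (snd c (\<gamma> t)) (frechet_derivative f (at t) 1) (frechet_derivative f (at t) 1)"
        by (simp add: chart_metric_def chart_facts(5)[OF c t(1)])
      then have "ennreal (m * norm (frechet_derivative f (at t) 1)) \<le> ennreal (sqrt (g (\<gamma> t) (differential A \<gamma> t 1) (differential A \<gamma> t 1)))"
        using m(1)[OF t(2)] by (simp add: ennreal_leI)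
      moreover have "t \<in> {0<..<1}" using True T by auto
      ultimately show ?thesis using True m(2) by (simp add: ennreal_mult)
    qed simp
  qed
  finally show ?thesis using m(2) by (simp add: ennreal_mult f_def)
qed

text \<open>
  A path that stays in the ball of radius \<open>2 * r\<close> is at least as long, up to the factor \<open>m\<close>, as the
  straight segment; a path that leaves it has to cross the shell between the radii \<open>r\<close> and \<open>2 * r\<close>.
\<close>

lemma riem_dist_lower:
  assumes c: "c \<in> A" and q: "q \<in> fst c" and r: "0 < r" "cball (snd c q) (2 * r) \<subseteq> snd c ` fst c"
  obtains m where "0 < m"
    "\<And>z x. z \<in> fst c \<Longrightarrow> snd c z \<in> ball (snd c q) r \<Longrightarrow>
        ennreal (if x \<in> fst c then m * min r (norm (snd c z - snd c x)) else m * r) \<le> riem_dist A g z x"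
proof -
  let ?K = "cball (snd c q) (2 * r)"
  obtain m M where m: "0 < m" "\<And>x e. x \<in> ?K \<Longrightarrow> m * norm e \<le> sqrt (chart_metric c x e e)"
    using metric_bounds[OF c compact_cball r(2)] by metis
  define G where "G = {x \<in> fst c. snd c x \<in> ball (snd c q) (2 * r)}"
  have oG: "open G"
    unfolding G_def using continuous_open_preimage[OF chart_facts(3,1)[OF c] open_ball, of "snd c q" "2 * r"]
    by (simp add: vimage_def Int_def)
  define C where "C = inv_chart c ` ?K"
  have "compact C" unfolding C_def by (rule compact_continuous_image[OF continuous_on_subset[OF chart_facts(4)[OF c] r(2)] compact_cball])
  then have cC: "closed C" by (rule compact_imp_closed)
  have GC: "G \<subseteq> C"
  proof
    fix x assume "x \<in> G"
    then show "x \<in> C" using chart_facts(5)[OF c, of x] by (auto simp: G_def C_def intro!: image_eqI[of x _ "snd c x"])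
  qed
  show ?thesis
  proof (rule that[OF m(1)])
    fix z x assume z: "z \<in> fst c" "snd c z \<in> ball (snd c q) r"
    have zG: "z \<in> G" using z r by (auto simp: G_def)
    show "ennreal (if x \<in> fst c then m * min r (norm (snd c z - snd c x)) else m * r) \<le> riem_dist A g z x"
      unfolding riem_dist_def
    proof (rule INF_greatest)
      fix \<gamma> assume "\<gamma> \<in> {\<gamma>. piecewise_C1_path A \<gamma> \<and> \<gamma> 0 = z \<and> \<gamma> 1 = x}"
      then have \<gamma>: "piecewise_C1_path A \<gamma>" "\<gamma> 0 = z" "\<gamma> 1 = x" by auto
      then have cont: "continuous_on {0..1} \<gamma>" by (simp add: piecewise_C1_path_def)
      let ?X = "{0..1} \<inter> \<gamma> -` (- G)"
      have cX: "closed ?X" by (intro continuous_closed_preimage[OF cont]) (use oG in auto)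
      show "ennreal (if x \<in> fst c then m * min r (norm (snd c z - snd c x)) else m * r) \<le> path_length A g \<gamma>"
      proof (cases "?X = {}")
        case True
        then have inG: "\<gamma> t \<in> G" if "t \<in> {0..1}" for t using that by blast
        have "ennreal (m * norm (snd c (\<gamma> 1) - snd c (\<gamma> 0))) \<le> path_length A g \<gamma>"
        proof (rule path_length_lower[OF c m(2) m(1) \<gamma>(1)])
          show "\<gamma> t \<in> fst c \<and> snd c (\<gamma> t) \<in> ?K" if "t \<in> {0..1}" for t
            using inG[OF that] by (simp add: G_def)
        qed auto
        moreover have "x \<in> fst c" using inG[of 1] \<gamma> by (auto simp: G_def)
        moreover have "m * min r (norm (snd c z - snd c x)) \<le> m * norm (snd c x - snd c z)"
          using m(1) by (intro mult_left_mono) (auto simp: norm_minus_commute)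
        ultimately show ?thesis using \<gamma> by (auto intro: order_trans[OF ennreal_leI])
      next
        case False
        \<comment> \<open>The first exit time from the ball of radius \<open>2 * r\<close>; up to it the path can be seen in the chart.\<close>
        define T where "T = Inf ?X"
        have bb: "bdd_below ?X" by (rule bdd_belowI[of _ 0]) auto
        have TX: "T \<in> ?X" unfolding T_def by (rule closed_contains_Inf[OF False bb cX])
        have T1: "0 \<le> T" "T \<le> 1" "\<gamma> T \<notin> G" using TX by auto
        have lt: "\<gamma> t \<in> G" if "0 \<le> t" "t < T" for t
        proof (rule ccontr)
          assume "\<gamma> t \<notin> G"
          then have "t \<in> ?X" using that T1 by auto
          then have "T \<le> t" unfolding T_def by (rule cInf_lower[OF _ bb])
          with that show False by simp
        qed
        have T0: "0 < T" using T1 zG \<gamma>(2) by (cases "T = 0") auto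
        have "closed ({0..T} \<inter> \<gamma> -` C)"
          by (intro continuous_closed_preimage continuous_on_subset[OF cont] cC) (use T1 in auto)
        moreover have "{0<..<T} \<subseteq> {0..T} \<inter> \<gamma> -` C" using lt GC by (auto simp: subset_iff)
        ultimately have "closure {0<..<T} \<subseteq> {0..T} \<inter> \<gamma> -` C" by (rule closure_minimal[rotated])
        moreover have "T \<in> closure {0<..<T}" using T0 by simp
        ultimately have "\<gamma> T \<in> C" by blast
        then have gT: "\<gamma> T \<in> fst c" "snd c (\<gamma> T) \<in> ?K"
          unfolding C_def using chart_facts(6)[OF c] r(2) by auto
        then have n: "2 * r \<le> norm (snd c (\<gamma> T) - snd c q)" using T1(3) by (auto simp: G_def dist_norm norm_minus_commute)
        have "ennreal (m * norm (snd c (\<gamma> T) - snd c (\<gamma> 0))) \<le> path_length A g \<gamma>"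
        proof (rule path_length_lower[OF c m(2) m(1) \<gamma>(1) T1(1,2)])
          fix t assume "t \<in> {0..T}"
          then show "\<gamma> t \<in> fst c \<and> snd c (\<gamma> t) \<in> ?K"
            using lt[of t] gT by (cases "t = T") (auto simp: G_def)
        qed
        moreover have "r \<le> norm (snd c (\<gamma> T) - snd c (\<gamma> 0))"
          using n z(2) \<gamma>(2) norm_triangle_ineq[of "snd c (\<gamma> T) - snd c z" "snd c z - snd c q"]
          by (simp add: dist_norm norm_minus_commute)
        then have "m * r \<le> m * norm (snd c (\<gamma> T) - snd c (\<gamma> 0))" using m(1) by simp
        ultimately have "ennreal (m * r) \<le> path_length A g \<gamma>"
          by (meson ennreal_leI order_trans)
        moreover have "(if x \<in> fst c then m * min r (norm (snd c z - snd c x)) else m * r) \<le> m * r"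
          using m(1) by simp
        ultimately show ?thesis by (metis ennreal_leI order_trans)
      qed
    qed
  qed
qed

end

section \<open>Level sets and their tangent spaces\<close>

lemma Ck_on_frechet: "smooth_on S f \<Longrightarrow> Ck_on k S (\<lambda>x. frechet_derivative f (at x) v)"
  using smooth_onD[of S f "Suc k"] by simp

lemma linear_functional_unit:
  assumes "linear (l :: 'e::real_normed_vector \<Rightarrow> real)" "l \<noteq> (\<lambda>_. 0)"
  obtains n where "l n = 1"
proof -
  obtain v where "l v \<noteq> 0" using assms(2) by auto
  then have "l ((1 / l v) *\<^sub>R v) = 1" by (simp add: linear_scale[OF assms(1)])
  then show ?thesis by (rule that)
qed

text \<open>
  By the inverse function theorem, the level set in the plane through \<open>Q\<close> spanned by \<open>w\<close> and \<open>n\<close> is a graph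
  over the direction \<open>w\<close>. Its slope is a smooth function of the point, so it is as smooth as \<open>r\<close>.
\<close>

lemma level_set_curve:
  fixes r :: "'e::euclidean_space \<Rightarrow> real"
  assumes W: "open W" "Q \<in> W" and r: "smooth_on W r" "r Q = 0"
    and w: "frechet_derivative r (at Q) w = 0" and n: "frechet_derivative r (at Q) n = 1"
  shows "\<exists>\<beta>. \<exists>\<epsilon>>0. (\<forall>k. Ck_on k {-\<epsilon><..<\<epsilon>::real} \<beta>) \<and> (\<forall>t\<in>{-\<epsilon><..<\<epsilon>}. \<beta> t \<in> W \<and> r (\<beta> t) = 0) \<and>
    \<beta> 0 = Q \<and> frechet_derivative \<beta> (at 0) 1 = w"
proof -
  define D where "D x = frechet_derivative r (at x)" for x
  have Dr: "(r has_derivative D x) (at x)" if "x \<in> W" for x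
    unfolding D_def by (rule smooth_on_has_derivative[OF r(1) that])
  have DC: "Ck_on k W (\<lambda>x. D x v)" for k v unfolding D_def by (rule Ck_on_frechet[OF r(1)])
  define P where "P z = Q + fst z *\<^sub>R w + snd z *\<^sub>R n" for z :: "real \<times> real"
  have cP: "continuous_on X P" for X unfolding P_def by (intro continuous_intros)
  have P0: "P 0 = Q" by (simp add: P_def)
  define U where "U = P -` (W \<inter> (\<lambda>x. D x n) -` {0<..})"
  have "open (W \<inter> (\<lambda>x. D x n) -` {0<..})"
    by (rule continuous_open_preimage[OF Ck_on_continuous[OF DC] W(1) open_greaterThan])
  then have U: "open U" unfolding U_def by (rule open_vimage[OF _ cP])
  have U0: "0 \<in> U" using W n by (simp add: U_def P0 D_def)
  define f where "f z = (fst z, r (P z))" for z :: "real \<times> real"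
  define E0 where "E0 = Blinfun (\<lambda>h::real\<times>real. (fst h, 0::real))"
  define E1 where "E1 = Blinfun (\<lambda>h::real\<times>real. (0::real, fst h))"
  define E2 where "E2 = Blinfun (\<lambda>h::real\<times>real. (0::real, snd h))"
  have E: "blinfun_apply E0 h = (fst h, 0)" "blinfun_apply E1 h = (0, fst h)" "blinfun_apply E2 h = (0, snd h)" for h
    unfolding E0_def E1_def E2_def
    by (auto intro!: bounded_linear_Blinfun_apply[THEN fun_cong] bounded_linear_intros)
  define f' where "f' z = E0 + D (P z) w *\<^sub>R E1 + D (P z) n *\<^sub>R E2" for z
  have f'_apply: "blinfun_apply (f' z) h = (fst h, fst h * D (P z) w + snd h * D (P z) n)" for z h
    by (simp add: f'_def blinfun.add_left blinfun.scaleR_left E mult.commute)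
  have UW: "P z \<in> W" "0 < D (P z) n" if "z \<in> U" for z using that by (auto simp: U_def)
  have dP: "(P has_derivative (\<lambda>h. fst h *\<^sub>R w + snd h *\<^sub>R n)) (at z)" for z
    unfolding P_def by (auto intro!: derivative_eq_intros)
  have df: "(f has_derivative blinfun_apply (f' z)) (at z)" if z: "z \<in> U" for z
  proof -
    have l: "linear (D (P z))" by (rule has_derivative_linear[OF Dr[OF UW(1)[OF z]]])
    have "((\<lambda>z. r (P z)) has_derivative (\<lambda>h. D (P z) (fst h *\<^sub>R w + snd h *\<^sub>R n))) (at z)"
      by (rule has_derivative_compose[OF dP Dr[OF UW(1)[OF z]]])
    from has_derivative_Pair[OF has_derivative_fst[OF has_derivative_ident] this]
    show ?thesis
      unfolding f_def[abs_def] f'_apply[abs_def] by (simp add: linear_add[OF l] linear_scale[OF l])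
  qed
  have cf': "continuous_on U f'"
    unfolding f'_def
    by (intro continuous_intros continuous_on_compose2[OF Ck_on_continuous[OF DC] cP]) (use UW in auto)
  have id: "id_blinfun o\<^sub>L f' 0 = id_blinfun"
    by (rule blinfun_eqI) (simp add: f'_apply P0 D_def w n)
  obtain U' V G G' where G: "open U'" "U' \<subseteq> U" "0 \<in> U'" "open V" "f 0 \<in> V" "homeomorphism U' V f G"
    "\<And>y. y \<in> V \<Longrightarrow> (G has_derivative G' y) (at y)"
    using inverse_function_theorem[OF U df cf' U0 id] by metis
  have "P (0, 0) = Q" by (simp add: P_def)
  then have f0: "f 0 = 0" by (simp add: f_def r(2) zero_prod_def)
  have G0: "G 0 = 0" using homeomorphism_apply1[OF G(6) G(3)] f0 by simp
  have "open ((\<lambda>t::real. (t, 0::real)) -` V)" by (intro open_vimage G(4) continuous_intros)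
  moreover have "0 \<in> (\<lambda>t::real. (t, 0::real)) -` V" using G(5) f0 by (simp add: zero_prod_def)
  ultimately obtain \<epsilon> where \<epsilon>: "0 < \<epsilon>" "ball 0 \<epsilon> \<subseteq> (\<lambda>t::real. (t, 0::real)) -` V"
    using open_contains_ball by blast
  let ?I = "{-\<epsilon><..<\<epsilon>}"
  have IV: "(t, 0) \<in> V" if "t \<in> ?I" for t using \<epsilon>(2) that by (auto simp: subset_iff dist_norm)
  define s where "s t = snd (G (t, 0))" for t
  have GU: "G (t, 0) \<in> U" if "t \<in> ?I" for t
    using homeomorphism_image2[OF G(6)] IV[OF that] G(2) by blast
  have Gs: "G (t, 0) = (t, s t)" "r (P (t, s t)) = 0" if t: "t \<in> ?I" for t
  proof -
    have "f (G (t, 0)) = (t, 0)" by (rule homeomorphism_apply2[OF G(6) IV[OF t]])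
    then have "fst (G (t, 0)) = t" "r (P (G (t, 0))) = 0" by (auto simp: f_def)
    then show e: "G (t, 0) = (t, s t)" by (simp add: s_def prod_eq_iff)
    show "r (P (t, s t)) = 0" using \<open>r (P (G (t, 0))) = 0\<close> unfolding e .
  qed
  define \<beta> where "\<beta> t = P (t, s t)" for t
  have \<beta>W: "\<beta> t \<in> W" "0 < D (\<beta> t) n" "r (\<beta> t) = 0" if "t \<in> ?I" for t
    using UW[OF GU[OF that]] Gs[OF that] by (simp_all add: \<beta>_def)
  define s' where "s' t = - D (\<beta> t) w * inverse (D (\<beta> t) n)" for t
  have ds: "(s has_derivative (\<lambda>h. h * s' t)) (at t)" if t: "t \<in> ?I" for t
  proof -
    have "((\<lambda>t. (t, 0::real)) has_derivative (\<lambda>h. (h, 0))) (at t)" by (auto intro!: derivative_eq_intros)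
    from has_derivative_snd[OF has_derivative_compose[OF this G(7)[OF IV[OF t]]]]
    have d: "(s has_derivative (\<lambda>h. snd (G' (t, 0) (h, 0)))) (at t)" by (simp add: s_def[abs_def])
    then have lin: "linear (\<lambda>h. snd (G' (t, 0) (h, 0)))" by (rule has_derivative_linear)
    define a where "a = snd (G' (t, 0) (1, 0))"
    have "(\<lambda>h. snd (G' (t, 0) (h, 0))) = (\<lambda>h. h * a)"
    proof
      fix h show "snd (G' (t, 0) (h, 0)) = h * a" using linear_scale[OF lin, of h 1] by (simp add: a_def)
    qed
    with d have da: "(s has_derivative (\<lambda>h. h * a)) (at t)" by simp
    have "(\<beta> has_derivative (\<lambda>h. h *\<^sub>R w + (h * a) *\<^sub>R n)) (at t)"
      unfolding \<beta>_def P_def by (auto intro!: derivative_eq_intros da)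
    from has_derivative_compose[OF this Dr[OF \<beta>W(1)[OF t]]]
    have c: "((\<lambda>t. r (\<beta> t)) has_derivative (\<lambda>h. D (\<beta> t) (h *\<^sub>R w + (h * a) *\<^sub>R n))) (at t)" .
    have z: "((\<lambda>t. r (\<beta> t)) has_derivative (\<lambda>h. 0)) (at t)"
    proof (rule has_derivative_transform_within_open[OF has_derivative_const[of 0] _ t])
      show "0 = r (\<beta> t)" if "t \<in> ?I" for t using \<beta>W(3)[OF that] by simp
    qed simp
    have "D (\<beta> t) (1 *\<^sub>R w + (1 * a) *\<^sub>R n) = 0"
      using has_derivative_unique[OF c z] by metis
    then have "D (\<beta> t) w + a * D (\<beta> t) n = 0"
      using has_derivative_linear[OF Dr[OF \<beta>W(1)[OF t]]] by (simp add: linear_add linear_scale)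
    then have "a = s' t" using \<beta>W(2)[OF t] by (simp add: s'_def field_simps)
    then show ?thesis using da by simp
  qed
  have CI: "open ?I" by simp
  have Cs: "Ck_on k ?I s \<and> Ck_on k ?I \<beta>" for k
  proof (induction k)
    case 0
    have "continuous_on ?I s"
      by (intro continuous_at_imp_continuous_on ballI) (rule has_derivative_continuous[OF ds])
    then show ?case unfolding \<beta>_def P_def by (auto intro!: continuous_intros)
  next
    case (Suc k)
    have Dk: "Ck_on k ?I (\<lambda>t. D (\<beta> t) v)" for v
      by (rule Ck_on_compose[OF CI W(1) _ _ DC]) (use Suc \<beta>W in auto)
    have "Ck_on k ?I (\<lambda>t. inverse (D (\<beta> t) n))"
      by (rule Ck_on_compose[OF CI _ _ Dk Ck_on_inverse]) (use \<beta>W(2) in fastforce)+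
    then have "Ck_on k ?I s'"
      unfolding s'_def
      using Ck_on_mult[OF CI Ck_on_linear[OF bounded_linear_minus[OF bounded_linear_ident] CI Dk]] by simp
    then have "Ck_on k ?I (\<lambda>t. v * s' t)" for v
      by (intro Ck_on_mult CI Ck_on_const)
    then have s: "Ck_on (Suc k) ?I s" by (intro Ck_on_SucI[OF CI ds])
    have "Ck_on (Suc k) ?I \<beta>"
      unfolding \<beta>_def P_def fst_conv snd_conv
      by (intro Ck_on_add Ck_on_const Ck_on_linear[OF bounded_linear_scaleR_left] Ck_on_id CI s)
    with s show ?case by blast
  qed
  have s0: "s 0 = 0" using G0 by (simp add: s_def zero_prod_def)
  have b0: "\<beta> 0 = Q" by (simp add: \<beta>_def s0 P_def)
  have "s' 0 = 0" by (simp add: s'_def b0 D_def w)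
  moreover have "0 \<in> ?I" using \<epsilon>(1) by simp
  ultimately have "(s has_derivative (\<lambda>h. 0)) (at 0)" using ds[of 0] by simp
  then have "(\<beta> has_derivative (\<lambda>h. h *\<^sub>R w)) (at 0)"
    unfolding \<beta>_def P_def by (auto intro!: derivative_eq_intros)
  from frechet_derivative_at[OF this, symmetric] have db: "frechet_derivative \<beta> (at 0) 1 = w" by simp
  show ?thesis
    using \<epsilon>(1) Cs \<beta>W b0 db by blast
qed

context smooth_manifold
begin

definition defining_function :: "'m set \<Rightarrow> 'm set \<Rightarrow> ('m \<Rightarrow> real) \<Rightarrow> bool" where
  "defining_function \<Omega> V \<rho> \<longleftrightarrow> open \<Omega> \<and> open V \<and> smooth_fun A V \<rho> \<and>
     (\<forall>x\<in>V. \<forall>c\<in>A. x \<in> fst c \<longrightarrow> frechet_derivative (\<rho> \<circ> inv_chart c) (at (snd c x)) \<noteq> (\<lambda>_. 0)) \<and>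
     \<Omega> \<inter> V = {x\<in>V. \<rho> x < 0}"

lemma defining_function_exists:
  assumes "smoothly_bounded_domain A \<Omega>" "q \<in> frontier \<Omega>"
  obtains V \<rho> where "defining_function \<Omega> V \<rho>" "q \<in> V"
proof -
  have "\<exists>V \<rho>. open V \<and> q \<in> V \<and> smooth_fun A V \<rho> \<and>
        (\<forall>x\<in>V. \<forall>c\<in>A. x \<in> fst c \<longrightarrow>
           frechet_derivative (\<rho> \<circ> inv_chart c) (at (snd c x)) \<noteq> (\<lambda>_. 0)) \<and>
        \<Omega> \<inter> V = {x\<in>V. \<rho> x < 0}" and "open \<Omega>"
    using assms by (simp_all add: smoothly_bounded_domain_def)
  then obtain V \<rho> where V: "open V" "q \<in> V" "smooth_fun A V \<rho>"
    "\<forall>x\<in>V. \<forall>c\<in>A. x \<in> fst c \<longrightarrow> frechet_derivative (\<rho> \<circ> inv_chart c) (at (snd c x)) \<noteq> (\<lambda>_. 0)"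
    "\<Omega> \<inter> V = {x\<in>V. \<rho> x < 0}"
    by (elim exE conjE)
  have "defining_function \<Omega> V \<rho>"
    unfolding defining_function_def by (intro conjI \<open>open \<Omega>\<close> V)
  then show ?thesis using V(2) by (rule that)
qed

lemma chart_exists: obtains c where "c \<in> A" "p \<in> fst c"
proof -
  have "(\<Union>c\<in>A. fst c) = UNIV"
    by (rule smooth_structure[unfolded smooth_structure_def, THEN conjunct2, THEN conjunct1])
  then show ?thesis using that by blast
qed

context
  fixes \<Omega> V :: "'m set" and \<rho> :: "'m \<Rightarrow> real"
  assumes df: "defining_function \<Omega> V \<rho>"
begin

lemmas df' = df[unfolded defining_function_def]

lemma df_open: "open V" "open \<Omega>"
  using df'[THEN conjunct1] df'[THEN conjunct2, THEN conjunct1] by blast+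

lemma df_smooth:
  assumes "c \<in> A" shows "smooth_on (snd c ` (fst c \<inter> V)) (\<rho> \<circ> inv_chart c)"
  by (rule df'[THEN conjunct2, THEN conjunct2, THEN conjunct1, unfolded smooth_fun_def, THEN bspec, OF assms])

lemma df_nonzero:
  assumes "x \<in> V" "c \<in> A" "x \<in> fst c"
  shows "frechet_derivative (\<rho> \<circ> inv_chart c) (at (snd c x)) \<noteq> (\<lambda>_. 0)"
  by (rule df'[THEN conjunct2, THEN conjunct2, THEN conjunct2, THEN conjunct1,
        THEN bspec, OF assms(1), THEN bspec, OF assms(2), THEN mp, OF assms(3)])

lemma df_neg: 
  assumes "x \<in> V" shows "x \<in> \<Omega> \<longleftrightarrow> \<rho> x < 0"
proof -
  have "\<Omega> \<inter> V = {x\<in>V. \<rho> x < 0}" using df' by (elim conjE)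
  then show ?thesis using assms by blast
qed

lemma df_continuous: "continuous_on V \<rho>"
proof (rule continuous_at_imp_continuous_on, rule ballI)
  fix x assume x: "x \<in> V"
  obtain c where c: "c \<in> A" "x \<in> fst c" by (rule chart_exists)
  have o: "open (fst c \<inter> V)" using chart_facts(1)[OF c(1)] df_open by auto
  have "continuous_on (fst c \<inter> V) (\<lambda>x. (\<rho> \<circ> inv_chart c) (snd c x))"
    by (rule continuous_on_compose2[OF Ck_on_continuous[OF smooth_onD[OF df_smooth[OF c(1)]]]
          continuous_on_subset[OF chart_facts(3)[OF c(1)]]]) auto
  then have "continuous_on (fst c \<inter> V) \<rho>"
    by (rule continuous_on_eq) (use chart_facts(5)[OF c(1)] in auto)
  then show "isCont \<rho> x" using o x c by (simp add: continuous_on_eq_continuous_at)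
qed

lemma df_closure: "x \<in> V \<Longrightarrow> x \<in> closure \<Omega> \<Longrightarrow> \<rho> x \<le> 0"
proof (rule ccontr)
  assume x: "x \<in> V" "x \<in> closure \<Omega>" "\<not> \<rho> x \<le> 0"
  have "open (V \<inter> \<rho> -` {0<..})" by (rule continuous_open_preimage[OF df_continuous df_open(1)]) simp
  moreover have "x \<in> V \<inter> \<rho> -` {0<..}" using x by auto
  ultimately obtain y where "y \<in> V \<inter> \<rho> -` {0<..}" "y \<in> \<Omega>"
    using x(2) by (meson IntE closure_iff_nhds_not_empty disjoint_iff order_refl)
  then show False using df_neg[of y] by auto
qed

lemma df_frontier: "x \<in> V \<Longrightarrow> x \<in> frontier \<Omega> \<Longrightarrow> \<rho> x = 0"
  using df_closure[of x] df_neg[of x] df_open(2) by (auto simp: frontier_def interior_open)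

context
  fixes c q
  assumes c: "c \<in> A" and q: "q \<in> V" "q \<in> fst c"
begin

abbreviation "dr \<equiv> frechet_derivative (\<rho> \<circ> inv_chart c) (at (snd c q))"

lemma chart_domain: "open (snd c ` (fst c \<inter> V))" "snd c q \<in> snd c ` (fst c \<inter> V)"
  using open_chart_image[OF c df_open(1)] q by auto

lemma dr: "((\<rho> \<circ> inv_chart c) has_derivative dr) (at (snd c q))"
  by (rule smooth_on_has_derivative[OF df_smooth[OF c] chart_domain(2)])

lemma r_q: "(\<rho> \<circ> inv_chart c) (snd c q) = \<rho> q"
  using chart_facts(5)[OF c q(2)] by simp

lemma dr_linear: "linear dr" "bounded_linear dr"
  using dr has_derivative_linear has_derivative_bounded_linear by blast+

text \<open>
  As the differential of \<open>\<rho>\<close> does not vanish, every zero of \<open>\<rho>\<close> is a limit of points with negative values.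
\<close>

lemma df_zero_frontier:
  assumes z: "\<rho> q = 0"
  shows "q \<in> frontier \<Omega>"
proof -
  obtain n where n: "dr n = 1" using linear_functional_unit[OF dr_linear(1) df_nonzero[OF q(1) c q(2)]] .
  have "q \<in> closure \<Omega>"
    unfolding closure_iff_nhds_not_empty
  proof (intro allI impI)
    fix S N assume N: "N \<subseteq> S" "open N" "q \<in> N"
    let ?W = "snd c ` (fst c \<inter> (V \<inter> N))"
    have W: "open ?W" "snd c q \<in> ?W"
      using open_chart_image[OF c open_Int[OF df_open(1) N(2)]] q N by auto
    have "((\<lambda>t. (\<rho> \<circ> inv_chart c) (snd c q + t *\<^sub>R n)) has_real_derivative 1) (at 0)"
    proof -
      have "((\<lambda>t. snd c q + t *\<^sub>R n) has_derivative (\<lambda>t. t *\<^sub>R n)) (at 0)" by (auto intro!: derivative_eq_intros)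
      from has_derivative_compose[OF this, of "\<rho> \<circ> inv_chart c" dr] dr
      have "((\<lambda>t. (\<rho> \<circ> inv_chart c) (snd c q + t *\<^sub>R n)) has_derivative (\<lambda>t. dr (t *\<^sub>R n))) (at 0)" by simp
      moreover have "(\<lambda>t. dr (t *\<^sub>R n)) = (*) 1" by (auto simp: linear_scale[OF dr_linear(1)] n)
      ultimately show ?thesis by (simp only: has_field_derivative_def)
    qed
    then obtain d where d: "0 < d" "\<And>h. 0 < h \<Longrightarrow> h < d \<Longrightarrow> (\<rho> \<circ> inv_chart c) (snd c q + (0 - h) *\<^sub>R n) < (\<rho> \<circ> inv_chart c) (snd c q + 0 *\<^sub>R n)"
      using DERIV_pos_inc_left[of "\<lambda>t. (\<rho> \<circ> inv_chart c) (snd c q + t *\<^sub>R n)" 1 0] by auto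
    have "open ((\<lambda>h. snd c q + (0 - h) *\<^sub>R n) -` ?W)" by (intro open_vimage W(1) continuous_intros)
    moreover have "0 \<in> (\<lambda>h. snd c q + (0 - h) *\<^sub>R n) -` ?W" using W(2) by simp
    ultimately obtain e where e: "0 < e" "ball 0 e \<subseteq> (\<lambda>h. snd c q + (0 - h) *\<^sub>R n) -` ?W"
      using open_contains_ball by blast
    define h where "h = min d e / 2"
    have h: "0 < h" "h < d" "h \<in> ball 0 e" using d(1) e(1) by (auto simp: h_def)
    define y where "y = snd c q + (0 - h) *\<^sub>R n"
    have "y \<in> ?W" using e(2) h(3) by (auto simp: y_def)
    then obtain x where x: "x \<in> fst c" "x \<in> V" "x \<in> N" "y = snd c x" by auto
    have "(\<rho> \<circ> inv_chart c) y < (\<rho> \<circ> inv_chart c) (snd c q)"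
      unfolding y_def using d(2)[OF h(1,2)] by simp
    then have "\<rho> x < 0" using r_q z chart_facts(5)[OF c x(1)] by (simp add: x(4))
    then have "x \<in> \<Omega>" using df_neg x by blast
    then show "\<Omega> \<inter> S \<noteq> {}" using x N by auto
  qed
  then show ?thesis using df_neg[OF q(1)] z df_open by (simp add: frontier_def interior_open)
qed

text \<open>
  The function \<open>\<rho>\<close> vanishes along any curve in the boundary.
\<close>

lemma tangent_frontier_kernel:
  assumes v: "v \<in> tangent_space_of A (frontier \<Omega>) q" shows "dr (v c) = 0"
proof -
  obtain \<gamma> and \<epsilon> :: real where \<gamma>: "v = differential A \<gamma> 0 1" "0 < \<epsilon>" "\<And>k. Ck_map A k {-\<epsilon><..<\<epsilon>} \<gamma>" "\<gamma> ` {-\<epsilon><..<\<epsilon>} \<subseteq> frontier \<Omega>" "\<gamma> 0 = q"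
    using v unfolding tangent_space_of_def mem_Collect_eq by blast
  have cont: "continuous_on {-\<epsilon><..<\<epsilon>} \<gamma>" by (rule \<gamma>(3)[of 0, unfolded Ck_map_def, THEN conjunct1])
  have C1: "Ck_on (Suc 0) {t \<in> {-\<epsilon><..<\<epsilon>}. \<gamma> t \<in> fst c} (snd c \<circ> \<gamma>)" 
    using \<gamma>(3)[of "Suc 0", unfolded Ck_map_def, THEN conjunct2, THEN bspec, OF c] .
  have d: "((snd c \<circ> \<gamma>) has_derivative frechet_derivative (snd c \<circ> \<gamma>) (at 0)) (at 0)"
    by (rule Ck_on_has_derivative[OF C1]) (use \<gamma> q in auto)
  have vc: "v c = frechet_derivative (snd c \<circ> \<gamma>) (at 0) 1"
    using \<gamma> q c by (simp add: differential_def)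
  have "((\<rho> \<circ> inv_chart c) \<circ> (snd c \<circ> \<gamma>) has_derivative dr \<circ> frechet_derivative (snd c \<circ> \<gamma>) (at 0)) (at 0)"
    by (rule diff_chain_at[OF d]) (use dr \<gamma>(5) in simp)
  moreover have "((\<rho> \<circ> inv_chart c) \<circ> (snd c \<circ> \<gamma>) has_derivative (\<lambda>_. 0)) (at 0)"
  proof (rule has_derivative_transform_within_open[OF has_derivative_const[of 0]])
    show "open ({-\<epsilon><..<\<epsilon>} \<inter> \<gamma> -` (fst c \<inter> V))"
      by (rule continuous_open_preimage[OF cont]) (use chart_facts(1)[OF c] df_open in auto)
    show "0 = ((\<rho> \<circ> inv_chart c) \<circ> (snd c \<circ> \<gamma>)) t" if "t \<in> {-\<epsilon><..<\<epsilon>} \<inter> \<gamma> -` (fst c \<inter> V)" for t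
    proof -
      have "\<gamma> t \<in> frontier \<Omega>" using \<gamma>(4) that by blast
      then show ?thesis using that df_frontier[of "\<gamma> t"] chart_facts(5)[OF c, of "\<gamma> t"] by auto
    qed
  qed (use \<gamma> q in auto)
  ultimately have "(dr \<circ> frechet_derivative (snd c \<circ> \<gamma>) (at 0)) 1 = 0"
    by (rule has_derivative_unique[THEN fun_cong])
  then show ?thesis by (simp add: vc)
qed

text \<open>
  A vector in the kernel is the velocity of a curve in the level set, which consists of boundary points.
\<close>

lemma kernel_tangent_frontier:
  assumes z: "\<rho> q = 0" and w: "dr w = 0"
  shows "\<exists>v\<in>tangent_space_of A (frontier \<Omega>) q. v c = w"
proof -
  obtain n where n: "dr n = 1" using linear_functional_unit[OF dr_linear(1) df_nonzero[OF q(1) c q(2)]] .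
  have rz: "(\<rho> \<circ> inv_chart c) (snd c q) = 0" using r_q z by simp
  obtain \<beta> and \<epsilon> :: real where \<beta>: "0 < \<epsilon>" "\<And>k. Ck_on k {-\<epsilon><..<\<epsilon>} \<beta>"
    "\<And>t. t \<in> {-\<epsilon><..<\<epsilon>} \<Longrightarrow> \<beta> t \<in> snd c ` (fst c \<inter> V) \<and> (\<rho> \<circ> inv_chart c) (\<beta> t) = 0"
    "\<beta> 0 = snd c q" "frechet_derivative \<beta> (at 0) 1 = w"
    using level_set_curve[OF chart_domain df_smooth[OF c] rz w n] by blast
  define \<gamma> where "\<gamma> = inv_chart c \<circ> \<beta>"
  have im: "\<beta> ` {-\<epsilon><..<\<epsilon>} \<subseteq> snd c ` fst c" using \<beta>(3) by (meson Int_lower1 image_mono image_subsetI subsetD)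
  have g0: "\<gamma> 0 = q" using \<beta>(4) chart_facts(5)[OF c q(2)] by (simp add: \<gamma>_def)
  have z0: "0 \<in> {-\<epsilon><..<\<epsilon>}" using \<beta>(1) by simp
  have fr: "\<gamma> t \<in> frontier \<Omega>" if t: "t \<in> {-\<epsilon><..<\<epsilon>}" for t
  proof -
    obtain x where x: "x \<in> fst c" "x \<in> V" "\<beta> t = snd c x" using \<beta>(3)[OF t] by auto
    then have gx: "\<gamma> t = x" using chart_facts(5)[OF c x(1)] by (simp add: \<gamma>_def)
    have "\<rho> x = 0" using \<beta>(3)[OF t] gx by (simp add: \<gamma>_def)
    then show ?thesis using smooth_manifold.df_zero_frontier[OF smooth_manifold_axioms df c x(2,1)] gx by simp
  qed
  have "differential A \<gamma> 0 1 = coord_vec A c (inv_chart c (\<beta> 0)) (frechet_derivative \<beta> (at 0) 1)"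
    unfolding \<gamma>_def by (rule differential_inv_chart[OF c _ z0 \<beta>(2)[of "Suc 0"] im]) simp
  then have e: "differential A \<gamma> 0 1 c = w"
    using coord_vec_self[OF c q(2)] \<beta>(4,5) chart_facts(5)[OF c q(2)] by simp
  have "differential A \<gamma> 0 1 \<in> tangent_space_of A (frontier \<Omega>) q"
    unfolding tangent_space_of_def mem_Collect_eq
  proof (intro exI conjI)
    show "0 < \<epsilon>" by (rule \<beta>(1))
    show "\<forall>k. Ck_map A k {-\<epsilon><..<\<epsilon>} \<gamma>" unfolding \<gamma>_def using Ck_map_inv_chart[OF c _ \<beta>(2) im] by simp
    show "\<gamma> ` {-\<epsilon><..<\<epsilon>} \<subseteq> frontier \<Omega>" using fr by auto
  qed (use g0 in auto)
  with e show ?thesis by blast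
qed

end

end

text \<open>
  Transition maps are differentiable.
\<close>

lemma chart_lipschitz:
  assumes c: "c \<in> A" "c' \<in> A" "q \<in> fst c" "q \<in> fst c'"
  obtains L where "0 < L" "\<forall>\<^sub>F z in nhds q. norm (snd c' z - snd c' q) \<le> L * norm (snd c z - snd c q)"
proof -
  let ?\<tau> = "snd c' \<circ> inv_chart c" and ?Q = "snd c q"
  let ?D = "frechet_derivative ?\<tau> (at ?Q)"
  have d: "(?\<tau> has_derivative ?D) (at ?Q)" by (rule transition_has_derivative[OF c])
  have bl: "bounded_linear ?D" by (rule has_derivative_bounded_linear[OF d])
  obtain e where e: "0 < e" "\<And>y. norm (y - ?Q) < e \<Longrightarrow> norm (?\<tau> y - ?\<tau> ?Q - ?D (y - ?Q)) \<le> 1 * norm (y - ?Q)"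
    using d[unfolded has_derivative_at_alt] by (metis zero_less_one)
  have "open (fst c \<inter> snd c -` ball ?Q e)"
    by (rule continuous_open_preimage[OF chart_facts(3,1)[OF c(1)] open_ball])
  then have ev: "\<forall>\<^sub>F z in nhds q. z \<in> fst c \<inter> snd c -` ball ?Q e"
    by (rule eventually_nhds_in_open) (use c e in auto)
  show ?thesis
  proof (rule that[of "onorm ?D + 1"])
    show "0 < onorm ?D + 1" using onorm_pos_le[OF bl] by simp
    show "\<forall>\<^sub>F z in nhds q. norm (snd c' z - snd c' q) \<le> (onorm ?D + 1) * norm (snd c z - ?Q)"
      using ev
    proof eventually_elim
      case (elim z)
      have "norm (?\<tau> (snd c z) - ?\<tau> ?Q - ?D (snd c z - ?Q)) \<le> 1 * norm (snd c z - ?Q)"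
        by (rule e(2)) (use elim in \<open>simp add: dist_norm norm_minus_commute\<close>)
      moreover have "?\<tau> (snd c z) = snd c' z" "?\<tau> ?Q = snd c' q"
        using elim chart_facts(5)[OF c(1)] c by auto
      moreover have "norm (?D (snd c z - ?Q)) \<le> onorm ?D * norm (snd c z - ?Q)" by (rule onorm[OF bl])
      ultimately show ?case
        using norm_triangle_ineq[of "snd c' z - snd c' q - ?D (snd c z - ?Q)" "?D (snd c z - ?Q)"]
        by (simp add: distrib_right)
    qed
  qed
qed

lemma eventually_chart_ball:
  assumes "c \<in> A" "q \<in> fst c" "0 < e"
  shows "\<forall>\<^sub>F z in nhds q. z \<in> fst c \<and> snd c z \<in> ball (snd c q) e"
proof -
  have "open (fst c \<inter> snd c -` ball (snd c q) e)"
    by (rule continuous_open_preimage[OF chart_facts(3,1)[OF assms(1)] open_ball])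
  then have "\<forall>\<^sub>F z in nhds q. z \<in> fst c \<inter> snd c -` ball (snd c q) e"
    by (rule eventually_nhds_in_open) (use assms in auto)
  then show ?thesis by eventually_elim auto
qed

end

section \<open>Non-tangential approach regions\<close>

context riemannian_manifold
begin

context
  fixes \<Omega> V :: "'m set" and \<rho> :: "'m \<Rightarrow> real" and q :: 'm and \<kappa> :: "'m \<Rightarrow> ('m, 'e) chart"
  assumes df: "defining_function \<Omega> V \<rho>" and qV: "q \<in> V" and qf: "q \<in> frontier \<Omega>"
    and \<kappa>: "\<kappa> q \<in> A" "q \<in> fst (\<kappa> q)"
begin

abbreviation (input) "cq \<equiv> \<kappa> q"
abbreviation (input) "kq \<equiv> snd (\<kappa> q)"
abbreviation (input) "lq \<equiv> frechet_derivative (\<rho> \<circ> inv_chart (\<kappa> q)) (at (snd (\<kappa> q) q))"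

lemma rho_q: "\<rho> q = 0"
  by (rule df_frontier[OF df qV qf])

lemma rho_first_order:
  assumes "0 < e"
  shows "\<forall>\<^sub>F z in nhds q. z \<in> fst cq \<and> z \<in> V \<and> \<bar>\<rho> z - lq (kq z - kq q)\<bar> \<le> e * norm (kq z - kq q)"
proof -
  note d = dr[OF df \<kappa>(1) qV \<kappa>(2)]
  obtain \<delta> where \<delta>: "0 < \<delta>" "\<And>y. norm (y - kq q) < \<delta> \<Longrightarrow>
      norm ((\<rho> \<circ> inv_chart cq) y - (\<rho> \<circ> inv_chart cq) (kq q) - lq (y - kq q)) \<le> e * norm (y - kq q)"
    using d[unfolded has_derivative_at_alt, THEN conjunct2, rule_format, OF assms] by blast
  have "\<forall>\<^sub>F z in nhds q. z \<in> V" by (rule eventually_nhds_in_open[OF df_open(1)[OF df] qV])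
  with eventually_chart_ball[OF \<kappa> \<delta>(1)] show ?thesis
  proof eventually_elim
    case (elim z)
    then show ?case
      using \<delta>(2)[of "kq z"] chart_facts(5)[OF \<kappa>(1), of z] chart_facts(5)[OF \<kappa>] rho_q
      by (simp add: dist_norm norm_minus_commute)
  qed
qed

text \<open>
  Removing from \<open>kq z\<close> the component transversal to the kernel of \<open>lq\<close> gives a point of the tangent plane, so
  the distance of \<open>z\<close> to the plane is at most a multiple of \<open>\<bar>lq (kq z - kq q)\<bar>\<close>. In an approach region
  this controls the distance of \<open>z\<close> to \<open>q\<close>. The sign is known as well, since \<open>\<rho>\<close> is negative in \<open>\<Omega>\<close> and equals
  \<open>lq (kq z - kq q)\<close> to first order.
\<close>

lemma approach_region_imp_rho:
  assumes \<alpha>: "0 \<le> \<alpha>"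
  obtains a where "0 < a"
    "\<forall>\<^sub>F z in nhds q. z \<in> approach_region A g \<Omega> \<kappa> \<alpha> q \<longrightarrow> \<rho> z \<le> - a * norm (kq z - kq q)"
proof -
  have lin: "linear lq" "bounded_linear lq" by (rule dr_linear[OF df \<kappa>(1) qV \<kappa>(2)])+
  obtain n where n: "lq n = 1"
    using linear_functional_unit[OF lin(1) df_nonzero[OF df qV \<kappa>]] .
  have n0: "n \<noteq> 0" using n linear_0[OF lin(1)] by auto
  obtain R where R: "0 < R" "cball (kq q) R \<subseteq> kq ` fst cq"
    using open_contains_cball chart_facts(2)[OF \<kappa>(1)] chart_in[OF \<kappa>] by meson
  obtain C where C: "0 < C" "\<And>z x. z \<in> cball (kq q) R \<Longrightarrow> x \<in> cball (kq q) R \<Longrightarrow> riem_dist A g (inv_chart cq z) (inv_chart cq x) \<le> ennreal (C * norm (z - x))"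
    using riem_dist_upper[OF \<kappa>(1) compact_cball convex_cball R(2)] by metis
  have R2: "0 < R / 2" "cball (kq q) (2 * (R / 2)) \<subseteq> kq ` fst cq" using R by auto
  obtain m where m: "0 < m" "\<And>z x. z \<in> fst cq \<Longrightarrow> kq z \<in> ball (kq q) (R / 2) \<Longrightarrow>
        ennreal (if x \<in> fst cq then m * min (R / 2) (norm (kq z - kq x)) else m * (R / 2)) \<le> riem_dist A g z x"
    using riem_dist_lower[OF \<kappa> R2] by metis
  define N where "N = onorm lq"
  have N: "\<bar>lq v\<bar> \<le> N * norm v" for v using onorm[OF lin(2), of v] by (simp add: N_def)
  have N0: "0 \<le> N" unfolding N_def by (rule onorm_pos_le[OF lin(2)])
  define b where "b = m / ((\<alpha> + 1) * C * norm n)"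
  have b: "0 < b" using m C n0 \<alpha> by (simp add: b_def)
  define r where "r = R / (2 * (1 + N * norm n))"
  have P: "1 \<le> 1 + N * norm n" using N0 by simp
  have r: "0 < r" "r \<le> R / 2" "r * (1 + N * norm n) \<le> R / 2"
  proof -
    show "0 < r" using R P by (simp add: r_def)
    show e: "r * (1 + N * norm n) \<le> R / 2" using P by (simp add: r_def field_simps)
    have "r * 1 \<le> r * (1 + N * norm n)" using P \<open>0 < r\<close> by (intro mult_left_mono) auto
    with e show "r \<le> R / 2" by simp
  qed
  show ?thesis
  proof (rule that[of "b / 2"])
    show "0 < b / 2" using b by simp
    have "0 < b / 2" using b by simp
    from rho_first_order[OF this] eventually_chart_ball[OF \<kappa> r(1)]
    show "\<forall>\<^sub>F z in nhds q. z \<in> approach_region A g \<Omega> \<kappa> \<alpha> q \<longrightarrow> \<rho> z \<le> - (b / 2) * norm (kq z - kq q)"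
    proof eventually_elim
      case (elim z)
      show ?case
      proof
        assume "z \<in> approach_region A g \<Omega> \<kappa> \<alpha> q"
        then have z: "z \<in> \<Omega>" "riem_dist A g z q \<le> ennreal \<alpha> * tangent_plane_dist A g \<Omega> cq q z"
          by (auto simp: approach_region_def)
        let ?d = "norm (kq z - kq q)" and ?t = "lq (kq z - kq q)"
        have dr: "?d < r" using elim by (simp add: dist_norm norm_minus_commute)
        define y where "y = kq z - ?t *\<^sub>R n"
        have yz: "norm (kq z - y) = \<bar>?t\<bar> * norm n" by (simp add: y_def)
        have "norm (y - kq q) \<le> ?d + \<bar>?t\<bar> * norm n"
          using norm_triangle_ineq4[of "kq z - kq q" "?t *\<^sub>R n"] by (simp add: y_def algebra_simps)
        also have "\<dots> \<le> ?d + (N * ?d) * norm n" using N by (intro add_left_mono mult_right_mono) auto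
        also have "\<dots> = ?d * (1 + N * norm n)" by (simp add: algebra_simps)
        also have "\<dots> \<le> r * (1 + N * norm n)" using dr P by (intro mult_right_mono) auto
        also have "\<dots> \<le> R" using r(3) R by simp
        finally have yR: "y \<in> cball (kq q) R" by (simp add: dist_norm norm_minus_commute)
        have zR: "kq z \<in> cball (kq q) R" using dr r R by (simp add: dist_norm norm_minus_commute)
        have "lq (y - kq q) = 0"
        proof -
          have "y - kq q = (kq z - kq q) - ?t *\<^sub>R n" by (simp add: y_def)
          then show ?thesis by (simp add: linear_diff[OF lin(1)] linear_scale[OF lin(1)] n)
        qed
        from kernel_tangent_frontier[OF df \<kappa>(1) qV \<kappa>(2) rho_q this]
        obtain v where v: "v \<in> tangent_space_of A (frontier \<Omega>) q" "v cq = y - kq q" by blast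
        have iy: "inv_chart cq y \<in> fst cq" "kq (inv_chart cq y) = y"
          using chart_facts(6)[OF \<kappa>(1), of y] yR R(2) by auto
        have "inv_chart cq y \<in> tangent_plane A \<Omega> cq q"
          unfolding tangent_plane_def using iy v by force
        then have "tangent_plane_dist A g \<Omega> cq q z \<le> riem_dist A g z (inv_chart cq y)"
          unfolding tangent_plane_dist_def by (rule INF_lower)
        also have "\<dots> \<le> ennreal (C * norm (kq z - y))"
          using C(2)[OF zR yR] elim chart_facts(5)[OF \<kappa>(1), of z] by simp
        finally have "riem_dist A g z q \<le> ennreal \<alpha> * ennreal (C * norm (kq z - y))"
          using z(2) by (meson mult_left_mono order_trans zero_le)
        also have "\<dots> = ennreal (\<alpha> * (C * norm (kq z - y)))" using \<alpha> C by (simp add: ennreal_mult)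
        finally have up: "riem_dist A g z q \<le> ennreal (\<alpha> * (C * norm (kq z - y)))" .
        have "kq z \<in> ball (kq q) (R / 2)" using dr r(2) by (simp add: dist_norm norm_minus_commute)
        from m(2)[OF _ this, of q] have "ennreal (m * min (R / 2) ?d) \<le> riem_dist A g z q"
          using elim \<kappa> by simp
        moreover have "min (R / 2) ?d = ?d" using dr r(2) by simp
        ultimately have "ennreal (m * ?d) \<le> ennreal (\<alpha> * (C * norm (kq z - y)))" using up by (simp add: order_trans)
        then have "m * ?d \<le> \<alpha> * (C * (\<bar>?t\<bar> * norm n))"
          unfolding yz using \<alpha> C by (simp add: ennreal_le_iff)
        also have "\<dots> \<le> (\<alpha> + 1) * (C * (\<bar>?t\<bar> * norm n))" using C by (intro mult_right_mono) auto
        finally have bt: "b * ?d \<le> \<bar>?t\<bar>"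
          using C n0 \<alpha> by (simp add: b_def pos_divide_le_eq mult_ac)
        have fo: "\<bar>\<rho> z - ?t\<bar> \<le> (b / 2) * ?d" using elim by simp
        have "\<rho> z < 0" using df_neg[OF df] elim z(1) by blast
        moreover have "0 \<le> b * ?d" using b by simp
        ultimately have "?t \<le> - (b * ?d)" using bt fo by (auto simp: abs_if split: if_splits)
        then show "\<rho> z \<le> - (b / 2) * ?d" using fo by (auto simp: abs_if split: if_splits)
      qed
    qed
  qed
qed

text \<open>
  The functional \<open>lq\<close> vanishes on the directions of the tangent plane, so the coordinate distance of \<open>z\<close> to any
  point of the plane is at least a multiple of \<open>\<bar>lq (kq z - kq q)\<bar>\<close>. This number is comparable to the
  distance of \<open>z\<close> to \<open>q\<close> because \<open>\<rho> z\<close> is.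
\<close>

lemma rho_imp_approach_region:
  assumes a: "0 < a"
  obtains \<alpha> where "1 < \<alpha>"
    "\<forall>\<^sub>F z in nhds q. z \<noteq> q \<longrightarrow> \<rho> z \<le> - a * norm (kq z - kq q) \<longrightarrow> z \<in> approach_region A g \<Omega> \<kappa> \<alpha> q"
proof -
  have lin: "linear lq" "bounded_linear lq" by (rule dr_linear[OF df \<kappa>(1) qV \<kappa>(2)])+
  obtain R where R: "0 < R" "cball (kq q) R \<subseteq> kq ` fst cq"
    using open_contains_cball chart_facts(2)[OF \<kappa>(1)] chart_in[OF \<kappa>] by meson
  obtain C where C: "0 < C" "\<And>z x. z \<in> cball (kq q) R \<Longrightarrow> x \<in> cball (kq q) R \<Longrightarrow> riem_dist A g (inv_chart cq z) (inv_chart cq x) \<le> ennreal (C * norm (z - x))"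
    using riem_dist_upper[OF \<kappa>(1) compact_cball convex_cball R(2)] by metis
  have R2: "0 < R / 2" "cball (kq q) (2 * (R / 2)) \<subseteq> kq ` fst cq" using R by auto
  obtain m where m: "0 < m" "\<And>z x. z \<in> fst cq \<Longrightarrow> kq z \<in> ball (kq q) (R / 2) \<Longrightarrow>
        ennreal (if x \<in> fst cq then m * min (R / 2) (norm (kq z - kq x)) else m * (R / 2)) \<le> riem_dist A g z x"
    using riem_dist_lower[OF \<kappa> R2] by metis
  define N where "N = onorm lq + 1"
  have N0: "0 < N" unfolding N_def using onorm_pos_le[OF lin(2)] by simp
  have N: "\<bar>lq v\<bar> \<le> N * norm v" for v
    using onorm[OF lin(2), of v] norm_ge_zero[of v] unfolding N_def distrib_right real_norm_def by linarith
  define s where "s = a / (2 * N)"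
  have s: "0 < s" using a N0 by (simp add: s_def)
  define \<alpha> where "\<alpha> = 1 + C / (m * s)"
  have \<alpha>: "1 < \<alpha>" using C m s by (simp add: \<alpha>_def)
  define r where "r = min (R / 2) (R / (2 * s))"
  have r: "0 < r" "r \<le> R / 2" "s * r \<le> R / 2"
  proof -
    show "0 < r" "r \<le> R / 2" using R s by (auto simp: r_def)
    have "s * r \<le> s * (R / (2 * s))" using s by (intro mult_left_mono) (auto simp: r_def)
    then show "s * r \<le> R / 2" using s by simp
  qed
  show ?thesis
  proof (rule that[OF \<alpha>])
    have a2: "0 < a / 2" using a by simp
    from rho_first_order[OF a2] eventually_chart_ball[OF \<kappa> r(1)]
    show "\<forall>\<^sub>F z in nhds q. z \<noteq> q \<longrightarrow> \<rho> z \<le> - a * norm (kq z - kq q) \<longrightarrow> z \<in> approach_region A g \<Omega> \<kappa> \<alpha> q"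
    proof eventually_elim
      case (elim z)
      show ?case
      proof (intro impI)
        assume zq: "z \<noteq> q" and rz: "\<rho> z \<le> - a * norm (kq z - kq q)"
        let ?d = "norm (kq z - kq q)" and ?t = "lq (kq z - kq q)"
        have dr: "?d < r" using elim by (simp add: dist_norm norm_minus_commute)
        have zc: "inv_chart cq (kq z) = z" "inv_chart cq (kq q) = q"
          using chart_facts(5)[OF \<kappa>(1)] elim \<kappa>(2) by auto
        have "kq z \<noteq> kq q" using zq zc by metis
        then have d0: "0 < ?d" by simp
        then have "\<rho> z < 0" using rz mult_pos_pos[OF a d0] by simp
        then have z\<Omega>: "z \<in> \<Omega>" using df_neg[OF df] elim by blast
        have fo: "\<bar>\<rho> z - ?t\<bar> \<le> (a / 2) * ?d" using elim by simp
        have t: "(a / 2) * ?d \<le> \<bar>?t\<bar>" using fo rz by (auto simp: abs_if split: if_splits)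
        have "riem_dist A g (inv_chart cq (kq z)) (inv_chart cq (kq q)) \<le> ennreal (C * ?d)"
          by (rule C(2)) (use dr r R in \<open>auto simp: dist_norm norm_minus_commute\<close>)
        then have up: "riem_dist A g z q \<le> ennreal (C * ?d)" by (simp add: zc)
        have kz: "kq z \<in> ball (kq q) (R / 2)" using dr r(2) by (simp add: dist_norm norm_minus_commute)
        have lo: "ennreal (m * (s * ?d)) \<le> tangent_plane_dist A g \<Omega> cq q z"
          unfolding tangent_plane_dist_def
        proof (rule INF_greatest)
          fix x assume "x \<in> tangent_plane A \<Omega> cq q"
          then obtain v where x: "x \<in> fst cq" "v \<in> tangent_space_of A (frontier \<Omega>) q" "kq x = kq q + v cq"
            by (auto simp: tangent_plane_def)
          have "lq (v cq) = 0" by (rule tangent_frontier_kernel[OF df \<kappa>(1) qV \<kappa>(2) x(2)])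
          moreover have "lq (kq z - kq q) = lq (kq z - kq x) + lq (v cq)"
            unfolding linear_add[OF lin(1), symmetric] x(3) by simp
          ultimately have "lq (kq z - kq x) = ?t" by simp
          then have "\<bar>?t\<bar> \<le> N * norm (kq z - kq x)" using N[of "kq z - kq x"] by simp
          with t have "(a / 2) * ?d \<le> N * norm (kq z - kq x)" by linarith
          then have "s * ?d \<le> norm (kq z - kq x)" using N0 by (simp add: s_def field_simps)
          moreover have "s * ?d \<le> R / 2" using r(3) mult_left_mono[of ?d r s] dr s by linarith
          ultimately have "m * (s * ?d) \<le> m * min (R / 2) (norm (kq z - kq x))"
            using m(1) by (intro mult_left_mono) auto
          then have "ennreal (m * (s * ?d)) \<le> ennreal (m * min (R / 2) (norm (kq z - kq x)))" by (rule ennreal_leI)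
          also have "\<dots> \<le> riem_dist A g z x" using m(2)[OF _ kz, of x] elim x(1) by simp
          finally show "ennreal (m * (s * ?d)) \<le> riem_dist A g z x" .
        qed
        have "C * ?d \<le> \<alpha> * (m * (s * ?d))"
        proof -
          have "\<alpha> * (m * s) = m * s + C" using m s by (simp add: \<alpha>_def field_simps)
          then have "C \<le> \<alpha> * (m * s)" using m(1) s by simp
          then have "C * ?d \<le> (\<alpha> * (m * s)) * ?d" by (rule mult_right_mono) simp
          then show ?thesis by (simp add: mult_ac)
        qed
        then have "ennreal (C * ?d) \<le> ennreal (\<alpha> * (m * (s * ?d)))" by (rule ennreal_leI)
        also have "\<dots> = ennreal \<alpha> * ennreal (m * (s * ?d))" using \<alpha> by (simp add: ennreal_mult')
        also have "\<dots> \<le> ennreal \<alpha> * tangent_plane_dist A g \<Omega> cq q z" by (rule mult_left_mono[OF lo]) simp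
        finally have "ennreal (C * ?d) \<le> ennreal \<alpha> * tangent_plane_dist A g \<Omega> cq q z" .
        with up show "z \<in> approach_region A g \<Omega> \<kappa> \<alpha> q"
          using z\<Omega> by (auto simp: approach_region_def)
      qed
    qed
  qed
qed

end

end

section \<open>Blowing up a smooth almost complex structure\<close>

lemma Ck_on_cball_bounds:
  fixes q :: "'e::euclidean_space \<Rightarrow> real"
  assumes q: "open U" "Ck_on (Suc n) U q" and r: "cball P r \<subseteq> U"
  obtains M :: real where "0 < M" "\<And>x. x \<in> cball P r \<Longrightarrow> \<bar>q x\<bar> \<le> M"
    "\<And>x y. x \<in> cball P r \<Longrightarrow> y \<in> cball P r \<Longrightarrow> \<bar>q x - q y\<bar> \<le> M * norm (x - y)"
proof -
  have d: "(q has_derivative frechet_derivative q (at x)) (at x)" if "x \<in> U" for x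
    by (rule Ck_on_has_derivative[OF q(2) that])
  have cont: "continuous_on (cball P r) q"
    using continuous_on_subset[OF Ck_on_continuous[OF q(2)] r] .
  obtain M0 where M0: "\<And>x. x \<in> cball P r \<Longrightarrow> \<bar>q x\<bar> \<le> M0"
    using compact_imp_bounded[OF compact_continuous_image[OF cont compact_cball]]
    unfolding bounded_iff by fastforce
  have "\<exists>M. \<forall>x\<in>cball P r. \<bar>frechet_derivative q (at x) i\<bar> \<le> M" for i
  proof -
    have "Ck_on n U (\<lambda>x. frechet_derivative q (at x) i)" using q(2) by simp
    from continuous_on_subset[OF Ck_on_continuous[OF this] r]
    have "bounded ((\<lambda>x. frechet_derivative q (at x) i) ` cball P r)"
      by (intro compact_imp_bounded compact_continuous_image compact_cball)
    then show ?thesis unfolding bounded_iff by fastforce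
  qed
  then obtain Mi where Mi: "\<And>i x. x \<in> cball P r \<Longrightarrow> \<bar>frechet_derivative q (at x) i\<bar> \<le> Mi i" by metis
  define M1 where "M1 = (\<Sum>i\<in>Basis. Mi i)"
  have b: "\<bar>frechet_derivative q (at x) v\<bar> \<le> M1 * norm v" if x: "x \<in> cball P r" for x v
  proof -
    have lin: "linear (frechet_derivative q (at x))" using d x r has_derivative_linear by blast
    have "frechet_derivative q (at x) v = frechet_derivative q (at x) (\<Sum>i\<in>Basis. (v \<bullet> i) *\<^sub>R i)"
      by (simp only: euclidean_representation)
    also have "\<dots> = (\<Sum>i\<in>Basis. (v \<bullet> i) * frechet_derivative q (at x) i)"
      by (simp add: linear_sum[OF lin] linear_scale[OF lin])
    also have "\<bar>\<dots>\<bar> \<le> (\<Sum>i\<in>Basis. \<bar>(v \<bullet> i) * frechet_derivative q (at x) i\<bar>)" by (rule sum_abs)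
    also have "\<dots> \<le> (\<Sum>i\<in>Basis. norm v * Mi i)"
      unfolding abs_mult by (intro sum_mono mult_mono Mi[OF x] Basis_le_norm) auto
    finally show ?thesis by (simp add: M1_def sum_distrib_left mult.commute)
  qed
  have lip: "\<bar>q x - q y\<bar> \<le> M1 * norm (x - y)" if "x \<in> cball P r" "y \<in> cball P r" for x y
    unfolding real_norm_def[symmetric]
  proof (rule differentiable_bound[OF convex_cball _ _ that])
    show "(q has_derivative frechet_derivative q (at x)) (at x within cball P r)" if "x \<in> cball P r" for x
      using d that r has_derivative_at_withinI by blast
    show "onorm (frechet_derivative q (at x)) \<le> M1" if "x \<in> cball P r" for x
      by (rule onorm_le) (use b[OF that] in simp)
  qed
  show ?thesis
  proof (rule that[of "\<bar>M0\<bar> + \<bar>M1\<bar> + 1"])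
    show "\<bar>q x\<bar> \<le> \<bar>M0\<bar> + \<bar>M1\<bar> + 1" if "x \<in> cball P r" for x using M0[OF that] by simp
    fix x y assume "x \<in> cball P r" "y \<in> cball P r"
    moreover have "M1 * norm (x - y) \<le> (\<bar>M0\<bar> + \<bar>M1\<bar> + 1) * norm (x - y)" by (intro mult_right_mono) auto
    ultimately show "\<bar>q x - q y\<bar> \<le> (\<bar>M0\<bar> + \<bar>M1\<bar> + 1) * norm (x - y)" using lip[of x y] by linarith
  qed simp
qed

lemma lip_class_mono: "lip_class n R \<eta> q \<Longrightarrow> \<eta> \<le> \<eta>' \<Longrightarrow> lip_class n R \<eta>' q"
proof (induction n arbitrary: q)
  case 0
  then show ?case using mult_right_mono[OF 0(2) norm_ge_zero] unfolding lip_class.simps by (meson order_trans)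
next
  case (Suc n)
  obtain q' where q': "\<forall>v\<in>ball 0 R. (q has_derivative (\<lambda>h. \<Sum>l\<in>Basis. q' l v * (h \<bullet> l))) (at v)"
    "\<forall>l\<in>Basis. lip_class n R \<eta> (q' l)" using Suc.prems(1) by auto
  have 1: "\<bar>q v\<bar> \<le> \<eta>'" if "v \<in> ball 0 R" for v using lip_classD(1)[OF Suc.prems(1) that] Suc.prems(2) by simp
  have 2: "\<bar>q v - q w\<bar> \<le> \<eta>' * norm (v - w)" if "v \<in> ball 0 R" "w \<in> ball 0 R" for v w
    using lip_classD(2)[OF Suc.prems(1) that] mult_right_mono[OF Suc.prems(2), of "norm (v - w)"] by simp
  show ?case unfolding lip_class.simps
    using 1 2 q' Suc.IH[OF _ Suc.prems(2)] by blast
qed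

lemma rescale_in_cball:
  fixes w :: "'e::real_normed_vector"
  assumes "w \<in> ball 0 R" "0 < \<delta>" "\<delta> * R \<le> r" shows "P + \<delta> *\<^sub>R w \<in> cball P r"
proof -
  have "\<delta> * norm w \<le> \<delta> * R" using assms by (intro mult_left_mono) auto
  then have "\<delta> * norm w \<le> r" using assms(3) by linarith
  then show ?thesis using assms by (simp add: dist_norm)
qed

lemma rescale_has_derivative:
  fixes q :: "'e::euclidean_space \<Rightarrow> real"
  assumes d: "(q has_derivative D) (at (P + \<delta> *\<^sub>R w))"
  shows "((\<lambda>w. a * q (P + \<delta> *\<^sub>R w) + b) has_derivative (\<lambda>h. \<Sum>l\<in>Basis. (a * \<delta> * D l) * (h \<bullet> l))) (at w)"
proof -
  have lin: "linear D" using d by (rule has_derivative_linear)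
  have "((\<lambda>w. P + \<delta> *\<^sub>R w) has_derivative (\<lambda>h. \<delta> *\<^sub>R h)) (at w)" by (auto intro!: derivative_eq_intros)
  from has_derivative_compose[OF this d]
  have "((\<lambda>w. a * q (P + \<delta> *\<^sub>R w) + b) has_derivative (\<lambda>h. a * D (\<delta> *\<^sub>R h))) (at w)"
    by (auto intro!: derivative_eq_intros)
  then show ?thesis
  proof (rule has_derivative_eq_rhs)
    show "(\<lambda>h. a * D (\<delta> *\<^sub>R h)) = (\<lambda>h. \<Sum>l\<in>Basis. (a * \<delta> * D l) * (h \<bullet> l))"
    proof
      fix h
      have "D h = D (\<Sum>i\<in>Basis. (h \<bullet> i) *\<^sub>R i)" by (simp only: euclidean_representation)
      also have "\<dots> = (\<Sum>i\<in>Basis. (h \<bullet> i) * D i)" by (simp add: linear_sum[OF lin] linear_scale[OF lin])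
      finally show "a * D (\<delta> *\<^sub>R h) = (\<Sum>l\<in>Basis. (a * \<delta> * D l) * (h \<bullet> l))"
        by (simp add: linear_scale[OF lin] sum_distrib_left mult_ac)
    qed
  qed
qed

lemma rescale_norm:
  fixes w :: "'e::real_normed_vector"
  assumes "0 < \<delta>" shows "norm ((P + \<delta> *\<^sub>R v) - (P + \<delta> *\<^sub>R w)) = \<delta> * norm (v - w)"
proof -
  have "(P + \<delta> *\<^sub>R v) - (P + \<delta> *\<^sub>R w) = \<delta> *\<^sub>R (v - w)" by (simp add: scaleR_diff_right)
  then show ?thesis using assms by simp
qed

lemma rescale_bounds:
  fixes q :: "'e::real_normed_vector \<Rightarrow> real"
  assumes M: "\<And>x. x \<in> cball P r \<Longrightarrow> \<bar>q x\<bar> \<le> M"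
    "\<And>x y. x \<in> cball P r \<Longrightarrow> y \<in> cball P r \<Longrightarrow> \<bar>q x - q y\<bar> \<le> M * norm (x - y)" "0 < M"
    and \<delta>: "0 < \<delta>" "\<delta> \<le> 1" "\<delta> * R \<le> r" and a: "\<bar>a\<bar> \<le> \<delta>" and v: "v \<in> ball 0 R" "w \<in> ball 0 R"
  shows "\<bar>a * q (P + \<delta> *\<^sub>R v)\<bar> \<le> M * \<delta>"
    "\<bar>a * q (P + \<delta> *\<^sub>R v) - a * q (P + \<delta> *\<^sub>R w)\<bar> \<le> M * \<delta> * norm (v - w)"
proof -
  note in_cball = rescale_in_cball[OF v(1) \<delta>(1,3), of P] rescale_in_cball[OF v(2) \<delta>(1,3), of P]
  have "\<bar>a\<bar> * \<bar>q (P + \<delta> *\<^sub>R v)\<bar> \<le> \<delta> * M" by (intro mult_mono a M in_cball) (use \<delta> in auto)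
  then show "\<bar>a * q (P + \<delta> *\<^sub>R v)\<bar> \<le> M * \<delta>" by (simp add: abs_mult mult.commute)
  have q: "\<bar>q (P + \<delta> *\<^sub>R v) - q (P + \<delta> *\<^sub>R w)\<bar> \<le> M * (\<delta> * norm (v - w))"
    using M(2)[OF in_cball] unfolding rescale_norm[OF \<delta>(1)] .
  have "\<bar>a\<bar> * \<bar>q (P + \<delta> *\<^sub>R v) - q (P + \<delta> *\<^sub>R w)\<bar> \<le> 1 * (M * (\<delta> * norm (v - w)))"
    by (intro mult_mono q) (use \<delta> a in auto)
  then show "\<bar>a * q (P + \<delta> *\<^sub>R v) - a * q (P + \<delta> *\<^sub>R w)\<bar> \<le> M * \<delta> * norm (v - w)"
    by (simp add: abs_mult mult.assoc flip: right_diff_distrib)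
qed

text \<open>
  Each derivative of a rescaled function carries one more factor \<open>\<delta>\<close>; the prefactor \<open>a\<close>, of the
  size of \<open>\<delta>\<close>, stands for those already collected.
\<close>

lemma lip_class_rescale:
  fixes q :: "'e::euclidean_space \<Rightarrow> real"
  assumes U: "open U" and r: "cball P r \<subseteq> U" and R: "0 < R" and q: "Ck_on (Suc n) U q"
  shows "\<exists>M>0. \<forall>\<delta> a. 0 < \<delta> \<longrightarrow> \<delta> \<le> 1 \<longrightarrow> \<delta> * R \<le> r \<longrightarrow> \<bar>a\<bar> \<le> \<delta> \<longrightarrow>
    lip_class n R (M * \<delta>) (\<lambda>w. a * q (P + \<delta> *\<^sub>R w))"
  using q
proof (induction n arbitrary: q)
  case (0 q)
  obtain M where M: "0 < M" "\<And>x. x \<in> cball P r \<Longrightarrow> \<bar>q x\<bar> \<le> M"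
    "\<And>x y. x \<in> cball P r \<Longrightarrow> y \<in> cball P r \<Longrightarrow> \<bar>q x - q y\<bar> \<le> M * norm (x - y)"
    using Ck_on_cball_bounds[OF U 0 r] by metis
  have "lip_class 0 R (M * \<delta>) (\<lambda>w. a * q (P + \<delta> *\<^sub>R w))"
    if \<delta>: "0 < \<delta>" "\<delta> \<le> 1" "\<delta> * R \<le> r" and a: "\<bar>a\<bar> \<le> \<delta>" for \<delta> a
    unfolding lip_class.simps using rescale_bounds[OF M(2,3,1) \<delta> a] by blast
  then show ?case using M(1) by blast
next
  case (Suc n q)
  obtain M where M: "0 < M" "\<And>x. x \<in> cball P r \<Longrightarrow> \<bar>q x\<bar> \<le> M"
    "\<And>x y. x \<in> cball P r \<Longrightarrow> y \<in> cball P r \<Longrightarrow> \<bar>q x - q y\<bar> \<le> M * norm (x - y)"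
    using Ck_on_cball_bounds[OF U Suc.prems r] by metis
  let ?D = "\<lambda>l x. frechet_derivative q (at x) l"
  have "Ck_on (Suc n) U (?D l)" for l using Suc.prems by (subst (asm) Ck_on.simps(2)) blast
  then have "\<exists>M>0. \<forall>\<delta> a. 0 < \<delta> \<longrightarrow> \<delta> \<le> 1 \<longrightarrow> \<delta> * R \<le> r \<longrightarrow> \<bar>a\<bar> \<le> \<delta> \<longrightarrow>
    lip_class n R (M * \<delta>) (\<lambda>w. a * ?D l (P + \<delta> *\<^sub>R w))" for l by (rule Suc.IH)
  then obtain Ml where Ml: "\<And>l. 0 < Ml l" "\<And>l \<delta> a. 0 < \<delta> \<Longrightarrow> \<delta> \<le> 1 \<Longrightarrow> \<delta> * R \<le> r \<Longrightarrow> \<bar>a\<bar> \<le> \<delta> \<Longrightarrow>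
    lip_class n R (Ml l * \<delta>) (\<lambda>w. a * ?D l (P + \<delta> *\<^sub>R w))" by metis
  define K where "K = M + sum Ml Basis"
  have K: "M \<le> K" "0 < K" "l \<in> Basis \<Longrightarrow> Ml l \<le> K" for l
  proof -
    show "M \<le> K" "0 < K" using M(1) sum_nonneg[of Basis Ml, OF less_imp_le[OF Ml(1)]] by (auto simp: K_def)
    show "Ml l \<le> K" if "l \<in> Basis"
      unfolding K_def using member_le_sum[OF that, of Ml, OF less_imp_le[OF Ml(1)] finite_Basis] M(1) by linarith
  qed
  have "lip_class (Suc n) R (K * \<delta>) (\<lambda>w. a * q (P + \<delta> *\<^sub>R w))"
    if \<delta>: "0 < \<delta>" "\<delta> \<le> 1" "\<delta> * R \<le> r" and a: "\<bar>a\<bar> \<le> \<delta>" for \<delta> a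
    unfolding lip_class.simps(2)
  proof (intro conjI ballI exI[of _ "\<lambda>l w. (a * \<delta>) * ?D l (P + \<delta> *\<^sub>R w)"])
    have M': "\<And>x. x \<in> cball P r \<Longrightarrow> \<bar>q x\<bar> \<le> K"
      "\<And>x y. x \<in> cball P r \<Longrightarrow> y \<in> cball P r \<Longrightarrow> \<bar>q x - q y\<bar> \<le> K * norm (x - y)"
      using M(2,3) K(1) mult_right_mono[OF K(1) norm_ge_zero] order_trans by blast+
    fix v :: 'e assume v: "v \<in> ball 0 R"
    show "\<bar>a * q (P + \<delta> *\<^sub>R v)\<bar> \<le> K * \<delta>" by (rule rescale_bounds[OF M' K(2) \<delta> a v v])
    show "\<bar>a * q (P + \<delta> *\<^sub>R v) - a * q (P + \<delta> *\<^sub>R w)\<bar> \<le> K * \<delta> * norm (v - w)" if w: "w \<in> ball 0 R" for w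
      by (rule rescale_bounds[OF M' K(2) \<delta> a v w])
    have "P + \<delta> *\<^sub>R v \<in> U" by (rule subsetD[OF r rescale_in_cball[OF v \<delta>(1,3)]])
    from rescale_has_derivative[OF Ck_on_has_derivative[OF Suc.prems this], of a 0]
    show "((\<lambda>w. a * q (P + \<delta> *\<^sub>R w)) has_derivative (\<lambda>h. \<Sum>l\<in>Basis. (a * \<delta>) * ?D l (P + \<delta> *\<^sub>R v) * (h \<bullet> l))) (at v)" by simp
  next
    fix l :: 'e assume l: "l \<in> Basis"
    have "\<bar>a * \<delta>\<bar> \<le> \<delta>" using a \<delta> mult_mono[of "\<bar>a\<bar>" 1 \<delta> \<delta>] by (simp add: abs_mult)
    from Ml(2)[OF \<delta> this, of l]
    show "lip_class n R (K * \<delta>) (\<lambda>w. (a * \<delta>) * ?D l (P + \<delta> *\<^sub>R w))"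
      by (rule lip_class_mono) (use K(3)[OF l] \<delta> in simp)
  qed
  then show ?case using K(2) by blast
qed

text \<open>
  The difference from the value at the centre is small by itself, without a prefactor.
\<close>

lemma lip_class_rescale_diff:
  fixes q :: "'e::euclidean_space \<Rightarrow> real"
  assumes U: "open U" and r: "cball P r \<subseteq> U" "0 \<le> r" and R: "0 < R" and q: "Ck_on (Suc (Suc n)) U q"
  shows "\<exists>M>0. \<forall>\<delta>. 0 < \<delta> \<longrightarrow> \<delta> \<le> 1 \<longrightarrow> \<delta> * R \<le> r \<longrightarrow>
    lip_class (Suc n) R (M * \<delta>) (\<lambda>w. q (P + \<delta> *\<^sub>R w) - q P)"
proof -
  obtain M where M: "0 < M" 
    "\<And>x y. x \<in> cball P r \<Longrightarrow> y \<in> cball P r \<Longrightarrow> \<bar>q x - q y\<bar> \<le> M * norm (x - y)"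
    using Ck_on_cball_bounds[OF U q r(1)] by metis
  let ?D = "\<lambda>l x. frechet_derivative q (at x) l"
  have "Ck_on (Suc n) U (?D l)" for l using q by (subst (asm) Ck_on.simps(2)) blast
  then have "\<exists>M>0. \<forall>\<delta> a. 0 < \<delta> \<longrightarrow> \<delta> \<le> 1 \<longrightarrow> \<delta> * R \<le> r \<longrightarrow> \<bar>a\<bar> \<le> \<delta> \<longrightarrow>
    lip_class n R (M * \<delta>) (\<lambda>w. a * ?D l (P + \<delta> *\<^sub>R w))" for l by (rule lip_class_rescale[OF U r(1) R])
  then obtain Ml where Ml: "\<And>l. 0 < Ml l" "\<And>l \<delta> a. 0 < \<delta> \<Longrightarrow> \<delta> \<le> 1 \<Longrightarrow> \<delta> * R \<le> r \<Longrightarrow> \<bar>a\<bar> \<le> \<delta> \<Longrightarrow>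
    lip_class n R (Ml l * \<delta>) (\<lambda>w. a * ?D l (P + \<delta> *\<^sub>R w))" by metis
  define K where "K = M * (1 + R) + sum Ml Basis"
  have s0: "0 \<le> sum Ml Basis" by (rule sum_nonneg[OF less_imp_le[OF Ml(1)]])
  have MR: "M \<le> M * (1 + R)" "M * R \<le> M * (1 + R)" "0 < M * (1 + R)" using M(1) R by (auto simp: algebra_simps add_pos_pos)
  have K: "M \<le> K" "M * R \<le> K" "0 < K" using s0 MR by (auto simp: K_def)
  have Kl: "Ml l \<le> K" if "l \<in> Basis" for l
    unfolding K_def using member_le_sum[OF that, of Ml, OF less_imp_le[OF Ml(1)] finite_Basis] MR(3) by linarith
  have "lip_class (Suc n) R (K * \<delta>) (\<lambda>w. q (P + \<delta> *\<^sub>R w) - q P)"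
    if \<delta>: "0 < \<delta>" "\<delta> \<le> 1" "\<delta> * R \<le> r" for \<delta>
    unfolding lip_class.simps(2)
  proof (intro conjI ballI exI[of _ "\<lambda>l w. \<delta> * ?D l (P + \<delta> *\<^sub>R w)"])
    fix v :: 'e assume v: "v \<in> ball 0 R"
    note vb = rescale_in_cball[OF v \<delta>(1,3), of P]
    have Pb: "P \<in> cball P r" using r(2) by simp
    have "\<bar>q (P + \<delta> *\<^sub>R v) - q P\<bar> \<le> M * (\<delta> * norm v)" using M(2)[OF vb Pb] \<delta>(1) by simp
    also have "\<dots> \<le> M * (\<delta> * R)" using v M(1) \<delta> by (intro mult_left_mono) auto
    also have "\<dots> \<le> K * \<delta>" using mult_right_mono[OF K(2), of \<delta>] \<delta> by (simp add: mult_ac)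
    finally show "\<bar>q (P + \<delta> *\<^sub>R v) - q P\<bar> \<le> K * \<delta>" .
    show "\<bar>q (P + \<delta> *\<^sub>R v) - q P - (q (P + \<delta> *\<^sub>R w) - q P)\<bar> \<le> K * \<delta> * norm (v - w)" if w: "w \<in> ball 0 R" for w
    proof -
      have "\<bar>q (P + \<delta> *\<^sub>R v) - q (P + \<delta> *\<^sub>R w)\<bar> \<le> M * (\<delta> * norm (v - w))"
        using M(2)[OF vb rescale_in_cball[OF w \<delta>(1,3), of P]] unfolding rescale_norm[OF \<delta>(1)] .
      also have "\<dots> \<le> K * (\<delta> * norm (v - w))" using K(1) \<delta> by (intro mult_right_mono) auto
      finally show ?thesis by (simp add: mult.assoc)
    qed
    have "P + \<delta> *\<^sub>R v \<in> U" by (rule subsetD[OF r(1) vb])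
    from rescale_has_derivative[OF Ck_on_has_derivative[OF q this], of 1 "- q P"]
    show "((\<lambda>w. q (P + \<delta> *\<^sub>R w) - q P) has_derivative (\<lambda>h. \<Sum>l\<in>Basis. \<delta> * ?D l (P + \<delta> *\<^sub>R v) * (h \<bullet> l))) (at v)" by simp
  next
    fix l :: 'e assume l: "l \<in> Basis"
    from Ml(2)[OF \<delta>, of \<delta> l]
    show "lip_class n R (K * \<delta>) (\<lambda>w. \<delta> * ?D l (P + \<delta> *\<^sub>R w))"
      by (rule lip_class_mono) (use Kl[OF l] \<delta> in simp_all)
  qed
  then show ?thesis using K(3) by blast
qed

lemma small_field_rescale:
  fixes T :: "'e::euclidean_space \<Rightarrow> 'e \<Rightarrow> 'e"
  assumes U: "open U" "P \<in> U" and R: "0 < R" and lin: "\<And>x. x \<in> U \<Longrightarrow> linear (T x)"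
    and sm: "\<And>v. smooth_on U (\<lambda>x. T x v)"
  obtains M \<delta>0 where "0 < M" "0 < \<delta>0"
    "\<And>\<delta>. 0 < \<delta> \<Longrightarrow> \<delta> \<le> \<delta>0 \<Longrightarrow> small_field R (M * \<delta>) (\<lambda>w v. T (P + \<delta> *\<^sub>R w) v - T P v)"
proof -
  obtain r where r: "0 < r" "cball P r \<subseteq> U" using U open_contains_cball by blast
  have "\<exists>M>0. \<forall>\<delta>. 0 < \<delta> \<longrightarrow> \<delta> \<le> 1 \<longrightarrow> \<delta> * R \<le> r \<longrightarrow>
    lip_class 2 R (M * \<delta>) (\<lambda>w. T (P + \<delta> *\<^sub>R w) j \<bullet> i - T P j \<bullet> i)" for i j
    unfolding numeral_2_eq_2
    by (rule lip_class_rescale_diff[OF U(1) r(2) _ R, where q="\<lambda>x. T x j \<bullet> i"])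
      (use r Ck_on_linear[OF bounded_linear_inner_left U(1) smooth_onD[OF sm]] in auto)
  then obtain Mi where Mi: "\<And>i j. 0 < Mi i j" "\<And>i j \<delta>. 0 < \<delta> \<Longrightarrow> \<delta> \<le> 1 \<Longrightarrow> \<delta> * R \<le> r \<Longrightarrow>
    lip_class 2 R (Mi i j * \<delta>) (\<lambda>w. T (P + \<delta> *\<^sub>R w) j \<bullet> i - T P j \<bullet> i)" by metis
  define M where "M = (\<Sum>i\<in>Basis. \<Sum>j\<in>Basis. Mi i j) + 1"
  have nn: "0 \<le> Mi i j" for i j using Mi(1) less_imp_le by blast
  have M: "Mi i j \<le> M" if "i \<in> Basis" "j \<in> Basis" for i j
    using member_le_sum[OF that(2), of "Mi i"] member_le_sum[OF that(1), of "\<lambda>i. \<Sum>j\<in>Basis. Mi i j"] nn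
    by (fastforce simp: M_def sum_nonneg)
  show ?thesis
  proof (rule that[of M "min 1 (r / R)"])
    show "0 < M" unfolding M_def using nn by (intro add_nonneg_pos sum_nonneg) auto
    show "0 < min 1 (r / R)" using r R by simp
    fix \<delta> :: real assume \<delta>: "0 < \<delta>" "\<delta> \<le> min 1 (r / R)"
    then have \<delta>': "0 < \<delta>" "\<delta> \<le> 1" "\<delta> * R \<le> r" using R by (auto simp: field_simps)
    show "small_field R (M * \<delta>) (\<lambda>w v. T (P + \<delta> *\<^sub>R w) v - T P v)"
      unfolding small_field_def
    proof (intro conjI ballI)
      fix w :: 'e assume "w \<in> ball 0 R"
      from rescale_in_cball[OF this \<delta>'(1,3)] r have "P + \<delta> *\<^sub>R w \<in> U" by blast
      then show "linear (\<lambda>v. T (P + \<delta> *\<^sub>R w) v - T P v)" by (intro linear_compose_sub lin U(2))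
    next
      fix i j :: 'e assume ij: "i \<in> Basis" "j \<in> Basis"
      show "lip_class 2 R (M * \<delta>) (\<lambda>w. (T (P + \<delta> *\<^sub>R w) j - T P j) \<bullet> i)"
        unfolding inner_diff_left
        by (rule lip_class_mono[OF Mi(2)[OF \<delta>', of i j]]) (use M[OF ij] \<delta>' in simp)
    qed
  qed
qed

section \<open>Totally real subspaces\<close>

text \<open>
  By dimension the space is the direct sum of \<open>L\<close> and \<open>J0 ` L\<close>, and the conjugation changes the sign on the
  second summand.
\<close>

lemma conj_space_totally_real:
  fixes J0 :: "'e::euclidean_space \<Rightarrow> 'e"
  assumes J0: "linear J0" "\<And>v. J0 (J0 v) = - v" and L: "subspace L" "2 * dim L = DIM('e)"
    and tr: "\<And>l. l \<in> L \<Longrightarrow> J0 l \<in> L \<Longrightarrow> l = 0"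
  obtains cj where "conj_space J0 cj" "\<And>v. cj v = v \<longleftrightarrow> v \<in> L"
proof -
  have inj: "inj J0" using J0(2) by (metis injI neg_equal_iff_equal)
  have sJ: "subspace (J0 ` L)" by (rule linear_subspace_image[OF J0(1) L(1)])
  have int: "L \<inter> J0 ` L = {0}"
  proof
    show "L \<inter> J0 ` L \<subseteq> {0}" using tr linear_0[OF J0(1)] by auto
    show "{0} \<subseteq> L \<inter> J0 ` L" using subspace_0[OF L(1)] subspace_0[OF sJ] by simp
  qed
  have "dim (J0 ` L) = dim L"
    by (rule dim_image_eq[OF J0(1)]) (use inj in \<open>auto intro: inj_on_subset\<close>)
  then have "dim {x + y |x y. x \<in> L \<and> y \<in> J0 ` L} = DIM('e)"
    using dim_sums_Int[OF L(1) sJ] L(2) int by simp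
  then have "span {x + y |x y. x \<in> L \<and> y \<in> J0 ` L} = UNIV" by (simp add: dim_eq_full)
  then have full: "{x + y |x y. x \<in> L \<and> y \<in> J0 ` L} = UNIV"
    using span_eq_iff[THEN iffD2, OF subspace_sums[OF L(1) sJ]] by simp
  have ex: "\<exists>l m. l \<in> L \<and> m \<in> L \<and> v = l + J0 m" for v
  proof -
    have "v \<in> {x + y |x y. x \<in> L \<and> y \<in> J0 ` L}" unfolding full by simp
    then show ?thesis by blast
  qed
  have uniq: "l = l' \<and> m = m'" if "l \<in> L" "m \<in> L" "l' \<in> L" "m' \<in> L" "l + J0 m = l' + J0 m'" for l m l' m'
  proof -
    have "J0 (m - m') = l' - l" using that(5) by (simp add: linear_diff[OF J0(1)] algebra_simps)
    then have "m - m' = 0" using tr[of "m - m'"] subspace_diff[OF L(1)] that by metis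
    then show ?thesis using that(5) by simp
  qed
  define cj where "cj v = (THE w. \<exists>l m. l \<in> L \<and> m \<in> L \<and> v = l + J0 m \<and> w = l - J0 m)" for v
  have cj: "cj (l + J0 m) = l - J0 m" if "l \<in> L" "m \<in> L" for l m
    unfolding cj_def using that uniq by (intro the_equality) (blast, metis)
  show ?thesis
  proof (rule that)
    show "conj_space J0 cj"
    proof (rule conj_space.intro)
      show "linear J0" by (rule J0)
      show "J0 (J0 v) = - v" for v by (rule J0)
      show "linear cj"
      proof (rule linearI)
        fix v w :: 'e and a :: real
        obtain l m l' m' where v: "l \<in> L" "m \<in> L" "v = l + J0 m" "l' \<in> L" "m' \<in> L" "w = l' + J0 m'"
          using ex[of v] ex[of w] by blast
        have "cj (v + w) = cj ((l + l') + J0 (m + m'))" by (simp add: v linear_add[OF J0(1)] algebra_simps)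
        also have "\<dots> = (l + l') - J0 (m + m')" by (intro cj subspace_add[OF L(1)] v)
        finally show "cj (v + w) = cj v + cj w"
          unfolding v(3,6) cj[OF v(1,2)] cj[OF v(4,5)] by (simp add: linear_add[OF J0(1)])
        have "cj (a *\<^sub>R v) = cj (a *\<^sub>R l + J0 (a *\<^sub>R m))" by (simp add: v linear_scale[OF J0(1)] algebra_simps)
        also have "\<dots> = a *\<^sub>R l - J0 (a *\<^sub>R m)" by (intro cj subspace_scale[OF L(1)] v)
        finally show "cj (a *\<^sub>R v) = a *\<^sub>R cj v"
          unfolding v(3) cj[OF v(1,2)] by (simp add: linear_scale[OF J0(1)] algebra_simps)
      qed
      fix v :: 'e
      obtain l m where v: "l \<in> L" "m \<in> L" "v = l + J0 m" using ex[of v] by blast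
      have 1: "cj v = l + J0 (- m)" using cj[OF v(1,2)] v(3) by (simp add: linear_neg[OF J0(1)])
      show "cj (cj v) = v"
        unfolding 1 cj[OF v(1) subspace_neg[OF L(1) v(2)]] by (simp add: v(3) linear_neg[OF J0(1)])
      have "cj (J0 v) = cj (- m + J0 l)" by (simp add: v(3) linear_add[OF J0(1)] J0(2))
      also have "\<dots> = - m - J0 l" by (intro cj subspace_neg[OF L(1)] v)
      finally show "cj (J0 v) = - J0 (cj v)"
        by (simp add: 1 linear_add[OF J0(1)] linear_diff[OF J0(1)] linear_neg[OF J0(1)] J0(2))
    qed
    fix v
    obtain l m where v: "l \<in> L" "m \<in> L" "v = l + J0 m" using ex[of v] by blast
    show "cj v = v \<longleftrightarrow> v \<in> L"
    proof
      assume "cj v = v"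
      then have "J0 m = - J0 m" using cj[OF v(1,2)] v(3) by simp
      then have "J0 m = 0" by (simp add: eq_neg_iff_add_eq_0 flip: scaleR_2)
      then show "v \<in> L" using v by simp
    next
      assume "v \<in> L"
      then show "cj v = v" using cj[of v 0] subspace_0[OF L(1)] linear_0[OF J0(1)] by simp
    qed
  qed
qed

section \<open>Small discs half-attached to a totally real submanifold\<close>

text \<open>
  A map of the strip into \<open>U\<close> that is complex for the structure \<open>T\<close>, has its lower edge in the fixed
  space of \<open>cj\<close>, and descends linearly below the hypersurface \<open>r = 0\<close> over the part of the strip
  that contains the half disc.
\<close>

definition attached_half_disc ::
  "'e::euclidean_space set \<Rightarrow> ('e \<Rightarrow> 'e \<Rightarrow> 'e) \<Rightarrow> ('e \<Rightarrow> 'e) \<Rightarrow> ('e \<Rightarrow> real) \<Rightarrow> (real \<times> real \<Rightarrow> 'e) \<Rightarrow> bool" where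
  "attached_half_disc U T cj r G \<longleftrightarrow> (\<exists>Gx Gy M b. 0 < M \<and> 0 < b \<and>
     (\<forall>z\<in>UNIV \<times> {0..1}. (G has_derivative (\<lambda>(s, t). s *\<^sub>R Gx z + t *\<^sub>R Gy z)) (at z within UNIV \<times> {0..1})) \<and>
     continuous_on (UNIV \<times> {0..1}) Gx \<and> continuous_on (UNIV \<times> {0..1}) Gy \<and>
     (\<forall>z\<in>UNIV \<times> {0..1}. G z \<in> U \<and> Gy z = T (G z) (Gx z)) \<and>
     (\<forall>x. cj (G (x, 0)) = G (x, 0)) \<and>
     (\<forall>x\<in>{-1..1}. \<forall>y\<in>{0..1}. r (G (x, y)) \<le> - b * y) \<and> inj_on (\<lambda>x. G (x, 0)) {-1..1} \<and>
     (\<forall>z\<in>UNIV \<times> {0..1}. \<forall>w\<in>UNIV \<times> {0..1}. norm (G z - G w) \<le> M * norm (z - w)))"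

text \<open>
  Continuity of the directional derivatives in the finitely many coordinate directions is continuity of
  the derivative in norm.
\<close>

lemma frechet_derivative_near:
  fixes r :: "'e::euclidean_space \<Rightarrow> real"
  assumes U: "open U" "P \<in> U" and r: "Ck_on 1 U r" and e: "0 < e"
  obtains \<delta> :: real where "0 < \<delta>" "ball P \<delta> \<subseteq> U"
    "\<And>x v. x \<in> ball P \<delta> \<Longrightarrow> \<bar>frechet_derivative r (at x) v - frechet_derivative r (at P) v\<bar> \<le> e * norm v"
proof -
  let ?D = "\<lambda>x. frechet_derivative r (at x)"
  have r': "Ck_on (Suc 0) U r" using r by simp
  have lin: "linear (?D x)" if "x \<in> U" for x
    by (rule has_derivative_linear[OF Ck_on_has_derivative[OF r' that]])
  define h where "h x = (\<Sum>i\<in>Basis. \<bar>?D x i - ?D P i\<bar>)" for x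
  have "continuous_on U (\<lambda>x. ?D x i)" for i using r' by simp
  then have "continuous_on U h" unfolding h_def by (intro continuous_intros)
  then have "isCont h P" using U by (simp add: continuous_on_eq_continuous_at)
  moreover have "h P = 0" by (simp add: h_def)
  ultimately have "(h \<longlongrightarrow> 0) (nhds P)" by (metis continuous_within tendsto_at_iff_tendsto_nhds)
  then have "\<forall>\<^sub>F x in nhds P. h x < e" using order_tendstoD(2)[of h 0 "nhds P" e] e by simp
  moreover have "\<forall>\<^sub>F x in nhds P. x \<in> U" by (rule eventually_nhds_in_open[OF U])
  ultimately have "\<forall>\<^sub>F x in nhds P. h x < e \<and> x \<in> U" by eventually_elim simp
  then obtain \<delta> where \<delta>: "0 < \<delta>" "\<And>x. dist x P < \<delta> \<Longrightarrow> h x < e \<and> x \<in> U"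
    unfolding eventually_nhds_metric by blast
  have near: "h x < e" "x \<in> U" if "x \<in> ball P \<delta>" for x
    using \<delta>(2)[of x] that by (simp_all add: dist_commute)
  show ?thesis
  proof (rule that[OF \<delta>(1)])
    show "ball P \<delta> \<subseteq> U" using near by blast
    fix x v assume x: "x \<in> ball P \<delta>"
    have ex: "?D y v = (\<Sum>i\<in>Basis. (v \<bullet> i) * ?D y i)" if "y \<in> U" for y
    proof -
      have "?D y v = ?D y (\<Sum>i\<in>Basis. (v \<bullet> i) *\<^sub>R i)" by (simp only: euclidean_representation)
      then show ?thesis by (simp add: linear_sum[OF lin[OF that]] linear_scale[OF lin[OF that]])
    qed
    have "?D x v - ?D P v = (\<Sum>i\<in>Basis. (v \<bullet> i) * (?D x i - ?D P i))"
      unfolding ex[OF near(2)[OF x]] ex[OF U(2)] by (simp add: sum_subtractf right_diff_distrib)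
    also have "\<bar>\<dots>\<bar> \<le> (\<Sum>i\<in>Basis. \<bar>(v \<bullet> i) * (?D x i - ?D P i)\<bar>)" by (rule sum_abs)
    also have "\<dots> \<le> (\<Sum>i\<in>Basis. norm v * \<bar>?D x i - ?D P i\<bar>)"
      unfolding abs_mult by (intro sum_mono mult_right_mono Basis_le_norm) auto
    also have "\<dots> = norm v * h x" by (simp add: h_def sum_distrib_left)
    also have "\<dots> \<le> norm v * e" using near(1)[OF x] by (intro mult_left_mono) auto
    finally show "\<bar>?D x v - ?D P v\<bar> \<le> e * norm v" by (simp add: mult.commute)
  qed
qed

lemma derivative_zero_of_max:
  fixes r :: "'e::real_normed_vector \<Rightarrow> real"
  assumes U: "open U" "P \<in> U" and d: "(r has_derivative l) (at P)"
    and le: "\<And>t. P + t *\<^sub>R v \<in> U \<Longrightarrow> r (P + t *\<^sub>R v) \<le> r P"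
  shows "l v = 0"
proof -
  obtain e where e: "0 < e" "ball P e \<subseteq> U" using U openE by blast
  have lin: "linear l" by (rule has_derivative_linear[OF d])
  have "((\<lambda>t. P + t *\<^sub>R v) has_derivative (\<lambda>t. t *\<^sub>R v)) (at (0::real))" by (auto intro!: derivative_eq_intros)
  then have "((\<lambda>t. r (P + t *\<^sub>R v)) has_derivative (\<lambda>t. l (t *\<^sub>R v))) (at (0::real))"
    by (rule has_derivative_compose) (use d in simp)
  then have "DERIV (\<lambda>t. r (P + t *\<^sub>R v)) 0 :> l v"
    unfolding has_field_derivative_def by (rule has_derivative_eq_rhs) (auto simp: linear_scale[OF lin])
  then show ?thesis
  proof (rule DERIV_local_max)
    show "0 < e / (norm v + 1)" using e by (simp add: add_nonneg_pos)
    show "\<forall>t. \<bar>0 - t\<bar> < e / (norm v + 1) \<longrightarrow> r (P + t *\<^sub>R v) \<le> r (P + 0 *\<^sub>R v)"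
    proof (intro allI impI)
      fix t assume "\<bar>0 - t\<bar> < e / (norm v + 1)"
      then have "\<bar>t\<bar> * (norm v + 1) < e" by (simp add: pos_less_divide_eq add_nonneg_pos)
      then have "\<bar>t\<bar> * norm v < e" by (simp add: distrib_left)
      then have "P + t *\<^sub>R v \<in> ball P e" by (simp add: dist_norm)
      then show "r (P + t *\<^sub>R v) \<le> r (P + 0 *\<^sub>R v)" using le e by auto
    qed
  qed
qed

lemma cos_one_pos: "0 < cos (1::real)"
  by (rule cos_gt_zero_pi) (use pi_gt3 in auto)

lemma cos_strip_bounds:
  assumes y: "0 \<le> y" "y \<le> 1"
  shows "cmod (cos (Complex x y)) \<le> 2 * exp 1"
    and "\<bar>x\<bar> \<le> 1 \<Longrightarrow> cos 1 \<le> Re (cos (Complex x y))"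
proof -
  have e: "exp y \<le> exp 1" "exp (- y) \<le> exp 1" "0 < exp (- y)" "0 < exp y" using y by auto
  have half: "\<bar>(p + m) / 2\<bar> \<le> E" "\<bar>(m - p) / 2\<bar> \<le> E"
    if "p \<le> E" "m \<le> E" "0 < m" "0 < p" for p m E :: real
    using that by (simp_all add: abs_le_iff)
  note h = half[OF e]
  have re: "Re (cos (Complex x y)) = cos x * ((exp y + exp (- y)) / 2)" by (simp add: Re_cos)
  have im: "Im (cos (Complex x y)) = sin x * ((exp (- y) - exp y) / 2)" by (simp add: Im_cos)
  have "\<bar>Re (cos (Complex x y))\<bar> \<le> 1 * exp 1"
    unfolding re abs_mult by (intro mult_mono h) simp_all
  moreover have "\<bar>Im (cos (Complex x y))\<bar> \<le> 1 * exp 1"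
    unfolding im abs_mult by (intro mult_mono h) simp_all
  ultimately show "cmod (cos (Complex x y)) \<le> 2 * exp 1"
    using cmod_le[of "cos (Complex x y)"] by linarith
  assume x: "\<bar>x\<bar> \<le> 1"
  have "cos 1 \<le> cos \<bar>x\<bar>" by (rule cos_monotone_0_pi_le) (use x pi_gt3 in auto)
  then have c: "cos 1 \<le> cos x" by simp
  have "1 \<le> (exp y + exp (- y)) / 2" using cosh_real_ge_1[of y] by (simp add: cosh_def)
  then have "cos x * 1 \<le> cos x * ((exp y + exp (- y)) / 2)"
    using c cos_one_pos by (intro mult_left_mono) auto
  then show "cos 1 \<le> Re (cos (Complex x y))" unfolding re using c by simp
qed

context conj_space
begin

lemma cj_disc_velocity: "cj (disc_velocity y0 Z) = disc_velocity y0 Z"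
  by (simp add: disc_velocity_def linear_neg[OF lin_cj] linear_scale[OF lin_cj] cj_J0 linear_diff[OF lin_cj]
      linear_diff[OF lin_J0] scaleR_diff_right)

lemma norm_disc_velocity: 
  assumes y0: "0 < y0" and Z: "norm Z \<le> 1"
  shows "norm (disc_velocity y0 Z) \<le> (1 / (2 * sinh y0)) * (cmb * (1 + cmb))"
proof -
  have "norm (Z - cj Z) \<le> norm Z + norm (cj Z)" by (rule norm_triangle_ineq4)
  also have "\<dots> \<le> 1 + cmb" using Z norm_cj_cmb[of Z] mult_left_mono[OF Z, of cmb] cmb_ge_1 by linarith
  finally have 1: "norm (Z - cj Z) \<le> 1 + cmb" .
  have "norm (J0 (Z - cj Z)) \<le> cmb * norm (Z - cj Z)"
    using norm_J0_cmb[of "Z - cj Z"] norm_ge_zero[of "Z - cj Z"] by linarith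
  also have "\<dots> \<le> cmb * (1 + cmb)" using 1 cmb_ge_1 by (intro mult_left_mono) auto
  finally show ?thesis using y0 unfolding disc_velocity_def by (simp add: divide_right_mono)
qed

text \<open>
  For a functional that vanishes on the fixed space of the conjugation, only the component of \<open>Z\<close>
  transversal to this space matters, and \<open>J0\<close> of the velocity is that component up to a factor.
\<close>

lemma functional_disc_velocity:
  assumes l: "linear l" "\<And>v. cj v = v \<Longrightarrow> l v = (0::real)" and y0: "0 < y0"
  shows "l (J0 (disc_velocity y0 Z)) = l Z / sinh y0"
proof -
  have "cj (Z + cj Z) = Z + cj Z" by (simp add: linear_add[OF lin_cj] add.commute)
  then have "l (Z + cj Z) = 0" by (rule l(2))
  then have 1: "l (cj Z) = - l Z" by (simp add: linear_add[OF l(1)])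
  have "J0 (disc_velocity y0 Z) = (1 / (2 * sinh y0)) *\<^sub>R (Z - cj Z)"
    by (simp add: disc_velocity_def linear_scale[OF lin_J0] linear_neg[OF lin_J0] scaleR_diff_right)
  then show ?thesis using y0 1 by (simp add: linear_scale[OF l(1)] linear_diff[OF l(1)])
qed

lemma functional_cm:
  assumes l: "linear l" "\<And>v. cj v = v \<Longrightarrow> l v = (0::real)" and d: "cj d = d"
  shows "l (J0 (cm z d)) = Re z * l (J0 d)"
  by (simp add: cm_def linear_add[OF lin_J0] linear_scale[OF lin_J0] linear_diff[OF l(1)] linear_scale[OF l(1)] l(2)[OF d])

text \<open>
  The disc for the dilated structure with centre \<open>(Z - P) / \<delta>\<close>, \<open>\<delta> = norm (Z - P)\<close>, is scaled back. Let \<open>l\<close> be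
  the derivative of \<open>r\<close> at \<open>P\<close>; it vanishes on the fixed space of \<open>cj\<close>, where \<open>r\<close> has its maximum at \<open>P\<close>.
  For the unperturbed disc, \<open>l\<close> of the \<open>y\<close>-derivative is \<open>Re (cos \<zeta>) * l (J0 d)\<close>, which is negative and
  bounded away from 0 for \<open>\<bar>x\<bar> \<le> 1\<close>. The same functional, applied to \<open>J0\<close> of the \<open>x\<close>-derivative,
  shows that the lower edge is injective. Both signs survive perturbations of size \<open>O(\<delta>)\<close>.
\<close>

theorem attached_disc_below:
  fixes T :: "'e \<Rightarrow> 'e \<Rightarrow> 'e" and r :: "'e \<Rightarrow> real"
  assumes y0: "0 < y0" "y0 \<le> 1" and U: "open U" "P \<in> U"
    and T: "\<And>x. x \<in> U \<Longrightarrow> linear (T x)" "\<And>v. smooth_on U (\<lambda>x. T x v)" "T P = J0"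
    and r: "Ck_on 1 U r" "\<And>x. x \<in> U \<Longrightarrow> cj x = x \<Longrightarrow> r x \<le> 0" and P: "cj P = P" "r P = 0"
    and a: "0 < a"
  shows "\<exists>\<delta>0>0. \<forall>Z. 0 < norm (Z - P) \<longrightarrow> norm (Z - P) < \<delta>0 \<longrightarrow> r Z \<le> - a * norm (Z - P) \<longrightarrow>
    (\<exists>G. attached_half_disc U T cj r G \<and> G (0, y0) = Z)"
proof -
  let ?D = "\<lambda>x. frechet_derivative r (at x)"
  let ?S = "UNIV \<times> {0..1} :: (real \<times> real) set"
  have r': "Ck_on (Suc 0) U r" using r(1) by simp
  define l where "l = ?D P"
  have dr: "(r has_derivative ?D x) (at x)" if "x \<in> U" for x by (rule Ck_on_has_derivative[OF r' that])
  have dl: "(r has_derivative l) (at P)" unfolding l_def by (rule dr[OF U(2)])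
  have lin: "linear l" "bounded_linear l"
    using dl has_derivative_linear has_derivative_bounded_linear by blast+
  have ker: "l v = 0" if v: "cj v = v" for v
    by (rule derivative_zero_of_max[OF U dl])
      (use r(2) P in \<open>auto simp: linear_add[OF lin_cj] linear_scale[OF lin_cj] v\<close>)
  define N where "N = onorm l + 1"
  have N0: "0 < N" unfolding N_def using onorm_pos_le[OF lin(2)] by simp
  have N: "\<bar>l v\<bar> \<le> N * norm v" for v
    using onorm[OF lin(2), of v] norm_ge_zero[of v] unfolding N_def distrib_right real_norm_def by linarith
  obtain R C \<eta>0 :: real where R: "0 < R" and C: "0 \<le> C" and \<eta>0: "0 < \<eta>0"
    and disc: "\<And>\<eta> K Z. small_field R \<eta> K \<Longrightarrow> \<eta> \<le> \<eta>0 \<Longrightarrow> norm Z \<le> 1 \<Longrightarrow>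
    (\<exists>F Fx Fy :: real \<times> real \<Rightarrow> 'e.
       (\<forall>z\<in>?S. (F has_derivative (\<lambda>(s, t). s *\<^sub>R Fx z + t *\<^sub>R Fy z)) (at z within ?S)) \<and>
       continuous_on ?S Fx \<and> continuous_on ?S Fy \<and>
       (\<forall>z\<in>?S. F z \<in> ball 0 R \<and> Fy z = J0 (Fx z) + K (F z) (Fx z) \<and>
          norm (Fx z - cm (cos (Complex (fst z) (snd z))) (disc_velocity y0 Z)) \<le> C * \<eta> \<and>
          norm (Fy z - J0 (cm (cos (Complex (fst z) (snd z))) (disc_velocity y0 Z))) \<le> C * \<eta>) \<and>
       (\<forall>x. cj (F (x, 0)) = F (x, 0)) \<and> F (0, y0) = Z)"
    using attached_disc_exists[OF y0] by blast
  obtain Mf \<delta>f :: real where f: "0 < Mf" "0 < \<delta>f"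
    "\<And>\<delta>. 0 < \<delta> \<Longrightarrow> \<delta> \<le> \<delta>f \<Longrightarrow> small_field R (Mf * \<delta>) (\<lambda>w v. T (P + \<delta> *\<^sub>R w) v - T P v)"
    using small_field_rescale[OF U R T(1,2)] by blast
  have sh: "0 < sinh y0" using y0 by simp
  \<comment> \<open>For the unperturbed disc, \<open>l\<close> of the \<open>y\<close>-derivative is at most \<open>- c2\<close>; the factor \<open>cos 1\<close> is the minimum
    of the cosine on \<open>{-1..1}\<close>.\<close>
  define c2 where "c2 = cos 1 * ((a / 2) / sinh y0)"
  have c2: "0 < c2" unfolding c2_def using a sh cos_one_pos by simp
  define D1 where "D1 = (1 / (2 * sinh y0)) * (cmb * (1 + cmb))"
  define B where "B = cmb * (cmb * (2 * exp 1 * D1)) + cmb * C * \<eta>0 + 1"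
  have D1: "0 \<le> D1" unfolding D1_def using sh cmb_ge_1 by (intro mult_nonneg_nonneg) auto
  have cmb0: "0 \<le> cmb" using cmb_ge_1 by simp
  have B0: "0 < B" unfolding B_def using D1 cmb0 C \<eta>0 by (intro add_nonneg_pos add_nonneg_nonneg mult_nonneg_nonneg) auto
  have "0 < c2 / (4 * B)" using c2 B0 by simp
  then obtain \<delta>1 :: real where \<delta>1: "0 < \<delta>1" "ball P \<delta>1 \<subseteq> U"
    "\<And>x v. x \<in> ball P \<delta>1 \<Longrightarrow> \<bar>?D x v - ?D P v\<bar> \<le> c2 / (4 * B) * norm v"
    using frechet_derivative_near[OF U r(1)] by blast
  obtain \<delta>2 :: real where \<delta>2: "0 < \<delta>2"
    "\<And>x. norm (x - P) < \<delta>2 \<Longrightarrow> \<bar>r x - l (x - P)\<bar> \<le> a / 2 * norm (x - P)"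
  proof -
    have a2: "0 < a / 2" using a by simp
    then obtain \<delta> where "0 < \<delta>" "\<forall>x. norm (x - P) < \<delta> \<longrightarrow> norm (r x - r P - l (x - P)) \<le> a / 2 * norm (x - P)"
      using dl[unfolded has_derivative_at_alt] by blast
    then show ?thesis using that[of \<delta>] P(2) by simp
  qed
  \<comment> \<open>In this order: the disc exists, the dilated structure is a small field, the first-order expansion
    of \<open>r\<close> holds at \<open>Z\<close>, the disc stays where the derivative of \<open>r\<close> is close to \<open>l\<close>, and the perturbation
    of the disc changes the value of \<open>l\<close> by at most \<open>c2 / 4\<close>.\<close>
  define \<delta>0 where "\<delta>0 = min (min (\<eta>0 / Mf) \<delta>f) (min (min \<delta>2 (\<delta>1 / R)) (c2 / (4 * N * (cmb * C + 1) * Mf)))"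
  have CN: "0 < cmb * C + 1" using cmb0 C by (intro add_nonneg_pos mult_nonneg_nonneg) auto
  show ?thesis
  proof (intro exI[of _ \<delta>0] conjI allI impI)
    show "0 < \<delta>0" using \<eta>0 f \<delta>2 \<delta>1 R c2 N0 CN by (simp add: \<delta>0_def)
    fix Z :: 'e
    define \<delta> where "\<delta> = norm (Z - P)"
    assume "0 < norm (Z - P)" "norm (Z - P) < \<delta>0" and rZ: "r Z \<le> - a * norm (Z - P)"
    then have \<delta>: "0 < \<delta>" "\<delta> < \<delta>0" by (simp_all add: \<delta>_def)
    have s1: "Mf * \<delta> \<le> \<eta>0" "\<delta> \<le> \<delta>f" "\<delta> < \<delta>2" "\<delta> * R < \<delta>1" "N * (cmb * C + 1) * (Mf * \<delta>) \<le> c2 / 4"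
    proof -
      have "\<delta> < \<eta>0 / Mf" using \<delta> by (simp add: \<delta>0_def)
      then show "Mf * \<delta> \<le> \<eta>0" using f by (simp add: field_simps)
      show "\<delta> \<le> \<delta>f" "\<delta> < \<delta>2" using \<delta> by (simp_all add: \<delta>0_def)
      have "\<delta> < \<delta>1 / R" using \<delta> by (simp add: \<delta>0_def)
      then show "\<delta> * R < \<delta>1" using R by (simp_all add: field_simps)
      have "\<delta> < c2 / (4 * N * (cmb * C + 1) * Mf)" using \<delta> by (simp add: \<delta>0_def)
      moreover have "0 < 4 * N * (cmb * C + 1) * Mf" using N0 CN f by simp
      ultimately have "\<delta> * (4 * N * (cmb * C + 1) * Mf) < c2" by (simp only: pos_less_divide_eq)
      then show "N * (cmb * C + 1) * (Mf * \<delta>) \<le> c2 / 4" by (simp add: mult_ac)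
    qed
    define Z' where "Z' = (1 / \<delta>) *\<^sub>R (Z - P)"
    have Z': "norm Z' = 1" "P + \<delta> *\<^sub>R Z' = Z" using \<delta> by (simp_all add: Z'_def \<delta>_def)
    define d where "d = disc_velocity y0 Z'"
    have "norm Z' \<le> 1" using Z'(1) by simp
    from disc[OF f(3)[OF \<delta>(1) s1(2)] s1(1) this, folded d_def]
    obtain F Fx Fy :: "real \<times> real \<Rightarrow> 'e" where FF:
      "(\<forall>z\<in>?S. (F has_derivative (\<lambda>(s, t). s *\<^sub>R Fx z + t *\<^sub>R Fy z)) (at z within ?S)) \<and>
       continuous_on ?S Fx \<and> continuous_on ?S Fy \<and>
       (\<forall>z\<in>?S. F z \<in> ball 0 R \<and> Fy z = J0 (Fx z) + (T (P + \<delta> *\<^sub>R F z) (Fx z) - T P (Fx z)) \<and>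
          norm (Fx z - cm (cos (Complex (fst z) (snd z))) d) \<le> C * (Mf * \<delta>) \<and>
          norm (Fy z - J0 (cm (cos (Complex (fst z) (snd z))) d)) \<le> C * (Mf * \<delta>)) \<and>
       (\<forall>x. cj (F (x, 0)) = F (x, 0)) \<and> F (0, y0) = Z'"
      by (elim exE) (rule that)
    note F = FF[THEN conjunct1, THEN bspec]
      and cont = FF[THEN conjunct2, THEN conjunct1] FF[THEN conjunct2, THEN conjunct2, THEN conjunct1]
      and FS = FF[THEN conjunct2, THEN conjunct2, THEN conjunct2, THEN conjunct1, THEN bspec]
      and Fc = FF[THEN conjunct2, THEN conjunct2, THEN conjunct2, THEN conjunct2, THEN conjunct1, THEN spec]
      and FZ = FF[THEN conjunct2, THEN conjunct2, THEN conjunct2, THEN conjunct2, THEN conjunct2]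
    note FR = FS[THEN conjunct1] and FJ = FS[THEN conjunct2, THEN conjunct1]
      and Fxd = FS[THEN conjunct2, THEN conjunct2, THEN conjunct1]
      and Fyd = FS[THEN conjunct2, THEN conjunct2, THEN conjunct2]
    have Mf\<delta>: "0 \<le> Mf * \<delta>" using f \<delta> by simp
    have dn: "norm d \<le> D1" unfolding d_def D1_def by (rule norm_disc_velocity) (use y0 Z' in auto)
    have lZ: "l Z' \<le> - (a / 2)"
    proof -
      have "\<bar>r Z - l (Z - P)\<bar> \<le> a / 2 * \<delta>" using \<delta>2(2)[of Z] s1(3) by (simp add: \<delta>_def)
      then have "l (Z - P) \<le> r Z + a / 2 * \<delta>" by (simp only: abs_le_iff) linarith
      also have "\<dots> \<le> - (a / 2) * \<delta>" using rZ unfolding \<delta>_def[symmetric] by (simp add: field_simps)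
      finally have "l (Z - P) \<le> - (a / 2) * \<delta>" .
      then have "l (Z - P) / \<delta> \<le> - (a / 2)" using \<delta>(1) by (simp add: pos_divide_le_eq)
      then show ?thesis by (simp add: Z'_def linear_scale[OF lin(1)])
    qed
    have "l (J0 d) = l Z' / sinh y0" unfolding d_def by (rule functional_disc_velocity[OF lin(1) _ y0(1)]) (rule ker)
    then have lJ: "l (J0 d) \<le> - ((a / 2) / sinh y0)"
      using divide_right_mono[OF lZ, of "sinh y0"] sh by simp
    have lcos: "l (J0 (cm (cos (Complex x y)) d)) \<le> - c2" if "x \<in> {-1..1}" "y \<in> {0..1}" for x y
    proof -
      have "cos 1 \<le> Re (cos (Complex x y))" using cos_strip_bounds(2)[of y x] that by auto
      then have "cos 1 * ((a / 2) / sinh y0) \<le> Re (cos (Complex x y)) * (- l (J0 d))"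
        using lJ cos_one_pos a sh by (intro mult_mono) auto
      moreover have "l (J0 (cm (cos (Complex x y)) d)) = Re (cos (Complex x y)) * l (J0 d)"
        by (rule functional_cm[OF lin(1)]) (auto simp: d_def cj_disc_velocity intro: ker)
      ultimately show ?thesis unfolding c2_def by simp
    qed
    have lnear: "l w \<le> - (3 * c2 / 4)" 
      if xy: "x \<in> {-1..1}" "y \<in> {0..1}" and w: "norm (w - J0 (cm (cos (Complex x y)) d)) \<le> cmb * C * (Mf * \<delta>)" for w x y
    proof -
      let ?v = "J0 (cm (cos (Complex x y)) d)"
      have "l w - l ?v = l (w - ?v)" by (simp add: linear_diff[OF lin(1)])
      also have "\<dots> \<le> N * norm (w - ?v)" using N[of "w - ?v"] by simp
      also have "\<dots> \<le> N * (cmb * C * (Mf * \<delta>))" using w N0 by (intro mult_left_mono) auto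
      also have "\<dots> \<le> N * ((cmb * C + 1) * (Mf * \<delta>))" using Mf\<delta> N0 by (intro mult_left_mono mult_right_mono) auto
      also have "\<dots> \<le> c2 / 4" using s1(5) by (simp add: mult.assoc)
      finally show ?thesis using lcos[OF xy] by linarith
    qed
    have C1: "C * (Mf * \<delta>) \<le> cmb * C * (Mf * \<delta>)"
      using mult_right_mono[OF cmb_ge_1, of "C * (Mf * \<delta>)"] C Mf\<delta> by (simp add: mult.assoc)
    have C2: "cmb * C * (Mf * \<delta>) \<le> cmb * C * \<eta>0" using s1(1) C cmb0 by (intro mult_left_mono mult_nonneg_nonneg) auto
    have cmd: "norm (cm (cos (Complex (fst z) (snd z))) d) \<le> cmb * (2 * exp 1 * D1)" if z: "z \<in> ?S" for z
      using norm_cm[of "cos (Complex (fst z) (snd z))" d]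
        mult_left_mono[OF mult_mono[OF cos_strip_bounds(1)[of "snd z" "fst z"] dn] cmb0] z by auto
    have FxB: "norm (Fx z) \<le> B" if z: "z \<in> ?S" for z
    proof -
      let ?c = "cm (cos (Complex (fst z) (snd z))) d"
      have "norm (Fx z) \<le> norm (Fx z - ?c) + norm ?c" using norm_triangle_ineq[of "Fx z - ?c" ?c] by simp
      moreover have "norm ?c \<le> cmb * (cmb * (2 * exp 1 * D1))"
        using cmd[OF z] mult_right_mono[OF cmb_ge_1, of "cmb * (2 * exp 1 * D1)"] D1 cmb0
        by (simp only: mult_1 mult_nonneg_nonneg exp_ge_zero zero_le_numeral order_trans)
      ultimately show ?thesis using Fxd[OF z] C1 C2 by (simp add: B_def)
    qed
    have FyB: "norm (Fy z) \<le> B" if z: "z \<in> ?S" for z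
    proof -
      let ?c = "cm (cos (Complex (fst z) (snd z))) d"
      have "norm (Fy z) \<le> norm (Fy z - J0 ?c) + norm (J0 ?c)" using norm_triangle_ineq[of "Fy z - J0 ?c" "J0 ?c"] by simp
      moreover have "norm (J0 ?c) \<le> cmb * (cmb * (2 * exp 1 * D1))"
        using norm_J0_cmb[of ?c] norm_ge_zero[of ?c] mult_left_mono[OF cmd[OF z] cmb0] by linarith
      ultimately show ?thesis using Fyd[OF z] C1 C2 by (simp add: B_def)
    qed
    define G where "G z = P + \<delta> *\<^sub>R F z" for z
    have GP: "G z \<in> ball P (\<delta> * R)" if "z \<in> ?S" for z
      using FR[OF that] \<delta>(1) by (simp add: G_def dist_norm)
    have G1: "G z \<in> ball P \<delta>1" "G z \<in> U" if "z \<in> ?S" for z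
      using GP[OF that] s1(4) \<delta>1(2) by auto
    have dG: "(G has_derivative (\<lambda>(s, t). s *\<^sub>R (\<delta> *\<^sub>R Fx z) + t *\<^sub>R (\<delta> *\<^sub>R Fy z))) (at z within ?S)" if "z \<in> ?S" for z
      unfolding G_def
      by (rule has_derivative_eq_rhs, (rule derivative_intros F[OF that])+)
        (auto simp: fun_eq_iff algebra_simps)
    have TF: "T (G z) (Fx z) = Fy z" if "z \<in> ?S" for z using FJ[OF that] by (simp add: G_def T(3))
    have dGy: "((\<lambda>y. G (x, y)) has_derivative (\<lambda>t. t *\<^sub>R (\<delta> *\<^sub>R Fy (x, y)))) (at y within {0..1})" if y: "y \<in> {0..1}" for x y
    proof -
      have "((\<lambda>y. (x, y)) has_derivative (\<lambda>t. (0, t))) (at y within {0..1})" by (auto intro!: derivative_eq_intros)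
      then have "((\<lambda>y. G (x, y)) has_derivative (\<lambda>t. (\<lambda>(s, t). s *\<^sub>R (\<delta> *\<^sub>R Fx (x, y)) + t *\<^sub>R (\<delta> *\<^sub>R Fy (x, y))) (0, t))) (at y within {0..1})"
        by (rule has_derivative_in_compose) (rule has_derivative_subset[OF dG], use y in auto)
      then show ?thesis by simp
    qed
    have dGx: "((\<lambda>x. G (x, 0)) has_derivative (\<lambda>s. s *\<^sub>R (\<delta> *\<^sub>R Fx (x, 0)))) (at x within X)" for x X
    proof -
      have "((\<lambda>x. (x, 0::real)) has_derivative (\<lambda>s. (s, 0))) (at x within X)" by (auto intro!: derivative_eq_intros)
      then have "((\<lambda>x. G (x, 0)) has_derivative (\<lambda>s. (\<lambda>(s, t). s *\<^sub>R (\<delta> *\<^sub>R Fx (x, 0)) + t *\<^sub>R (\<delta> *\<^sub>R Fy (x, 0))) (s, 0))) (at x within X)"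
        by (rule has_derivative_in_compose) (rule has_derivative_subset[OF dG], auto)
      then show ?thesis by simp
    qed
    have "cj (G (x, 0)) = G (x, 0)" for x
      by (simp add: G_def linear_add[OF lin_cj] linear_scale[OF lin_cj] P Fc)
    note Gc = this
    have below: "r (G (x, y)) \<le> - (\<delta> * (c2 / 2)) * y" if x: "x \<in> {-1..1}" and y: "y \<in> {0..1}" for x y
    proof (cases "y = 0")
      case True
      then show ?thesis using r(2)[OF G1(2) Gc, of x] by simp
    next
      case False
      have "\<exists>t\<in>{0<..<y}. r (G (x, y)) - r (G (x, 0)) = ?D (G (x, t)) ((y - 0) *\<^sub>R (\<delta> *\<^sub>R Fy (x, t)))"
      proof (rule mvt_simple)
        show "0 < y" using False y by simp
        fix t assume t: "0 \<le> t" "t \<le> y"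
        then have t1: "t \<in> {0..1}" using y by simp
        have "((\<lambda>y. r (G (x, y))) has_derivative (\<lambda>s. ?D (G (x, t)) (s *\<^sub>R (\<delta> *\<^sub>R Fy (x, t))))) (at t within {0..1})"
          by (rule has_derivative_compose[OF dGy[OF t1] dr[OF G1(2)]]) (use t1 in simp)
        then show "((\<lambda>y. r (G (x, y))) has_derivative (\<lambda>s. ?D (G (x, t)) (s *\<^sub>R (\<delta> *\<^sub>R Fy (x, t))))) (at t within {0..y})"
          by (rule has_derivative_subset) (use y in auto)
      qed
      then obtain t where t: "t \<in> {0<..<y}" "r (G (x, y)) - r (G (x, 0)) = ?D (G (x, t)) (y *\<^sub>R (\<delta> *\<^sub>R Fy (x, t)))" by auto
      have t1: "t \<in> {0..1}" and tS: "(x, t) \<in> ?S" using t(1) y by auto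
      have lD: "linear (?D (G (x, t)))" by (rule has_derivative_linear[OF dr[OF G1(2)[OF tS]]])
      have "l (Fy (x, t)) \<le> - (3 * c2 / 4)" by (rule lnear[OF x t1]) (use Fyd[OF tS] C1 in simp)
      moreover have "\<bar>?D (G (x, t)) (Fy (x, t)) - l (Fy (x, t))\<bar> \<le> c2 / 4"
      proof -
        have "\<bar>?D (G (x, t)) (Fy (x, t)) - l (Fy (x, t))\<bar> \<le> c2 / (4 * B) * norm (Fy (x, t))"
          unfolding l_def by (rule \<delta>1(3)[OF G1(1)[OF tS]])
        also have "\<dots> \<le> c2 / (4 * B) * B" using FyB[OF tS] c2 B0 by (intro mult_left_mono) auto
        finally show ?thesis using B0 by simp
      qed
      ultimately have "?D (G (x, t)) (Fy (x, t)) \<le> - (c2 / 2)"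
        unfolding abs_le_iff by linarith
      then have "y * \<delta> * ?D (G (x, t)) (Fy (x, t)) \<le> y * \<delta> * (- (c2 / 2))"
        using y \<delta>(1) by (intro mult_left_mono) auto
      moreover have "r (G (x, y)) = r (G (x, 0)) + y * \<delta> * ?D (G (x, t)) (Fy (x, t))"
        using t(2) by (simp add: linear_scale[OF lD])
      moreover have "r (G (x, 0)) \<le> 0" by (rule r(2)[OF G1(2) Gc]) simp
      ultimately show ?thesis by (simp add: mult_ac)
    qed
    have inj: "inj_on (\<lambda>x. G (x, 0)) {-1..1}"
    proof (rule linorder_inj_onI)
      fix x1 x2 :: real assume x: "x1 < x2" "x1 \<in> {-1..1}" "x2 \<in> {-1..1}"
      have bl: "bounded_linear (\<lambda>v. l (J0 v))" by (rule bounded_linear_compose[OF lin(2) bl_J0])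
      have "\<exists>t\<in>{x1<..<x2}. l (J0 (G (x2, 0))) - l (J0 (G (x1, 0))) = l (J0 ((x2 - x1) *\<^sub>R (\<delta> *\<^sub>R Fx (t, 0))))"
        by (rule mvt_simple[OF x(1)]) (rule bounded_linear.has_derivative[OF bl dGx])
      then obtain t where t: "t \<in> {x1<..<x2}"
        "l (J0 (G (x2, 0))) - l (J0 (G (x1, 0))) = (x2 - x1) * \<delta> * l (J0 (Fx (t, 0)))"
        by (auto simp: linear_scale[OF lin_J0] linear_scale[OF lin(1)])
      have tS: "(t, 0) \<in> ?S" by simp
      have "l (J0 (Fx (t, 0))) \<le> - (3 * c2 / 4)"
      proof (rule lnear[of t 0])
        show "t \<in> {-1..1}" using t x by auto
        let ?w = "Fx (t, 0) - cm (cos (Complex t 0)) d"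
        have "norm (J0 ?w) \<le> cmb * norm ?w" using norm_J0_cmb[of ?w] norm_ge_zero[of ?w] by linarith
        also have "\<dots> \<le> cmb * (C * (Mf * \<delta>))" using Fxd[OF tS] cmb0 by (intro mult_left_mono) auto
        finally show "norm (J0 (Fx (t, 0)) - J0 (cm (cos (Complex t 0)) d)) \<le> cmb * C * (Mf * \<delta>)"
          by (simp add: linear_diff[OF lin_J0] mult.assoc)
      qed simp
      then have "l (J0 (Fx (t, 0))) < 0" using c2 by linarith
      then have "(x2 - x1) * \<delta> * l (J0 (Fx (t, 0))) < 0" using x(1) \<delta>(1) by (intro mult_pos_neg) auto
      then show "G (x1, 0) \<noteq> G (x2, 0)" using t(2) by auto
    qed auto
    have lipG: "norm (G z - G w) \<le> 2 * \<delta> * B * norm (z - w)" if "z \<in> ?S" "w \<in> ?S" for z w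
    proof (rule differentiable_bound[OF _ dG _ that])
      show "convex ?S" by (intro convex_Times convex_UNIV convex_real_interval)
      fix z assume z: "z \<in> ?S"
      show "onorm (\<lambda>(s, t). s *\<^sub>R (\<delta> *\<^sub>R Fx z) + t *\<^sub>R (\<delta> *\<^sub>R Fy z)) \<le> 2 * \<delta> * B"
      proof (rule onorm_le)
        fix h :: "real \<times> real"
        obtain s t where h: "h = (s, t)" by (cases h)
        have st: "\<bar>s\<bar> \<le> norm h" "\<bar>t\<bar> \<le> norm h" using norm_fst_le[of s t] norm_snd_le[of t s] by (auto simp: h)
        have "norm (s *\<^sub>R (\<delta> *\<^sub>R Fx z) + t *\<^sub>R (\<delta> *\<^sub>R Fy z)) \<le> \<bar>s\<bar> * (\<delta> * norm (Fx z)) + \<bar>t\<bar> * (\<delta> * norm (Fy z))"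
          using norm_triangle_ineq[of "s *\<^sub>R (\<delta> *\<^sub>R Fx z)" "t *\<^sub>R (\<delta> *\<^sub>R Fy z)"] \<delta>(1) by (simp add: abs_mult mult.assoc)
        also have "\<dots> \<le> norm h * (\<delta> * B) + norm h * (\<delta> * B)"
          using st FxB[OF z] FyB[OF z] \<delta>(1) by (intro add_mono mult_mono) auto
        finally show "norm ((\<lambda>(s, t). s *\<^sub>R (\<delta> *\<^sub>R Fx z) + t *\<^sub>R (\<delta> *\<^sub>R Fy z)) h) \<le> 2 * \<delta> * B * norm h"
          by (simp add: h mult_ac)
      qed
    qed
    show "\<exists>G. attached_half_disc U T cj r G \<and> G (0, y0) = Z"
      unfolding attached_half_disc_def
    proof (intro exI conjI ballI allI)
      show "0 < 2 * \<delta> * B" "0 < \<delta> * (c2 / 2)" using \<delta> B0 c2 by auto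
      show "continuous_on ?S (\<lambda>z. \<delta> *\<^sub>R Fx z)" "continuous_on ?S (\<lambda>z. \<delta> *\<^sub>R Fy z)"
        using cont by (auto intro: continuous_intros)
      show "\<delta> *\<^sub>R Fy z = T (G z) (\<delta> *\<^sub>R Fx z)" if "z \<in> ?S" for z
        using TF[OF that] linear_scale[OF T(1)[OF G1(2)[OF that]]] by simp
      show "G (0, y0) = Z" using Z'(2) FZ by (simp add: G_def)
    qed (use dG G1 Gc below inj lipG in auto)
  qed
qed

end

section \<open>Almost complex structures in charts\<close>

lemma J_values:
  assumes J: "almost_complex_structure A J" and v: "v \<in> tangent_space A p"
  shows "J p v \<in> tangent_space A p" "J p (J p v) = (\<lambda>c. - v c)"
    "J p (\<lambda>c. a *\<^sub>R v c) = (\<lambda>c. a *\<^sub>R J p v c)"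
    "w \<in> tangent_space A p \<Longrightarrow> J p (\<lambda>c. v c + w c) = (\<lambda>c. J p v c + J p w c)"
proof -
  note * = J[unfolded almost_complex_structure_def, THEN conjunct1, THEN spec, of p, THEN bspec, OF v]
  show "J p v \<in> tangent_space A p" by (rule *[THEN conjunct1])
  show "J p (J p v) = (\<lambda>c. - v c)" by (rule *[THEN conjunct2, THEN conjunct1])
  show "J p (\<lambda>c. a *\<^sub>R v c) = (\<lambda>c. a *\<^sub>R J p v c)" by (rule *[THEN conjunct2, THEN conjunct2, THEN conjunct1, THEN spec])
  show "w \<in> tangent_space A p \<Longrightarrow> J p (\<lambda>c. v c + w c) = (\<lambda>c. J p v c + J p w c)"
    by (rule *[THEN conjunct2, THEN conjunct2, THEN conjunct2, THEN bspec])
qed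

locale almost_complex_manifold = smooth_manifold A
  for A :: "('m::{t2_space,second_countable_topology}, 'e::euclidean_space) chart set" +
  fixes J :: "'m \<Rightarrow> ('m, 'e) tangent \<Rightarrow> ('m, 'e) tangent"
  assumes acs: "almost_complex_structure A J"
begin

definition chart_J :: "('m, 'e) chart \<Rightarrow> 'e \<Rightarrow> 'e \<Rightarrow> 'e" where
  "chart_J c x e = J (inv_chart c x) (coord_vec A c (inv_chart c x) e) c"

context
  fixes c x
  assumes c: "c \<in> A" and x: "x \<in> snd c ` fst c"
begin

lemma inv_chart_mem: "inv_chart c x \<in> fst c"
  using chart_facts(6)[OF c x] by simp

lemma J_coord_vec: "J (inv_chart c x) (coord_vec A c (inv_chart c x) e) = coord_vec A c (inv_chart c x) (chart_J c x e)"
  unfolding chart_J_def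
  by (rule tangent_eq_coord_vec[OF c inv_chart_mem J_values(1)[OF acs coord_vec_in_tangent_space[OF c inv_chart_mem]]])

lemma linear_chart_J: "linear (chart_J c x)"
proof (rule linearI)
  note T = coord_vec_in_tangent_space[OF c inv_chart_mem]
  show "chart_J c x (e + e') = chart_J c x e + chart_J c x e'" for e e'
    unfolding chart_J_def coord_vec_add[OF c inv_chart_mem] J_values(4)[OF acs T T] by simp
  show "chart_J c x (a *\<^sub>R e) = a *\<^sub>R chart_J c x e" for a e
    unfolding chart_J_def coord_vec_scaleR[OF c inv_chart_mem] J_values(3)[OF acs T] by simp
qed

lemma chart_J_chart_J: "chart_J c x (chart_J c x e) = - e"
proof -
  note T = coord_vec_in_tangent_space[OF c inv_chart_mem]
  have "chart_J c x (chart_J c x e) = J (inv_chart c x) (J (inv_chart c x) (coord_vec A c (inv_chart c x) e)) c"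
    by (simp only: J_coord_vec coord_vec_self[OF c inv_chart_mem])
  also have "\<dots> = - coord_vec A c (inv_chart c x) e c" unfolding J_values(2)[OF acs T] by simp
  finally show ?thesis by (simp add: coord_vec_self[OF c inv_chart_mem])
qed

end

lemma smooth_chart_J: "c \<in> A \<Longrightarrow> smooth_on (snd c ` fst c) (\<lambda>x. chart_J c x e)"
  unfolding chart_J_def
  using acs[unfolded almost_complex_structure_def, THEN conjunct2, THEN bspec, of c] by blast

text \<open>
  In a chart, a disc is \<open>J\<close>-complex as soon as its \<open>y\<close>-derivative is \<open>J\<close> of its \<open>x\<close>-derivative;
  precomposition with a holomorphic map preserves this.
\<close>

lemma J_complex_halfdisc:
  fixes G Gx Gy :: "real \<times> real \<Rightarrow> 'e"
  assumes c: "c \<in> A"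
    and dG: "\<And>z. z \<in> UNIV \<times> {0..1} \<Longrightarrow> (G has_derivative (\<lambda>(s, t). s *\<^sub>R Gx z + t *\<^sub>R Gy z)) (at z within UNIV \<times> {0..1})"
    and cont: "continuous_on (UNIV \<times> {0..1}) Gx" "continuous_on (UNIV \<times> {0..1}) Gy"
    and GJ: "\<And>z. z \<in> UNIV \<times> {0..1} \<Longrightarrow> G z \<in> snd c ` fst c \<and> Gy z = chart_J c (G z) (Gx z)"
  shows "J_complex_disc A J (inv_chart c \<circ> (\<lambda>w. G (Re (halfdisc w), Im (halfdisc w))))"
proof -
  let ?h = "\<lambda>w. (Re (halfdisc w), Im (halfdisc w))"
  define h' where "h' w = 2 * \<i> / (1 - w)\<^sup>2 / (csqrt (cayley w) * (csqrt (cayley w) + 1)\<^sup>2)" for w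
  have hd: "(halfdisc has_field_derivative h' w) (at w)" if "w \<in> ball 0 1" for w
    unfolding h'_def using halfdisc_deriv[of w] halfdisc_interior[of w] that by simp
  have conth': "continuous_on (ball 0 1) h'"
  proof (rule continuous_at_imp_continuous_on, rule ballI)
    fix w :: complex assume "w \<in> ball 0 1"
    then have w: "cmod w < 1" "w \<noteq> 1" "cayley w \<notin> \<real>\<^sub>\<le>\<^sub>0" using halfdisc_interior[of w] by auto
    have "(cmod w)\<^sup>2 < 1" using w by (simp add: abs_square_less_1)
    then have "0 < Im (cayley w)" using w by (simp add: cayley_Im)
    then have R: "0 < Re (csqrt (cayley w))" by (rule csqrt_upper)
    have "q \<noteq> 0 \<and> q + 1 \<noteq> 0" if "0 < Re q" for q using that by (auto simp: complex_eq_iff)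
    from this[OF R] have "csqrt (cayley w) \<noteq> 0" "csqrt (cayley w) + 1 \<noteq> 0" by blast+
    moreover have "isCont cayley w" by (rule DERIV_isCont[OF cayley_deriv[OF w(2)]])
    ultimately show "isCont h' w" unfolding h'_def using w by (intro continuous_intros isCont_csqrt') auto
  qed
  have hS: "?h w \<in> UNIV \<times> {0..1}" if "w \<in> ball 0 1" for w
    using halfdisc_interior(1,2)[of w] abs_Im_le_cmod[of "halfdisc w"] that by auto
  have conth: "continuous_on (ball 0 1) ?h"
    by (intro continuous_intros DERIV_continuous_on[OF has_field_derivative_at_within[OF hd]])
  let ?H = "\<lambda>w. G (?h w)"
  define D where "D w k = Re (h' w * k) *\<^sub>R Gx (?h w) + Im (h' w * k) *\<^sub>R Gy (?h w)" for w k
  have dH: "(?H has_derivative D w) (at w)" if w: "w \<in> ball 0 1" for w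
  proof -
    have "(halfdisc has_derivative (\<lambda>k. h' w * k)) (at w within ball 0 1)"
      using hd[OF w] by (simp add: has_field_derivative_def has_derivative_at_withinI)
    then have "(?h has_derivative (\<lambda>k. (Re (h' w * k), Im (h' w * k)))) (at w within ball 0 1)"
      by (intro has_derivative_Pair has_derivative_Re has_derivative_Im)
    then have "(?H has_derivative (\<lambda>k. (\<lambda>(s, t). s *\<^sub>R Gx (?h w) + t *\<^sub>R Gy (?h w)) (Re (h' w * k), Im (h' w * k)))) (at w within ball 0 1)"
      by (rule has_derivative_in_compose) (rule has_derivative_subset[OF dG[OF hS[OF w]]], use hS in blast)
    then have "(?H has_derivative D w) (at w within ball 0 1)" by (simp add: D_def[abs_def])
    then show ?thesis using at_within_open[OF w open_ball] by simp
  qed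
  have contG: "continuous_on (ball 0 1) (\<lambda>w. Gx (?h w))" "continuous_on (ball 0 1) (\<lambda>w. Gy (?h w))"
    by (rule continuous_on_compose2[OF cont(1) conth], use hS in blast)
      (rule continuous_on_compose2[OF cont(2) conth], use hS in blast)
  have C1: "Ck_on (Suc 0) (ball 0 1) ?H"
  proof (rule Ck_on_SucI[OF open_ball dH])
    show "Ck_on 0 (ball 0 1) (\<lambda>w. D w k)" for k
      unfolding D_def Ck_on.simps by (intro continuous_intros contG conth')
  qed
  have HU: "?H ` ball 0 1 \<subseteq> snd c ` fst c" using GJ hS by blast
  show ?thesis
    unfolding J_complex_disc_def
  proof (intro conjI ballI allI)
    show "Ck_map A 1 (ball 0 1) (inv_chart c \<circ> ?H)"
      using Ck_map_inv_chart[OF c open_ball C1 HU] by simp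
    fix w k :: complex assume w: "w \<in> ball 0 1"
    have z: "G (?h w) \<in> snd c ` fst c" "Gy (?h w) = chart_J c (G (?h w)) (Gx (?h w))" using GJ[OF hS[OF w]] by auto
    let ?T = "chart_J c (?H w)"
    note lin = linear_chart_J[OF c z(1)]
    have "?T (Gy (?h w)) = - Gx (?h w)" unfolding z(2) by (rule chart_J_chart_J[OF c z(1)])
    then have "?T (D w k) = D w (\<i> * k)"
      unfolding D_def linear_add[OF lin] linear_scale[OF lin] z(2)[symmetric] by (simp add: algebra_simps)
    moreover have "differential A (inv_chart c \<circ> ?H) w h = coord_vec A c (inv_chart c (?H w)) (D w h)" for h
      using differential_inv_chart[OF c open_ball w C1 HU, of h] frechet_derivative_at[OF dH[OF w], symmetric] by simp
    ultimately show "differential A (inv_chart c \<circ> ?H) w (\<i> * k) =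
        J ((inv_chart c \<circ> ?H) w) (differential A (inv_chart c \<circ> ?H) w k)"
      by (simp add: J_coord_vec[OF c z(1)])
  qed
qed

text \<open>
  In a slice chart, straight lines show that all vectors of the slice are tangent to \<open>E\<close>; total reality
  of \<open>E\<close> at \<open>p\<close> then is that of the slice.
\<close>

lemma totally_real_coordinates:
  assumes dim: "DIM('e) = 2 * n" and E: "submanifold A n E" "totally_real A J E" and p: "p \<in> E"
  obtains c cj where "c \<in> A" "p \<in> fst c" "conj_space (chart_J c (snd c p)) cj"
    "\<And>x. x \<in> snd c ` fst c \<Longrightarrow> cj x = x \<longleftrightarrow> inv_chart c x \<in> E"
proof -
  obtain c L where c: "c \<in> A" "p \<in> fst c" and L: "subspace L" "dim L = n" "snd c ` (E \<inter> fst c) = snd c ` fst c \<inter> L"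
    using E(1) p unfolding submanifold_def by blast
  let ?P = "snd c p" and ?U = "snd c ` fst c"
  have U: "open ?U" "?P \<in> ?U" using chart_facts(2)[OF c(1)] c(2) by auto
  have invP: "inv_chart c ?P = p" by (rule chart_facts(5)[OF c])
  have mem: "inv_chart c x \<in> E \<longleftrightarrow> x \<in> L" if x: "x \<in> ?U" for x
  proof
    assume "inv_chart c x \<in> E"
    then have "snd c (inv_chart c x) \<in> snd c ` (E \<inter> fst c)" using chart_facts(6)[OF c(1) x] by blast
    then show "x \<in> L" using L(3) chart_facts(6)[OF c(1) x] by auto
  next
    assume "x \<in> L"
    then have "x \<in> snd c ` (E \<inter> fst c)" using L(3) x by blast
    then obtain y where "y \<in> E \<inter> fst c" "x = snd c y" by blast
    then show "inv_chart c x \<in> E" using chart_facts(5)[OF c(1)] by auto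
  qed
  have PL: "?P \<in> L" using mem[OF U(2)] p invP by simp
  have tang: "coord_vec A c p v \<in> tangent_space_of A E p" if v: "v \<in> L" for v
  proof -
    obtain e where e: "0 < e" "ball ?P e \<subseteq> ?U" using U openE by blast
    define \<epsilon> where "\<epsilon> = e / (norm v + 1)"
    have \<epsilon>: "0 < \<epsilon>" using e by (simp add: \<epsilon>_def add_nonneg_pos)
    let ?S = "{-\<epsilon><..<\<epsilon>}"
    let ?F = "\<lambda>t::real. ?P + t *\<^sub>R v"
    have F: "?F t \<in> ?U" if "t \<in> ?S" for t
    proof -
      have "\<bar>t\<bar> < \<epsilon>" using that by auto
      then have "\<bar>t\<bar> * (norm v + 1) < e" unfolding \<epsilon>_def by (simp add: pos_less_divide_eq add_nonneg_pos)
      then have "\<bar>t\<bar> * norm v < e" by (simp add: distrib_left)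
      then show ?thesis using e(2) by (auto simp: dist_norm)
    qed
    have dF: "(?F has_derivative (\<lambda>s. s *\<^sub>R v)) (at t)" for t by (auto intro!: derivative_eq_intros)
    have Ck: "Ck_on k ?S ?F" for k
    proof (cases k)
      case 0
      then show ?thesis by (auto intro!: continuous_intros)
    next
      case (Suc j)
      show ?thesis unfolding Suc by (rule Ck_on_SucI[OF _ dF]) (auto intro: Ck_on_const)
    qed
    have FU: "?F ` ?S \<subseteq> ?U" using F by blast
    let ?\<gamma> = "inv_chart c \<circ> ?F"
    have "differential A ?\<gamma> 0 1 = coord_vec A c (inv_chart c (?F 0)) (frechet_derivative ?F (at 0) 1)"
      by (rule differential_inv_chart[OF c(1) _ _ Ck FU]) (use \<epsilon> in auto)
    then have d: "differential A ?\<gamma> 0 1 = coord_vec A c p v"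
      using frechet_derivative_at[OF dF[of 0], symmetric] by (simp add: invP)
    have "Ck_map A k ?S ?\<gamma>" for k by (rule Ck_map_inv_chart[OF c(1) _ Ck FU]) simp
    moreover have "?\<gamma> ` ?S \<subseteq> E"
      using mem[OF F] subspace_add[OF L(1) PL subspace_scale[OF L(1) v]] by auto
    moreover have "?\<gamma> 0 = p" by (simp add: invP)
    ultimately show ?thesis unfolding tangent_space_of_def d[symmetric] using \<epsilon> by blast
  qed
  let ?J = "chart_J c ?P"
  have J: "linear ?J" "\<And>v. ?J (?J v) = - v"
    by (rule linear_chart_J[OF c(1) U(2)], rule chart_J_chart_J[OF c(1) U(2)])
  have tr: "v = 0" if v: "v \<in> L" "?J v \<in> L" for v
  proof -
    have 1: "coord_vec A c p (?J v) = J p (coord_vec A c p v)" using J_coord_vec[OF c(1) U(2), of v] by (simp add: invP)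
    have "coord_vec A c p (?J v) \<in> tangent_space_of A E p \<inter> J p ` tangent_space_of A E p"
      using tang[OF v(2)] tang[OF v(1)] unfolding 1 by blast
    then have "coord_vec A c p (?J v) = (\<lambda>_. 0)" using E(2) p unfolding totally_real_def by blast
    then have "?J v = 0" using coord_vec_zero_iff[OF c] by blast
    then show ?thesis using J(2)[of v] linear_0[OF J(1)] by simp
  qed
  have "2 * dim L = DIM('e)" using L(2) dim by simp
  from conj_space_totally_real[OF J L(1) this tr] obtain cj where "conj_space ?J cj" "\<And>v. cj v = v \<longleftrightarrow> v \<in> L" by metis
  then show ?thesis using that[OF c] mem by blast
qed

end

section \<open>The boundary uniqueness theorem\<close>

lemma nontangential_extension_boundary:
  assumes "q \<notin> \<Omega>" "nontangential_extension A g \<Omega> \<kappa> u q < y" "1 < \<beta>"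
  shows "\<forall>\<^sub>F z in at q within approach_region A g \<Omega> \<kappa> \<beta> q. u z < y"
proof (rule Limsup_lessD)
  have "Limsup (at q within approach_region A g \<Omega> \<kappa> \<beta> q) u
      \<le> (SUP \<alpha>\<in>{1<..}. Limsup (at q within approach_region A g \<Omega> \<kappa> \<alpha> q) u)"
    by (rule SUP_upper) (use assms in simp)
  also have "\<dots> < y" using assms by (simp add: nontangential_extension_def)
  finally show "Limsup (at q within approach_region A g \<Omega> \<kappa> \<beta> q) u < y" .
qed

locale plurisubharmonic_setting = riemannian_manifold A g + almost_complex_manifold A J
  for A :: "('m::{t2_space,second_countable_topology}, 'e::euclidean_space) chart set" and g J +
  fixes \<Omega> :: "'m set" and \<kappa> :: "'m \<Rightarrow> ('m, 'e) chart" and u :: "'m \<Rightarrow> ereal"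
  assumes domain: "smoothly_bounded_domain A \<Omega>"
    and \<kappa>: "\<And>q. q \<in> frontier \<Omega> \<Longrightarrow> \<kappa> q \<in> A \<and> q \<in> fst (\<kappa> q)"
    and psh: "plurisubharmonic A J \<Omega> u"
begin

lemma open_domain: "open \<Omega>"
  using domain unfolding smoothly_bounded_domain_def by blast

lemma u_usc: "open {x\<in>\<Omega>. u x < y}"
proof -
  have "openin (top_of_set \<Omega>) {x\<in>\<Omega>. u x < y}"
    using psh unfolding plurisubharmonic_def usc_on_def by blast
  then show ?thesis using openin_open_trans[OF _ open_domain] by blast
qed

text \<open>
  If \<open>q\<close> is a point of \<open>\<Omega>\<close>, semicontinuity suffices. If it is a boundary point, the condition on \<open>\<rho>\<close> says
  that \<open>f s\<close> stays in an approach region at \<open>q\<close>.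
\<close>

lemma boundary_limit:
  assumes V: "defining_function \<Omega> V \<rho>" and c: "c \<in> A" "q \<in> fst c" and q: "q \<in> V" "q \<in> closure \<Omega>"
    and u: "nontangential_extension A g \<Omega> \<kappa> u q < y"
    and lim: "filterlim f (nhds q) F" and a: "0 < a"
    and f: "\<forall>\<^sub>F s in F. f s \<in> \<Omega> \<and> \<rho> (f s) \<le> - a * norm (snd c (f s) - snd c q)"
  shows "\<forall>\<^sub>F s in F. u (f s) < y"
proof (cases "q \<in> \<Omega>")
  case True
  then have "q \<in> {x\<in>\<Omega>. u x < y}" using u by (simp add: nontangential_extension_def)
  then have "\<forall>\<^sub>F z in nhds q. z \<in> {x\<in>\<Omega>. u x < y}" by (rule eventually_nhds_in_open[OF u_usc])
  then show ?thesis using lim by (auto simp: filterlim_iff elim: eventually_mono)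
next
  case False
  then have qf: "q \<in> frontier \<Omega>" using q(2) open_domain by (simp add: frontier_def interior_open)
  have \<kappa>q: "\<kappa> q \<in> A" "q \<in> fst (\<kappa> q)" using \<kappa>[OF qf] by blast+
  obtain L where L: "0 < L" "\<forall>\<^sub>F z in nhds q. norm (snd (\<kappa> q) z - snd (\<kappa> q) q) \<le> L * norm (snd c z - snd c q)"
    using chart_lipschitz[OF c(1) \<kappa>q(1) c(2) \<kappa>q(2)] .
  have "0 < a / L" using a L by simp
  then obtain \<beta> where \<beta>: "1 < \<beta>" "\<forall>\<^sub>F z in nhds q. z \<noteq> q \<longrightarrow> \<rho> z \<le> - (a / L) * norm (snd (\<kappa> q) z - snd (\<kappa> q) q)
      \<longrightarrow> z \<in> approach_region A g \<Omega> \<kappa> \<beta> q"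
    by (rule rho_imp_approach_region[where \<kappa>=\<kappa>, OF V q(1) qf \<kappa>q])
  have "\<forall>\<^sub>F z in nhds q. z \<noteq> q \<longrightarrow> z \<in> approach_region A g \<Omega> \<kappa> \<beta> q \<longrightarrow> u z < y"
    using nontangential_extension_boundary[OF False u \<beta>(1)] by (simp add: eventually_at_filter)
  with \<beta>(2) L(2) have "\<forall>\<^sub>F z in nhds q. z \<noteq> q \<longrightarrow> \<rho> z \<le> - a * norm (snd c z - snd c q) \<longrightarrow> u z < y"
  proof eventually_elim
    case (elim z)
    show ?case
    proof (intro impI)
      assume z: "z \<noteq> q" "\<rho> z \<le> - a * norm (snd c z - snd c q)"
      have "(a / L) * norm (snd (\<kappa> q) z - snd (\<kappa> q) q) \<le> (a / L) * (L * norm (snd c z - snd c q))"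
        using elim(2) a L(1) by (intro mult_left_mono) auto
      also have "\<dots> = a * norm (snd c z - snd c q)" using L(1) by simp
      finally have "\<rho> z \<le> - (a / L) * norm (snd (\<kappa> q) z - snd (\<kappa> q) q)" using z(2) by linarith
      then show "u z < y" using elim(1,3) z(1) by blast
    qed
  qed
  then have "\<forall>\<^sub>F s in F. f s \<noteq> q \<longrightarrow> \<rho> (f s) \<le> - a * norm (snd c (f s) - snd c q) \<longrightarrow> u (f s) < y"
    using lim by (auto simp: filterlim_iff)
  with f show ?thesis
  proof eventually_elim
    case (elim s)
    then have "f s \<noteq> q" using False by auto
    then show ?case using elim by blast
  qed
qed

text \<open>
  The composition of \<open>u\<close> with the disc centred at \<open>z\<close> is compared with its radial boundary values. The edge
  of the disc passes through \<open>p\<close>, where nothing is known about \<open>u\<close>, for at most one radius.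
\<close>

theorem small_near_totally_real:
  assumes dim: "DIM('e) = 2 * n" and E: "submanifold A n E" "totally_real A J E" "E \<subseteq> closure \<Omega>"
    and p: "p \<in> E" "p \<in> frontier \<Omega>" and B: "0 \<le> B" "\<And>x. x \<in> \<Omega> \<Longrightarrow> u x \<le> ereal B" and N: "0 < N"
    and lim: "\<forall>\<^sub>F q in at p within E. nontangential_extension A g \<Omega> \<kappa> u q < ereal (- N)" and \<alpha>: "0 \<le> \<alpha>"
  shows "\<forall>\<^sub>F z in at p within approach_region A g \<Omega> \<kappa> \<alpha> p. u z \<le> ereal (B - N / 2)"
proof -
  let ?S = "UNIV \<times> {0..1} :: (real \<times> real) set"
  obtain c cj where c: "c \<in> A" "p \<in> fst c" and cj: "conj_space (chart_J c (snd c p)) cj"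
    and cjE: "\<And>x. x \<in> snd c ` fst c \<Longrightarrow> cj x = x \<longleftrightarrow> inv_chart c x \<in> E"
    using totally_real_coordinates[OF dim E(1,2) p(1)] by blast
  obtain V \<rho> where df: "defining_function \<Omega> V \<rho>" and pV: "p \<in> V"
    by (rule defining_function_exists[OF domain p(2)])
  obtain W where W: "open W" "p \<in> W" "\<And>q. q \<in> W \<Longrightarrow> q \<in> E \<Longrightarrow> q \<noteq> p \<Longrightarrow> nontangential_extension A g \<Omega> \<kappa> u q < ereal (- N)"
    using lim unfolding eventually_at_topological by blast
  note charts = chart_facts(5)[OF c(1)] chart_facts(6)[OF c(1)]
  let ?P = "snd c p"
  define U where "U = snd c ` (fst c \<inter> (V \<inter> W))"
  have U: "open U" "?P \<in> U"
    unfolding U_def using open_chart_image[OF c(1) open_Int[OF df_open(1)[OF df] W(1)]] c(2) pV W(2) by auto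
  have UC: "x \<in> snd c ` fst c" "inv_chart c x \<in> fst c" "inv_chart c x \<in> V" "inv_chart c x \<in> W" "snd c (inv_chart c x) = x"
    if "x \<in> U" for x using that charts unfolding U_def by auto
  let ?r = "\<rho> \<circ> inv_chart c"
  have r: "Ck_on 1 U ?r"
    by (rule Ck_on_subset[OF smooth_onD[OF df_smooth[OF df c(1)]]]) (auto simp: U_def)
  have rE: "?r x \<le> 0" if "x \<in> U" "cj x = x" for x
    using df_closure[OF df UC(3)[OF that(1)]] cjE[OF UC(1)[OF that(1)]] that(2) E(3) by auto
  have P: "cj ?P = ?P" "?r ?P = 0"
    using cjE[OF UC(1)[OF U(2)]] p charts(1)[OF c(2)] df_frontier[OF df pV p(2)] by auto
  have T: "linear (chart_J c x)" if "x \<in> U" for x by (rule linear_chart_J[OF c(1) UC(1)[OF that]])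
  have smT: "smooth_on U (\<lambda>x. chart_J c x v)" for v
    using smooth_chart_J[OF c(1), of v] unfolding smooth_on_def U_def by (blast intro: Ck_on_subset)
  have \<kappa>p: "\<kappa> p \<in> A" "p \<in> fst (\<kappa> p)" using \<kappa>[OF p(2)] by blast+
  obtain a where a: "0 < a" "\<forall>\<^sub>F z in nhds p. z \<in> approach_region A g \<Omega> \<kappa> \<alpha> p \<longrightarrow> \<rho> z \<le> - a * norm (snd (\<kappa> p) z - snd (\<kappa> p) p)"
    by (rule approach_region_imp_rho[where \<kappa>=\<kappa>, OF df pV p(2) \<kappa>p \<alpha>])
  obtain L where L: "0 < L" "\<forall>\<^sub>F z in nhds p. norm (snd c z - ?P) \<le> L * norm (snd (\<kappa> p) z - snd (\<kappa> p) p)"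
    using chart_lipschitz[OF \<kappa>p(1) c(1) \<kappa>p(2) c(2)] .
  have aL: "0 < a / L" using a L by simp
  \<comment> \<open>The centre of the unit disc corresponds to the point \<open>\<i> y0\<close> of the half disc.\<close>
  define y0 where "y0 = Im (halfdisc 0)"
  have y0: "0 < y0" "y0 \<le> 1" "halfdisc 0 = Complex 0 y0"
    using halfdisc_interior(1,2)[of 0] abs_Im_le_cmod[of "halfdisc 0"] halfdisc_0 by (auto simp: y0_def complex_eq_iff)
  obtain \<delta>0 :: real where \<delta>0: "0 < \<delta>0"
    "\<And>Z. 0 < norm (Z - ?P) \<Longrightarrow> norm (Z - ?P) < \<delta>0 \<Longrightarrow> ?r Z \<le> - (a / L) * norm (Z - ?P) \<Longrightarrow>
     \<exists>G. attached_half_disc U (chart_J c) cj ?r G \<and> G (0, y0) = Z"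
    using conj_space.attached_disc_below[OF cj y0(1,2) U T smT refl r rE P aL] by blast
  have main: "u z \<le> ereal (B - N / 2)"
    if z: "z \<in> fst c" "snd c z \<in> ball ?P \<delta>0" "z \<noteq> p" "\<rho> z \<le> - (a / L) * norm (snd c z - ?P)" for z
  proof -
    let ?Z = "snd c z"
    have "?Z \<noteq> ?P" using charts(1)[OF z(1)] charts(1)[OF c(2)] z(3) by metis
    then have "0 < norm (?Z - ?P)" by simp
    moreover have "norm (?Z - ?P) < \<delta>0" using z(2) by (simp add: dist_norm norm_minus_commute)
    moreover have "?r ?Z \<le> - (a / L) * norm (?Z - ?P)" using z(4) charts(1)[OF z(1)] by simp
    ultimately have "\<exists>G. attached_half_disc U (chart_J c) cj ?r G \<and> G (0, y0) = ?Z" by (rule \<delta>0(2))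
    then obtain G where att: "attached_half_disc U (chart_J c) cj ?r G" and GZ: "G (0, y0) = ?Z" by blast
    obtain Gx Gy M b where Mb: "0 < M" "0 < b"
      and G: "\<forall>z\<in>?S. (G has_derivative (\<lambda>(s, t). s *\<^sub>R Gx z + t *\<^sub>R Gy z)) (at z within ?S)"
        "continuous_on ?S Gx" "continuous_on ?S Gy"
        "\<forall>z\<in>?S. G z \<in> U \<and> Gy z = chart_J c (G z) (Gx z)"
      and Gc: "\<forall>x. cj (G (x, 0)) = G (x, 0)"
      and below: "\<forall>x\<in>{-1..1}. \<forall>y\<in>{0..1}. ?r (G (x, y)) \<le> - b * y"
      and inj: "inj_on (\<lambda>x. G (x, 0)) {-1..1}"
      and lip: "\<forall>z\<in>?S. \<forall>w\<in>?S. norm (G z - G w) \<le> M * norm (z - w)"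
      using att unfolding attached_half_disc_def by (elim exE conjE) (rule that)
    have GU: "G z \<in> U" if "z \<in> ?S" for z using bspec[OF G(4) that] by blast
    define \<psi> where "\<psi> w = (Re (halfdisc w), Im (halfdisc w))" for w
    have \<psi>: "\<psi> w \<in> ?S" "Re (halfdisc w) \<in> {-1..1}" "Im (halfdisc w) \<in> {0..1}" "0 < Im (halfdisc w)" if "w \<in> ball 0 1" for w
      using halfdisc_interior(1,2)[of w] abs_Im_le_cmod[of "halfdisc w"] abs_Re_le_cmod[of "halfdisc w"] that
      by (auto simp: \<psi>_def)
    define f where "f w = inv_chart c (G (\<psi> w))" for w
    have fV: "f w \<in> V" and \<rho>f: "\<rho> (f w) \<le> - b * Im (halfdisc w)" if "w \<in> ball 0 1" for w
      using UC(3)[OF GU[OF \<psi>(1)[OF that]]] below[THEN bspec, OF \<psi>(2)[OF that], THEN bspec, OF \<psi>(3)[OF that]]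
      by (simp_all add: f_def \<psi>_def)
    have f\<Omega>: "f w \<in> \<Omega>" if "w \<in> ball 0 1" for w
    proof -
      have "\<rho> (f w) < 0" using \<rho>f[OF that] mult_pos_pos[OF Mb(2) \<psi>(4)[OF that]] by simp
      then show ?thesis using df_neg[OF df fV[OF that]] by simp
    qed
    have "J_complex_disc A J (inv_chart c \<circ> (\<lambda>w. G (Re (halfdisc w), Im (halfdisc w))))"
      by (rule J_complex_halfdisc[OF c(1) _ G(2,3)]) (use G(1,4) UC(1) in blast)+
    then have "J_complex_disc A J f" by (simp add: f_def[abs_def] \<psi>_def o_def)
    then have sub: "subharmonic_on (ball 0 1) (u \<circ> f)"
      using psh f\<Omega> unfolding plurisubharmonic_def by blast
    have f0: "f 0 = z" using GZ y0(3) charts(1)[OF z(1)] by (simp add: f_def \<psi>_def)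
    define X where "X = {\<theta>\<in>{pi<..<2*pi}. G (edge \<theta>, 0) = ?P}"
    have edge1: "edge \<theta> \<in> {-1..1}" if "\<theta> \<in> {pi<..<2*pi}" for \<theta> using halfdisc_edge(4)[OF that] by auto
    have "inj_on (\<lambda>\<theta>. G (edge \<theta>, 0)) {pi<..<2*pi}"
      using inj_on_edge inj edge1 unfolding inj_on_def by blast
    then have "finite ((\<lambda>\<theta>. G (edge \<theta>, 0)) -` {?P} \<inter> {pi<..<2*pi})" by (intro finite_vimage_IntI) simp
    moreover have "X = (\<lambda>\<theta>. G (edge \<theta>, 0)) -` {?P} \<inter> {pi<..<2*pi}" by (auto simp: X_def)
    ultimately have "finite X" by (simp only:)
    have "(u \<circ> f) 0 \<le> ereal (B - N / 2)"
    proof (rule subharmonic_radial_bound[OF sub _ B(1) N \<open>finite X\<close>])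
      show "(u \<circ> f) w \<le> ereal B" if "w \<in> ball 0 1" for w using B(2)[OF f\<Omega>[OF that]] by simp
      fix \<theta> assume "\<theta> \<in> {pi<..<2*pi} - X"
      then have \<theta>: "\<theta> \<in> {pi<..<2*pi}" "G (edge \<theta>, 0) \<noteq> ?P" by (auto simp: X_def)
      let ?x = "edge \<theta>" and ?w = "\<lambda>s. of_real s * cis \<theta>"
      define Q where "Q = G (?x, 0)"
      define q where "q = inv_chart c Q"
      have xS: "(?x, 0) \<in> ?S" by simp
      have QU: "Q \<in> U" unfolding Q_def by (rule GU[OF xS])
      note q = UC[OF QU, folded q_def]
      have qE: "q \<in> E" using cjE[OF q(1)] Gc by (simp add: Q_def q_def)
      have qp: "q \<noteq> p" using \<theta>(2) q(5) by (auto simp: Q_def)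
      have unit: "\<forall>\<^sub>F s in at_left (1::real). ?w s \<in> ball 0 1"
      proof -
        have "\<forall>\<^sub>F s in at_left (1::real). s \<in> {0<..<1}" by (rule eventually_at_left_real) simp
        then show ?thesis by eventually_elim (simp add: norm_mult)
      qed
      have dist: "norm (G (\<psi> (?w s)) - Q) \<le> M * cmod (halfdisc (?w s) - of_real ?x)" if "?w s \<in> ball 0 1" for s
      proof -
        have "norm (\<psi> (?w s) - (?x, 0)) = cmod (halfdisc (?w s) - of_real ?x)"
          by (simp add: \<psi>_def norm_Pair cmod_def)
        then show ?thesis using lip[THEN bspec, OF \<psi>(1)[OF that], THEN bspec, OF xS] by (simp add: Q_def)
      qed
      have limG: "((\<lambda>s. G (\<psi> (?w s))) \<longlongrightarrow> Q) (at_left 1)"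
      proof (rule Lim_null_comparison[THEN LIM_zero_cancel])
        show "\<forall>\<^sub>F s in at_left 1. norm (G (\<psi> (?w s)) - Q) \<le> M * cmod (halfdisc (?w s) - of_real ?x)"
          using unit by eventually_elim (rule dist)
        have "((\<lambda>s. halfdisc (?w s) - of_real ?x) \<longlongrightarrow> 0) (at_left 1)"
          by (rule LIM_zero[OF halfdisc_radial(2)[OF \<theta>(1)]])
        from tendsto_mult_right_zero[OF tendsto_norm_zero[OF this]]
        show "((\<lambda>s. M * cmod (halfdisc (?w s) - of_real ?x)) \<longlongrightarrow> 0) (at_left 1)" .
      qed
      have "isCont (inv_chart c) Q"
        using continuous_on_eq_continuous_at[OF chart_facts(2)[OF c(1)]] chart_facts(4)[OF c(1)] q(1) by blast
      then have limf: "((\<lambda>s. f (?w s)) \<longlongrightarrow> q) (at_left 1)"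
        unfolding f_def q_def by (rule isCont_tendsto_compose[OF _ limG])
      have "\<forall>\<^sub>F s in at_left 1. u (f (?w s)) < ereal (- N)"
      proof (rule boundary_limit[OF df c(1) q(2,3) _ W(3)[OF q(4) qE qp] limf])
        show "q \<in> closure \<Omega>" using qE E(3) by blast
        show "0 < b / (3 * M)" using Mb by simp
        from unit halfdisc_radial(1)[OF \<theta>(1)]
        show "\<forall>\<^sub>F s in at_left 1. f (?w s) \<in> \<Omega> \<and> \<rho> (f (?w s)) \<le> - (b / (3 * M)) * norm (snd c (f (?w s)) - snd c q)"
        proof eventually_elim
          case (elim s)
          have "snd c (f (?w s)) - snd c q = G (\<psi> (?w s)) - Q"
            using UC(5)[OF GU[OF \<psi>(1)[OF elim(1)]]] q(5) by (simp add: f_def)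
          then have "norm (snd c (f (?w s)) - snd c q) \<le> M * (3 * Im (halfdisc (?w s)))"
            using order_trans[OF dist[OF elim(1)] mult_left_mono[OF elim(2), of M]] Mb(1) by simp
          then have "(b / (3 * M)) * norm (snd c (f (?w s)) - snd c q) \<le> (b / (3 * M)) * (M * (3 * Im (halfdisc (?w s))))"
            using Mb by (intro mult_left_mono) auto
          also have "\<dots> = b * Im (halfdisc (?w s))" using Mb by simp
          finally show ?case using \<rho>f[OF elim(1)] f\<Omega>[OF elim(1)] by simp
        qed
      qed
      then show "\<forall>\<^sub>F s in at_left 1. (u \<circ> f) (?w s) \<le> ereal (- N)" by eventually_elim simp
    qed
    then show ?thesis by (simp add: f0)
  qed
  from eventually_chart_ball[OF c \<delta>0(1)] a(2) L(2)
  have "\<forall>\<^sub>F z in nhds p. z \<noteq> p \<longrightarrow> z \<in> approach_region A g \<Omega> \<kappa> \<alpha> p \<longrightarrow> u z \<le> ereal (B - N / 2)"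
  proof eventually_elim
    case (elim z)
    show ?case
    proof (intro impI)
      assume z: "z \<noteq> p" "z \<in> approach_region A g \<Omega> \<kappa> \<alpha> p"
      have "(a / L) * norm (snd c z - ?P) \<le> (a / L) * (L * norm (snd (\<kappa> p) z - snd (\<kappa> p) p))"
        using elim(3) aL by (intro mult_left_mono) auto
      also have "\<dots> = a * norm (snd (\<kappa> p) z - snd (\<kappa> p) p)" using L(1) by simp
      finally have "\<rho> z \<le> - (a / L) * norm (snd c z - ?P)" using elim(2) z(2) by fastforce
      then show "u z \<le> ereal (B - N / 2)" using main z(1) elim(1) by blast
    qed
  qed
  then show ?thesis by (simp add: eventually_at_filter)
qed

end

theorem corollary5p5:
  fixes A :: "('m::{t2_space,second_countable_topology}, 'e::euclidean_space) chart set"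
    and n :: nat
    and J :: "'m \<Rightarrow> ('m, 'e) tangent \<Rightarrow> ('m, 'e) tangent"
    and g :: "'m \<Rightarrow> ('m, 'e) tangent \<Rightarrow> ('m, 'e) tangent \<Rightarrow> real"
    and \<Omega> E :: "'m set"
    and \<kappa> :: "'m \<Rightarrow> ('m, 'e) chart"
    and u :: "'m \<Rightarrow> ereal"
    and p :: 'm
  assumes "smooth_structure A"
    and "DIM('e) = 2 * n"
    and "almost_complex_structure A J"
    and "riemannian_metric A g"
    and "smoothly_bounded_domain A \<Omega>"
    and "\<And>q. q \<in> frontier \<Omega> \<Longrightarrow> \<kappa> q \<in> A \<and> q \<in> fst (\<kappa> q)"
    and "submanifold A n E"
    and "totally_real A J E"
    and "E \<subseteq> closure \<Omega>"
    and "plurisubharmonic A J \<Omega> u"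
    and "\<exists>B::real. \<forall>x\<in>\<Omega>. u x \<le> ereal B"
    and "p \<in> E \<inter> frontier \<Omega>"
    and "Limsup (at p within E) (nontangential_extension A g \<Omega> \<kappa> u) = -\<infinity>"
  shows "\<forall>\<alpha>>1. (u \<longlongrightarrow> -\<infinity>) (at p within approach_region A g \<Omega> \<kappa> \<alpha> p)"
proof -
  interpret plurisubharmonic_setting A g J \<Omega> \<kappa> u
    by unfold_locales (use assms in blast)+
  obtain B0 :: real where B0: "\<And>x. x \<in> \<Omega> \<Longrightarrow> u x \<le> ereal B0" using assms(11) by blast
  define B where "B = max B0 0"
  have "ereal B0 \<le> ereal B" by (simp add: B_def)
  then have B: "0 \<le> B" "\<And>x. x \<in> \<Omega> \<Longrightarrow> u x \<le> ereal B"
    using order_trans[OF B0] by (simp_all add: B_def)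
  have p: "p \<in> E" "p \<in> frontier \<Omega>" using assms(12) by blast+
  show ?thesis
  proof (intro allI impI)
    fix \<alpha> :: real assume \<alpha>: "1 < \<alpha>"
    show "(u \<longlongrightarrow> -\<infinity>) (at p within approach_region A g \<Omega> \<kappa> \<alpha> p)"
      unfolding tendsto_MInfty
    proof
      fix r :: real
      define N where "N = 2 * (B + \<bar>r\<bar> + 1)"
      have N: "0 < N" "B - N / 2 < r" using B(1) by (auto simp: N_def field_simps)
      have "Limsup (at p within E) (nontangential_extension A g \<Omega> \<kappa> u) < ereal (- N)" unfolding assms(13) by simp
      then have "\<forall>\<^sub>F q in at p within E. nontangential_extension A g \<Omega> \<kappa> u q < ereal (- N)" by (rule Limsup_lessD)
      from small_near_totally_real[OF assms(2,7,8,9) p B N(1) this] \<alpha>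
      have "\<forall>\<^sub>F z in at p within approach_region A g \<Omega> \<kappa> \<alpha> p. u z \<le> ereal (B - N / 2)" by simp
      then show "\<forall>\<^sub>F z in at p within approach_region A g \<Omega> \<kappa> \<alpha> p. u z < ereal r"
        by eventually_elim (use N(2) in \<open>auto intro: le_less_trans\<close>)
    qed
  qed
qed

end
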